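(* Let $\beta>0$. There exists a constant $C_\beta>0$ such that if $\rho(x,t)=\rho_1(bx,bt)$ with $0<a^2/b^2<C_\beta$, where $\rho_1(x,t)=(|x|^4+t^2)^{1/4}$ and $a,b$ are nonzero real numbers, then the convolution operator $Tf=f*K_{\alpha,\beta}$ on the Heisenberg group $\mathbf H_a^n$ associated to $\rho$ extends to a bounded operator from $L^2(\mathbf H_a^n)$ to itself if and only if $\alpha\le (n+\tfrac12)\beta$.
   Context: For a nonzero real number $a$, the Heisenberg group $\mathbf H_a^n$ is $\mathbf R^{2n+1}=\{(x,t):x\in\mathbf R^{2n},t\in\mathbf R\}$ with group law $$(x,t)\cdot(y,s)=(x+y,\;s+t-2a\,x^{\mathrm t}Jy),\qquad J=\begin{pmatrix}0&I_n\\-I_n&0\end{pmatrix},$$ and inverses $(x,t)^{-1}=-(x,t)$. $L^2(\mathbf H_a^n)$ is taken with respect to Lebesgue measure $dx\,dt$, and $|x|$ is the Euclidean norm on $\mathbf R^{2n}$. Given $\rho$, the operator $T$ is formally given by the group convolution $$Tf(x,t)=f*K_{\alpha,\beta}(x,t)=\int K_{\alpha,\beta}\bigl((y,s)^{-1}\cdot(x,t)\bigr)f(y,s)\,dy\,ds,$$ where $K_{\alpha,\beta}$ is a strongly singular distributional kernel on $\mathbf H_a^n$ that agrees, for $(x,t)\neq(0,0)$, with the function $$K_{\alpha,\beta}(x,t)=\rho(x,t)^{-2n-2-\alpha}e^{i\rho(x,t)^{-\beta}}\chi(\rho(x,t)).$$ Here $\beta>0$ and $\chi$ is smooth and compactly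 supported in a small neighborhood of the origin. The kernel is understood through its dyadic decomposition, as the limit of $\sum_{j=0}^{N}\vartheta(2^j\rho)K_{\alpha,\beta}$ as $N\to\infty$, where $\vartheta\in C_0^\infty(\mathbf R)$ is supported in $[\frac12,2]$ and $\sum_{j=0}^\infty\vartheta(2^jr)=1$ for $0<r\le1$.
   Formalization: The cutoff χ is additionally assumed to satisfy χ(0) ≠ 0 (and to be supported in [-1,1]); without χ(0) ≠ 0 the "only if" part fails, e.g. for χ = 0, where T = 0 is bounded for every α. *)

theory Defs
  imports "HOL-Analysis.Analysis"
begin

text \<open>
  A point \<open>(x, t)\<close> of \<open>R\<^sup>2\<^sup>n \<times> R\<close> is a pair whose first component is a function on indices
  \<open>0, \<dots>, 2n - 1\<close>, extensional (i.e. \<open>undefined\<close>) outside them. The dimension is a term and not a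
  type because the constant in the theorem is uniform in \<open>n\<close>.
\<close>

type_synonym hpoint = "(nat \<Rightarrow> real) \<times> real"

definition hspace :: "nat \<Rightarrow> hpoint set" where
  "hspace n = ({..<2 * n} \<rightarrow>\<^sub>E UNIV) \<times> UNIV"

definition hmeasure :: "nat \<Rightarrow> hpoint measure" where
  "hmeasure n = (\<Pi>\<^sub>M i\<in>{..<2 * n}. lborel) \<Otimes>\<^sub>M lborel"

text \<open>\<open>symp n x y\<close> is \<open>x\<^sup>t J y\<close> written out for the block matrix \<open>J = (0, I; -I, 0)\<close>.\<close>

definition symp :: "nat \<Rightarrow> (nat \<Rightarrow> real) \<Rightarrow> (nat \<Rightarrow> real) \<Rightarrow> real" where
  "symp n x y = (\<Sum>k<n. x k * y (n + k) - x (n + k) * y k)"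

definition hmult :: "nat \<Rightarrow> real \<Rightarrow> hpoint \<Rightarrow> hpoint \<Rightarrow> hpoint" where
  "hmult n a = (\<lambda>(x, t) (y, s).
     (\<lambda>i\<in>{..<2 * n}. x i + y i, s + t - 2 * a * symp n x y))"

definition hinv :: "nat \<Rightarrow> hpoint \<Rightarrow> hpoint" where
  "hinv n = (\<lambda>(x, t). (\<lambda>i\<in>{..<2 * n}. - x i, - t))"

definition rho1 :: "nat \<Rightarrow> hpoint \<Rightarrow> real" where
  "rho1 n = (\<lambda>(x, t). root 4 (L2_set x {..<2 * n} ^ 4 + t ^ 2))"

definition hscale :: "nat \<Rightarrow> real \<Rightarrow> hpoint \<Rightarrow> hpoint" where
  "hscale n b = (\<lambda>(x, t). (\<lambda>i\<in>{..<2 * n}. b * x i, b * t))"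


subsection \<open>Smooth functions\<close>

definition smooth_real :: "(real \<Rightarrow> real) \<Rightarrow> bool" where
  "smooth_real f \<longleftrightarrow> (\<forall>k x. (deriv ^^ k) f differentiable (at x))"

text \<open>Translation along the \<open>i\<close>-th coordinate axis; index \<open>2n\<close> is the \<open>t\<close>-axis.\<close>

definition shift :: "nat \<Rightarrow> nat \<Rightarrow> hpoint \<Rightarrow> real \<Rightarrow> hpoint" where
  "shift n i = (\<lambda>(x, t) h. if i < 2 * n then (x(i := x i + h), t) else (x, t + h))"

definition partial_deriv :: "nat \<Rightarrow> nat \<Rightarrow> (hpoint \<Rightarrow> complex) \<Rightarrow> hpoint \<Rightarrow> complex" where
  "partial_deriv n i f p = vector_derivative (\<lambda>h. f (shift n i p h)) (at 0)"

text \<open>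
  \<open>C\<^sup>\<infinity>\<close>: all iterated partial derivatives exist and are continuous. On \<open>hspace n\<close> the product
  topology of \<open>nat \<Rightarrow> real\<close> induces the Euclidean one.
\<close>

definition smooth :: "nat \<Rightarrow> (hpoint \<Rightarrow> complex) \<Rightarrow> bool" where
  "smooth n f \<longleftrightarrow> (\<forall>l \<in> lists {..2 * n}.
     continuous_on (hspace n) (foldr (partial_deriv n) l f) \<and>
     (\<forall>i \<le> 2 * n. \<forall>p \<in> hspace n.
        (\<lambda>h. foldr (partial_deriv n) l f (shift n i p h)) differentiable (at 0)))"

definition test_functions :: "nat \<Rightarrow> (hpoint \<Rightarrow> complex) set" where
  "test_functions n = {f. smooth n f \<and>
     (\<exists>R. \<forall>(x, t) \<in> hspace n. f (x, t) \<noteq> 0 \<longrightarrow> L2_set x {..<2 * n} \<le> R \<and> \<bar>t\<bar> \<le> R)}"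


subsection \<open>Bounded extensions to \<open>L\<^sup>2\<close>\<close>

definition square_integrable :: "'a measure \<Rightarrow> ('a \<Rightarrow> complex) \<Rightarrow> bool" where
  "square_integrable M f \<longleftrightarrow>
     f \<in> borel_measurable M \<and> integrable M (\<lambda>p. (cmod (f p))\<^sup>2)"

definition norm_L2 :: "'a measure \<Rightarrow> ('a \<Rightarrow> complex) \<Rightarrow> real" where
  "norm_L2 M f = sqrt (\<integral>p. (cmod (f p))\<^sup>2 \<partial>M)"

text \<open>
  An operator on \<open>L\<^sup>2\<close> acts here on representatives. Linearity almost everywhere and the norm bound
  together make it compatible with equality almost everywhere.
\<close>

definition bounded_operator_L2 ::
    "'a measure \<Rightarrow> (('a \<Rightarrow> complex) \<Rightarrow> ('a \<Rightarrow> complex)) \<Rightarrow> bool" where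
  "bounded_operator_L2 M S \<longleftrightarrow>
     (\<forall>f g c. square_integrable M f \<longrightarrow> square_integrable M g \<longrightarrow>
        (AE p in M. S (\<lambda>q. f q + c * g q) p = S f p + c * S g p)) \<and>
     (\<exists>B. \<forall>f. square_integrable M f \<longrightarrow>
        square_integrable M (S f) \<and> norm_L2 M (S f) \<le> B * norm_L2 M f)"

definition extends_to_bounded_L2 ::
    "'a measure \<Rightarrow> ('a \<Rightarrow> complex) set \<Rightarrow> (('a \<Rightarrow> complex) \<Rightarrow> ('a \<Rightarrow> complex)) \<Rightarrow> bool" where
  "extends_to_bounded_L2 M D T \<longleftrightarrow>
     (\<exists>S. bounded_operator_L2 M S \<and> (\<forall>f\<in>D. AE p in M. S f p = T f p))"


subsection \<open>The strongly singular operator\<close>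

text \<open>
  The support is taken inside \<open>[-1, 1]\<close>, where the dyadic partition below sums to 1. The condition
  at 0 keeps the cutoff from weakening or removing the singularity of the kernel.
\<close>

definition cutoff :: "(real \<Rightarrow> real) \<Rightarrow> bool" where
  "cutoff \<psi> \<longleftrightarrow> smooth_real \<psi> \<and> (\<forall>r. r \<notin> {-1..1} \<longrightarrow> \<psi> r = 0) \<and> \<psi> 0 \<noteq> 0"

definition dyadic_partition :: "(real \<Rightarrow> real) \<Rightarrow> bool" where
  "dyadic_partition \<theta> \<longleftrightarrow> smooth_real \<theta> \<and> (\<forall>r. r \<notin> {1/2..2} \<longrightarrow> \<theta> r = 0) \<and>
     (\<forall>r. 0 < r \<and> r \<le> 1 \<longrightarrow> (\<lambda>j. \<theta> (2 ^ j * r)) sums 1)"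

definition kernel ::
    "nat \<Rightarrow> (hpoint \<Rightarrow> real) \<Rightarrow> real \<Rightarrow> real \<Rightarrow> (real \<Rightarrow> real) \<Rightarrow> hpoint \<Rightarrow> complex" where
  "kernel n \<rho> \<alpha> \<beta> \<psi> p =
     of_real (\<rho> p powr (- 2 * real n - 2 - \<alpha>)) *
     exp (\<i> * of_real (\<rho> p powr (- \<beta>))) * of_real (\<psi> (\<rho> p))"

definition truncated_kernel ::
    "nat \<Rightarrow> (hpoint \<Rightarrow> real) \<Rightarrow> real \<Rightarrow> real \<Rightarrow> (real \<Rightarrow> real) \<Rightarrow> (real \<Rightarrow> real) \<Rightarrow>
     nat \<Rightarrow> hpoint \<Rightarrow> complex" where
  "truncated_kernel n \<rho> \<alpha> \<beta> \<psi> \<theta> N p =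
     (\<Sum>j\<le>N. of_real (\<theta> (2 ^ j * \<rho> p)) * kernel n \<rho> \<alpha> \<beta> \<psi> p)"

text \<open>
  The kernel is the distributional limit of its truncations, so \<open>T f\<close> is the pointwise limit of
  the truncated convolutions. For \<open>\<beta> > 0\<close> and \<open>f\<close> smooth with compact support that limit
  exists at every point and for every real \<open>\<alpha>\<close>: repeated integration by parts along the dilation
  orbits gains a factor \<open>2 powr (- j * \<beta>)\<close> each time in the \<open>j\<close>-th dyadic piece.
\<close>

definition T_op ::
    "nat \<Rightarrow> real \<Rightarrow> (hpoint \<Rightarrow> real) \<Rightarrow> real \<Rightarrow> real \<Rightarrow> (real \<Rightarrow> real) \<Rightarrow> (real \<Rightarrow> real) \<Rightarrow>
     (hpoint \<Rightarrow> complex) \<Rightarrow> hpoint \<Rightarrow> complex" where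
  "T_op n a \<rho> \<alpha> \<beta> \<psi> \<theta> f p =
     lim (\<lambda>N. \<integral>q. truncated_kernel n \<rho> \<alpha> \<beta> \<psi> \<theta> N (hmult n a (hinv n q) p) * f q \<partial>hmeasure n)"

end

theory Submission
  imports Defs
begin

text \<open>
  \<^bold>\<open>Sufficiency.\<close> The \<open>j\<close>-th dyadic piece \<open>K\<^sub>j\<close> is, up to dilation by \<open>2\<^sup>j\<close>, \<open>2 powr (j \<alpha>)\<close> times a
  bump carrying the phase \<open>\<lambda> \<rho> powr (-\<beta>)\<close> with \<open>\<lambda> = 2 powr (j \<beta>)\<close>. Convolution with it is an
  oscillatory integral operator with phase \<open>\<lambda> F(q\<^sup>-\<^sup>1 p)\<close>, whose mixed Hessian is nondegenerate for
  \<open>a\<^sup>2/b\<^sup>2 < 3\<close>. Cutting the bump into small cubes and integrating by parts along a coordinate line,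
  \<open>K\<^sub>j * K\<^sub>j\<^sup>~\<close> is bounded by \<open>(1 + \<lambda> |w|)\<close> to a large negative power, so its \<open>L\<^sup>1\<close> norm is
  \<open>O(\<lambda> powr (-2n - 1))\<close> and \<open>K\<^sub>j\<close> has operator norm \<open>O(2 powr (j (\<alpha> - (n + 1/2) \<beta>)))\<close>. Pieces at
  distant scales have very different frequencies, so the faster one integrates by parts against
  the slower one and they are almost orthogonal.

  \<^bold>\<open>Necessity.\<close> For \<open>f\<close> a bump of width \<open>\<eta> 2 powr (-j (1 + \<beta>))\<close> in \<open>x\<close> and \<open>\<eta> 2 powr (-j (2 + \<beta>))\<close>
  in \<open>t\<close>, the phase is nearly constant on its support as seen from distance \<open>2\<^sup>-\<^sup>j\<close>, so \<open>|T f|\<close> is at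
  least \<open>c 2 powr (j (2n + 2 + \<alpha>))\<close> times the integral of \<open>f\<close> on a set of measure \<open>2 powr (-j (2n + 2))\<close>.
  Comparing \<open>L\<^sup>2\<close> norms forces \<open>2 \<alpha> \<le> (2n + 1) \<beta>\<close>.
\<close>

section \<open>Bounded derivatives and nonstationary phase\<close>

text \<open>Every constant must be uniform in the scale, the cube and the group element, so the
  analytic lemmas have the shape \<open>\<exists>C\<ge>0. \<forall>...\<close>, the functions being
  quantified after the constant. Integration by parts needs one coordinate direction in which the
  phase is nonstationary on a whole cube, whereas nondegeneracy only provides some direction at each
  point. Compactness closes this gap: it yields a cube size and a lower bound that serve all
  centres. For the diagonal term the bound must be proportional to |w|, so difference quotients are
  passed to the limit, and there the mixed Hessian appears. A second obstacle is that the operator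
  is defined by a pointwise limit, while almost orthogonality gives a limit in
  \<open>L\<^sup>2\<close>; the two agree because on a test function the norms of the pieces are
  summable. All smooth bumps (partition of unity, mollifier, test functions) are made from the
  square of the given cutoff \<psi>. The constant 3 serves for every \<beta>, since a larger \<beta>
  only improves the sign of the relevant quadratic form.\<close>

text \<open>A \<open>C^m\<close> bound with one constant for all derivatives up to order m. The
  derivatives are two-sided, so the sets of interest are open; continuity is asked for at order 0
  only, since differentiability supplies it above.\<close>

fun bd :: "nat => real set => real => (real => real) => bool" where
 "bd 0 I K f \<longleftrightarrow> continuous_on I f \<and> (\<forall>s\<in>I. \<bar>f s\<bar> \<le> K)"
| "bd (Suc m) I K f \<longleftrightarrow> (\<forall>s\<in>I. \<bar>f s\<bar> \<le> K) \<and>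
   (\<exists>f'. (\<forall>s\<in>I. (f has_real_derivative f' s) (at s)) \<and> bd m I K f')"

lemma bd_SucI:
 assumes "\<And>s. s \<in> I ==> \<bar>f s\<bar> \<le> K" "bd m I K f'"
  "\<And>s. s \<in> I ==> (f has_real_derivative f' s) (at s)"
 shows "bd (Suc m) I K f"
 using assms by auto

lemma bd_SucE:
 assumes "bd (Suc m) I K f"
 obtains f' where "\<forall>s\<in>I. (f has_real_derivative f' s) (at s)" "bd m I K f'"
 using assms by auto

lemma bd_bound: "bd m I K f ==> s \<in> I ==> \<bar>f s\<bar> \<le> K"
 by (cases m) auto

lemma bd_continuous_on: "bd m I K f ==> continuous_on I f"
 by (cases m) (auto simp: continuous_on_eq_continuous_within
   intro: DERIV_isCont continuous_at_imp_continuous_at_within)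

lemma bd_mono: "bd m I K f ==> K \<le> L ==> bd m I L f"
 by (induction m arbitrary: f) (auto intro: order_trans)

lemma bd_pred: "bd (Suc m) I K f ==> bd m I K f"
proof (induction m arbitrary: f)
 case 0
 then show ?case using bd_continuous_on[OF 0] by auto
next
 case (Suc m)
 then obtain f' where "\<forall>s\<in>I. (f has_real_derivative f' s) (at s)" "bd (Suc m) I K f'"
  using bd.simps(2)[of "Suc m"] by blast
 moreover have "\<forall>s\<in>I. \<bar>f s\<bar> \<le> K" using Suc.prems by (simp add: bd_bound)
 ultimately show ?case using Suc.IH unfolding bd.simps(2)[of m] by blast
qed

lemma bd_cong:
 assumes "open I" "\<And>s. s \<in> I ==> f s = g s" "bd m I K f"
 shows "bd m I K g"
proof (cases m)
 case 0
 then show ?thesis using assms continuous_on_cong[of I I f g] by auto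
next
 case (Suc k)
 with assms(3) obtain f' where f': "\<forall>s\<in>I. (f has_real_derivative f' s) (at s)" "bd k I K f'"
  "\<forall>s\<in>I. \<bar>f s\<bar> \<le> K" by auto
 have "(g has_real_derivative f' s) (at s)" if "s \<in> I" for s
  using f'(1) that assms(1,2) by (metis has_field_derivative_transform_within_open)
 then show ?thesis using f' Suc assms(2) by auto
qed

lemma bd_deriv:
 assumes "open I" "bd (Suc m) I K f" "\<And>s. s \<in> I ==> (f has_real_derivative f' s) (at s)"
 shows "bd m I K f'"
proof -
 obtain g where g: "\<forall>s\<in>I. (f has_real_derivative g s) (at s)" "bd m I K g"
  using assms(2) by auto
 show ?thesis
  by (rule bd_cong[OF assms(1) _ g(2)]) (use g(1) assms(3) DERIV_unique in blast)
qed

lemma bd_const: "\<bar>c\<bar> \<le> K ==> bd m I K (%_. c)"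
proof (induction m arbitrary: c)
 case (Suc m)
 have "bd m I K (%_. 0)" using Suc by auto
 then show ?case using Suc.prems by (auto intro!: exI[of _ "%_. 0"])
qed auto

lemma bd_affine:
 assumes "\<And>s. s \<in> I ==> \<bar>c + d * s\<bar> \<le> K" "\<bar>d\<bar> \<le> K"
 shows "bd m I K (%s. c + d * s)"
proof (cases m)
 case 0
 then show ?thesis using assms by (auto intro!: continuous_intros)
next
 case (Suc k)
 have "bd k I K (%_. d)" by (rule bd_const) fact
 moreover have "((%s. c + d * s) has_real_derivative d) (at s)" for s
  by (auto intro!: derivative_eq_intros)
 ultimately show ?thesis using Suc assms by (auto intro!: exI[of _ "%_. d"])
qed

lemma bd_add:
 "bd m I K f ==> bd m I L g ==> bd m I (K + L) (%s. f s + g s)"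
proof (induction m arbitrary: f g)
 case 0
 then show ?case
  by (auto intro!: continuous_on_add intro: order_trans[OF abs_triangle_ineq add_mono])
next
 case (Suc m)
 then obtain f' g' where "\<forall>s\<in>I. (f has_real_derivative f' s) (at s)" "bd m I K f'"
  "\<forall>s\<in>I. (g has_real_derivative g' s) (at s)" "bd m I L g'" by auto
 moreover from this have "bd m I (K + L) (%s. f' s + g' s)" using Suc.IH by blast
 moreover have "\<forall>s\<in>I. \<bar>f s + g s\<bar> \<le> K + L"
  using Suc.prems by (metis abs_triangle_ineq add_mono bd_bound order_trans)
 ultimately show ?case by (auto intro!: exI[of _ "%s. f' s + g' s"] derivative_eq_intros)
qed

lemma bd_cmult: "bd m I K f ==> bd m I (\<bar>c\<bar> * K) (%s. c * f s)"
proof (induction m arbitrary: f)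
 case 0
 then show ?case by (auto intro!: continuous_intros simp: abs_mult mult_left_mono)
next
 case (Suc m)
 then obtain f' where "\<forall>s\<in>I. (f has_real_derivative f' s) (at s)" "bd m I K f'" by auto
 moreover from this have "bd m I (\<bar>c\<bar> * K) (%s. c * f' s)" using Suc.IH by blast
 moreover have "\<forall>s\<in>I. \<bar>c * f s\<bar> \<le> \<bar>c\<bar> * K"
  using Suc.prems by (auto simp: abs_mult mult_left_mono)
 ultimately show ?case by (auto intro!: exI[of _ "%s. c * f' s"] derivative_eq_intros)
qed

lemma bd_diff: "bd m I K f ==> bd m I L g ==> bd m I (K + L) (%s. f s - g s)"
 using bd_add[of m I K f L "%s. (-1) * g s"] bd_cmult[of m I L g "-1"] by auto

text \<open>Leibniz's rule: each order of differentiation doubles the number of products, which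
  gives the factor \<open>2 ^ m\<close>.\<close>

lemma bd_mult:
 assumes "0 \<le> K" "0 \<le> L"
 shows "bd m I K f ==> bd m I L g ==> bd m I (2 ^ m * K * L) (%s. f s * g s)"
proof (induction m arbitrary: f g)
 case 0
 then show ?case using assms by (auto intro!: continuous_intros mult_mono simp: abs_mult)
next
 case (Suc m)
 then obtain f' g' where d: "\<forall>s\<in>I. (f has_real_derivative f' s) (at s)" "bd m I K f'"
  "\<forall>s\<in>I. (g has_real_derivative g' s) (at s)" "bd m I L g'" by auto
 have "bd m I (2 ^ m * K * L + 2 ^ m * K * L) (%s. f' s * g s + f s * g' s)"
  by (intro bd_add Suc.IH d bd_pred[OF Suc.prems(1)] bd_pred[OF Suc.prems(2)])
 moreover have "\<forall>s\<in>I. \<bar>f s * g s\<bar> \<le> 2 ^ Suc m * K * L"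
 proof
  fix s assume "s \<in> I"
  then have "\<bar>f s * g s\<bar> \<le> K * L"
   using Suc.prems assms by (auto simp: abs_mult intro!: mult_mono)
  also have "\<dots> = 1 * (K * L)" by simp
  also have "\<dots> \<le> 2 ^ Suc m * (K * L)"
   using assms by (intro mult_right_mono one_le_power) auto
  finally show "\<bar>f s * g s\<bar> \<le> 2 ^ Suc m * K * L" by (simp add: mult.assoc)
 qed
 ultimately show ?case using d
  by (auto intro!: exI[of _ "%s. f' s * g s + f s * g' s"] derivative_eq_intros simp: mult_ac)
qed

lemma bd_sum:
 assumes "finite A" "\<And>k. k \<in> A ==> bd m I (K k) (f k)"
 shows "bd m I (\<Sum>k\<in>A. K k) (%s. \<Sum>k\<in>A. f k s)"
 using assms by (induction A) (simp_all add: bd_const bd_add)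

lemma bd_prod:
 assumes "finite A" "1 \<le> K" "\<And>k. k \<in> A ==> bd m I K (f k)"
 shows "bd m I ((2 ^ m * K) ^ card A) (%s. \<Prod>k\<in>A. f k s)"
 using assms
proof (induction A)
 case empty
 then show ?case by (auto intro!: bd_const)
next
 case (insert x A)
 have "bd m I (2 ^ m * K * (2 ^ m * K) ^ card A) (%s. f x s * (\<Prod>k\<in>A. f k s))"
  using insert by (intro bd_mult) auto
 then show ?case using insert by simp
qed

text \<open>By the chain rule and induction the constant depends on \<open>m\<close>,
  \<open>H\<close> and \<open>K\<close> only. It stands before the functions and the sets because it
  is later applied to families indexed by scale, cube and group element.\<close>

lemma bd_comp:
 assumes "0 \<le> H" "0 \<le> K"
 shows "\<exists>C\<ge>0. \<forall>h f I J. bd m J H h --> bd m I K f --> f ` I \<subseteq> J --> bd m I C (%s. h (f s))"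
proof (induction m)
 case 0
 show ?case
 proof (intro exI[of _ H] conjI allI impI)
  fix h f and I J :: "real set"
  assume "bd 0 J H h" "bd 0 I K f" "f ` I \<subseteq> J"
  then show "bd 0 I H (%s. h (f s))"
   using continuous_on_compose2[of J h I f] by (auto simp: image_subset_iff)
 qed (rule assms)
next
 case (Suc m)
 then obtain C where C: "C \<ge> 0"
  "\<And>h f I J. bd m J H h ==> bd m I K f ==> f ` I \<subseteq> J ==> bd m I C (%s. h (f s))" by blast
 show ?case
 proof (intro exI conjI allI impI)
  show "0 \<le> max H (2 ^ m * C * K)" using assms by auto
  fix h f and I J :: "real set"
  assume a: "bd (Suc m) J H h" "bd (Suc m) I K f" "f ` I \<subseteq> J"
  then obtain h' f' where d: "\<forall>s\<in>J. (h has_real_derivative h' s) (at s)" "bd m J H h'"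
   "\<forall>s\<in>I. (f has_real_derivative f' s) (at s)" "bd m I K f'" by auto
  have "bd m I (2 ^ m * C * K) (%s. h' (f s) * f' s)"
   by (intro bd_mult C(1) C(2)[OF d(2) bd_pred[OF a(2)] a(3)] d assms)
  then have "bd m I (max H (2 ^ m * C * K)) (%s. h' (f s) * f' s)"
   by (rule bd_mono) auto
  moreover have "((%s. h (f s)) has_real_derivative h' (f s) * f' s) (at s)" if "s \<in> I" for s
   using d that a(3) by (intro DERIV_chain2[of h]) auto
  moreover have "\<bar>h (f s)\<bar> \<le> H" if "s \<in> I" for s
   using that a by (auto simp: image_subset_iff)
  ultimately show "bd (Suc m) I (max H (2 ^ m * C * K)) (%s. h (f s))"
   by (intro bd_SucI[where f' = "%s. h' (f s) * f' s"]) (auto simp: le_max_iff_disj)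
 qed
qed

text \<open>For the phase difference between a point and its translate by w: all derivatives of the
  difference must be O(|w|), hence linearity in \<open>E\<close>. The price is one more derivative
  of the outer function, used by the mean value theorem; this is why its domain is an
  interval.\<close>

lemma bd_comp_diff:
 assumes "0 \<le> H" "0 \<le> K"
 shows "\<exists>C\<ge>0. \<forall>g p q I a b E. 0 \<le> E --> open I --> bd (Suc m) {a<..<b} H g --> bd m I K p --> bd m I K q -->
  p ` I \<subseteq> {a<..<b} --> q ` I \<subseteq> {a<..<b} --> bd m I E (%s. p s - q s) -->
  bd m I (C * E) (%s. g (p s) - g (q s))"
proof -
 have mvt: "\<bar>g x - g y\<bar> \<le> H * \<bar>x - y\<bar>"
  if g: "bd (Suc m) {a<..<b} H g" and xy: "x \<in> {a<..<b}" "y \<in> {a<..<b}" for g m a b x y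
 proof -
  obtain g' where g': "\<forall>s\<in>{a<..<b}. (g has_real_derivative g' s) (at s)" "bd m {a<..<b} H g'"
   using g by auto
  show ?thesis
   using field_differentiable_bound[of "{a<..<b}" g g' H x y, unfolded real_norm_def]
    g'(1) xy bd_bound[OF g'(2)] has_field_derivative_at_within convex_real_interval(8)
   by blast
 qed
 show ?thesis
 proof (induction m)
  case 0
  show ?case
  proof (intro exI conjI allI impI)
   fix g p q I a b E
   assume A: "0 \<le> E" "open I" "bd (Suc 0) {a<..<b} H g" "bd 0 I K p" "bd 0 I K q"
    "p ` I \<subseteq> {a<..<b}" "q ` I \<subseteq> {a<..<b}" "bd 0 I E (%s. p s - q s)"
   have "continuous_on I (%s. g (p s) - g (q s))"
    using A bd_continuous_on[OF A(3)]
    by (auto intro!: continuous_intros intro: continuous_on_compose2)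
   moreover have "\<bar>g (p s) - g (q s)\<bar> \<le> H * E" if "s \<in> I" for s
   proof -
    have "\<bar>g (p s) - g (q s)\<bar> \<le> H * \<bar>p s - q s\<bar>"
     using A that by (intro mvt[OF A(3)]) auto
    also have "\<dots> \<le> H * E" using A that assms by (intro mult_left_mono) auto
    finally show ?thesis .
   qed
   ultimately show "bd 0 I (H * E) (%s. g (p s) - g (q s))" by auto
  qed (use assms in auto)
 next
  case (Suc m)
  then obtain C where C: "C \<ge> 0" "\<And>g p q I a b E. 0 \<le> E ==> open I ==> bd (Suc m) {a<..<b} H g ==>
   bd m I K p ==> bd m I K q ==> p ` I \<subseteq> {a<..<b} ==> q ` I \<subseteq> {a<..<b} ==>
   bd m I E (%s. p s - q s) ==> bd m I (C * E) (%s. g (p s) - g (q s))" by blast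
  obtain D where D: "D \<ge> 0" "\<And>h f I J. bd m J H h ==> bd m I K f ==> f ` I \<subseteq> J ==>
   bd m I D (%s. h (f s))" using bd_comp[OF assms, of m] by blast
  let ?C = "max H (2 ^ m * C * K + 2 ^ m * D)"
  show ?case
  proof (intro exI[of _ ?C] conjI allI impI)
   fix g p q I a b E
   assume A: "0 \<le> E" "open I" "bd (Suc (Suc m)) {a<..<b} H g" "bd (Suc m) I K p" "bd (Suc m) I K q"
    "p ` I \<subseteq> {a<..<b}" "q ` I \<subseteq> {a<..<b}" "bd (Suc m) I E (%s. p s - q s)"
   obtain g' where
    g': "\<forall>s\<in>{a<..<b}. (g has_real_derivative g' s) (at s)" "bd (Suc m) {a<..<b} H g'"
    using A(3) by (rule bd_SucE)
   obtain p' where p': "\<forall>s\<in>I. (p has_real_derivative p' s) (at s)" "bd m I K p'"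
    using A(4) by (rule bd_SucE)
   obtain q' where q': "\<forall>s\<in>I. (q has_real_derivative q' s) (at s)" "bd m I K q'"
    using A(5) by (rule bd_SucE)
   have pq': "bd m I E (%s. p' s - q' s)"
    using A(2,8) by (rule bd_deriv) (use p' q' in \<open>auto intro!: derivative_eq_intros\<close>)
   have "bd m I (2 ^ m * (C * E) * K + 2 ^ m * D * E)
     (%s. (g' (p s) - g' (q s)) * p' s + g' (q s) * (p' s - q' s))"
    using A(1) C(1) D(1) assms
    by (intro bd_add bd_mult p'(2) pq'
      C(2)[OF A(1,2) g'(2) bd_pred[OF A(4)] bd_pred[OF A(5)] A(6,7) bd_pred[OF A(8)]]
      D(2)[OF bd_pred[OF g'(2)] bd_pred[OF A(5)] A(7)]) simp_all
   then have "bd m I (?C * E) (%s. (g' (p s) - g' (q s)) * p' s + g' (q s) * (p' s - q' s))"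
    by (rule bd_mono) (use mult_right_mono[OF max.cobounded2[of "2 ^ m * C * K + 2 ^ m * D" H] A(1)]
      in \<open>simp only: ring_distribs mult_ac\<close>)
   moreover have "((%s. g (p s) - g (q s)) has_real_derivative
     (g' (p s) - g' (q s)) * p' s + g' (q s) * (p' s - q' s)) (at s)" if "s \<in> I" for s
   proof -
    have "((%s. g (p s)) has_real_derivative g' (p s) * p' s) (at s)"
     "((%s. g (q s)) has_real_derivative g' (q s) * q' s) (at s)"
     using that g' p' q' A(6,7) by (auto intro!: DERIV_chain2[of g])
    from DERIV_diff[OF this] show ?thesis by (simp add: algebra_simps)
   qed
   moreover have "\<bar>g (p s) - g (q s)\<bar> \<le> ?C * E" if "s \<in> I" for s
   proof -
    have "\<bar>g (p s) - g (q s)\<bar> \<le> H * \<bar>p s - q s\<bar>"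
     using A that by (intro mvt[OF A(3)]) auto
    also have "\<dots> \<le> ?C * E" using A(8) that assms by (intro mult_mono) auto
    finally show ?thesis .
   qed
   ultimately show "bd (Suc m) I (?C * E) (%s. g (p s) - g (q s))"
    by (intro bd_SucI[where f' = "%s. (g' (p s) - g' (q s)) * p' s + g' (q s) * (p' s - q' s)"])
  qed (use assms in auto)
 qed
qed

lemma bd_inverse:
 assumes "0 \<le> K" "0 < \<kappa>"
 shows "\<exists>C\<ge>0. \<forall>u I. bd m I K u --> (\<forall>s\<in>I. \<kappa> \<le> \<bar>u s\<bar>) --> bd m I C (%s. inverse (u s))"
proof (induction m)
 case 0
 show ?case
  by (rule exI[of _ "inverse \<kappa>"])
   (use assms in \<open>fastforce intro!: continuous_intros le_imp_inverse_le\<close>)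
next
 case (Suc m)
 then obtain C where C: "C \<ge> 0" "\<And>u I. bd m I K u ==> (\<forall>s\<in>I. \<kappa> \<le> \<bar>u s\<bar>) ==>
  bd m I C (%s. inverse (u s))" by blast
 let ?C = "max C (\<bar>-1\<bar> * (2 ^ m * (2 ^ m * C * K) * C))"
 show ?case
 proof (intro exI[of _ ?C] conjI allI impI)
  fix u and I :: "real set" assume A: "bd (Suc m) I K u" "\<forall>s\<in>I. \<kappa> \<le> \<bar>u s\<bar>"
  then obtain u' where u': "\<forall>s\<in>I. (u has_real_derivative u' s) (at s)" "bd m I K u'" by auto
  have B: "bd m I C (%s. inverse (u s))" using A bd_pred by (intro C) blast+
  have "bd m I (\<bar>-1\<bar> * (2 ^ m * (2 ^ m * C * K) * C)) (%s. (-1) * (inverse (u s) * u' s * inverse (u s)))"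
   by (intro bd_cmult bd_mult B u'(2)) (simp_all add: C(1) assms)
  then have "bd m I ?C (%s. (-1) * (inverse (u s) * u' s * inverse (u s)))"
   by (rule bd_mono) auto
  moreover have "((%s. inverse (u s)) has_real_derivative (-1) * (inverse (u s) * u' s * inverse (u s))) (at s)"
   if "s \<in> I" for s
  proof -
   have "u s \<noteq> 0" using that A(2) assms(2) by force
   then show ?thesis using DERIV_inverse'[of u "u' s" s] u'(1) that by simp
  qed
  moreover have "\<bar>inverse (u s)\<bar> \<le> ?C" if "s \<in> I" for s
   using bd_bound[OF B that] by simp
  ultimately show "bd (Suc m) I ?C (%s. inverse (u s))"
   by (intro bd_SucI[where f' = "%s. (-1) * (inverse (u s) * u' s * inverse (u s))"])
 qed (use C in auto)
qed

lemma bd_powr: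
 assumes "0 < c" "c < d"
 shows "\<exists>C\<ge>0. bd m {c<..<d} C (%u. u powr e)"
proof (induction m arbitrary: e)
 have le: "u powr e \<le> max (c powr e) (d powr e)" if "u \<in> {c<..<d}" for u e :: real
 proof (cases "e \<ge> 0")
  case True
  then show ?thesis using that assms by (auto intro!: max.coboundedI2 powr_mono2)
 next
  case False
  then show ?thesis using that assms by (auto intro!: max.coboundedI1 powr_mono2')
 qed
 {
  case 0
  have "continuous_on {c<..<d} (%u. u powr e)"
   using assms by (intro continuous_intros) auto
  then show ?case using le by (intro exI[of _ "max (c powr e) (d powr e)"]) (simp add: le_max_iff_disj)
 next
  case (Suc m)
  obtain C where C: "C \<ge> 0" "bd m {c<..<d} C (%u. u powr (e - 1))" using Suc by blast
  have "bd m {c<..<d} (\<bar>e\<bar> * C) (%u. e * u powr (e - 1))" by (rule bd_cmult) fact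
  then have "bd m {c<..<d} (max (\<bar>e\<bar> * C) (max (c powr e) (d powr e))) (%u. e * u powr (e - 1))"
   by (rule bd_mono) auto
  moreover have "((%u. u powr e) has_real_derivative e * u powr (e - 1)) (at u)" if "u \<in> {c<..<d}" for u
   using that assms by (auto intro!: has_real_derivative_powr)
  ultimately have "bd (Suc m) {c<..<d} (max (\<bar>e\<bar> * C) (max (c powr e) (d powr e))) (%u. u powr e)"
   using le by (intro bd_SucI[where f' = "%u. e * u powr (e - 1)"]) (simp_all add: le_max_iff_disj)
  moreover have "0 \<le> max (\<bar>e\<bar> * C) (max (c powr e) (d powr e))" by (simp add: le_max_iff_disj)
  ultimately show ?case by blast
 }
qed

text \<open>Each integration by parts replaces \<open>A\<close> by the derivative of
  \<open>A / u\<close> and gains a factor \<open>1 / \<omega>\<close>. The amplitude lives in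
  \<open>[-r, r]\<close>, the integral runs over \<open>[-2r, 2r]\<close> and the data are given on
  \<open>(-3r, 3r)\<close>, so boundary terms vanish and every derivative is two-sided.\<close>

lemma nonstationary_phase:
 assumes "0 < \<kappa>" "0 < r" "0 \<le> L"
 shows "0 \<le> K ==> \<exists>C\<ge>0. \<forall>A \<Phi> u \<omega>. bd m {-3*r<..<3*r} K A --> bd m {-3*r<..<3*r} L u -->
  (\<forall>s\<in>{-3*r<..<3*r}. \<kappa> \<le> \<bar>u s\<bar>) -->
  (\<forall>s\<in>{-3*r<..<3*r}. (\<Phi> has_real_derivative \<omega> * u s) (at s)) -->
  (\<forall>s\<in>{-3*r<..<3*r}. r < \<bar>s\<bar> --> A s = 0) --> 0 < \<omega> -->
  cmod (integral {-2*r..2*r} (%s. of_real (A s) * exp (\<i> * of_real (\<Phi> s)))) \<le> C / \<omega> ^ m"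
proof (induction m arbitrary: K)
 case 0
 show ?case
 proof (intro exI[of _ "K * (4 * r)"] conjI allI impI)
  fix A \<Phi> u \<omega>
  assume *: "bd 0 {-3*r<..<3*r} K A" "\<forall>s\<in>{-3*r<..<3*r}. (\<Phi> has_real_derivative \<omega> * u s) (at s)"
  have sub: "{-2*r..2*r} \<subseteq> {-3*r<..<3*r}" using assms by auto
  have "continuous_on {-3*r<..<3*r} \<Phi>" using *(2) by (auto intro!: continuous_at_imp_continuous_on DERIV_isCont)
  then have "continuous_on {-2*r..2*r} (%s. of_real (A s) * exp (\<i> * of_real (\<Phi> s)) :: complex)"
   using sub *(1) by (auto intro!: continuous_intros intro: continuous_on_subset)
  then have int: "(%s. of_real (A s) * exp (\<i> * of_real (\<Phi> s)) :: complex) integrable_on {-2*r..2*r}"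
   by (rule integrable_continuous_real)
  have "norm (integral (cbox (-2*r) (2*r)) (%s. of_real (A s) * exp (\<i> * of_real (\<Phi> s)) :: complex))
   \<le> K * measure lborel (cbox (-2*r) (2*r))"
   using int *(1) sub 0 by (intro integrable_bound) (auto simp: norm_mult)
  then show "cmod (integral {-2*r..2*r} (%s. of_real (A s) * exp (\<i> * of_real (\<Phi> s)))) \<le> K * (4 * r) / \<omega> ^ 0"
   using assms by simp
 qed (use 0 assms in auto)
next
 case (Suc m)
 obtain C1 where C1: "C1 \<ge> 0" "\<And>u I. bd (Suc m) I L u ==> (\<forall>s\<in>I. \<kappa> \<le> \<bar>u s\<bar>) ==>
  bd (Suc m) I C1 (%s. inverse (u s))" using bd_inverse[OF assms(3,1), of "Suc m"] by blast
 \<comment> \<open>Bounds \<open>A / u\<close> and therefore its derivative, the next amplitude.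
   This growth is why \<open>K\<close> is arbitrary in the induction.\<close>
 let ?K = "2 ^ Suc m * K * C1"
 have "0 \<le> ?K" using Suc.prems C1 by simp
 from Suc.IH[OF this] obtain C where C: "C \<ge> 0" "\<And>A \<Phi> u \<omega>. bd m {-3*r<..<3*r} ?K A ==> bd m {-3*r<..<3*r} L u ==>
  (\<forall>s\<in>{-3*r<..<3*r}. \<kappa> \<le> \<bar>u s\<bar>) ==>
  (\<forall>s\<in>{-3*r<..<3*r}. (\<Phi> has_real_derivative \<omega> * u s) (at s)) ==>
  (\<forall>s\<in>{-3*r<..<3*r}. r < \<bar>s\<bar> --> A s = 0) ==> 0 < \<omega> ==>
  cmod (integral {-2*r..2*r} (%s. of_real (A s) * exp (\<i> * of_real (\<Phi> s)))) \<le> C / \<omega> ^ m" by blast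
 show ?case
 proof (intro exI[of _ C] conjI allI impI)
  fix A \<Phi> u \<omega>
  let ?I = "{-3*r<..<3*r}"
  assume A: "bd (Suc m) ?I K A" and u: "bd (Suc m) ?I L u" "\<forall>s\<in>?I. \<kappa> \<le> \<bar>u s\<bar>"
   and \<Phi>: "\<forall>s\<in>?I. (\<Phi> has_real_derivative \<omega> * u s) (at s)"
   and supp: "\<forall>s\<in>?I. r < \<bar>s\<bar> --> A s = 0" and \<omega>: "0 < \<omega>"
  have sub: "{-2*r..2*r} \<subseteq> ?I" using assms by auto
  have "bd (Suc m) ?I ?K (%s. A s * inverse (u s))"
   using Suc.prems C1 A u by (intro bd_mult) auto
  then obtain B where B: "bd m ?I ?K B"
   "\<forall>s\<in>?I. ((%s. A s * inverse (u s)) has_real_derivative B s) (at s)" by auto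
  have B0: "B s = 0" if "s \<in> ?I" "r < \<bar>s\<bar>" for s
  proof -
   have op: "open (?I \<inter> {s. r < \<bar>s\<bar>})"
    by (intro open_Int open_Collect_less) (auto intro!: continuous_intros)
   have z: "((%s. A s * inverse (u s)) has_real_derivative 0) (at s)"
   proof (rule has_field_derivative_transform_within_open[OF DERIV_const, rotated])
    show "open (?I \<inter> {s. r < \<bar>s\<bar>})" by (rule op)
    show "s \<in> ?I \<inter> {s. r < \<bar>s\<bar>}" using that by blast
    show "0 = A t * inverse (u t)" if "t \<in> ?I \<inter> {s. r < \<bar>s\<bar>}" for t
     using supp[rule_format, of t] that by simp
   qed
   show ?thesis by (rule DERIV_unique[OF bspec[OF B(2) that(1)] z])
  qed
  let ?e = "%s. exp (\<i> * of_real (\<Phi> s)) :: complex"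
  have vd: "((%s. of_real (A s * inverse (u s)) * ?e s) has_vector_derivative
    of_real (B s) * ?e s + \<i> * of_real \<omega> * (of_real (A s) * ?e s)) (at s within {-2*r..2*r})"
   if "s \<in> {-2*r..2*r}" for s
  proof -
   have s: "s \<in> ?I" using that sub by auto
   have "u s \<noteq> 0" using u(2) s assms(1) by fastforce
   have "((%s. \<i> * of_real (\<Phi> s)) has_vector_derivative \<i> * of_real (\<omega> * u s)) (at s)"
    using \<Phi> s
    by (intro has_vector_derivative_mult_right bounded_linear.has_vector_derivative[OF bounded_linear_of_real])
     (simp add: has_real_derivative_iff_has_vector_derivative)
   from field_vector_diff_chain_at[OF this DERIV_exp]
   have e: "(?e has_vector_derivative \<i> * of_real (\<omega> * u s) * ?e s) (at s)" by (simp add: o_def)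
   have "((%s. of_real (A s * inverse (u s)) :: complex) has_vector_derivative of_real (B s)) (at s)"
    using B(2) s by (intro bounded_linear.has_vector_derivative[OF bounded_linear_of_real])
     (simp add: has_real_derivative_iff_has_vector_derivative)
   from has_vector_derivative_mult[OF this e]
   have "((%s. of_real (A s * inverse (u s)) * ?e s) has_vector_derivative
     of_real (A s * inverse (u s)) * (\<i> * of_real (\<omega> * u s) * ?e s) + of_real (B s) * ?e s) (at s)" .
   also have "of_real (A s * inverse (u s)) * (\<i> * of_real (\<omega> * u s) * ?e s) + of_real (B s) * ?e s
    = of_real (B s) * ?e s + \<i> * of_real \<omega> * (of_real (A s) * ?e s)"
    using \<open>u s \<noteq> 0\<close> by (simp add: field_simps)
   finally show ?thesis by (rule has_vector_derivative_at_within)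
  qed
  have "((%s. of_real (B s) * ?e s + \<i> * of_real \<omega> * (of_real (A s) * ?e s)) has_integral
   of_real (A (2*r) * inverse (u (2*r))) * ?e (2*r) - of_real (A (-2*r) * inverse (u (-2*r))) * ?e (-2*r)) {-2*r..2*r}"
   using assms vd by (intro fundamental_theorem_of_calculus) auto
  moreover have "A (2*r) = 0" "A (-2*r) = 0" using supp assms by auto
  ultimately have tot: "((%s. of_real (B s) * ?e s + \<i> * of_real \<omega> * (of_real (A s) * ?e s)) has_integral 0) {-2*r..2*r}"
   by simp
  have c\<Phi>: "continuous_on {-2*r..2*r} \<Phi>"
   using \<Phi> sub by (auto intro!: continuous_at_imp_continuous_on DERIV_isCont)
  have cA: "continuous_on {-2*r..2*r} A" and cB: "continuous_on {-2*r..2*r} B"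
   using bd_continuous_on[OF A] bd_continuous_on[OF B(1)] sub by (auto intro: continuous_on_subset)
  have iA: "(%s. of_real (A s) * ?e s) integrable_on {-2*r..2*r}"
   and iB: "(%s. of_real (B s) * ?e s) integrable_on {-2*r..2*r}"
   using c\<Phi> cA cB by (auto intro!: integrable_continuous_real continuous_intros)
  have "integral {-2*r..2*r} (%s. of_real (B s) * ?e s) + \<i> * of_real \<omega> * integral {-2*r..2*r} (%s. of_real (A s) * ?e s) = 0"
   using has_integral_unique[OF tot has_integral_add[OF integrable_integral[OF iB]
    has_integral_mult_right[OF integrable_integral[OF iA], of "\<i> * of_real \<omega>"]]] by simp
  then have "\<i> * of_real \<omega> * integral {-2*r..2*r} (%s. of_real (A s) * ?e s) = - integral {-2*r..2*r} (%s. of_real (B s) * ?e s)"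
   by (simp add: add_eq_0_iff)
  then have "cmod (\<i> * of_real \<omega> * integral {-2*r..2*r} (%s. of_real (A s) * ?e s)) = cmod (integral {-2*r..2*r} (%s. of_real (B s) * ?e s))"
   by simp
  then have "\<omega> * cmod (integral {-2*r..2*r} (%s. of_real (A s) * ?e s)) = cmod (integral {-2*r..2*r} (%s. of_real (B s) * ?e s))"
   using \<omega> by (simp add: norm_mult)
  also have "\<dots> \<le> C / \<omega> ^ m"
   using B B0 u \<Phi> \<omega> bd_pred[OF u(1)] by (intro C(2)[of B u]) auto
  finally show "cmod (integral {-2*r..2*r} (%s. of_real (A s) * ?e s)) \<le> C / \<omega> ^ Suc m"
   using \<omega> by (simp add: field_simps)
 qed (rule C)
qed

section \<open>The group and its Haar measure\<close>

text \<open>Uniqueness of product measures: both measures agree on boxes, where the claim splits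
  into one-dimensional substitutions.\<close>

lemma nn_integral_PiM_lborel_affine:
 fixes c :: real and \<xi> :: "'i => real"
 assumes I: "finite I" and c: "c \<noteq> 0"
  and g[measurable]: "g \<in> borel_measurable (PiM I (%_. lborel))"
 shows "(\<integral>\<^sup>+x. g x \<partial>PiM I (%_. lborel)) =
  ennreal (\<bar>c\<bar> ^ card I) * (\<integral>\<^sup>+x. g (\<lambda>i\<in>I. c * x i + \<xi> i) \<partial>PiM I (%_. lborel))"
proof -
 interpret P: product_sigma_finite "%_::'i. lborel :: real measure"
  by standard
 let ?P = "PiM I (%_. lborel :: real measure)"
 let ?T = "%x. \<lambda>i\<in>I. c * x i + \<xi> i"
 have T[measurable]: "?T \<in> measurable ?P ?P"
  by (intro measurable_restrict) measurable
 let ?Q = "density (distr ?P ?P ?T) (%_. ennreal (\<bar>c\<bar> ^ card I))"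
 have "?Q = ?P"
 proof (rule P.PiM_eqI)
  fix A :: "'i => real set" assume A: "\<And>i. i \<in> I ==> A i \<in> sets lborel"
  have pre: "?T -` (Pi\<^sub>E I A) \<inter> space ?P = (\<Pi>\<^sub>E i\<in>I. (%s. c * s + \<xi> i) -` A i)"
   by (auto simp: space_PiM PiE_iff extensional_def)
  have m: "(%s. c * s + \<xi> i) -` A i \<in> sets lborel" if "i \<in> I" for i
   using measurable_sets[of "%s. c * s + \<xi> i" borel borel "A i"] A[OF that] by simp
  have e: "emeasure lborel (A i) = ennreal \<bar>c\<bar> * emeasure lborel ((%s. c * s + \<xi> i) -` A i)" if "i \<in> I" for i
  proof -
   have "emeasure lborel (A i) = (\<integral>\<^sup>+s. indicator (A i) s \<partial>lborel)" using A[OF that] by simp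
   also have "\<dots> = \<bar>c\<bar> * (\<integral>\<^sup>+s. indicator (A i) (\<xi> i + c * s) \<partial>lborel)"
    using A[OF that] c by (intro nn_integral_real_affine) auto
   also have "(\<integral>\<^sup>+s. indicator (A i) (\<xi> i + c * s) \<partial>lborel) = (\<integral>\<^sup>+s. indicator ((%s. c * s + \<xi> i) -` A i) s \<partial>lborel)"
    by (intro nn_integral_cong) (auto simp: indicator_def add.commute)
   also have "\<dots> = emeasure lborel ((%s. c * s + \<xi> i) -` A i)" using m[OF that] by simp
   finally show ?thesis .
  qed
  have P: "Pi\<^sub>E I A \<in> sets ?P" using A I by (intro sets_PiM_I_finite) auto
  have "emeasure ?Q (Pi\<^sub>E I A) = ennreal (\<bar>c\<bar> ^ card I) * emeasure ?P (\<Pi>\<^sub>E i\<in>I. (%s. c * s + \<xi> i) -` A i)"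
   using P by (simp add: emeasure_density_const emeasure_distr pre)
  also have "\<dots> = (\<Prod>i\<in>I. emeasure lborel (A i))"
   using I m by (subst P.emeasure_PiM) (auto simp: e prod.distrib ennreal_power)
  finally show "emeasure ?Q (Pi\<^sub>E I A) = (\<Prod>i\<in>I. emeasure lborel (A i))" .
 qed (auto simp: I)
 then have "(\<integral>\<^sup>+x. g x \<partial>?P) = (\<integral>\<^sup>+x. g x \<partial>?Q)" by simp
 also have "\<dots> = ennreal (\<bar>c\<bar> ^ card I) * (\<integral>\<^sup>+x. g (?T x) \<partial>?P)"
  by (subst nn_integral_density) (auto simp: nn_integral_cmult nn_integral_distr)
 finally show ?thesis .
qed

section \<open>Coordinates, measurability and the group laws\<close>

text \<open>Treats \<open>t\<close> as the coordinate of index \<open>2 * n\<close>, so that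
  estimates and partial derivatives quantify over \<open>k \<le> 2 * n\<close> without a separate
  case.\<close>

definition co :: "nat => hpoint => nat => real" where
 "co n p i = (if i < 2 * n then fst p i else snd p)"

lemma sigma_finite_hmeasure: "sigma_finite_measure (hmeasure n)"
proof -
 interpret P: product_sigma_finite "%_::nat. lborel :: real measure" by standard
 have "sigma_finite_measure (PiM {..<2 * n} (%_. lborel :: real measure))"
  by (rule P.sigma_finite) simp
 then show ?thesis unfolding hmeasure_def
  by (intro sigma_finite_pair_measure) (auto intro: lborel.sigma_finite_measure_axioms)
qed

interpretation hm: sigma_finite_measure "hmeasure n" for n
 by (rule sigma_finite_hmeasure)

interpretation hmp: pair_sigma_finite "hmeasure n" "hmeasure m" for n m
 by standard

lemma space_hmeasure: "space (hmeasure n) = hspace n"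
 by (simp add: hmeasure_def hspace_def space_pair_measure space_PiM)

lemma measurable_fst_hmeasure[measurable]: "fst \<in> measurable (hmeasure n) (PiM {..<2 * n} (%_. lborel))"
 by (simp add: hmeasure_def)

lemma measurable_snd_hmeasure[measurable]: "snd \<in> borel_measurable (hmeasure n)"
 using measurable_snd[of "PiM {..<2 * n} (%_. lborel)" "lborel :: real measure"]
 by (simp add: hmeasure_def)

lemma measurable_fst_comp[measurable (raw)]:
 assumes "f \<in> measurable N (hmeasure n)" "i < 2 * n"
 shows "(%x. fst (f x) i) \<in> borel_measurable N"
proof -
 have "(%x. x i) \<in> borel_measurable (PiM {..<2 * n} (%_. lborel :: real measure))"
  using measurable_component_singleton[of i "{..<2 * n}" "%_. lborel :: real measure"] assms(2) by simp
 then show ?thesis using assms(1) by measurable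
qed

lemma measurable_snd_comp[measurable (raw)]:
 assumes "f \<in> measurable N (hmeasure n)"
 shows "(%x. snd (f x)) \<in> borel_measurable N"
 using assms by measurable

lemma measurable_co[measurable (raw)]:
 assumes "f \<in> measurable N (hmeasure n)"
 shows "(%x. co n (f x) i) \<in> borel_measurable N"
 using assms by (cases "i < 2 * n") (auto simp: co_def)

lemma measurable_hmeasureI:
 assumes "\<And>i. i < 2 * n ==> (%x. X x i) \<in> borel_measurable N" "T \<in> borel_measurable N"
 shows "(%x. (\<lambda>i\<in>{..<2 * n}. X x i, T x)) \<in> measurable N (hmeasure n)"
 unfolding hmeasure_def using assms
 by (intro measurable_Pair measurable_restrict) auto

lemma measurable_symp[measurable (raw)]:
 assumes f: "f \<in> measurable N (hmeasure n)" and g: "g \<in> measurable N (hmeasure n)"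
 shows "(%x. symp n (fst (f x)) (fst (g x))) \<in> borel_measurable N"
 unfolding symp_def
 by (intro borel_measurable_sum borel_measurable_diff borel_measurable_times measurable_fst_comp[OF f] measurable_fst_comp[OF g]) auto

lemma hmult_eq: "hmult n a p q = (\<lambda>i\<in>{..<2 * n}. fst p i + fst q i, snd q + snd p - 2 * a * symp n (fst p) (fst q))"
 by (simp add: hmult_def case_prod_beta)

lemma hinv_eq: "hinv n p = (\<lambda>i\<in>{..<2 * n}. - fst p i, - snd p)"
 by (simp add: hinv_def case_prod_beta)

lemma measurable_hmult[measurable (raw)]:
 assumes f[measurable]: "f \<in> measurable N (hmeasure n)" and g[measurable]: "g \<in> measurable N (hmeasure n)"
 shows "(%x. hmult n a (f x) (g x)) \<in> measurable N (hmeasure n)"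
 unfolding hmult_eq by (intro measurable_hmeasureI) measurable

lemma measurable_hinv[measurable (raw)]:
 assumes f[measurable]: "f \<in> measurable N (hmeasure n)"
 shows "(%x. hinv n (f x)) \<in> measurable N (hmeasure n)"
 unfolding hinv_eq by (intro measurable_hmeasureI) measurable

text \<open>The automorphic dilations: \<open>t\<close> scales quadratically because the group law
  adds a bilinear form in the horizontal variables to it.\<close>

definition dil :: "nat => real => hpoint => hpoint" where
 "dil n r p = (\<lambda>i\<in>{..<2 * n}. r * fst p i, r\<^sup>2 * snd p)"

lemma measurable_dil[measurable (raw)]:
 assumes f[measurable]: "f \<in> measurable N (hmeasure n)"
 shows "(%x. dil n r (f x)) \<in> measurable N (hmeasure n)"
 unfolding dil_def by (intro measurable_hmeasureI) measurable

lemma shift_eq: "shift n i p h = (if i < 2 * n then ((fst p)(i := fst p i + h), snd p) else (fst p, snd p + h))"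
 by (simp add: shift_def case_prod_beta)

lemma co_shift: "i \<le> 2 * n ==> k \<le> 2 * n ==> co n (shift n i p h) k = co n p k + (if k = i then h else 0)"
 by (auto simp: co_def shift_eq)

lemma hspace_iff: "p \<in> hspace n \<longleftrightarrow> fst p \<in> extensional {..<2 * n}"
 by (cases p) (auto simp: hspace_def PiE_def)

lemma hspace_eqI:
 assumes "p \<in> hspace n" "q \<in> hspace n" "\<And>i. i < 2 * n ==> fst p i = fst q i" "snd p = snd q"
 shows "p = q"
 using assms unfolding hspace_iff by (intro prod_eqI extensionalityI[of "fst p" "{..<2 * n}"]) auto

lemma hspace_co_eqI:
 assumes "p \<in> hspace n" "q \<in> hspace n" "\<And>i. i \<le> 2 * n ==> co n p i = co n q i"
 shows "p = q"
proof (rule hspace_eqI[OF assms(1,2)])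
 show "fst p i = fst q i" if "i < 2 * n" for i using assms(3)[of i] that by (simp add: co_def)
 show "snd p = snd q" using assms(3)[of "2 * n"] by (simp add: co_def)
qed

lemma hspace_closed[simp]:
 "hmult n a p q \<in> hspace n" "hinv n p \<in> hspace n" "dil n r p \<in> hspace n"
 by (simp_all add: hspace_iff hmult_eq hinv_eq dil_def)

lemma shift_hspace[simp]: "p \<in> hspace n ==> shift n i p h \<in> hspace n"
 by (auto simp: hspace_iff shift_eq extensional_def)

lemma measurable_shift[measurable (raw)]:
 assumes f[measurable]: "f \<in> measurable N (hmeasure n)" and h[measurable]: "h \<in> borel_measurable N"
 shows "(%x. shift n i (f x) (h x)) \<in> measurable N (hmeasure n)"
proof -
 have "(%x. (\<lambda>k\<in>{..<2 * n}. fst (f x) k + (if k = i then h x else 0), snd (f x) + (if i < 2 * n then 0 else h x)))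
   \<in> measurable N (hmeasure n)"
  by (intro measurable_hmeasureI) measurable
 moreover have "shift n i (f x) (h x) = (\<lambda>k\<in>{..<2 * n}. fst (f x) k + (if k = i then h x else 0), snd (f x) + (if i < 2 * n then 0 else h x))"
  if "x \<in> space N" for x
 proof -
  have "f x \<in> hspace n" using measurable_space[OF f that] by (simp add: space_hmeasure)
  then show ?thesis by (auto simp: shift_eq hspace_iff extensional_def)
 qed
 ultimately show ?thesis by (subst measurable_cong) auto
qed

lemma symp_cong: "(\<And>i. i < 2 * n ==> x i = x' i) ==> (\<And>i. i < 2 * n ==> y i = y' i) ==> symp n x y = symp n x' y'"
 unfolding symp_def by (intro sum.cong) auto

lemma symp_restrict[simp]:
 "symp n (restrict x {..<2 * n}) y = symp n x y" "symp n x (restrict y {..<2 * n}) = symp n x y"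
 "symp n (%i. if i < 2 * n then x i else x' i) y = symp n x y"
 "symp n x (%i. if i < 2 * n then y i else y' i) = symp n x y"
 by (auto intro!: symp_cong)

lemma symp_add_left: "symp n (%i. x i + y i) z = symp n x z + symp n y z"
 and symp_add_right: "symp n z (%i. x i + y i) = symp n z x + symp n z y"
 by (simp_all add: symp_def algebra_simps sum.distrib sum_subtractf)

lemma symp_scale_left: "symp n (%i. c * x i) z = c * symp n x z"
 and symp_scale_right: "symp n z (%i. c * x i) = c * symp n z x"
 by (simp_all add: symp_def algebra_simps sum_distrib_left)

lemma symp_minus_left: "symp n (%i. - x i) z = - symp n x z"
 and symp_minus_right: "symp n z (%i. - x i) = - symp n z x"
 using symp_scale_left[of n "-1"] symp_scale_right[of n _ "-1"] by simp_all

lemma symp_self[simp]: "symp n x x = 0"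
 by (simp add: symp_def)

lemma symp_swap: "symp n x y = - symp n y x"
 by (simp add: symp_def sum_negf[symmetric] algebra_simps)

lemmas symp_linear = symp_add_left symp_add_right symp_minus_left symp_minus_right
 symp_scale_left symp_scale_right

lemma restrict_hspace[simp]: "(restrict x {..<2 * n}, t) \<in> hspace n"
 by (simp add: hspace_iff)

lemma hmult_assoc: "hmult n a (hmult n a p q) r = hmult n a p (hmult n a q r)"
proof (rule hspace_eqI[of _ n])
 show "snd (hmult n a (hmult n a p q) r) = snd (hmult n a p (hmult n a q r))"
  by (simp add: hmult_eq symp_linear distrib_left)
qed (simp_all, simp add: hmult_eq)

lemma hinv_hmult: "hinv n (hmult n a p q) = hmult n a (hinv n q) (hinv n p)"
 using symp_swap[of n "fst q" "fst p"]
 by (auto simp: hmult_eq hinv_eq symp_linear fun_eq_iff)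

lemma hinv_hinv[simp]: "p \<in> hspace n ==> hinv n (hinv n p) = p"
 by (rule hspace_eqI[of _ n]) (auto simp: hinv_eq)

lemma hmult_hinv_cancel[simp]:
 assumes "q \<in> hspace n"
 shows "hmult n a (hinv n p) (hmult n a p q) = q" "hmult n a p (hmult n a (hinv n p) q) = q"
  "hmult n a (hmult n a q p) (hinv n p) = q" "hmult n a (hmult n a q (hinv n p)) p = q"
proof -
 have *: "u = q" if "u \<in> hspace n" "\<And>i. i < 2 * n ==> fst u i = fst q i" "snd u = snd q" for u
  using hspace_eqI[OF that(1) assms] that(2,3) by blast
 show "hmult n a (hinv n p) (hmult n a p q) = q" "hmult n a p (hmult n a (hinv n p) q) = q"
  "hmult n a (hmult n a q p) (hinv n p) = q" "hmult n a (hmult n a q (hinv n p)) p = q"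
  by (rule *; simp add: hmult_eq hinv_eq symp_linear symp_swap[of n "fst q" "fst p"])+
qed

lemma dil_hmult: "dil n r (hmult n a p q) = hmult n a (dil n r p) (dil n r q)"
proof (rule hspace_eqI[of _ n])
 show "snd (dil n r (hmult n a p q)) = snd (hmult n a (dil n r p) (dil n r q))"
  unfolding dil_def hmult_eq fst_conv snd_conv symp_restrict symp_linear
  by (simp add: algebra_simps power2_eq_square)
qed (simp_all, simp add: hmult_eq dil_def distrib_left)

lemma dil_hinv: "dil n r (hinv n p) = hinv n (dil n r p)"
 by (auto simp: dil_def hinv_eq)

lemma dil_dil: "dil n r (dil n s p) = dil n (r * s) p"
 by (auto simp: dil_def power_mult_distrib)

lemma dil_1[simp]: "p \<in> hspace n ==> dil n 1 p = p"
 by (rule hspace_eqI[of _ n]) (auto simp: dil_def)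

lemma co_dil: "k \<le> 2 * n ==> co n (dil n r p) k = (if k < 2 * n then r else r\<^sup>2) * co n p k"
 by (auto simp: co_def dil_def)

section \<open>Changes of variables\<close>

text \<open>Covers translations, inversion, dilations and coordinate shifts at once: all are affine
  in \<open>x\<close> with a shear of \<open>t\<close> by a function of \<open>x\<close>. For fixed
  \<open>x\<close> the shear is a translation, so Tonelli reduces the claim to the substitution in
  \<open>x\<close>.\<close>

lemma nn_integral_hmeasure_affine:
 assumes c: "c \<noteq> 0" "e \<noteq> 0" and f[measurable]: "f \<in> borel_measurable (hmeasure n)"
  and l[measurable]: "l \<in> borel_measurable (PiM {..<2 * n} (%_. lborel))"
 shows "(\<integral>\<^sup>+p. f p \<partial>hmeasure n) =
  ennreal (\<bar>c\<bar> ^ (2 * n) * \<bar>e\<bar>) * (\<integral>\<^sup>+p. f (\<lambda>i\<in>{..<2 * n}. c * fst p i + \<xi> i, e * snd p + l (fst p)) \<partial>hmeasure n)"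
proof -
 let ?P = "PiM {..<2 * n} (%_. lborel :: real measure)"
 have f'[measurable]: "f \<in> borel_measurable (?P \<Otimes>\<^sub>M lborel)" using f by (simp add: hmeasure_def)
 let ?T = "%x. \<lambda>i\<in>{..<2 * n}. c * x i + \<xi> i"
 have T[measurable]: "?T \<in> measurable ?P ?P"
  by (intro measurable_restrict) measurable
 define g where "g = (%x. \<integral>\<^sup>+t. f (x, t) \<partial>lborel)"
 have g[measurable]: "g \<in> borel_measurable ?P" unfolding g_def by measurable
 have "(\<integral>\<^sup>+p. f (?T (fst p), e * snd p + l (fst p)) \<partial>hmeasure n) =
   (\<integral>\<^sup>+x. \<integral>\<^sup>+t. f (?T x, e * t + l x) \<partial>lborel \<partial>?P)"
  unfolding hmeasure_def by (subst lborel.nn_integral_fst[symmetric]) auto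
 also have "ennreal \<bar>e\<bar> * \<dots> = (\<integral>\<^sup>+x. ennreal \<bar>e\<bar> * (\<integral>\<^sup>+t. f (?T x, e * t + l x) \<partial>lborel) \<partial>?P)"
  by (intro nn_integral_cmult[symmetric]) measurable
 also have "\<dots> = (\<integral>\<^sup>+x. g (?T x) \<partial>?P)"
 proof (intro nn_integral_cong)
  fix x assume "x \<in> space ?P"
  then have "?T x \<in> space ?P" using measurable_space[OF T] by auto
  then have "(%t. f (?T x, t)) \<in> borel_measurable borel"
   using measurable_Pair2[OF f', of "?T x"] by simp
  then show "ennreal \<bar>e\<bar> * (\<integral>\<^sup>+t. f (?T x, e * t + l x) \<partial>lborel) = g (?T x)"
   unfolding g_def using c
   by (subst nn_integral_real_affine[of "%t. f (?T x, t)" e "l x"]) (auto simp: add.commute)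
 qed
 also have "ennreal (\<bar>c\<bar> ^ (2 * n)) * \<dots> = (\<integral>\<^sup>+x. g x \<partial>?P)"
  by (subst nn_integral_PiM_lborel_affine[where c = c and \<xi> = \<xi>]) (auto simp: c)
 also have "\<dots> = (\<integral>\<^sup>+p. f p \<partial>hmeasure n)"
  unfolding hmeasure_def g_def by (subst lborel.nn_integral_fst[symmetric]) auto
 finally show ?thesis by (simp add: ennreal_mult' mult_ac)
qed

text \<open>\<open>k\<close> is the Jacobian. An equation between measures is used because the
  formulas for non-negative integrals, for Bochner integrals and for integrability all follow from
  it.\<close>

definition scales :: "nat => (hpoint => hpoint) => real => bool" where
 "scales n T k \<longleftrightarrow> 0 < k \<and> T \<in> measurable (hmeasure n) (hmeasure n) \<and>
   density (distr (hmeasure n) (hmeasure n) T) (%_. ennreal k) = hmeasure n"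

lemma scalesI:
 assumes "0 < k" and T[measurable]: "T \<in> measurable (hmeasure n) (hmeasure n)"
  and eq: "\<And>f. f \<in> borel_measurable (hmeasure n) ==>
   (\<integral>\<^sup>+p. f p \<partial>hmeasure n) = ennreal k * (\<integral>\<^sup>+p. f (T p) \<partial>hmeasure n)"
 shows "scales n T k"
 unfolding scales_def
proof (intro conjI assms(1) T measure_eqI)
 fix A assume "A \<in> sets (density (distr (hmeasure n) (hmeasure n) T) (%_. ennreal k))"
 then have A[measurable]: "A \<in> sets (hmeasure n)" by simp
 have "emeasure (hmeasure n) A = (\<integral>\<^sup>+p. indicator A p \<partial>hmeasure n)" by simp
 also have "\<dots> = ennreal k * (\<integral>\<^sup>+p. indicator A (T p) \<partial>hmeasure n)" by (rule eq) simp
 also have "(\<integral>\<^sup>+p. indicator A (T p) \<partial>hmeasure n) = (\<integral>\<^sup>+p. indicator A p \<partial>distr (hmeasure n) (hmeasure n) T)"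
  by (subst nn_integral_distr) auto
 finally show "emeasure (density (distr (hmeasure n) (hmeasure n) T) (%_. ennreal k)) A = emeasure (hmeasure n) A"
  by (simp add: emeasure_density_const)
qed simp

lemma scales_measurable: "scales n T k ==> T \<in> measurable (hmeasure n) (hmeasure n)"
 by (simp add: scales_def)

lemma nn_integral_scales:
 assumes "scales n T k" and [measurable]: "f \<in> borel_measurable (hmeasure n)"
 shows "(\<integral>\<^sup>+p. f p \<partial>hmeasure n) = ennreal k * (\<integral>\<^sup>+p. f (T p) \<partial>hmeasure n)"
proof -
 note [measurable] = scales_measurable[OF assms(1)]
 have "(\<integral>\<^sup>+p. f p \<partial>hmeasure n) = (\<integral>\<^sup>+p. f p \<partial>density (distr (hmeasure n) (hmeasure n) T) (%_. ennreal k))"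
  using assms(1) by (simp add: scales_def)
 also have "\<dots> = ennreal k * (\<integral>\<^sup>+p. f (T p) \<partial>hmeasure n)"
  by (subst nn_integral_density) (auto simp: nn_integral_cmult nn_integral_distr)
 finally show ?thesis .
qed

lemma integral_scales:
 fixes f :: "hpoint => 'b :: {banach, second_countable_topology}"
 assumes "scales n T k" and [measurable]: "f \<in> borel_measurable (hmeasure n)"
 shows "(\<integral>p. f p \<partial>hmeasure n) = k *\<^sub>R (\<integral>p. f (T p) \<partial>hmeasure n)"
proof -
 note [measurable] = scales_measurable[OF assms(1)]
 have "(\<integral>p. f p \<partial>hmeasure n) = (\<integral>p. f p \<partial>density (distr (hmeasure n) (hmeasure n) T) (%_. ennreal k))"
  using assms(1) by (simp add: scales_def)
 also have "\<dots> = k *\<^sub>R (\<integral>p. f (T p) \<partial>hmeasure n)"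
  using assms(1) by (subst integral_density) (auto simp: integral_distr scales_def)
 finally show ?thesis .
qed

lemma integrable_scales:
 fixes f :: "hpoint => 'b :: {banach, second_countable_topology}"
 assumes "scales n T k" and [measurable]: "f \<in> borel_measurable (hmeasure n)"
 shows "integrable (hmeasure n) (%p. f (T p)) \<longleftrightarrow> integrable (hmeasure n) f"
proof -
 note [measurable] = scales_measurable[OF assms(1)]
 have k: "0 < k" using assms(1) by (simp add: scales_def)
 have "integrable (hmeasure n) f \<longleftrightarrow> integrable (density (distr (hmeasure n) (hmeasure n) T) (%_. ennreal k)) f"
  using assms(1) by (simp add: scales_def)
 also have "\<dots> \<longleftrightarrow> integrable (hmeasure n) (%p. k *\<^sub>R f (T p))"
  using k by (subst integrable_density) (auto simp: integrable_distr_eq)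
 also have "\<dots> \<longleftrightarrow> integrable (hmeasure n) (%p. f (T p))"
 proof
  assume "integrable (hmeasure n) (%p. k *\<^sub>R f (T p))"
  then have "integrable (hmeasure n) (%p. inverse k *\<^sub>R (k *\<^sub>R f (T p)))" by (rule integrable_scaleR_right)
  then show "integrable (hmeasure n) (%p. f (T p))" using k by simp
 qed auto
 finally show ?thesis by simp
qed

lemma scales_affine:
 assumes c: "c \<noteq> 0" "e \<noteq> 0"
  and l[measurable]: "l \<in> borel_measurable (PiM {..<2 * n} (%_. lborel))"
 shows "scales n (%p. (\<lambda>i\<in>{..<2 * n}. c * fst p i + \<xi> i, e * snd p + l (fst p))) (\<bar>c\<bar> ^ (2 * n) * \<bar>e\<bar>)"
 using c by (intro scalesI nn_integral_hmeasure_affine measurable_hmeasureI) auto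

lemma scales_cong:
 assumes "scales n T k" "\<And>p. p \<in> hspace n ==> T p = T' p" "k = k'"
 shows "scales n T' k'"
proof -
 have "distr (hmeasure n) (hmeasure n) T = distr (hmeasure n) (hmeasure n) T'"
  using assms(2) by (intro distr_cong) (auto simp: space_hmeasure)
 moreover have "T' \<in> measurable (hmeasure n) (hmeasure n)"
  using assms by (subst measurable_cong[of _ _ T]) (auto simp: space_hmeasure scales_def)
 ultimately show ?thesis using assms by (simp add: scales_def)
qed

lemma measurable_symp_PiM[measurable]:
 "(%x. symp n w x) \<in> borel_measurable (PiM {..<2 * n} (%_. lborel :: real measure))"
 unfolding symp_def
proof (intro borel_measurable_sum borel_measurable_diff borel_measurable_times borel_measurable_const)
 fix k assume "k \<in> {..<n}"
 then have k: "k \<in> {..<2 * n}" "n + k \<in> {..<2 * n}" by auto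
 show "(%x. x k) \<in> borel_measurable (PiM {..<2 * n} (%_. lborel :: real measure))"
  "(%x. x (n + k)) \<in> borel_measurable (PiM {..<2 * n} (%_. lborel :: real measure))"
  using measurable_component_singleton[of k "{..<2 * n}" "%_. lborel :: real measure"]
   measurable_component_singleton[of "n + k" "{..<2 * n}" "%_. lborel :: real measure"] k by simp_all
qed

text \<open>With \<open>scales_right\<close>: Lebesgue measure is a Haar measure on both
  sides.\<close>

lemma scales_left: "scales n (hmult n a w) 1"
 by (rule scales_cong[OF scales_affine[where c = 1 and e = 1 and \<xi> = "fst w" and
    l = "%x. snd w - 2 * a * symp n (fst w) x"]]) (auto simp: hmult_eq add.commute)

lemma scales_right: "scales n (%p. hmult n a p w) 1"
 by (rule scales_cong[OF scales_affine[where c = 1 and e = 1 and \<xi> = "fst w" and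
    l = "%x. snd w + 2 * a * symp n (fst w) x"]])
  (auto simp: hmult_eq add.commute symp_swap[of n _ "fst w"])

lemma scales_hinv: "scales n (hinv n) 1"
 by (rule scales_cong[OF scales_affine[where c = "-1" and e = "-1" and \<xi> = "%_. 0" and
    l = "%_. 0"]]) (auto simp: hinv_eq)

lemma scales_shift: "scales n (%p. shift n i p h) 1"
 by (rule scales_cong[OF scales_affine[where c = 1 and e = 1 and \<xi> = "%k. if k = i then h else 0" and
    l = "%_. if i < 2 * n then 0 else h"]]) (auto simp: hspace_iff shift_eq extensional_def fun_eq_iff)

text \<open>The exponent \<open>2 * n + 2\<close> is the homogeneous dimension.\<close>

lemma scales_dil: "0 < r ==> scales n (dil n r) (r ^ (2 * n + 2))"
 by (rule scales_cong[OF scales_affine[where c = r and e = "r\<^sup>2" and \<xi> = "%k. 0" and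
    l = "%_. 0"]]) (auto simp: dil_def power_add power2_eq_square)

section \<open>\<open>L\<^sup>2\<close> spaces and almost orthogonality\<close>

lemma borel_measurable_cnj[measurable (raw)]:
 "f \<in> borel_measurable M ==> (%x. cnj (f x)) \<in> borel_measurable M"
 by (rule borel_measurable_continuous_on[OF continuous_on_cnj[OF continuous_on_id, simplified id_def]])

lemma ennreal_power2_leD:
 assumes "x\<^sup>2 \<le> (ennreal r)\<^sup>2" "0 \<le> r"
 shows "x \<le> ennreal r"
proof (cases x)
 case (real s)
 then show ?thesis using assms by (auto simp: ennreal_power intro!: ennreal_leI elim: power2_le_imp_le)
next
 case top
 then show ?thesis using assms by (simp add: ennreal_power top_unique)
qed

lemma ennreal_power2_less_top: "(ennreal r)\<^sup>2 < \<infinity>"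
 by (simp add: power2_eq_square ennreal_mult_less_top)

definition inner_L2 :: "'a measure => ('a => complex) => ('a => complex) => complex" where
 "inner_L2 M f g = (\<integral>p. f p * cnj (g p) \<partial>M)"

lemma square_integrable_measurable[measurable_dest]: "square_integrable M f ==> f \<in> borel_measurable M"
 by (simp add: square_integrable_def)

lemma square_integrable_iff:
 "square_integrable M f \<longleftrightarrow> f \<in> borel_measurable M \<and> (\<integral>\<^sup>+p. (ennreal (cmod (f p)))\<^sup>2 \<partial>M) < \<infinity>"
 unfolding square_integrable_def integrable_iff_bounded
 by (auto simp: ennreal_power)

lemma norm_L2_nonneg[simp]: "0 \<le> norm_L2 M f"
 by (simp add: norm_L2_def)

lemma norm_L2_power2: "(norm_L2 M f)\<^sup>2 = (\<integral>p. (cmod (f p))\<^sup>2 \<partial>M)"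
 by (simp add: norm_L2_def)

lemma nn_integral_norm_L2:
 assumes "square_integrable M f"
 shows "(\<integral>\<^sup>+p. (ennreal (cmod (f p)))\<^sup>2 \<partial>M) = (ennreal (norm_L2 M f))\<^sup>2"
 using assms by (simp add: ennreal_power norm_L2_power2 nn_integral_eq_integral square_integrable_def)

lemma square_integrableI:
 assumes f: "f \<in> borel_measurable M" and B: "(\<integral>\<^sup>+p. (ennreal (cmod (f p)))\<^sup>2 \<partial>M) \<le> (ennreal B)\<^sup>2" "0 \<le> B"
 shows "square_integrable M f" "norm_L2 M f \<le> B"
proof -
 show s: "square_integrable M f"
  unfolding square_integrable_iff using f le_less_trans[OF B(1) ennreal_power2_less_top] by blast
 have "ennreal ((norm_L2 M f)\<^sup>2) \<le> ennreal (B\<^sup>2)"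
  using B nn_integral_norm_L2[OF s] by (simp add: ennreal_power)
 then show "norm_L2 M f \<le> B" using B(2) by (auto elim: power2_le_imp_le)
qed

lemma square_integrable_mono:
 assumes g: "square_integrable M g" and f: "f \<in> borel_measurable M" and le: "AE p in M. cmod (f p) \<le> cmod (g p)"
 shows "square_integrable M f" "norm_L2 M f \<le> norm_L2 M g"
proof -
 have "(\<integral>\<^sup>+p. (ennreal (cmod (f p)))\<^sup>2 \<partial>M) \<le> (\<integral>\<^sup>+p. (ennreal (cmod (g p)))\<^sup>2 \<partial>M)"
  by (intro nn_integral_mono_AE) (use le in \<open>auto intro!: power_mono simp: ennreal_power\<close>)
 then have "(\<integral>\<^sup>+p. (ennreal (cmod (f p)))\<^sup>2 \<partial>M) \<le> (ennreal (norm_L2 M g))\<^sup>2"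
  by (simp add: nn_integral_norm_L2[OF g])
 from square_integrableI[OF f this] show "square_integrable M f" "norm_L2 M f \<le> norm_L2 M g" by auto
qed

lemma nn_integral_mult_norm_L2:
 assumes f: "square_integrable M f" and g: "square_integrable M g"
 shows "(\<integral>\<^sup>+p. ennreal (cmod (f p)) * ennreal (cmod (g p)) \<partial>M) \<le> ennreal (norm_L2 M f * norm_L2 M g)"
proof -
 note [measurable] = square_integrable_measurable[OF f] square_integrable_measurable[OF g]
 have "(\<integral>\<^sup>+p. ennreal (cmod (f p)) * ennreal (cmod (g p)) \<partial>M)\<^sup>2 \<le>
   (\<integral>\<^sup>+p. (ennreal (cmod (f p)))\<^sup>2 \<partial>M) * (\<integral>\<^sup>+p. (ennreal (cmod (g p)))\<^sup>2 \<partial>M)"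
  by (rule Cauchy_Schwarz_nn_integral) auto
 also have "\<dots> = (ennreal (norm_L2 M f * norm_L2 M g))\<^sup>2"
  by (simp add: nn_integral_norm_L2[OF f] nn_integral_norm_L2[OF g] ennreal_mult power_mult_distrib)
 finally show ?thesis by (rule ennreal_power2_leD) simp
qed

lemma integrable_mult_L2:
 assumes f: "square_integrable M f" and g: "square_integrable M g"
 shows "integrable M (%p. f p * cnj (g p))"
proof (rule integrableI_bounded)
 note [measurable] = square_integrable_measurable[OF f] square_integrable_measurable[OF g]
 show "(%p. f p * cnj (g p)) \<in> borel_measurable M" by measurable
 have "(\<integral>\<^sup>+p. ennreal (norm (f p * cnj (g p))) \<partial>M) \<le> ennreal (norm_L2 M f * norm_L2 M g)"
  using nn_integral_mult_norm_L2[OF f g] by (simp add: norm_mult ennreal_mult)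
 then show "(\<integral>\<^sup>+p. ennreal (norm (f p * cnj (g p))) \<partial>M) < \<infinity>" by (simp add: le_less_trans)
qed

lemma inner_L2_le:
 assumes f: "square_integrable M f" and g: "square_integrable M g"
 shows "cmod (inner_L2 M f g) \<le> norm_L2 M f * norm_L2 M g"
proof -
 have "ennreal (cmod (inner_L2 M f g)) \<le> (\<integral>\<^sup>+p. ennreal (norm (f p * cnj (g p))) \<partial>M)"
  unfolding inner_L2_def by (rule integral_norm_bound_ennreal) (rule integrable_mult_L2[OF f g])
 also have "\<dots> \<le> ennreal (norm_L2 M f * norm_L2 M g)"
  using nn_integral_mult_norm_L2[OF f g] by (simp add: norm_mult ennreal_mult)
 finally show ?thesis by simp
qed

lemma inner_L2_self: "inner_L2 M f f = of_real ((norm_L2 M f)\<^sup>2)"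
 unfolding inner_L2_def norm_L2_power2
 by (simp add: complex_norm_square[symmetric] flip: integral_complex_of_real)

lemma inner_L2_cnj: "inner_L2 M g f = cnj (inner_L2 M f g)"
 unfolding inner_L2_def by (simp add: mult.commute flip: Bochner_Integration.integral_cnj)

lemma square_integrable_cmult[intro]:
 assumes f: "square_integrable M f"
 shows "square_integrable M (%p. c * f p)" "norm_L2 M (%p. c * f p) = cmod c * norm_L2 M f"
proof -
 show "square_integrable M (%p. c * f p)"
  using f by (auto simp: square_integrable_def norm_mult power_mult_distrib)
 show "norm_L2 M (%p. c * f p) = cmod c * norm_L2 M f"
  by (simp add: norm_L2_def norm_mult power_mult_distrib real_sqrt_mult)
qed

lemma square_integrable_add:
 assumes f: "square_integrable M f" and g: "square_integrable M g"
 shows "square_integrable M (%p. f p + g p)" "norm_L2 M (%p. f p + g p) \<le> norm_L2 M f + norm_L2 M g"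
proof -
 note [measurable] = square_integrable_measurable[OF f] square_integrable_measurable[OF g]
 have "(\<integral>\<^sup>+p. (ennreal (cmod (f p + g p)))\<^sup>2 \<partial>M) \<le> (\<integral>\<^sup>+p. (ennreal (cmod (f p)) + ennreal (cmod (g p)))\<^sup>2 \<partial>M)"
  by (intro nn_integral_mono power_mono)
   (auto simp: norm_triangle_ineq ennreal_leI simp flip: ennreal_plus)
 also have "\<dots> = (\<integral>\<^sup>+p. (ennreal (cmod (f p)))\<^sup>2 + 2 * (ennreal (cmod (f p)) * ennreal (cmod (g p))) + (ennreal (cmod (g p)))\<^sup>2 \<partial>M)"
  by (intro nn_integral_cong) (simp add: power2_eq_square algebra_simps flip: mult_2)
 also have "\<dots> = (\<integral>\<^sup>+p. (ennreal (cmod (f p)))\<^sup>2 \<partial>M) + 2 * (\<integral>\<^sup>+p. ennreal (cmod (f p)) * ennreal (cmod (g p)) \<partial>M)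
   + (\<integral>\<^sup>+p. (ennreal (cmod (g p)))\<^sup>2 \<partial>M)"
  by (subst nn_integral_add, measurable)+ (simp add: nn_integral_cmult)
 also have "\<dots> \<le> (ennreal (norm_L2 M f))\<^sup>2 + 2 * ennreal (norm_L2 M f * norm_L2 M g) + (ennreal (norm_L2 M g))\<^sup>2"
  using nn_integral_mult_norm_L2[OF f g]
  by (intro add_mono mult_left_mono) (auto simp: nn_integral_norm_L2 f g)
 also have "\<dots> = (ennreal (norm_L2 M f + norm_L2 M g))\<^sup>2"
  by (simp add: power2_eq_square algebra_simps ennreal_mult flip: mult_2)
 finally show "square_integrable M (%p. f p + g p)" "norm_L2 M (%p. f p + g p) \<le> norm_L2 M f + norm_L2 M g"
  using square_integrableI[of "%p. f p + g p" M "norm_L2 M f + norm_L2 M g"] by auto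
qed

lemma square_integrable_diff:
 assumes f: "square_integrable M f" and g: "square_integrable M g"
 shows "square_integrable M (%p. f p - g p)" "norm_L2 M (%p. f p - g p) \<le> norm_L2 M f + norm_L2 M g"
 using square_integrable_add[OF f square_integrable_cmult(1)[OF g, of "-1"]] square_integrable_cmult(2)[OF g, of "-1"]
 by simp_all

lemma square_integrable_zero[simp]: "square_integrable M (%p. 0)" "norm_L2 M (%p. 0) = 0"
 by (simp_all add: square_integrable_def norm_L2_def)

lemma norm_L2_minus_commute: "norm_L2 M (%p. f p - g p) = norm_L2 M (%p. g p - f p)"
 by (simp add: norm_L2_def norm_minus_commute)

lemma square_integrable_sum:
 assumes "finite A" "\<And>k. k \<in> A ==> square_integrable M (f k)"
 shows "square_integrable M (%p. \<Sum>k\<in>A. f k p) \<and> norm_L2 M (%p. \<Sum>k\<in>A. f k p) \<le> (\<Sum>k\<in>A. norm_L2 M (f k))"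
 using assms
proof (induction A)
 case (insert x A)
 then show ?case
  using square_integrable_add[of M "f x" "%p. \<Sum>k\<in>A. f k p"] by auto
qed auto

lemma inner_L2_sum_left:
 assumes "finite A" "\<And>k. k \<in> A ==> square_integrable M (f k)" "square_integrable M g"
 shows "inner_L2 M (%p. \<Sum>k\<in>A. f k p) g = (\<Sum>k\<in>A. inner_L2 M (f k) g)"
 unfolding inner_L2_def sum_distrib_right using assms
 by (subst Bochner_Integration.integral_sum) (auto intro: integrable_mult_L2)

lemma inner_L2_sum_right:
 assumes "finite A" "\<And>k. k \<in> A ==> square_integrable M (f k)" "square_integrable M g"
 shows "inner_L2 M g (%p. \<Sum>k\<in>A. f k p) = (\<Sum>k\<in>A. inner_L2 M g (f k))"
 using inner_L2_sum_left[OF assms] by (simp add: inner_L2_cnj[of M g])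

lemma norm_L2_sum_power2_le:
 assumes "finite A" "\<And>k. k \<in> A ==> square_integrable M (f k)"
 shows "(norm_L2 M (%p. \<Sum>k\<in>A. f k p))\<^sup>2 \<le> (\<Sum>j\<in>A. \<Sum>k\<in>A. cmod (inner_L2 M (f j) (f k)))"
proof -
 have s: "square_integrable M (%p. \<Sum>k\<in>A. f k p)" using square_integrable_sum[OF assms] by auto
 have "complex_of_real ((norm_L2 M (%p. \<Sum>k\<in>A. f k p))\<^sup>2) = (\<Sum>j\<in>A. \<Sum>k\<in>A. inner_L2 M (f j) (f k))"
  using assms s by (subst inner_L2_self[symmetric]) (simp add: inner_L2_sum_left inner_L2_sum_right)
 then have "(norm_L2 M (%p. \<Sum>k\<in>A. f k p))\<^sup>2 = cmod (\<Sum>j\<in>A. \<Sum>k\<in>A. inner_L2 M (f j) (f k))"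
  by (metis norm_of_real abs_of_nonneg[OF zero_le_power2])
 also have "\<dots> \<le> (\<Sum>j\<in>A. \<Sum>k\<in>A. cmod (inner_L2 M (f j) (f k)))"
  by (intro order_trans[OF norm_sum] sum_mono norm_sum)
 finally show ?thesis .
qed

lemma norm_L2_eq_0:
 assumes "square_integrable M f" "norm_L2 M f = 0"
 shows "AE p in M. f p = 0"
proof -
 have "(\<integral>p. (cmod (f p))\<^sup>2 \<partial>M) = 0" using norm_L2_power2[of M f] assms(2) by simp
 then have "AE p in M. (cmod (f p))\<^sup>2 = 0"
  using assms(1) by (subst (asm) integral_nonneg_eq_0_iff_AE) (auto simp: square_integrable_def)
 then show ?thesis by auto
qed

section \<open>Completeness on representatives\<close>

text \<open>Minkowski's inequality for series, by monotone convergence from the finite partial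
  sums.\<close>

lemma nn_integral_suminf_norm_L2:
 assumes u: "\<And>k. square_integrable M (u k)" and s: "summable (%k. norm_L2 M (u k))"
 shows "(\<integral>\<^sup>+p. (\<Sum>k. ennreal (cmod (u k p)))\<^sup>2 \<partial>M) \<le> (ennreal (\<Sum>k. norm_L2 M (u k)))\<^sup>2"
proof -
 note [measurable] = square_integrable_measurable[OF u]
 let ?G = "%N p. (\<Sum>k<N. ennreal (cmod (u k p)))\<^sup>2"
 have inc: "incseq (%N. \<Sum>k<N. ennreal (cmod (u k p)))" for p
  by (intro incseq_SucI) simp
 have "(\<Sum>k. ennreal (cmod (u k p)))\<^sup>2 = (SUP N. ?G N p)" for p
 proof -
  have "(%N. \<Sum>k<N. ennreal (cmod (u k p))) \<longlonglongrightarrow> (\<Sum>k. ennreal (cmod (u k p)))"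
   by (rule summable_LIMSEQ) simp
  \<comment> \<open>Multiplication in \<open>ennreal\<close> is continuous except at 0 times
    infinity, which cannot occur when both factors coincide.\<close>
  moreover have "\<not> (x = 0 \<and> x = \<infinity> \<or> x = \<infinity> \<and> x = 0)" for x :: ennreal by auto
  ultimately have 1: "(%N. ?G N p) \<longlonglongrightarrow> (\<Sum>k. ennreal (cmod (u k p)))\<^sup>2"
   unfolding power2_eq_square by (intro tendsto_mult_ennreal)
  have "incseq (%N. ?G N p)"
   using inc[of p] by (auto simp: incseq_def intro!: power_mono)
  from LIMSEQ_SUP[OF this] show ?thesis using 1 LIMSEQ_unique by blast
 qed
 then have "(\<integral>\<^sup>+p. (\<Sum>k. ennreal (cmod (u k p)))\<^sup>2 \<partial>M) = (\<integral>\<^sup>+p. (SUP N. ?G N p) \<partial>M)" by simp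
 also have "\<dots> = (SUP N. \<integral>\<^sup>+p. ?G N p \<partial>M)"
  using inc by (intro nn_integral_monotone_convergence_SUP)
   (auto simp: incseq_def le_fun_def intro!: power_mono)
 also have "\<dots> \<le> (ennreal (\<Sum>k. norm_L2 M (u k)))\<^sup>2"
 proof (rule SUP_least)
  fix N
  let ?v = "%k p. complex_of_real (cmod (u k p))"
  have v: "square_integrable M (?v k)" "norm_L2 M (?v k) \<le> norm_L2 M (u k)" for k
   by (rule square_integrable_mono[OF u[of k]], auto)+
  have 1: "square_integrable M (%p. \<Sum>k<N. ?v k p)" "norm_L2 M (%p. \<Sum>k<N. ?v k p) \<le> (\<Sum>k<N. norm_L2 M (?v k))"
   using square_integrable_sum[of "{..<N}" M ?v] v by auto
  have "(\<integral>\<^sup>+p. ?G N p \<partial>M) = (\<integral>\<^sup>+p. (ennreal (cmod (\<Sum>k<N. ?v k p)))\<^sup>2 \<partial>M)"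
   by (intro nn_integral_cong)
    (simp add: sum_nonneg flip: of_real_sum)
  also have "\<dots> = (ennreal (norm_L2 M (%p. \<Sum>k<N. ?v k p)))\<^sup>2" by (rule nn_integral_norm_L2[OF 1(1)])
  also have "\<dots> \<le> (ennreal (\<Sum>k. norm_L2 M (u k)))\<^sup>2"
  proof (intro power_mono ennreal_leI)
   have "(\<Sum>k<N. norm_L2 M (?v k)) \<le> (\<Sum>k<N. norm_L2 M (u k))" using v by (intro sum_mono)
   also have "\<dots> \<le> (\<Sum>k. norm_L2 M (u k))" by (intro sum_le_suminf s) auto
   finally show "norm_L2 M (%p. \<Sum>k<N. ?v k p) \<le> (\<Sum>k. norm_L2 M (u k))" using 1 by linarith
  qed auto
  finally show "(\<integral>\<^sup>+p. ?G N p \<partial>M) \<le> (ennreal (\<Sum>k. norm_L2 M (u k)))\<^sup>2" .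
 qed
 finally show ?thesis .
qed

text \<open>Finiteness of the \<open>L\<^sup>2\<close> norm of the sum of moduli gives absolute
  convergence almost everywhere; the same bound applied to the tails gives convergence in
  norm.\<close>

lemma Riesz_Fischer_series:
 assumes u: "\<And>k. square_integrable M (u k)" and s: "summable (%k. norm_L2 M (u k))"
 shows "AE p in M. summable (%k. u k p)"
  and "square_integrable M (%p. \<Sum>k. u k p)"
  and "(%N. norm_L2 M (%p. (\<Sum>k. u k p) - (\<Sum>k<N. u k p))) \<longlonglongrightarrow> 0"
proof -
 note [measurable] = square_integrable_measurable[OF u]
 have "(\<integral>\<^sup>+p. (\<Sum>k. ennreal (cmod (u k p)))\<^sup>2 \<partial>M) < \<infinity>"
  by (rule le_less_trans[OF nn_integral_suminf_norm_L2[OF u s] ennreal_power2_less_top])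
 then have "AE p in M. (\<Sum>k. ennreal (cmod (u k p)))\<^sup>2 \<noteq> \<infinity>"
  by (intro nn_integral_noteq_infinite) auto
 then have ae: "AE p in M. summable (%k. cmod (u k p))"
 proof eventually_elim
  case (elim p)
  then have "(\<Sum>k. ennreal (cmod (u k p))) \<noteq> top" by (auto simp: power2_eq_square ennreal_mult_eq_top_iff)
  then show ?case by (intro summable_suminf_not_top) auto
 qed
 then show "AE p in M. summable (%k. u k p)" by eventually_elim (rule summable_norm_cancel)
 have tail: "square_integrable M (%p. (\<Sum>k. u k p) - (\<Sum>k<N. u k p)) \<and>
   norm_L2 M (%p. (\<Sum>k. u k p) - (\<Sum>k<N. u k p)) \<le> (\<Sum>k. norm_L2 M (u (k + N)))" for N
 proof -
  have sN: "summable (%k. norm_L2 M (u (k + N)))" using s by (subst summable_iff_shift)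
  have "(\<integral>\<^sup>+p. (ennreal (cmod ((\<Sum>k. u k p) - (\<Sum>k<N. u k p))))\<^sup>2 \<partial>M) \<le> (\<integral>\<^sup>+p. (\<Sum>k. ennreal (cmod (u (k + N) p)))\<^sup>2 \<partial>M)"
  proof (intro nn_integral_mono_AE)
   show "AE p in M. (ennreal (cmod ((\<Sum>k. u k p) - (\<Sum>k<N. u k p))))\<^sup>2 \<le> (\<Sum>k. ennreal (cmod (u (k + N) p)))\<^sup>2"
    using ae
   proof eventually_elim
    case (elim p)
    then have e: "summable (%k. cmod (u (k + N) p))" by (subst summable_iff_shift)
    have "(\<Sum>k. u k p) - (\<Sum>k<N. u k p) = (\<Sum>k. u (k + N) p)"
     using suminf_minus_initial_segment[OF summable_norm_cancel[OF elim], of N] by simp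
    then have "ennreal (cmod ((\<Sum>k. u k p) - (\<Sum>k<N. u k p))) \<le> ennreal (\<Sum>k. cmod (u (k + N) p))"
     using summable_norm[OF e] by (simp add: ennreal_leI)
    also have "\<dots> = (\<Sum>k. ennreal (cmod (u (k + N) p)))"
     by (rule suminf_ennreal2[symmetric]) (auto simp: e)
    finally show ?case by (intro power_mono) auto
   qed
  qed
  also have "\<dots> \<le> (ennreal (\<Sum>k. norm_L2 M (u (k + N))))\<^sup>2"
   by (rule nn_integral_suminf_norm_L2[OF u sN])
  finally have *: "(\<integral>\<^sup>+p. (ennreal (cmod ((\<Sum>k. u k p) - (\<Sum>k<N. u k p))))\<^sup>2 \<partial>M) \<le> (ennreal (\<Sum>k. norm_L2 M (u (k + N))))\<^sup>2" .
  have "0 \<le> (\<Sum>k. norm_L2 M (u (k + N)))" by (intro suminf_nonneg sN) simp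
  from square_integrableI[OF _ * this] show ?thesis by auto
 qed
 show "square_integrable M (%p. \<Sum>k. u k p)" using tail[of 0] by simp
 have "(%N. \<Sum>k. norm_L2 M (u (k + N))) \<longlonglongrightarrow> 0"
  using s by (rule suminf_exist_split2)
 then show "(%N. norm_L2 M (%p. (\<Sum>k. u k p) - (\<Sum>k<N. u k p))) \<longlonglongrightarrow> 0"
  by (rule tendsto_sandwich[OF _ _ tendsto_const, rotated -1]) (use tail in auto)
qed

text \<open>Operators act on representatives, so the limit must be a genuine function: a subsequence
  with geometrically small differences is summed as a telescoping series.\<close>

lemma L2_complete:
 assumes f: "\<And>k. square_integrable M (f k)"
  and c: "\<And>e. 0 < e ==> \<exists>N::nat. \<forall>m\<ge>N. \<forall>k\<ge>N. norm_L2 M (%p. f m p - f k p) < e"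
 shows "\<exists>g. square_integrable M g \<and> (%k. norm_L2 M (%p. f k p - g p)) \<longlonglongrightarrow> 0"
proof -
 obtain N where N: "\<And>j m k. N j \<le> m ==> N j \<le> k ==> norm_L2 M (%p. f m p - f k p) < (1/2)^j"
  using c[of "(1/2)^j" for j] by (auto simp: choice_iff) (metis zero_less_divide_1_iff zero_less_numeral zero_less_power)
 \<comment> \<open>The running maximum makes the chosen indices increasing as well as large
   enough.\<close>
 define r where "r j = Max (N ` {..j})" for j
 have rN: "N j \<le> r j" "r j \<le> r (Suc j)" for j
  unfolding r_def by (auto intro!: Max_ge Max_mono)
 define u where "u j = (%p. f (r (Suc j)) p - f (r j) p)" for j
 have u: "square_integrable M (u j)" for j unfolding u_def by (intro square_integrable_diff f)
 have un: "norm_L2 M (u j) \<le> (1/2)^j" for j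
  unfolding u_def using N[of j "r (Suc j)" "r j"] rN[of j] by simp
 have s: "summable (%k. norm_L2 M (u k))"
  by (rule summable_comparison_test[of _ "%j. (1/2)^j"]) (use un in auto)
 let ?g = "%p. f (r 0) p + (\<Sum>k. u k p)"
 have g: "square_integrable M ?g"
  by (intro square_integrable_add f Riesz_Fischer_series(2)[OF u s])
 have tel: "(\<Sum>k<j. u k p) = f (r j) p - f (r 0) p" for j p
  unfolding u_def by (rule sum_lessThan_telescope[of "%j. f (r j) p"])
 have sub: "(%j. norm_L2 M (%p. ?g p - f (r j) p)) \<longlonglongrightarrow> 0"
  using Riesz_Fischer_series(3)[OF u s] by (simp add: tel algebra_simps)
 have "(%k. norm_L2 M (%p. f k p - ?g p)) \<longlonglongrightarrow> 0"
 proof (rule LIMSEQ_I)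
  fix e :: real assume e: "0 < e"
  obtain J where J: "\<And>j. j \<ge> J ==> norm_L2 M (%p. ?g p - f (r j) p) < e / 2"
   using LIMSEQ_D[OF sub, of "e/2"] e by auto
  obtain J' where J': "(1/2::real)^J' < e / 2"
   using real_arch_pow_inv[of "e/2" "1/2"] e by auto
  let ?j = "max J J'"
  have pw: "(1/2::real)^?j \<le> (1/2)^J'" by (intro power_decreasing) auto
  show "\<exists>no. \<forall>k\<ge>no. norm (norm_L2 M (%p. f k p - ?g p) - 0) < e"
  proof (intro exI[of _ "N ?j"] allI impI)
   fix k assume k: "N ?j \<le> k"
   have "norm_L2 M (%p. (f k p - f (r ?j) p) + (f (r ?j) p - ?g p)) \<le>
    norm_L2 M (%p. f k p - f (r ?j) p) + norm_L2 M (%p. f (r ?j) p - ?g p)"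
    by (intro square_integrable_add(2) square_integrable_diff f g)
   also have "norm_L2 M (%p. f (r ?j) p - ?g p) < e / 2"
    using J[of ?j] by (subst norm_L2_minus_commute) simp
   also have "norm_L2 M (%p. f k p - f (r ?j) p) < e / 2"
    using N[of ?j k "r ?j"] k rN(1)[of ?j] pw J' by linarith
   finally have "norm_L2 M (%p. (f k p - f (r ?j) p) + (f (r ?j) p - ?g p)) < e" by simp
   also have "(%p. (f k p - f (r ?j) p) + (f (r ?j) p - ?g p)) = (%p. f k p - ?g p)" by auto
   finally show "norm (norm_L2 M (%p. f k p - ?g p) - 0) < e" by simp
  qed
 qed
 with g show ?thesis by blast
qed

section \<open>Almost orthogonality\<close>

text \<open>A band matrix has at most \<open>2 * m\<close> entries in each row; with
  \<open>x j * x k\<close> at most the mean of the two squares, rows and columns contribute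
  equally.\<close>

lemma sum_near_le:
 fixes x :: "nat => real"
 assumes "finite A"
 shows "(\<Sum>j\<in>A. \<Sum>k\<in>{k\<in>A. j < k + m \<and> k < j + m}. x j * x k) \<le> 2 * real m * (\<Sum>j\<in>A. (x j)\<^sup>2)"
proof -
 let ?N = "%j. {k\<in>A. j < k + m \<and> k < j + m}"
 have card: "real (card (?N j)) \<le> 2 * real m" for j
 proof -
  have "card (?N j) \<le> card {j - m..<j + m}" by (intro card_mono) auto
  then show ?thesis by simp
 qed
 have "(\<Sum>j\<in>A. \<Sum>k\<in>?N j. x j * x k) \<le> (\<Sum>j\<in>A. \<Sum>k\<in>?N j. (x j)\<^sup>2 / 2 + (x k)\<^sup>2 / 2)"
  by (intro sum_mono) (use sum_squares_bound in \<open>simp add: field_simps\<close>)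
 also have "\<dots> = (\<Sum>j\<in>A. \<Sum>k\<in>?N j. (x j)\<^sup>2 / 2) + (\<Sum>j\<in>A. \<Sum>k\<in>?N j. (x k)\<^sup>2 / 2)"
  by (simp add: sum.distrib)
 also have "(\<Sum>j\<in>A. \<Sum>k\<in>?N j. (x k)\<^sup>2 / 2) = (\<Sum>k\<in>A. \<Sum>j\<in>?N k. (x k)\<^sup>2 / 2)"
 proof -
  have "(\<Sum>j\<in>A. \<Sum>k\<in>?N j. (x k)\<^sup>2 / 2) = (\<Sum>j\<in>A. \<Sum>k\<in>A. if j < k + m \<and> k < j + m then (x k)\<^sup>2 / 2 else 0)"
   using assms by (intro sum.cong sum.inter_filter) auto
  also have "\<dots> = (\<Sum>k\<in>A. \<Sum>j\<in>A. if j < k + m \<and> k < j + m then (x k)\<^sup>2 / 2 else 0)" by (rule sum.swap)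
  also have "\<dots> = (\<Sum>k\<in>A. \<Sum>j\<in>A. if k < j + m \<and> j < k + m then (x k)\<^sup>2 / 2 else 0)"
   by (simp only: conj_commute)
  also have "\<dots> = (\<Sum>k\<in>A. \<Sum>j\<in>?N k. (x k)\<^sup>2 / 2)"
   using assms by (intro sum.cong refl sum.inter_filter[symmetric]) auto
  finally show ?thesis .
 qed
 also have "(\<Sum>j\<in>A. \<Sum>k\<in>?N j. (x j)\<^sup>2 / 2) + (\<Sum>k\<in>A. \<Sum>j\<in>?N k. (x k)\<^sup>2 / 2) = (\<Sum>j\<in>A. real (card (?N j)) * (x j)\<^sup>2)"
  by (simp add: mult.commute flip: sum.distrib)
 also have "\<dots> \<le> (\<Sum>j\<in>A. 2 * real m * (x j)\<^sup>2)" by (intro sum_mono mult_right_mono card) auto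
 finally show ?thesis by (simp add: sum_distrib_left)
qed

lemma sum_half_powers_le: "finite A ==> (\<Sum>j\<in>A. (1/2::real)^j) \<le> 2"
proof -
 assume "finite A"
 then have "(\<Sum>j\<in>A. (1/2::real)^j) \<le> (\<Sum>j. (1/2::real)^j)" by (intro sum_le_suminf) auto
 then show ?thesis by (simp add: suminf_geometric)
qed

text \<open>Near the diagonal the band bound applies; far from it the entries are dominated by a
  rank one matrix with geometric weights, whose sum is at most 4.\<close>

lemma sum_near_far_le:
 fixes x :: "nat => real" and c :: "nat => nat => real"
 assumes A: "finite A" and D: "0 \<le> B" "0 \<le> D" and x: "\<And>j. 0 \<le> x j"
  and near: "\<And>j k. c j k \<le> B * (x j * x k)"
  and far: "\<And>j k. j + m \<le> k \<or> k + m \<le> j ==> c j k \<le> D * (1/2)^j * (1/2)^k * (y j * y k)"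
  and y: "\<And>j. 0 \<le> y j" "\<And>j. j \<in> A ==> (y j)\<^sup>2 \<le> Y" and Y: "0 \<le> Y"
 shows "(\<Sum>j\<in>A. \<Sum>k\<in>A. c j k) \<le> 2 * real m * B * (\<Sum>j\<in>A. (x j)\<^sup>2) + 4 * D * Y"
proof -
 have yy: "y j * y k \<le> Y" if "j \<in> A" "k \<in> A" for j k
  using sum_squares_bound[of "y j" "y k"] y(2)[OF that(1)] y(2)[OF that(2)] by simp
 let ?P = "%j k. j < k + m \<and> k < j + m"
 have "(\<Sum>j\<in>A. \<Sum>k\<in>A. c j k) \<le> (\<Sum>j\<in>A. \<Sum>k\<in>A. (if ?P j k then B * (x j * x k) else 0) + D * Y * ((1/2)^j * (1/2)^k))"
 proof (intro sum_mono)
  fix j k assume jk: "j \<in> A" "k \<in> A"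
  show "c j k \<le> (if ?P j k then B * (x j * x k) else 0) + D * Y * ((1/2)^j * (1/2)^k)"
  proof (cases "?P j k")
   case True
   then show ?thesis using near[of j k] D Y by (simp add: add_increasing2)
  next
   case False
   then have "c j k \<le> D * (1/2)^j * (1/2)^k * (y j * y k)" by (intro far) auto
   also have "\<dots> \<le> D * (1/2)^j * (1/2)^k * Y" using D yy[OF jk] by (intro mult_left_mono) auto
   finally have "c j k \<le> D * Y * ((1/2)^j * (1/2)^k)" by (simp add: mult_ac)
   then show ?thesis using False by simp argo
  qed
 qed
 also have "\<dots> = B * (\<Sum>j\<in>A. \<Sum>k\<in>{k\<in>A. ?P j k}. x j * x k) + D * Y * ((\<Sum>j\<in>A. (1/2)^j) * (\<Sum>k\<in>A. (1/2)^k))"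
  using A unfolding sum.distrib
  by (simp add: sum_distrib_left sum_distrib_right sum.inter_filter mult_ac if_distrib[of "%x. B * x"] cong: if_cong)
 also have "\<dots> \<le> B * (2 * real m * (\<Sum>j\<in>A. (x j)\<^sup>2)) + D * Y * (2 * 2)"
  using D Y sum_half_powers_le[OF A] by (intro add_mono mult_left_mono sum_near_le A mult_mono) (auto intro: sum_nonneg)
 finally show ?thesis by (simp add: mult_ac)
qed

text \<open>
 The off-diagonal products decay so fast that Cotlar--Stein is not needed: almost orthogonality
 of the \<open>T' j\<close> gives, by duality, a square function bound for the \<open>T j\<close>, and almost orthogonality
 of the \<open>T j\<close> then bounds the sum by the square function.
\<close>

lemma square_function_bound:
 assumes T: "\<And>j f. square_integrable M f ==> square_integrable M (T j f)"
  and T': "\<And>j f. square_integrable M f ==> square_integrable M (T' j f)"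
  and adj: "\<And>j f g. square_integrable M f ==> square_integrable M g ==>
   inner_L2 M (T j f) g = inner_L2 M f (T' j g)"
  and bnd: "0 \<le> B" "\<And>j f. square_integrable M f ==> norm_L2 M (T' j f) \<le> B * norm_L2 M f"
  and far: "0 \<le> D" "\<And>j k f g. square_integrable M f ==> square_integrable M g ==> j + m \<le> k \<or> k + m \<le> j ==>
   cmod (inner_L2 M (T' j f) (T' k g)) \<le> D * (1/2)^j * (1/2)^k * (norm_L2 M f * norm_L2 M g)"
  and f: "square_integrable M f" and A: "finite A"
 shows "(\<Sum>j\<in>A. (norm_L2 M (T j f))\<^sup>2) \<le> (2 * real m * B\<^sup>2 + 4 * D) * (norm_L2 M f)\<^sup>2"
proof -
 define S where "S = (\<Sum>j\<in>A. (norm_L2 M (T j f))\<^sup>2)"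
 \<comment> \<open>Pairing \<open>f\<close> with \<open>E\<close> recovers \<open>S\<close>, while
   almost orthogonality bounds the squared norm of \<open>E\<close> by a multiple of
   \<open>S\<close>. One factor of \<open>S\<close> then cancels.\<close>
 define E where "E = (%p. \<Sum>j\<in>A. T' j (T j f) p)"
 have S: "0 \<le> S" unfolding S_def by (intro sum_nonneg) auto
 have sE: "square_integrable M E" unfolding E_def by (intro conjunct1[OF square_integrable_sum[OF A]] T T' f)
 have "complex_of_real S = (\<Sum>j\<in>A. inner_L2 M (T j f) (T j f))"
  unfolding S_def by (simp add: inner_L2_self)
 also have "\<dots> = inner_L2 M f E"
  unfolding E_def using A T T' f by (simp add: adj inner_L2_sum_right)
 finally have "cmod (complex_of_real S) = cmod (inner_L2 M f E)" by (rule arg_cong)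
 then have "S = cmod (inner_L2 M f E)" using S by simp
 then have SE: "S \<le> norm_L2 M f * norm_L2 M E" using inner_L2_le[OF f sE] by simp
 have "(norm_L2 M E)\<^sup>2 \<le> (\<Sum>j\<in>A. \<Sum>k\<in>A. cmod (inner_L2 M (T' j (T j f)) (T' k (T k f))))"
  unfolding E_def by (rule norm_L2_sum_power2_le[OF A]) (intro T T' f)
 also have "\<dots> \<le> 2 * real m * B\<^sup>2 * (\<Sum>j\<in>A. (norm_L2 M (T j f))\<^sup>2) + 4 * D * S"
 proof (rule sum_near_far_le[OF A, where y = "%j. norm_L2 M (T j f)"])
  show "cmod (inner_L2 M (T' j (T j f)) (T' k (T k f))) \<le> B\<^sup>2 * (norm_L2 M (T j f) * norm_L2 M (T k f))" for j k
  proof -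
   have "cmod (inner_L2 M (T' j (T j f)) (T' k (T k f))) \<le> norm_L2 M (T' j (T j f)) * norm_L2 M (T' k (T k f))"
    by (intro inner_L2_le T T' f)
   also have "\<dots> \<le> (B * norm_L2 M (T j f)) * (B * norm_L2 M (T k f))"
    using bnd(1) by (intro mult_mono bnd(2) T f) auto
   finally show ?thesis by (simp add: power2_eq_square mult_ac)
  qed
  show "(norm_L2 M (T j f))\<^sup>2 \<le> S" if "j \<in> A" for j
   unfolding S_def using A that by (intro member_le_sum) auto
 qed (use bnd far T f S in auto)
 finally have "(norm_L2 M E)\<^sup>2 \<le> (2 * real m * B\<^sup>2 + 4 * D) * S" by (simp add: S_def algebra_simps)
 moreover have "S\<^sup>2 \<le> (norm_L2 M f)\<^sup>2 * (norm_L2 M E)\<^sup>2"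
  using power_mono[OF SE S, of 2] by (simp add: power_mult_distrib)
 ultimately have "S\<^sup>2 \<le> (norm_L2 M f)\<^sup>2 * ((2 * real m * B\<^sup>2 + 4 * D) * S)"
  by (meson mult_left_mono order_trans zero_le_power2)
 then have "S * S \<le> ((2 * real m * B\<^sup>2 + 4 * D) * (norm_L2 M f)\<^sup>2) * S" by (simp add: power2_eq_square mult_ac)
 then have "S \<le> (2 * real m * B\<^sup>2 + 4 * D) * (norm_L2 M f)\<^sup>2"
  using S bnd(1) far(1) by (cases "S = 0") (auto simp: mult_le_cancel_right)
 then show ?thesis by (simp add: S_def)
qed

text \<open>The factor \<open>(1/2)^J\<close> in the far part makes blocks starting at a late index
  small; without it the partial sums would only be bounded, not Cauchy.\<close>

lemma almost_orthogonal_sum: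
 assumes T: "\<And>j. square_integrable M (T j f)"
  and far: "0 \<le> D" "\<And>j k. j + m \<le> k \<or> k + m \<le> j ==>
   cmod (inner_L2 M (T j f) (T k f)) \<le> D * (1/2)^j * (1/2)^k * (norm_L2 M f)\<^sup>2"
  and A: "finite A" "\<And>j. j \<in> A ==> J \<le> j"
 shows "(norm_L2 M (%p. \<Sum>j\<in>A. T j f p))\<^sup>2 \<le>
  2 * real m * (\<Sum>j\<in>A. (norm_L2 M (T j f))\<^sup>2) + 4 * D * (norm_L2 M f)\<^sup>2 * (1/2)^J"
proof -
 have "(norm_L2 M (%p. \<Sum>j\<in>A. T j f p))\<^sup>2 \<le> (\<Sum>j\<in>A. \<Sum>k\<in>A. cmod (inner_L2 M (T j f) (T k f)))"
  by (intro norm_L2_sum_power2_le A T)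
 also have "\<dots> \<le> (\<Sum>j\<in>A. \<Sum>k\<in>A. (if j < k + m \<and> k < j + m then norm_L2 M (T j f) * norm_L2 M (T k f) else 0)
   + D * (norm_L2 M f)\<^sup>2 * ((1/2)^j * (1/2)^k))"
 proof (intro sum_mono)
  fix j k
  show "cmod (inner_L2 M (T j f) (T k f)) \<le> (if j < k + m \<and> k < j + m then norm_L2 M (T j f) * norm_L2 M (T k f) else 0)
   + D * (norm_L2 M f)\<^sup>2 * ((1/2)^j * (1/2)^k)"
   using inner_L2_le[OF T[of j] T[of k]] far(2)[of j k] far(1)
   by (cases "j < k + m \<and> k < j + m") (auto simp: add_increasing2 mult_ac)
 qed
 also have "\<dots> = (\<Sum>j\<in>A. \<Sum>k\<in>{k\<in>A. j < k + m \<and> k < j + m}. norm_L2 M (T j f) * norm_L2 M (T k f))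
   + D * (norm_L2 M f)\<^sup>2 * ((\<Sum>j\<in>A. (1/2)^j) * (\<Sum>k\<in>A. (1/2)^k))"
  using A unfolding sum.distrib by (simp add: sum_distrib_left sum_distrib_right sum.inter_filter mult_ac)
 also have "\<dots> \<le> 2 * real m * (\<Sum>j\<in>A. (norm_L2 M (T j f))\<^sup>2) + D * (norm_L2 M f)\<^sup>2 * ((2 * (1/2)^J) * 2)"
 proof (intro add_mono sum_near_le A mult_left_mono mult_mono sum_half_powers_le)
  have inj: "inj_on (%j. j - J) A" using A(2) by (auto simp: inj_on_def) (metis le_add_diff_inverse)
  have "(\<Sum>j\<in>A. (1/2::real)^j) = (\<Sum>j\<in>A. (1/2)^J * (1/2)^(j - J))"
   using A(2) by (intro sum.cong) (auto simp: power_add[symmetric])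
  also have "\<dots> = (1/2)^J * (\<Sum>i\<in>(%j. j - J) ` A. (1/2)^i)"
   using inj by (simp add: sum.reindex sum_distrib_left)
  also have "\<dots> \<le> (1/2)^J * 2" using A by (intro mult_left_mono sum_half_powers_le) auto
  finally show "(\<Sum>j\<in>A. (1/2::real)^j) \<le> 2 * (1/2)^J" by (simp only: mult.commute)
 qed (use far in \<open>auto intro!: sum_nonneg\<close>)
 finally show ?thesis by (simp add: mult_ac)
qed

section \<open>Convolution\<close>

lemma integral_norm_le_integral:
 fixes f :: "'a => 'b::{banach,second_countable_topology}"
 assumes "integrable M f" "integrable M g" "\<And>x. x \<in> space M ==> norm (f x) \<le> g x"
 shows "norm (\<integral>x. f x \<partial>M) \<le> (\<integral>x. g x \<partial>M)"
 using assms by (intro order_trans[OF integral_norm_bound] integral_mono) auto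

definition conv :: "nat => real => (hpoint => complex) => (hpoint => complex) => hpoint => complex" where
 "conv n a f K p = (\<integral>q. K (hmult n a (hinv n q) p) * f q \<partial>hmeasure n)"

text \<open>The kernel of the adjoint operator, see \<open>conv_adjoint\<close>.\<close>

definition tilde :: "nat => (hpoint => complex) => hpoint => complex" where
 "tilde n K p = cnj (K (hinv n p))"

definition norm_L1 :: "nat => (hpoint => complex) => real" where
 "norm_L1 n K = (\<integral>p. cmod (K p) \<partial>hmeasure n)"

section \<open>Boxes and kernels of compact support\<close>

definition box :: "nat => (nat => real) => (nat => real) => hpoint set" where
 "box n l u = {p \<in> hspace n. \<forall>k\<le>2 * n. l k \<le> co n p k \<and> co n p k \<le> u k}"

lemma box_eq: "box n l u = (\<Pi>\<^sub>E k\<in>{..<2 * n}. {l k..u k}) \<times> {l (2 * n)..u (2 * n)}"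
proof -
 have "p \<in> box n l u \<longleftrightarrow> p \<in> (\<Pi>\<^sub>E k\<in>{..<2 * n}. {l k..u k}) \<times> {l (2 * n)..u (2 * n)}" for p
  by (cases p) (auto simp: box_def hspace_iff PiE_iff co_def le_less)
 then show ?thesis by blast
qed

lemma emeasure_box:
 assumes "\<And>k. k \<le> 2 * n ==> l k \<le> u k"
 shows "emeasure (hmeasure n) (box n l u) = ennreal (\<Prod>k\<le>2 * n. u k - l k)"
proof -
 interpret P: product_sigma_finite "%_::nat. lborel :: real measure" by standard
 have "emeasure (hmeasure n) (box n l u) =
  emeasure (PiM {..<2 * n} (%_. lborel)) (\<Pi>\<^sub>E k\<in>{..<2 * n}. {l k..u k}) * emeasure lborel {l (2 * n)..u (2 * n)}"
  unfolding box_eq hmeasure_def by (intro lborel.emeasure_pair_measure_Times) auto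
 also have "\<dots> = (\<Prod>k<2 * n. ennreal (u k - l k)) * ennreal (u (2 * n) - l (2 * n))"
  using assms by (simp add: P.emeasure_PiM)
 also have "\<dots> = ennreal ((\<Prod>k<2 * n. u k - l k) * (u (2 * n) - l (2 * n)))"
  using assms by (subst prod_ennreal) (auto intro!: ennreal_mult[symmetric] prod_nonneg)
 finally show ?thesis by (simp add: lessThan_Suc_atMost[symmetric])
qed

lemma sets_box[measurable]: "box n l u \<in> sets (hmeasure n)"
 unfolding box_eq hmeasure_def by (intro pair_measureI sets_PiM_I_finite) auto

abbreviation "cube n c \<delta> \<equiv> box n (%k. c k - \<delta> :: real) (%k. c k + \<delta>)"

definition ball_inf :: "nat => real => hpoint set" where
 "ball_inf n R = box n (%_. - R) (%_. R)"

lemma ball_inf_iff: "p \<in> ball_inf n R \<longleftrightarrow> p \<in> hspace n \<and> (\<forall>k\<le>2 * n. \<bar>co n p k\<bar> \<le> R)"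
 by (auto simp: ball_inf_def box_def abs_le_iff)

lemma sets_ball_inf[measurable]: "ball_inf n R \<in> sets (hmeasure n)"
 by (simp add: ball_inf_def)

lemma emeasure_ball_inf: "0 \<le> R ==> emeasure (hmeasure n) (ball_inf n R) = ennreal ((2 * R) ^ (2 * n + 1))"
 unfolding ball_inf_def by (subst emeasure_box) auto

lemma ball_inf_mono: "R \<le> S ==> ball_inf n R \<subseteq> ball_inf n S"
 by (fastforce simp: ball_inf_iff)

lemma abs_co_le: "p \<in> ball_inf n R ==> k < 2 * n ==> \<bar>fst p k\<bar> \<le> R"
 unfolding ball_inf_iff co_def by (metis less_imp_le)

lemma abs_snd_le: "p \<in> ball_inf n R ==> \<bar>snd p\<bar> \<le> R"
 unfolding ball_inf_iff co_def by (metis less_irrefl order_refl)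

lemma ball_infI: "p \<in> hspace n ==> (\<And>k. k < 2 * n ==> \<bar>fst p k\<bar> \<le> R) ==> \<bar>snd p\<bar> \<le> R ==> p \<in> ball_inf n R"
 by (auto simp: ball_inf_iff co_def)

lemma abs_symp_le:
 assumes "\<And>k. k < 2 * n ==> \<bar>x k\<bar> \<le> R" "\<And>k. k < 2 * n ==> \<bar>y k\<bar> \<le> S" "0 \<le> R"
 shows "\<bar>symp n x y\<bar> \<le> 2 * real n * R * S"
proof -
 have "\<bar>symp n x y\<bar> \<le> (\<Sum>k<n. \<bar>x k * y (n + k) - x (n + k) * y k\<bar>)"
  unfolding symp_def by (rule sum_abs)
 also have "\<dots> \<le> (\<Sum>k<n. R * S + R * S)"
 proof (intro sum_mono)
  fix k assume k: "k \<in> {..<n}"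
  have "\<bar>x k * y (n + k) - x (n + k) * y k\<bar> \<le> \<bar>x k\<bar> * \<bar>y (n + k)\<bar> + \<bar>x (n + k)\<bar> * \<bar>y k\<bar>"
   by (metis abs_mult abs_triangle_ineq4)
  also have "\<dots> \<le> R * S + R * S" using k assms by (intro add_mono mult_mono) auto
  finally show "\<bar>x k * y (n + k) - x (n + k) * y k\<bar> \<le> R * S + R * S" .
 qed
 finally show ?thesis by (simp add: algebra_simps)
qed

lemma hmult_ball_inf:
 assumes p: "p \<in> ball_inf n R" and q: "q \<in> ball_inf n S"
 shows "hmult n a p q \<in> ball_inf n (R + S + 4 * \<bar>a\<bar> * real n * R * S)"
proof (rule ball_infI)
 have R: "0 \<le> R" "0 \<le> S" using abs_snd_le[OF p] abs_snd_le[OF q] by auto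
 have nn: "0 \<le> 4 * \<bar>a\<bar> * real n * R * S" using R by simp
 show "\<bar>fst (hmult n a p q) k\<bar> \<le> R + S + 4 * \<bar>a\<bar> * real n * R * S" if "k < 2 * n" for k
 proof -
  have "\<bar>fst p k + fst q k\<bar> \<le> R + S"
   using abs_co_le[OF p that] abs_co_le[OF q that] abs_triangle_ineq[of "fst p k" "fst q k"] by linarith
  also have "\<dots> \<le> R + S + 4 * \<bar>a\<bar> * real n * R * S" using nn by linarith
  finally show ?thesis using that by (simp add: hmult_eq)
 qed
 have "\<bar>symp n (fst p) (fst q)\<bar> \<le> 2 * real n * R * S"
  by (rule abs_symp_le[OF abs_co_le[OF p] abs_co_le[OF q] R(1)])
 then have "2 * \<bar>a\<bar> * \<bar>symp n (fst p) (fst q)\<bar> \<le> 2 * \<bar>a\<bar> * (2 * real n * R * S)" by (intro mult_left_mono) auto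
 then have "\<bar>2 * a * symp n (fst p) (fst q)\<bar> \<le> 4 * \<bar>a\<bar> * real n * R * S" by (simp add: abs_mult mult_ac)
 then show "\<bar>snd (hmult n a p q)\<bar> \<le> R + S + 4 * \<bar>a\<bar> * real n * R * S"
  using abs_snd_le[OF p] abs_snd_le[OF q] unfolding hmult_eq snd_conv by linarith
qed simp

lemma hinv_ball_inf: "p \<in> hspace n ==> hinv n p \<in> ball_inf n R \<longleftrightarrow> p \<in> ball_inf n R"
 by (auto simp: ball_inf_iff co_def hinv_eq split: if_splits)

text \<open>Bounded measurable kernels of compact support. Every dyadic piece is one, and the class
  is closed under adjoints, dilations and convolution, so all compositions converge
  absolutely.\<close>

definition ckernel :: "nat => (hpoint => complex) => bool" where
 "ckernel n K \<longleftrightarrow> K \<in> borel_measurable (hmeasure n) \<and>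
   (\<exists>C R. \<forall>p\<in>hspace n. cmod (K p) \<le> C * indicator (ball_inf n R) p)"

lemma ckernel_measurable[measurable_dest]: "ckernel n K ==> K \<in> borel_measurable (hmeasure n)"
 by (simp add: ckernel_def)

lemma ckernelI:
 assumes "K \<in> borel_measurable (hmeasure n)" "\<And>p. p \<in> hspace n ==> cmod (K p) \<le> C"
  "\<And>p. p \<in> hspace n ==> K p \<noteq> 0 ==> p \<in> ball_inf n R"
 shows "ckernel n K"
 unfolding ckernel_def using assms by (intro conjI exI[of _ C] exI[of _ R]) (auto simp: indicator_def)

lemma ckernelE:
 assumes "ckernel n K"
 obtains C R where "0 \<le> C" "0 \<le> R" "\<And>p. p \<in> hspace n ==> cmod (K p) \<le> C"
  "\<And>p. p \<in> hspace n ==> K p \<noteq> 0 ==> p \<in> ball_inf n R"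
proof -
 obtain C R where *: "\<And>p. p \<in> hspace n ==> cmod (K p) \<le> C * indicator (ball_inf n R) p"
  using assms by (auto simp: ckernel_def)
 show thesis
 proof (rule that[of "\<bar>C\<bar>" "\<bar>R\<bar>"])
  fix p assume p: "p \<in> hspace n"
  show "cmod (K p) \<le> \<bar>C\<bar>" using *[OF p] by (cases "p \<in> ball_inf n R") auto
  show "p \<in> ball_inf n \<bar>R\<bar>" if "K p \<noteq> 0"
   using *[OF p] that ball_inf_mono[OF abs_ge_self, of n R] by (cases "p \<in> ball_inf n R") auto
 qed auto
qed

lemma nn_integral_ckernel_bound:
 assumes "\<And>p. p \<in> hspace n ==> cmod (K p) \<le> C" "0 \<le> C" "0 \<le> R"
  "\<And>p. p \<in> hspace n ==> K p \<noteq> 0 ==> p \<in> ball_inf n R"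
 shows "(\<integral>\<^sup>+p. ennreal (cmod (K p)) \<partial>hmeasure n) \<le> ennreal (C * (2 * R) ^ (2 * n + 1))"
proof -
 have "(\<integral>\<^sup>+p. ennreal (cmod (K p)) \<partial>hmeasure n) \<le> (\<integral>\<^sup>+p. ennreal C * indicator (ball_inf n R) p \<partial>hmeasure n)"
  using assms by (intro nn_integral_mono) (auto simp: space_hmeasure indicator_def intro!: ennreal_leI)
 also have "\<dots> = ennreal (C * (2 * R) ^ (2 * n + 1))"
  using assms by (simp add: nn_integral_cmult emeasure_ball_inf ennreal_mult)
 finally show ?thesis .
qed

lemma ckernel_integrable:
 assumes "ckernel n K"
 shows "integrable (hmeasure n) K"
proof -
 obtain C R where "0 \<le> C" "0 \<le> R" "\<And>p. p \<in> hspace n ==> cmod (K p) \<le> C"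
  "\<And>p. p \<in> hspace n ==> K p \<noteq> 0 ==> p \<in> ball_inf n R" using ckernelE[OF assms] by blast
 from nn_integral_ckernel_bound[OF this(3,1,2,4)]
 have "(\<integral>\<^sup>+p. ennreal (cmod (K p)) \<partial>hmeasure n) < \<infinity>" by (rule le_less_trans) auto
 then show ?thesis using assms by (intro integrableI_bounded) auto
qed

lemma norm_L1_nonneg[simp]: "0 \<le> norm_L1 n K"
 by (simp add: norm_L1_def)

lemma nn_integral_norm_L1:
 "ckernel n K ==> (\<integral>\<^sup>+p. ennreal (cmod (K p)) \<partial>hmeasure n) = ennreal (norm_L1 n K)"
 unfolding norm_L1_def by (intro nn_integral_eq_integral integrable_norm ckernel_integrable) auto

lemma norm_L1_leI:
 assumes "ckernel n K" "(\<integral>\<^sup>+p. ennreal (cmod (K p)) \<partial>hmeasure n) \<le> ennreal B" "0 \<le> B"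
 shows "norm_L1 n K \<le> B"
 using assms nn_integral_norm_L1[of n K] by simp

lemma norm_L1_bound:
 assumes "ckernel n K" "\<And>p. p \<in> hspace n ==> cmod (K p) \<le> C" "0 \<le> C" "0 \<le> R"
  "\<And>p. p \<in> hspace n ==> K p \<noteq> 0 ==> p \<in> ball_inf n R"
 shows "norm_L1 n K \<le> C * (2 * R) ^ (2 * n + 1)"
 using assms nn_integral_ckernel_bound[OF assms(2-5)] by (intro norm_L1_leI) auto

lemma ckernel_square_integrable:
 assumes "ckernel n K"
 shows "square_integrable (hmeasure n) K"
proof -
 obtain C R where K: "0 \<le> C" "0 \<le> R" "\<And>p. p \<in> hspace n ==> cmod (K p) \<le> C"
  "\<And>p. p \<in> hspace n ==> K p \<noteq> 0 ==> p \<in> ball_inf n R" using ckernelE[OF assms] by blast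
 have "ckernel n (%p. (K p)\<^sup>2)"
  using K assms by (intro ckernelI[where C = "C\<^sup>2" and R = R]) (auto simp: norm_power intro!: power_mono)
 from integrable_norm[OF ckernel_integrable[OF this]] show ?thesis
  using assms by (simp add: square_integrable_def norm_power ckernel_measurable)
qed

lemma ckernel_tilde:
 assumes "ckernel n K"
 shows "ckernel n (tilde n K)"
proof -
 obtain C R where "0 \<le> C" "0 \<le> R" "\<And>p. p \<in> hspace n ==> cmod (K p) \<le> C"
  "\<And>p. p \<in> hspace n ==> K p \<noteq> 0 ==> p \<in> ball_inf n R" using ckernelE[OF assms] by blast
 note K = this
 note [measurable] = ckernel_measurable[OF assms]
 show ?thesis
 proof (rule ckernelI)
  show "tilde n K \<in> borel_measurable (hmeasure n)" unfolding tilde_def by measurable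
  show "cmod (tilde n K p) \<le> C" for p by (simp add: tilde_def K)
  show "p \<in> ball_inf n R" if "p \<in> hspace n" "tilde n K p \<noteq> 0" for p
   using that K(4)[of "hinv n p"] by (simp add: tilde_def hinv_ball_inf)
 qed
qed

section \<open>Young's inequality, adjoints and associativity\<close>

lemma nn_integral_translates:
 assumes [measurable]: "K \<in> borel_measurable (hmeasure n)" and p: "p \<in> hspace n"
 shows "(\<integral>\<^sup>+q. (K (hmult n a (hinv n q) p) :: ennreal) \<partial>hmeasure n) = (\<integral>\<^sup>+q. K q \<partial>hmeasure n)"
  and "(\<integral>\<^sup>+q. K (hmult n a (hinv n p) q) \<partial>hmeasure n) = (\<integral>\<^sup>+q. K q \<partial>hmeasure n)"
proof -
 have "(\<integral>\<^sup>+q. K q \<partial>hmeasure n) = (\<integral>\<^sup>+q. K (hmult n a q p) \<partial>hmeasure n)"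
  by (subst nn_integral_scales[OF scales_right[of n a p]]) auto
 also have "\<dots> = (\<integral>\<^sup>+q. K (hmult n a (hinv n q) p) \<partial>hmeasure n)"
  using p by (subst nn_integral_scales[OF scales_hinv]) (auto simp: space_hmeasure)
 finally show "(\<integral>\<^sup>+q. K (hmult n a (hinv n q) p) \<partial>hmeasure n) = (\<integral>\<^sup>+q. K q \<partial>hmeasure n)" by simp
 show "(\<integral>\<^sup>+q. K (hmult n a (hinv n p) q) \<partial>hmeasure n) = (\<integral>\<^sup>+q. K q \<partial>hmeasure n)"
  by (subst nn_integral_scales[OF scales_left[of n a "hinv n p"], of K]) auto
qed

text \<open>Convolution of the absolute values in \<open>ennreal\<close>. Its
  \<open>L\<^sup>2\<close> bound is what licenses Fubini in \<open>conv_adjoint\<close> and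
  \<open>conv_conv\<close>.\<close>

definition absconv :: "nat => real => (hpoint => complex) => (hpoint => complex) => hpoint => ennreal" where
 "absconv n a f K p = (\<integral>\<^sup>+q. ennreal (cmod (K (hmult n a (hinv n q) p))) * ennreal (cmod (f q)) \<partial>hmeasure n)"

lemma square_integrable_translate:
 assumes K: "ckernel n K" and p: "p \<in> hspace n"
 shows "square_integrable (hmeasure n) (%q. K (hmult n a (hinv n q) p))"
proof -
 note [measurable] = ckernel_measurable[OF K]
 have "(%q. K (hmult n a (hinv n q) p)) \<in> borel_measurable (hmeasure n)"
  using p by (auto simp: space_hmeasure)
 moreover have "(\<integral>\<^sup>+q. (ennreal (cmod (K (hmult n a (hinv n q) p))))\<^sup>2 \<partial>hmeasure n) < \<infinity>"
  using ckernel_square_integrable[OF K] p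
  by (subst nn_integral_translates(1)[where K = "%q. (ennreal (cmod (K q)))\<^sup>2"]) (auto simp: square_integrable_iff)
 ultimately show ?thesis by (simp add: square_integrable_iff)
qed

lemma conv_integrable:
 assumes f: "square_integrable (hmeasure n) f" and K: "ckernel n K" and p: "p \<in> hspace n"
 shows "integrable (hmeasure n) (%q. K (hmult n a (hinv n q) p) * f q)"
proof -
 note [measurable] = square_integrable_measurable[OF f]
 have "square_integrable (hmeasure n) (%q. cnj (f q))"
  using f by (auto simp: square_integrable_def)
 from integrable_mult_L2[OF square_integrable_translate[OF K p] this] show ?thesis by simp
qed

text \<open>Cauchy-Schwarz with \<open>|K|\<close> split into two square roots leaves one factor
  \<open>norm_L1 n K\<close>; Tonelli and invariance on the other side of the kernel give the
  second.\<close>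

lemma absconv_le:
 assumes f: "square_integrable (hmeasure n) f" and K: "ckernel n K"
 shows "(\<integral>\<^sup>+p. (absconv n a f K p)\<^sup>2 \<partial>hmeasure n) \<le> (ennreal (norm_L1 n K * norm_L2 (hmeasure n) f))\<^sup>2"
proof -
 let ?M = "hmeasure n"
 let ?K = "%q p. ennreal (cmod (K (hmult n a (hinv n q) p)))"
 note [measurable] = square_integrable_measurable[OF f] ckernel_measurable[OF K]
 have 1: "(absconv n a f K p)\<^sup>2 \<le> ennreal (norm_L1 n K) * (\<integral>\<^sup>+q. ?K q p * (ennreal (cmod (f q)))\<^sup>2 \<partial>?M)"
  if p: "p \<in> hspace n" for p
 proof -
  have [measurable]: "p \<in> space ?M" using p by (simp add: space_hmeasure)
  let ?r = "%q. ennreal (sqrt (cmod (K (hmult n a (hinv n q) p))))"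
  have r: "?r q * ?r q = ?K q p" for q by (simp flip: ennreal_mult)
  have "(absconv n a f K p)\<^sup>2 = (\<integral>\<^sup>+q. ?r q * (?r q * ennreal (cmod (f q))) \<partial>?M)\<^sup>2"
   unfolding absconv_def by (simp add: r flip: mult.assoc)
  also have "\<dots> \<le> (\<integral>\<^sup>+q. (?r q)\<^sup>2 \<partial>?M) * (\<integral>\<^sup>+q. (?r q * ennreal (cmod (f q)))\<^sup>2 \<partial>?M)"
   by (rule Cauchy_Schwarz_nn_integral) measurable
  also have "\<dots> = (\<integral>\<^sup>+q. ?K q p \<partial>?M) * (\<integral>\<^sup>+q. ?K q p * (ennreal (cmod (f q)))\<^sup>2 \<partial>?M)"
   by (simp add: power_mult_distrib) (simp add: power2_eq_square r)
  also have "(\<integral>\<^sup>+q. ?K q p \<partial>?M) = ennreal (norm_L1 n K)"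
   using nn_integral_translates(1)[of "%q. ennreal (cmod (K q))" n p a] p by (simp add: nn_integral_norm_L1[OF K])
  finally show ?thesis .
 qed
 have "(\<integral>\<^sup>+p. (absconv n a f K p)\<^sup>2 \<partial>?M) \<le>
   (\<integral>\<^sup>+p. ennreal (norm_L1 n K) * (\<integral>\<^sup>+q. ?K q p * (ennreal (cmod (f q)))\<^sup>2 \<partial>?M) \<partial>?M)"
  by (intro nn_integral_mono 1) (simp add: space_hmeasure)
 also have "\<dots> = ennreal (norm_L1 n K) * (\<integral>\<^sup>+p. (\<integral>\<^sup>+q. ?K q p * (ennreal (cmod (f q)))\<^sup>2 \<partial>?M) \<partial>?M)"
  by (intro nn_integral_cmult) measurable
 also have "(\<integral>\<^sup>+p. (\<integral>\<^sup>+q. ?K q p * (ennreal (cmod (f q)))\<^sup>2 \<partial>?M) \<partial>?M) =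
   (\<integral>\<^sup>+q. (\<integral>\<^sup>+p. ?K q p * (ennreal (cmod (f q)))\<^sup>2 \<partial>?M) \<partial>?M)"
  by (rule hmp.Fubini') measurable
 also have "\<dots> = (\<integral>\<^sup>+q. ennreal (norm_L1 n K) * (ennreal (cmod (f q)))\<^sup>2 \<partial>?M)"
 proof (intro nn_integral_cong)
  fix q assume q: "q \<in> space ?M"
  then have "(\<integral>\<^sup>+p. ?K q p * (ennreal (cmod (f q)))\<^sup>2 \<partial>?M) = (\<integral>\<^sup>+p. ?K q p \<partial>?M) * (ennreal (cmod (f q)))\<^sup>2"
   by (intro nn_integral_multc) measurable
  also have "(\<integral>\<^sup>+p. ?K q p \<partial>?M) = ennreal (norm_L1 n K)"
   using nn_integral_translates(2)[of "%q. ennreal (cmod (K q))" n q a] q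
   by (simp add: nn_integral_norm_L1[OF K] space_hmeasure)
  finally show "(\<integral>\<^sup>+p. ?K q p * (ennreal (cmod (f q)))\<^sup>2 \<partial>?M) = ennreal (norm_L1 n K) * (ennreal (cmod (f q)))\<^sup>2" .
 qed
 also have "\<dots> = ennreal (norm_L1 n K) * (ennreal (norm_L2 ?M f))\<^sup>2"
  by (subst nn_integral_cmult) (auto simp: nn_integral_norm_L2[OF f])
 also have "ennreal (norm_L1 n K) * (ennreal (norm_L1 n K) * (ennreal (norm_L2 ?M f))\<^sup>2) =
   (ennreal (norm_L1 n K * norm_L2 ?M f))\<^sup>2"
  by (simp add: ennreal_mult power2_eq_square mult_ac)
 finally show ?thesis .
qed

lemma measurable_absconv[measurable]:
 assumes [measurable]: "f \<in> borel_measurable (hmeasure n)" "K \<in> borel_measurable (hmeasure n)"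
 shows "absconv n a f K \<in> borel_measurable (hmeasure n)"
 unfolding absconv_def[abs_def] by measurable

lemma measurable_conv[measurable]:
 assumes [measurable]: "f \<in> borel_measurable (hmeasure n)" "K \<in> borel_measurable (hmeasure n)"
 shows "conv n a f K \<in> borel_measurable (hmeasure n)"
 unfolding conv_def[abs_def] by measurable

lemma conv_le_absconv:
 assumes "square_integrable (hmeasure n) f" "ckernel n K" "p \<in> hspace n"
 shows "ennreal (cmod (conv n a f K p)) \<le> absconv n a f K p"
 unfolding conv_def absconv_def
 using integral_norm_bound_ennreal[OF conv_integrable[OF assms, of a]] by (simp add: norm_mult ennreal_mult)

lemma Young:
 assumes f: "square_integrable (hmeasure n) f" and K: "ckernel n K"
 shows "square_integrable (hmeasure n) (conv n a f K)"
  and "norm_L2 (hmeasure n) (conv n a f K) \<le> norm_L1 n K * norm_L2 (hmeasure n) f"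
proof -
 note [measurable] = square_integrable_measurable[OF f] ckernel_measurable[OF K]
 have "(\<integral>\<^sup>+p. (ennreal (cmod (conv n a f K p)))\<^sup>2 \<partial>hmeasure n) \<le> (\<integral>\<^sup>+p. (absconv n a f K p)\<^sup>2 \<partial>hmeasure n)"
  by (intro nn_integral_mono power_mono conv_le_absconv[OF f K]) (auto simp: space_hmeasure)
 also note absconv_le[OF f K]
 finally have *: "(\<integral>\<^sup>+p. (ennreal (cmod (conv n a f K p)))\<^sup>2 \<partial>hmeasure n) \<le> (ennreal (norm_L1 n K * norm_L2 (hmeasure n) f))\<^sup>2" .
 show "square_integrable (hmeasure n) (conv n a f K)"
  "norm_L2 (hmeasure n) (conv n a f K) \<le> norm_L1 n K * norm_L2 (hmeasure n) f"
  using square_integrableI[OF _ *] by auto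
qed

lemma conv_adjoint:
 assumes f: "square_integrable (hmeasure n) f" and g: "square_integrable (hmeasure n) g" and K: "ckernel n K"
 shows "inner_L2 (hmeasure n) (conv n a f K) g = inner_L2 (hmeasure n) f (conv n a g (tilde n K))"
proof -
 let ?M = "hmeasure n"
 note [measurable] = square_integrable_measurable[OF f] square_integrable_measurable[OF g] ckernel_measurable[OF K]
 let ?F = "%p q. K (hmult n a (hinv n q) p) * f q * cnj (g p)"
 have int: "integrable (?M \<Otimes>\<^sub>M ?M) (case_prod ?F)"
 proof (rule integrableI_bounded)
  have "(\<integral>\<^sup>+z. ennreal (norm (case_prod ?F z)) \<partial>(?M \<Otimes>\<^sub>M ?M)) = (\<integral>\<^sup>+p. \<integral>\<^sup>+q. ennreal (norm (?F p q)) \<partial>?M \<partial>?M)"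
   by (subst hm.nn_integral_fst[symmetric]) (auto simp: space_hmeasure)
  also have "\<dots> = (\<integral>\<^sup>+p. absconv n a f K p * ennreal (cmod (g p)) \<partial>?M)"
   unfolding absconv_def
   by (intro nn_integral_cong) (auto simp: norm_mult ennreal_mult nn_integral_multc)
  also have "\<dots> < \<infinity>"
  proof -
   have "(\<integral>\<^sup>+p. absconv n a f K p * ennreal (cmod (g p)) \<partial>?M)\<^sup>2 \<le>
    (\<integral>\<^sup>+p. (absconv n a f K p)\<^sup>2 \<partial>?M) * (\<integral>\<^sup>+p. (ennreal (cmod (g p)))\<^sup>2 \<partial>?M)"
    by (rule Cauchy_Schwarz_nn_integral) measurable
   also have "\<dots> \<le> (ennreal (norm_L1 n K * norm_L2 ?M f))\<^sup>2 * (ennreal (norm_L2 ?M g))\<^sup>2"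
    using absconv_le[OF f K] by (intro mult_mono) (auto simp: nn_integral_norm_L2[OF g])
   also have "\<dots> = (ennreal (norm_L1 n K * norm_L2 ?M f * norm_L2 ?M g))\<^sup>2"
    by (simp add: ennreal_mult power_mult_distrib)
   finally have "(\<integral>\<^sup>+p. absconv n a f K p * ennreal (cmod (g p)) \<partial>?M) \<le> ennreal (norm_L1 n K * norm_L2 ?M f * norm_L2 ?M g)"
    by (rule ennreal_power2_leD) simp
   then show ?thesis by (rule le_less_trans) simp
  qed
  finally show "(\<integral>\<^sup>+z. ennreal (norm (case_prod ?F z)) \<partial>(?M \<Otimes>\<^sub>M ?M)) < \<infinity>" .
 qed measurable
 have "inner_L2 ?M (conv n a f K) g = (\<integral>p. \<integral>q. ?F p q \<partial>?M \<partial>?M)"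
  unfolding inner_L2_def conv_def
  by (intro Bochner_Integration.integral_cong refl)
   (subst integral_mult_left_zero[symmetric], simp)
 also have "\<dots> = (\<integral>q. \<integral>p. ?F p q \<partial>?M \<partial>?M)"
  by (rule hmp.Fubini_integral[symmetric]) (rule int)
 also have "\<dots> = inner_L2 ?M f (conv n a g (tilde n K))"
  unfolding inner_L2_def conv_def
 proof (intro Bochner_Integration.integral_cong refl)
  fix q assume q: "q \<in> space ?M"
  have "cnj (\<integral>p. tilde n K (hmult n a (hinv n p) q) * g p \<partial>?M) = (\<integral>p. K (hmult n a (hinv n q) p) * cnj (g p) \<partial>?M)"
   using q by (subst Bochner_Integration.integral_cnj[symmetric])
    (auto intro!: Bochner_Integration.integral_cong simp: tilde_def hinv_hmult space_hmeasure)
  then show "(\<integral>p. ?F p q \<partial>?M) = f q * cnj (\<integral>p. tilde n K (hmult n a (hinv n p) q) * g p \<partial>?M)"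
   by (simp add: mult_ac flip: integral_mult_right_zero)
 qed
 finally show ?thesis .
qed

lemma ckernel_conv:
 assumes L: "ckernel n L" and K: "ckernel n K"
 shows "ckernel n (conv n a L K)"
proof -
 obtain C R where C: "0 \<le> C" "0 \<le> R" "\<And>p. p \<in> hspace n ==> cmod (K p) \<le> C"
  "\<And>p. p \<in> hspace n ==> K p \<noteq> 0 ==> p \<in> ball_inf n R" using ckernelE[OF K] by blast
 obtain D S where D: "0 \<le> D" "0 \<le> S" "\<And>p. p \<in> hspace n ==> cmod (L p) \<le> D"
  "\<And>p. p \<in> hspace n ==> L p \<noteq> 0 ==> p \<in> ball_inf n S" using ckernelE[OF L] by blast
 note [measurable] = ckernel_measurable[OF K] ckernel_measurable[OF L]
 show ?thesis
 proof (rule ckernelI)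
  fix p assume p: "p \<in> hspace n"
  have "cmod (conv n a L K p) \<le> (\<integral>q. C * cmod (L q) \<partial>hmeasure n)"
   unfolding conv_def
  proof (rule integral_norm_le_integral)
   show "integrable (hmeasure n) (%q. K (hmult n a (hinv n q) p) * L q)"
    by (rule conv_integrable[OF ckernel_square_integrable[OF L] K p])
   show "integrable (hmeasure n) (%q. C * cmod (L q))"
    using ckernel_integrable[OF L] by auto
   show "cmod (K (hmult n a (hinv n q) p) * L q) \<le> C * cmod (L q)" for q
    by (auto simp: norm_mult intro!: mult_right_mono C)
  qed
  then show "cmod (conv n a L K p) \<le> C * norm_L1 n L" by (simp add: norm_L1_def)
  show "p \<in> ball_inf n (S + R + 4 * \<bar>a\<bar> * real n * S * R)" if nz: "conv n a L K p \<noteq> 0"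
  proof -
   obtain q where q: "q \<in> hspace n" "K (hmult n a (hinv n q) p) * L q \<noteq> 0"
    using nz Bochner_Integration.integral_cong[OF refl, of "hmeasure n" "%q. K (hmult n a (hinv n q) p) * L q" "%q. 0"]
    unfolding conv_def by (auto simp: space_hmeasure)
   then have "q \<in> ball_inf n S" "hmult n a (hinv n q) p \<in> ball_inf n R" using C(4) D(4) by auto
   from hmult_ball_inf[OF this, of a] show ?thesis using p by simp
  qed
 qed measurable
qed

text \<open>Fubini and left invariance. This makes a composition of two operators a single
  convolution, whose kernel can be estimated pointwise.\<close>

lemma conv_conv:
 assumes f: "square_integrable (hmeasure n) f" and L: "ckernel n L" and K: "ckernel n K" and p: "p \<in> hspace n"
 shows "conv n a (conv n a f L) K p = conv n a f (conv n a L K) p"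
proof -
 let ?M = "hmeasure n"
 note [measurable] = square_integrable_measurable[OF f] ckernel_measurable[OF L] ckernel_measurable[OF K]
 have [measurable]: "p \<in> space ?M" using p by (simp add: space_hmeasure)
 let ?F = "%q r. K (hmult n a (hinv n q) p) * (L (hmult n a (hinv n r) q) * f r)"
 have int: "integrable (?M \<Otimes>\<^sub>M ?M) (case_prod ?F)"
 proof (rule integrableI_bounded)
  let ?k = "%q. ennreal (cmod (K (hmult n a (hinv n q) p)))"
  have "(\<integral>\<^sup>+z. ennreal (norm (case_prod ?F z)) \<partial>(?M \<Otimes>\<^sub>M ?M)) = (\<integral>\<^sup>+q. \<integral>\<^sup>+r. ennreal (norm (?F q r)) \<partial>?M \<partial>?M)"
   by (subst hm.nn_integral_fst[symmetric]) (auto simp: space_hmeasure)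
  also have "\<dots> = (\<integral>\<^sup>+q. ?k q * absconv n a f L q \<partial>?M)"
   unfolding absconv_def
   by (intro nn_integral_cong) (auto simp: norm_mult ennreal_mult nn_integral_cmult)
  also have "\<dots> < \<infinity>"
  proof -
   have k: "square_integrable ?M (%q. K (hmult n a (hinv n q) p))" by (rule square_integrable_translate[OF K p])
   have "(\<integral>\<^sup>+q. ?k q * absconv n a f L q \<partial>?M)\<^sup>2 \<le> (\<integral>\<^sup>+q. (?k q)\<^sup>2 \<partial>?M) * (\<integral>\<^sup>+q. (absconv n a f L q)\<^sup>2 \<partial>?M)"
    by (rule Cauchy_Schwarz_nn_integral) measurable
   also have "\<dots> \<le> (ennreal (norm_L2 ?M (%q. K (hmult n a (hinv n q) p))))\<^sup>2 * (ennreal (norm_L1 n L * norm_L2 ?M f))\<^sup>2"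
    using absconv_le[OF f L] by (intro mult_mono) (auto simp: nn_integral_norm_L2[OF k])
   also have "\<dots> = (ennreal (norm_L2 ?M (%q. K (hmult n a (hinv n q) p)) * (norm_L1 n L * norm_L2 ?M f)))\<^sup>2"
    by (simp add: ennreal_mult power_mult_distrib)
   finally have "(\<integral>\<^sup>+q. ?k q * absconv n a f L q \<partial>?M) \<le>
     ennreal (norm_L2 ?M (%q. K (hmult n a (hinv n q) p)) * (norm_L1 n L * norm_L2 ?M f))"
    by (rule ennreal_power2_leD) simp
   then show ?thesis by (rule le_less_trans) simp
  qed
  finally show "(\<integral>\<^sup>+z. ennreal (norm (case_prod ?F z)) \<partial>(?M \<Otimes>\<^sub>M ?M)) < \<infinity>" .
 qed measurable
 have "conv n a (conv n a f L) K p = (\<integral>q. \<integral>r. ?F q r \<partial>?M \<partial>?M)"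
  unfolding conv_def by simp
 also have "\<dots> = (\<integral>r. \<integral>q. ?F q r \<partial>?M \<partial>?M)"
  by (rule hmp.Fubini_integral[symmetric]) (rule int)
 also have "\<dots> = conv n a f (conv n a L K) p"
  unfolding conv_def
 proof (intro Bochner_Integration.integral_cong refl)
  fix r assume r: "r \<in> space ?M"
  have "(\<integral>q. K (hmult n a (hinv n q) (hmult n a (hinv n r) p)) * L q \<partial>?M)
   = (\<integral>q. K (hmult n a (hinv n (hmult n a (hinv n r) q)) (hmult n a (hinv n r) p)) * L (hmult n a (hinv n r) q) \<partial>?M)"
   using r by (subst integral_scales[OF scales_left[of n a "hinv n r"]]) auto
  also have "\<dots> = (\<integral>q. K (hmult n a (hinv n q) p) * L (hmult n a (hinv n r) q) \<partial>?M)"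
   using r p by (intro Bochner_Integration.integral_cong refl)
    (simp add: hinv_hmult hmult_assoc space_hmeasure)
  finally show "(\<integral>q. ?F q r \<partial>?M) = (\<integral>q. K (hmult n a (hinv n q) (hmult n a (hinv n r) p)) * L q \<partial>?M) * f r"
   by (simp flip: mult.assoc)
 qed
 finally show ?thesis .
qed

text \<open>Moving the first operator to the other side leaves the convolution of \<open>g\<close>
  with \<open>L * K~\<close>, to which Young's inequality applies. The interaction of two pieces is
  thereby measured by one \<open>L\<^sup>1\<close> norm.\<close>

lemma inner_conv_conv_le:
 assumes f: "square_integrable (hmeasure n) f" and g: "square_integrable (hmeasure n) g"
  and K: "ckernel n K" and L: "ckernel n L"
 shows "cmod (inner_L2 (hmeasure n) (conv n a f K) (conv n a g L)) \<le>
  norm_L1 n (conv n a L (tilde n K)) * (norm_L2 (hmeasure n) f * norm_L2 (hmeasure n) g)"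
proof -
 let ?M = "hmeasure n"
 have c: "ckernel n (conv n a L (tilde n K))" by (intro ckernel_conv ckernel_tilde K L)
 have "inner_L2 ?M (conv n a f K) (conv n a g L) = inner_L2 ?M f (conv n a (conv n a g L) (tilde n K))"
  by (intro conv_adjoint f Young(1)[OF g L] K)
 also have "\<dots> = inner_L2 ?M f (conv n a g (conv n a L (tilde n K)))"
  unfolding inner_L2_def using conv_conv[OF g L ckernel_tilde[OF K]]
  by (intro Bochner_Integration.integral_cong refl) (simp add: space_hmeasure)
 also have "cmod \<dots> \<le> norm_L2 ?M f * (norm_L1 n (conv n a L (tilde n K)) * norm_L2 ?M g)"
  by (intro order_trans[OF inner_L2_le[OF f Young(1)[OF g c]]] mult_left_mono Young(2)[OF g c]) auto
 finally show ?thesis by (simp add: mult_ac)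
qed

text \<open>The \<open>T*T\<close> argument. It beats Young's inequality for \<open>K\<close> itself
  because the composed kernel records the cancellation, which the \<open>L\<^sup>1\<close> norm of
  \<open>K\<close> does not see.\<close>

lemma conv_norm_le:
 assumes f: "square_integrable (hmeasure n) f" and K: "ckernel n K"
  and B: "norm_L1 n (conv n a K (tilde n K)) \<le> B\<^sup>2" "0 \<le> B"
 shows "norm_L2 (hmeasure n) (conv n a f K) \<le> B * norm_L2 (hmeasure n) f"
proof -
 let ?M = "hmeasure n"
 have "(norm_L2 ?M (conv n a f K))\<^sup>2 = cmod (inner_L2 ?M (conv n a f K) (conv n a f K))"
  by (simp add: inner_L2_self norm_power)
 also have "\<dots> \<le> B\<^sup>2 * (norm_L2 ?M f * norm_L2 ?M f)"
  using inner_conv_conv_le[OF f f K K, of a] B by (elim order_trans) (intro mult_right_mono, auto)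
 also have "\<dots> = (B * norm_L2 ?M f)\<^sup>2" by (simp add: power2_eq_square)
 finally show ?thesis by (rule power2_le_imp_le) (use B in auto)
qed

section \<open>Nondegeneracy of the phase\<close>

text \<open>Bolzano-Weierstrass one coordinate at a time, since the dimension is a term and no
  Euclidean type is at hand.\<close>

lemma common_convergent_subseq:
 fixes u :: "nat => nat => real"
 assumes "\<And>m k. k < d ==> \<bar>u m k\<bar> \<le> R"
 shows "\<exists>r l. strict_mono r \<and> (\<forall>k<d. (%m. u (r m) k) \<longlonglongrightarrow> l k)"
 using assms
proof (induction d)
 case 0
 show ?case by (rule exI[of _ id]) (auto simp: strict_mono_def)
next
 case (Suc d)
 then obtain r l where r: "strict_mono r" "\<And>k. k < d ==> (%m. u (r m) k) \<longlonglongrightarrow> l k"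
  by (metis less_SucI)
 have "bounded (range (%m. u (r m) d))"
  using Suc.prems by (intro boundedI[of _ R]) auto
 then obtain x s where s: "strict_mono s" "((%m. u (r m) d) \<circ> s) \<longlonglongrightarrow> x"
  using bounded_imp_convergent_subsequence by blast
 show ?case
 proof (intro exI conjI allI impI)
  show "strict_mono (r \<circ> s)" by (rule strict_mono_o[OF r(1) s(1)])
  fix k assume k: "k < Suc d"
  show "(%m. u ((r \<circ> s) m) k) \<longlonglongrightarrow> (l(d := x)) k"
  proof (cases "k = d")
   case True
   then show ?thesis using s(2) by (simp add: o_def)
  next
   case False
   then show ?thesis using LIMSEQ_subseq_LIMSEQ[OF r(2) s(1), of k] k by (simp add: o_def)
  qed
 qed
qed

definition unitv :: "nat => nat => real" where
 "unitv i k = (if k = i then 1 else 0)"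

lemma sum_unitv: "finite A ==> (\<Sum>k\<in>A. x k * unitv i k) = (if i \<in> A then x i else 0)"
 by (simp add: unitv_def if_distrib sum.delta cong: if_cong)

lemma symp_expand: "symp n z v = (\<Sum>i<2 * n. v i * symp n z (unitv i))"
proof -
 have *: "symp n z v = (\<Sum>k<n. \<Sum>i<2 * n. v i * (z k * unitv i (n + k) - z (n + k) * unitv i k))"
  unfolding symp_def
 proof (intro sum.cong refl)
  fix k assume k: "k \<in> {..<n}"
  have "(\<Sum>i<2 * n. v i * (z k * unitv i (n + k) - z (n + k) * unitv i k)) =
   z k * (\<Sum>i<2 * n. v i * unitv (n + k) i) - z (n + k) * (\<Sum>i<2 * n. v i * unitv k i)"
   by (simp add: algebra_simps sum_subtractf sum_distrib_left unitv_def eq_commute)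
  then show "z k * v (n + k) - z (n + k) * v k = (\<Sum>i<2 * n. v i * (z k * unitv i (n + k) - z (n + k) * unitv i k))"
   using k by (simp add: sum_unitv)
 qed
 show ?thesis unfolding * by (subst sum.swap) (simp add: symp_def sum_distrib_left)
qed

text \<open>The vector \<open>J x\<close> for the symplectic block matrix.\<close>

definition rotJ :: "nat => (nat => real) => nat => real" where
 "rotJ n x k = (if k < n then x (n + k) else - x (k - n))"

lemma sum_double: "(\<Sum>k<2 * n. f k) = (\<Sum>k<n. f k + f (n + k :: nat) :: real)"
proof -
 have "(\<Sum>k<2 * n. f k) = (\<Sum>k<n. f k) + (\<Sum>k=n..<n + n. f k)"
  using sum.atLeastLessThan_concat[of 0 n "2 * n" f] by (simp add: atLeast0LessThan mult_2)
 also have "(\<Sum>k=n..<n + n. f k) = (\<Sum>k<n. f (n + k))"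
  using sum.shift_bounds_nat_ivl[of f 0 n n] by (simp add: atLeast0LessThan add.commute)
 finally show ?thesis by (simp add: sum.distrib)
qed

lemma symp_rotJ: "symp n z (rotJ n x) = - (\<Sum>k<2 * n. z k * x k)"
 unfolding sum_double symp_def sum_negf[symmetric] by (intro sum.cong) (auto simp: rotJ_def)

lemma sum_rotJ: "(\<Sum>k<2 * n. z k * rotJ n x k) = symp n z x"
 unfolding sum_double by (simp add: symp_def rotJ_def)

section \<open>The phase and its mixed Hessian\<close>

text \<open>\<open>ab\<close> is the smallness condition of the theorem with constant 3; it enters
  through the sign of the quadratic form in \<open>mixed_Hessian_injective\<close>.\<close>

locale heis =
 fixes n :: nat and a b \<beta> :: real
 assumes n_pos: "1 \<le> n" and a_nz: "a \<noteq> 0" and b_nz: "b \<noteq> 0" and beta_pos: "0 < \<beta>"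
  and ab: "a\<^sup>2 < 3 * b\<^sup>2"
begin

definition sq :: "(nat => real) => real" where
 "sq y = (\<Sum>k<2 * n. (y k)\<^sup>2)"

definition ip :: "(nat => real) => (nat => real) => real" where
 "ip y z = (\<Sum>k<2 * n. y k * z k)"

text \<open>
 Points are handled through their coordinate vectors, the index \<open>2n\<close> being the \<open>t\<close>-coordinate.
 \<open>N0\<close> is \<open>\<rho>\<^sup>4\<close>, \<open>F0\<close> the phase \<open>\<rho>\<close> to the power \<open>-\<beta>\<close>; \<open>LN\<close>, \<open>HN\<close> and \<open>LF\<close>, \<open>HF\<close> are
 their first and second differentials.
\<close>

definition N0 :: "(nat => real) => real" where
 "N0 y = b ^ 4 * (sq y)\<^sup>2 + b\<^sup>2 * (y (2 * n))\<^sup>2"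

definition LN :: "(nat => real) => (nat => real) => real" where
 "LN y v = 4 * b ^ 4 * sq y * ip y v + 2 * b\<^sup>2 * y (2 * n) * v (2 * n)"

definition HN :: "(nat => real) => (nat => real) => (nat => real) => real" where
 "HN y z v = 8 * b ^ 4 * ip y z * ip y v + 4 * b ^ 4 * sq y * ip z v + 2 * b\<^sup>2 * z (2 * n) * v (2 * n)"

definition F0 :: "(nat => real) => real" where
 "F0 y = N0 y powr (- \<beta> / 4)"

definition LF :: "(nat => real) => (nat => real) => real" where
 "LF y v = - \<beta> / 4 * N0 y powr (- \<beta> / 4 - 1) * LN y v"

definition HF :: "(nat => real) => (nat => real) => (nat => real) => real" where
 "HF y z v = - \<beta> / 4 * ((- \<beta> / 4 - 1) * N0 y powr (- \<beta> / 4 - 2) * LN y z * LN y v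
   + N0 y powr (- \<beta> / 4 - 1) * HN y z v)"

text \<open>Left translation by \<open>w\<close> in coordinate vectors, see \<open>co_hmult\<close>.
  For fixed \<open>w\<close> it is affine in \<open>z\<close>, and for fixed \<open>z\<close> affine
  in \<open>w\<close>; both facts are used.\<close>

definition lmul :: "(nat => real) => (nat => real) => nat => real" where
 "lmul w z k = w k + z k - (if k = 2 * n then 2 * a * symp n w z else 0)"

text \<open>Left translation by \<open>w\<close> maps a line along the \<open>i\<close>-th axis to a
  straight line with this direction.\<close>

definition slope :: "nat => (nat => real) => nat => real" where
 "slope i w k = unitv i k - (if k = 2 * n then 2 * a * symp n w (unitv i) else 0)"

lemma N0_nonneg: "0 \<le> N0 y"
 by (simp add: N0_def)

lemma ip_self: "ip y y = sq y"
 by (simp add: ip_def sq_def power2_eq_square)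

lemma sq_0_iff: "sq y = 0 \<longleftrightarrow> (\<forall>k<2 * n. y k = 0)"
 by (auto simp: sq_def sum_nonneg_eq_0_iff)

lemma symp_unitv_top: "symp n w (unitv (2 * n)) = 0"
 unfolding symp_def by (intro sum.neutral) (auto simp: unitv_def)

lemma ip_unitv: "ip y (unitv i) = (if i < 2 * n then y i else 0)"
 by (simp add: ip_def sum_unitv)

lemma LN_expand: "LN y v = (\<Sum>i\<le>2 * n. v i * LN y (unitv i))"
proof -
 have "(\<Sum>i\<le>2 * n. v i * LN y (unitv i)) = (\<Sum>i<2 * n. v i * LN y (unitv i)) + v (2 * n) * LN y (unitv (2 * n))"
  by (simp add: lessThan_Suc_atMost[symmetric])
 also have "(\<Sum>i<2 * n. v i * LN y (unitv i)) = (\<Sum>i<2 * n. 4 * b ^ 4 * sq y * (y i * v i))"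
  by (intro sum.cong refl) (auto simp: LN_def ip_unitv, auto simp: unitv_def)
 also have "\<dots> = 4 * b ^ 4 * sq y * ip y v" by (simp add: ip_def sum_distrib_left)
 finally show ?thesis by (simp add: LN_def ip_unitv) (simp add: unitv_def)
qed

lemma HN_expand: "HN y z v = (\<Sum>i\<le>2 * n. v i * HN y z (unitv i))"
proof -
 have "(\<Sum>i\<le>2 * n. v i * HN y z (unitv i)) = (\<Sum>i<2 * n. v i * HN y z (unitv i)) + v (2 * n) * HN y z (unitv (2 * n))"
  by (simp add: lessThan_Suc_atMost[symmetric])
 also have "(\<Sum>i<2 * n. v i * HN y z (unitv i)) = (\<Sum>i<2 * n. 8 * b ^ 4 * ip y z * (y i * v i) + 4 * b ^ 4 * sq y * (z i * v i))"
  by (intro sum.cong refl) (auto simp: HN_def ip_unitv algebra_simps, auto simp: unitv_def)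
 also have "\<dots> = 8 * b ^ 4 * ip y z * ip y v + 4 * b ^ 4 * sq y * ip z v"
  by (simp add: ip_def sum_distrib_left sum.distrib)
 finally show ?thesis by (simp add: HN_def ip_unitv) (simp add: unitv_def)
qed

lemma HF_expand: "HF y z v = (\<Sum>i\<le>2 * n. v i * HF y z (unitv i))"
proof -
 have "HF y z v = (\<Sum>i\<le>2 * n. - \<beta> / 4 * ((- \<beta> / 4 - 1) * N0 y powr (- \<beta> / 4 - 2) * LN y z * (v i * LN y (unitv i))
   + N0 y powr (- \<beta> / 4 - 1) * (v i * HN y z (unitv i))))"
  unfolding HF_def by (subst LN_expand[of y v], subst HN_expand[of y z v]) (simp only: sum_distrib_left sum.distrib distrib_left)
 then show ?thesis by (simp add: HF_def algebra_simps)
qed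

text \<open>
 Up to row operations, the mixed Hessian of \<open>F0 (u\<^sup>-\<^sup>1 v)\<close> is the Hessian of \<open>F0\<close> plus a multiple of
 the symplectic matrix. On the span of \<open>x\<close>, \<open>J x\<close> and the \<open>t\<close>-axis its determinant is a multiple of
 a quadratic form in \<open>R = b\<^sup>4 |x|\<^sup>4\<close> and \<open>U = b\<^sup>2 t\<^sup>2\<close>, negative definite on \<open>R, U \<ge> 0\<close> when \<open>a\<^sup>2/b\<^sup>2\<close> is
 less than \<open>3 + 3 \<beta> / 2\<close>; on the complement it is \<open>b\<^sup>2 |x|\<^sup>2 I + a t J\<close> up to a factor.
\<close>

lemma mixed_Hessian_injective:
 assumes N: "N0 y > 0"
  and z: "\<And>i. i \<le> 2 * n ==> HF y z (unitv i) - 2 * a * symp n z (unitv i) * LF y (unitv (2 * n)) = 0"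
 shows "\<forall>k\<le>2 * n. z k = 0"
proof -
 \<comment> \<open>The hypothesis concerns coordinate directions; by linearity it holds for all
   \<open>v\<close>, so test vectors adapted to \<open>y\<close> and \<open>z\<close> become
   available.\<close>
 have all: "HF y z v - 2 * a * symp n z v * LF y (unitv (2 * n)) = 0" for v
 proof -
  have s: "symp n z v = (\<Sum>i\<le>2 * n. v i * symp n z (unitv i))"
   by (subst symp_expand) (simp add: lessThan_Suc_atMost[symmetric] symp_unitv_top)
  have "HF y z v - 2 * a * symp n z v * LF y (unitv (2 * n)) =
   (\<Sum>i\<le>2 * n. v i * (HF y z (unitv i) - 2 * a * symp n z (unitv i) * LF y (unitv (2 * n))))"
   by (subst HF_expand, subst s) (simp add: sum_distrib_left sum_distrib_right sum_subtractf algebra_simps)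
  then show ?thesis by (simp add: z)
 qed
 define \<gamma> where "\<gamma> = 1 + \<beta> / 4"
 define \<Lambda> where "\<Lambda> = LN y z"
 define t where "t = y (2 * n)"
 define \<tau> where "\<tau> = z (2 * n)"
 define r where "r = sq y"
 define X where "X = ip y z"
 define Y where "Y = symp n z y"
 define M where "M = N0 y"
 have M: "M > 0" "M = b ^ 4 * r\<^sup>2 + b\<^sup>2 * t\<^sup>2" using N by (simp_all add: M_def N0_def r_def t_def)
 have \<Lambda>: "\<Lambda> = 4 * b ^ 4 * r * X + 2 * b\<^sup>2 * t * \<tau>"
  by (simp add: \<Lambda>_def LN_def r_def X_def t_def \<tau>_def)
 \<comment> \<open>Divides out \<open>- \<beta> / 4 * M powr (- \<beta> / 4 - 2)\<close>. What
   remains is polynomial, and \<gamma> is minus the exponent \<open>- \<beta> / 4 - 1\<close> that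
   the second differentiation brings down.\<close>
 have gen: "- \<gamma> * \<Lambda> * LN y v + M * HN y z v - 4 * a * b\<^sup>2 * t * M * symp n z v = 0" for v
 proof -
  have p: "M powr (- \<beta> / 4 - 1) = M powr (- \<beta> / 4 - 2) * M"
  proof -
   have "- \<beta> / 4 - 1 = (- \<beta> / 4 - 2) + 1" by simp
   then show ?thesis using M(1) by (simp only: powr_add) simp
  qed
  have "LF y (unitv (2 * n)) = - \<beta> / 4 * M powr (- \<beta> / 4 - 1) * (2 * b\<^sup>2 * t)"
   by (simp add: LF_def LN_def ip_unitv t_def M_def) (simp add: unitv_def)
  then have "0 = (- \<beta> / 4 * M powr (- \<beta> / 4 - 2)) * (- \<gamma> * \<Lambda> * LN y v + M * HN y z v - 4 * a * b\<^sup>2 * t * M * symp n z v)"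
   using all[of v] unfolding HF_def \<Lambda>_def[symmetric] M_def[symmetric] p
   by (simp add: \<gamma>_def algebra_simps)
  then show ?thesis using beta_pos M by simp
 qed
 \<comment> \<open>Testing with the \<open>t\<close>-axis, with the horizontal part of
   \<open>y\<close> and with its rotation by \<open>J\<close> gives \<open>e1\<close>,
   \<open>e2\<close> and \<open>e3\<close>, a closed system for \<tau>, \<open>X\<close> and
   \<open>Y\<close>.\<close>
 have e1: "- \<gamma> * \<Lambda> * t + M * \<tau> = 0"
 proof -
  have "2 * b\<^sup>2 * (- \<gamma> * \<Lambda> * t + M * \<tau>) = 0"
   using gen[of "unitv (2 * n)"] by (simp add: LN_def HN_def ip_unitv symp_unitv_top t_def \<tau>_def)
    (simp add: unitv_def algebra_simps)
  then show ?thesis using b_nz by simp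
 qed
 let ?v = "%v k. if k < 2 * n then v k else 0 :: real"
 have ipv: "ip u (?v v) = ip u v" for u v unfolding ip_def by (intro sum.cong) auto
 have sv: "symp n u (?v v) = symp n u v" for u v by (intro symp_cong) auto
 have ipzy: "ip z y = X" by (simp add: X_def ip_def mult.commute)
 have e2: "- \<gamma> * \<Lambda> * b\<^sup>2 * r\<^sup>2 + M * (3 * b\<^sup>2 * r * X) - a * t * M * Y = 0"
 proof -
  have "4 * b\<^sup>2 * (- \<gamma> * \<Lambda> * b\<^sup>2 * r\<^sup>2 + M * (3 * b\<^sup>2 * r * X) - a * t * M * Y) = 0"
   using gen[of "?v y"] ipzy unfolding LN_def HN_def ipv sv
   by (simp add: ip_self r_def[symmetric] X_def[symmetric] Y_def[symmetric]
     power4_eq_xxxx power2_eq_square algebra_simps)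
  then show ?thesis using b_nz by simp
 qed
 have e3: "b\<^sup>2 * r * Y + a * t * X = 0"
 proof -
  have 1: "ip y (rotJ n y) = 0" "ip z (rotJ n y) = Y"
   unfolding ip_def sum_rotJ Y_def by simp_all
  have 2: "symp n z (rotJ n y) = - X" by (simp add: symp_rotJ X_def ip_def mult.commute)
  have "4 * b\<^sup>2 * M * (b\<^sup>2 * r * Y + a * t * X) = 0"
   using gen[of "?v (rotJ n y)"] unfolding LN_def HN_def ipv sv 1 2
   by (simp add: r_def[symmetric] power4_eq_xxxx power2_eq_square algebra_simps)
  then show ?thesis using b_nz M by simp
 qed
 define R where "R = b ^ 4 * r\<^sup>2"
 define U where "U = b\<^sup>2 * t\<^sup>2"
 have RU: "0 \<le> R" "0 \<le> U" "M = R + U" "0 < R + U" using M by (simp_all add: R_def U_def)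
 \<comment> \<open>Eliminates \<tau> between the definition of \<Lambda> and
   \<open>e1\<close>.\<close>
 have l: "\<Lambda> * (M - 2 * \<gamma> * U) = 4 * b ^ 4 * r * M * X"
 proof -
  have "M * \<Lambda> = 4 * b ^ 4 * r * M * X + 2 * b\<^sup>2 * t * (M * \<tau>)" by (simp add: \<Lambda> algebra_simps)
  also have "M * \<tau> = \<gamma> * \<Lambda> * t" using e1 by simp
  finally show ?thesis by (simp add: U_def power2_eq_square algebra_simps)
 qed
 have X: "X = 0"
 proof (rule ccontr)
  assume X: "X \<noteq> 0"
  have "b\<^sup>2 * r * (- \<gamma> * \<Lambda> * b\<^sup>2 * r\<^sup>2 + M * (3 * b\<^sup>2 * r * X)) - a * t * M * (b\<^sup>2 * r * Y) = 0"
   using arg_cong[OF e2, of "%u. b\<^sup>2 * r * u"] by (simp add: algebra_simps)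
  also have "b\<^sup>2 * r * Y = - a * t * X" using e3 by simp
  finally have "- \<gamma> * \<Lambda> * (b ^ 4 * r ^ 3) + (3 * R + a\<^sup>2 * t\<^sup>2) * M * X = 0"
   by (simp add: R_def power4_eq_xxxx power3_eq_cube power2_eq_square algebra_simps)
  \<comment> \<open>Multiplying by \<open>M - 2 * \<gamma> * U\<close> lets \<open>l\<close> remove
    \<Lambda>; it is not divided by, since it may vanish.\<close>
  then have "- \<gamma> * (\<Lambda> * (M - 2 * \<gamma> * U)) * (b ^ 4 * r ^ 3) + (3 * R + a\<^sup>2 * t\<^sup>2) * M * X * (M - 2 * \<gamma> * U) = 0"
   by algebra
  then have "M * X * ((3 * R + a\<^sup>2 * t\<^sup>2) * (M - 2 * \<gamma> * U) - 4 * \<gamma> * R\<^sup>2) = 0"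
   unfolding l by (simp add: R_def power4_eq_xxxx power3_eq_cube power2_eq_square algebra_simps)
  then have "(3 * R + a\<^sup>2 * t\<^sup>2) * (M - 2 * \<gamma> * U) - 4 * \<gamma> * R\<^sup>2 = 0" using X M by simp
  moreover have "(3 * R + a\<^sup>2 * t\<^sup>2) * (M - 2 * \<gamma> * U) - 4 * \<gamma> * R\<^sup>2 < 0"
  proof -
   define \<kappa> where "\<kappa> = a\<^sup>2 / b\<^sup>2"
   have \<kappa>: "0 < \<kappa>" "\<kappa> < 3" "a\<^sup>2 * t\<^sup>2 = \<kappa> * U"
    using a_nz b_nz ab by (simp_all add: \<kappa>_def U_def field_simps)
   \<comment> \<open>Here the constant 3 arises: the coefficient of \<open>R * U\<close> has to be
     non-negative. The square terms give strictness, the one in \<open>U\<close> because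
     \<open>\<kappa> > 0\<close>.\<close>
   have "(3 * R + a\<^sup>2 * t\<^sup>2) * (M - 2 * \<gamma> * U) - 4 * \<gamma> * R\<^sup>2 =
     - ((1 + \<beta>) * R\<^sup>2 + (3 - \<kappa> + 3 * \<beta> / 2) * (R * U) + \<kappa> * (1 + \<beta> / 2) * U\<^sup>2)"
    unfolding \<kappa>(3) RU(3) \<gamma>_def by (simp add: field_simps power2_eq_square)
   moreover have "0 \<le> (3 - \<kappa> + 3 * \<beta> / 2) * (R * U)"
    using \<kappa> RU beta_pos by (intro mult_nonneg_nonneg) auto
   moreover have "0 < (1 + \<beta>) * R\<^sup>2 + \<kappa> * (1 + \<beta> / 2) * U\<^sup>2"
   proof (cases "R = 0")
    case True
    then show ?thesis using RU \<kappa> beta_pos by (simp add: add_pos_pos)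
   next
    case False
    then show ?thesis using RU \<kappa> beta_pos by (intro add_pos_nonneg) auto
   qed
   ultimately show ?thesis by linarith
  qed
  ultimately show False by simp
 qed
 have L0: "\<Lambda> = 0"
 proof (cases "r = 0")
  case True
  then have "M = U" by (simp add: RU R_def)
  moreover have "\<Lambda> * (M - 2 * \<gamma> * U) = 0" using l X by simp
  moreover have "U - 2 * \<gamma> * U = - (1 + \<beta> / 2) * U" by (simp add: \<gamma>_def field_simps)
  ultimately show ?thesis using M beta_pos by auto
 next
  case False
  then have "Y = 0" using e3 X b_nz by simp
  then have "\<gamma> * \<Lambda> * b\<^sup>2 * r\<^sup>2 = 0" using e2 X by simp
  then show ?thesis using False b_nz beta_pos by (simp add: \<gamma>_def)
 qed
 have \<tau>: "\<tau> = 0" using e1 L0 M by simp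
 have hor: "b\<^sup>2 * r * ip z v - a * t * symp n z v = 0" for v
 proof -
  have "4 * b\<^sup>2 * M * (b\<^sup>2 * r * ip z v - a * t * symp n z v) = 0"
   using gen[of "?v v"] L0 X unfolding HN_def ipv sv
   by (simp add: X_def[symmetric] r_def[symmetric] power4_eq_xxxx power2_eq_square algebra_simps)
  then show ?thesis using b_nz M by simp
 qed
 \<comment> \<open>Of \<open>hor\<close> only one term survives in each case. Away from the
   \<open>t\<close>-axis \<open>v = z\<close> kills the symplectic term; on it \<open>r = 0\<close>,
   and \<open>v = J z\<close> turns the symplectic term into \<open>sq z\<close>.\<close>
 have "sq z = 0"
 proof (cases "r = 0")
  case True
  then have "t \<noteq> 0" using M by auto
  moreover have "symp n z (rotJ n z) = - sq z" by (simp add: symp_rotJ sq_def power2_eq_square)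
  ultimately show ?thesis using hor[of "rotJ n z"] True a_nz by simp
 next
  case False
  then show ?thesis using hor[of z] b_nz by (simp add: ip_self)
 qed
 then show ?thesis using \<tau> by (auto simp: sq_0_iff \<tau>_def le_less)
qed

section \<open>Continuity and differentiation of the phase\<close>

lemma tendsto_sq: "(\<And>k. k \<le> 2 * n ==> ((%m. y m k) \<longlongrightarrow> y0 k) F) ==> ((%m. sq (y m)) \<longlongrightarrow> sq y0) F"
 unfolding sq_def by (intro tendsto_sum tendsto_power) auto

lemma tendsto_ip:
 "(\<And>k. k \<le> 2 * n ==> ((%m. y m k) \<longlongrightarrow> y0 k) F) ==>
  (\<And>k. k \<le> 2 * n ==> ((%m. z m k) \<longlongrightarrow> z0 k) F) ==> ((%m. ip (y m) (z m)) \<longlongrightarrow> ip y0 z0) F"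
 unfolding ip_def by (intro tendsto_sum tendsto_mult) auto

lemma tendsto_symp:
 assumes "\<And>k. k \<le> 2 * n ==> ((%m. y m k) \<longlongrightarrow> y0 k) F"
  "\<And>k. k \<le> 2 * n ==> ((%m. z m k) \<longlongrightarrow> z0 k) F"
 shows "((%m. symp n (y m) (z m)) \<longlongrightarrow> symp n y0 z0) F"
 unfolding symp_def by (intro tendsto_sum tendsto_diff tendsto_mult) (auto intro: assms)

lemma tendsto_N0:
 "(\<And>k. k \<le> 2 * n ==> ((%m. y m k) \<longlongrightarrow> y0 k) F) ==> ((%m. N0 (y m)) \<longlongrightarrow> N0 y0) F"
 unfolding N0_def by (intro tendsto_intros tendsto_sq) auto

lemma tendsto_LN:
 "(\<And>k. k \<le> 2 * n ==> ((%m. y m k) \<longlongrightarrow> y0 k) F) ==>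
  (\<And>k. k \<le> 2 * n ==> ((%m. z m k) \<longlongrightarrow> z0 k) F) ==> ((%m. LN (y m) (z m)) \<longlongrightarrow> LN y0 z0) F"
 unfolding LN_def by (intro tendsto_intros tendsto_sq tendsto_ip) auto

lemma tendsto_HN:
 "(\<And>k. k \<le> 2 * n ==> ((%m. y m k) \<longlongrightarrow> y0 k) F) ==>
  (\<And>k. k \<le> 2 * n ==> ((%m. z m k) \<longlongrightarrow> z0 k) F) ==>
  ((%m. HN (y m) (z m) v) \<longlongrightarrow> HN y0 z0 v) F"
 unfolding HN_def by (intro tendsto_intros tendsto_sq tendsto_ip) auto

lemma tendsto_LF:
 "(\<And>k. k \<le> 2 * n ==> ((%m. y m k) \<longlongrightarrow> y0 k) F) ==> 0 < N0 y0 ==> ((%m. LF (y m) v) \<longlongrightarrow> LF y0 v) F"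
 unfolding LF_def by (intro tendsto_intros tendsto_N0 tendsto_LN) auto

lemma tendsto_HF:
 "(\<And>k. k \<le> 2 * n ==> ((%m. y m k) \<longlongrightarrow> y0 k) F) ==>
  (\<And>k. k \<le> 2 * n ==> ((%m. z m k) \<longlongrightarrow> z0 k) F) ==> 0 < N0 y0 ==>
  ((%m. HF (y m) (z m) v) \<longlongrightarrow> HF y0 z0 v) F"
 unfolding HF_def by (intro tendsto_intros tendsto_N0 tendsto_LN tendsto_HN) auto

lemma has_derivative_N0:
 assumes "\<And>k. k \<le> 2 * n ==> ((%s. g s k) has_real_derivative v k) (at s)"
 shows "((%s. N0 (g s)) has_real_derivative LN (g s) v) (at s)"
proof -
 have "((%s. sq (g s)) has_real_derivative (\<Sum>k<2 * n. 2 * (g s k * v k))) (at s)"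
  unfolding sq_def using assms by (intro DERIV_sum) (auto intro!: derivative_eq_intros)
 then show ?thesis unfolding N0_def using assms[of "2 * n"]
  by (auto intro!: derivative_eq_intros simp: LN_def ip_def sum_distrib_left sum_distrib_right mult_ac)
qed

lemma has_derivative_F0:
 assumes "\<And>k. k \<le> 2 * n ==> ((%s. g s k) has_real_derivative v k) (at s)" "0 < N0 (g s)"
 shows "((%s. F0 (g s)) has_real_derivative LF (g s) v) (at s)"
 using DERIV_chain2[OF has_real_derivative_powr[OF assms(2), of "- \<beta> / 4"] has_derivative_N0[OF assms(1)]]
 unfolding F0_def LF_def by (simp add: mult.assoc)

lemma has_derivative_LF:
 assumes g: "\<And>k. k \<le> 2 * n ==> ((%s. g s k) has_real_derivative v k) (at s)" and N: "0 < N0 (g s)"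
 shows "((%s. LF (g s) u) has_real_derivative HF (g s) v u) (at s)"
proof -
 have sq: "((%s. sq (g s)) has_real_derivative 2 * ip (g s) v) (at s)"
  unfolding sq_def ip_def sum_distrib_left using g by (intro DERIV_sum) (auto intro!: derivative_eq_intros)
 have ip: "((%s. ip (g s) u) has_real_derivative ip v u) (at s)"
  unfolding ip_def using g by (intro DERIV_sum) (auto intro!: derivative_eq_intros)
 have LN: "((%s. LN (g s) u) has_real_derivative HN (g s) v u) (at s)"
  unfolding LN_def using sq ip g[of "2 * n"]
  by (auto intro!: derivative_eq_intros simp: HN_def algebra_simps)
 have p: "((%s. N0 (g s) powr (- \<beta> / 4 - 1)) has_real_derivative
   (- \<beta> / 4 - 1) * N0 (g s) powr (- \<beta> / 4 - 2) * LN (g s) v) (at s)"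
 proof -
  have "- \<beta> / 4 - 2 = (- \<beta> / 4 - 1) - 1" by simp
  then show ?thesis
   using DERIV_chain2[OF has_real_derivative_powr[OF N, of "- \<beta> / 4 - 1"] has_derivative_N0[OF g]]
   by (simp only:)
 qed
 have "((%s. - \<beta> / 4 * (N0 (g s) powr (- \<beta> / 4 - 1) * LN (g s) u)) has_real_derivative
   - \<beta> / 4 * ((- \<beta> / 4 - 1) * N0 (g s) powr (- \<beta> / 4 - 2) * LN (g s) v * LN (g s) u + HN (g s) v u * N0 (g s) powr (- \<beta> / 4 - 1))) (at s)"
  by (intro DERIV_cmult DERIV_mult p LN)
 then show ?thesis unfolding LF_def HF_def by (simp only: mult_ac)
qed

text \<open>The differential is tested on \<open>y\<close> itself: \<open>N0\<close> is a quartic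
  plus a quadratic, so its derivative in that direction is at least \<open>2 * N0 y\<close>.\<close>

lemma LF_gradient_nz:
 assumes "0 < N0 y"
 shows "\<exists>i\<le>2 * n. LF y (unitv i) \<noteq> 0"
proof (rule ccontr)
 assume "\<not> ?thesis"
 then have z: "LN y (unitv i) = 0" if "i \<le> 2 * n" for i
  using that assms beta_pos by (auto simp: LF_def)
 have "LN y y = 0" by (subst LN_expand) (simp add: z)
 moreover have "LN y y = 2 * N0 y + 2 * b ^ 4 * (sq y)\<^sup>2"
  by (simp add: LN_def N0_def ip_self power2_eq_square algebra_simps)
 moreover have "0 \<le> b ^ 4 * (sq y)\<^sup>2" by simp
 ultimately show False using assms by linarith
qed

section \<open>Uniform lower bounds by compactness\<close>

definition near :: "real => (nat => real) => (nat => real) => bool" where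
 "near \<delta> y z \<longleftrightarrow> (\<forall>k\<le>2 * n. \<bar>y k - z k\<bar> \<le> \<delta>)"

definition nsize :: "(nat => real) => real" where
 "nsize w = (\<Sum>k\<le>2 * n. \<bar>w k\<bar>)"

lemma abs_le_nsize: "k \<le> 2 * n ==> \<bar>w k\<bar> \<le> nsize w"
 unfolding nsize_def by (rule member_le_sum) auto

lemma nsize_nonneg: "0 \<le> nsize w"
 unfolding nsize_def by (rule sum_nonneg) auto

text \<open>The index \<open>i\<close> is chosen before \<open>z\<close>, so one coordinate
  direction serves a whole cube. A failing sequence would have, for every \<open>i\<close>, bad
  points converging to a common limit at which the entire gradient vanishes.\<close>

lemma gradient_lower_bound:
 assumes c: "0 < c"
 shows "\<exists>\<kappa>>0. \<exists>\<delta>>0. \<forall>z0. (\<forall>k\<le>2 * n. \<bar>z0 k\<bar> \<le> R) --> c \<le> N0 z0 -->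
  (\<exists>i\<le>2 * n. \<forall>z. near \<delta> z z0 --> \<kappa> \<le> \<bar>LF z (unitv i)\<bar>)"
proof (rule ccontr)
 assume neg: "\<not> ?thesis"
 let ?e = "%m. 1 / (real m + 1)"
 have ex: "\<exists>z0. (\<forall>k\<le>2 * n. \<bar>z0 k\<bar> \<le> R) \<and> c \<le> N0 z0 \<and>
   (\<forall>i\<le>2 * n. \<exists>z. near e z z0 \<and> \<bar>LF z (unitv i)\<bar> < e)" if "0 < e" for e
 proof (rule ccontr)
  assume "\<not> ?thesis"
  then have "\<forall>z0. (\<forall>k\<le>2 * n. \<bar>z0 k\<bar> \<le> R) --> c \<le> N0 z0 -->
   (\<exists>i\<le>2 * n. \<forall>z. near e z z0 --> e \<le> \<bar>LF z (unitv i)\<bar>)" by (auto simp: not_less)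
  then show False using neg that by blast
 qed
 define P where "P m z0 \<longleftrightarrow> (\<forall>k\<le>2 * n. \<bar>z0 k\<bar> \<le> R) \<and> c \<le> N0 z0 \<and>
   (\<forall>i\<le>2 * n. \<exists>z. near (?e m) z z0 \<and> \<bar>LF z (unitv i)\<bar> < ?e m)" for m z0
 define z0 where "z0 m = (SOME z. P m z)" for m
 have "\<exists>z. P m z" for m
  unfolding P_def by (rule ex) simp
 then have "P m (z0 m)" for m
  unfolding z0_def by (rule someI_ex)
 then have z0: "\<And>m k. k \<le> 2 * n ==> \<bar>z0 m k\<bar> \<le> R" "\<And>m. c \<le> N0 (z0 m)"
  "\<And>m i. i \<le> 2 * n ==> \<exists>z. near (?e m) z (z0 m) \<and> \<bar>LF z (unitv i)\<bar> < ?e m" by (auto simp: P_def)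
 \<comment> \<open>The bad point depends on the direction \<open>i\<close>; all of them share the
   limit of the centres \<open>z0 m\<close>.\<close>
 define z where "z m i = (SOME z. near (?e m) z (z0 m) \<and> \<bar>LF z (unitv i)\<bar> < ?e m)" for m i
 have z: "near (?e m) (z m i) (z0 m)" "\<bar>LF (z m i) (unitv i)\<bar> < ?e m" if "i \<le> 2 * n" for m i
  using someI_ex[OF z0(3)[OF that, of m]] unfolding z_def by auto
 obtain r l where r: "strict_mono r" "\<And>k. k < 2 * n + 1 ==> (%m. z0 (r m) k) \<longlonglongrightarrow> l k"
  using common_convergent_subseq[of "2 * n + 1" z0 R] z0(1) by auto
 have e0: "(%m. ?e (r m)) \<longlonglongrightarrow> 0"
  using LIMSEQ_subseq_LIMSEQ[OF LIMSEQ_inverse_real_of_nat r(1)] by (simp add: o_def inverse_eq_divide add.commute)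
 have lim0: "(%m. z0 (r m) k) \<longlonglongrightarrow> l k" if "k \<le> 2 * n" for k using r(2)[of k] that by simp
 have "c \<le> N0 l"
  by (rule LIMSEQ_le_const[OF tendsto_N0[OF lim0]]) (use z0 in auto)
 then have l: "0 < N0 l" using c by simp
 have "LF l (unitv i) = 0" if i: "i \<le> 2 * n" for i
 proof -
  have zl: "(%m. z (r m) i k) \<longlonglongrightarrow> l k" if k: "k \<le> 2 * n" for k
  proof -
   have "(%m. z (r m) i k - z0 (r m) k) \<longlonglongrightarrow> 0"
    by (rule tendsto_rabs_zero_cancel, rule tendsto_sandwich[OF _ _ tendsto_const e0])
     (use z(1)[OF i] k in \<open>auto simp: near_def\<close>)
   from tendsto_add[OF this lim0[OF k]] show ?thesis by simp
  qed
  have "(%m. LF (z (r m) i) (unitv i)) \<longlonglongrightarrow> 0"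
   by (rule tendsto_rabs_zero_cancel, rule tendsto_sandwich[OF _ _ tendsto_const e0])
    (use z(2)[OF i] in \<open>auto intro!: always_eventually less_imp_le\<close>)
  with tendsto_LF[OF zl l, of "unitv i"] show ?thesis using LIMSEQ_unique by blast
 qed
 with LF_gradient_nz[OF l] show False by auto
qed

lemma N0_near:
 assumes "0 < N0 l"
 shows "\<exists>\<eta>>0. \<forall>y. near \<eta> y l --> 0 < N0 y"
proof (rule ccontr)
 assume neg: "\<not> ?thesis"
 have "\<exists>y. near (1 / (real m + 1)) y l \<and> N0 y = 0" for m
 proof -
  have "0 < 1 / (real m + 1)" by simp
  then have "\<exists>y. near (1 / (real m + 1)) y l \<and> \<not> 0 < N0 y" using neg by blast
  then show ?thesis using N0_nonneg by (metis order_le_less)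
 qed
 then obtain y where y: "\<And>m. near (1 / (real m + 1)) (y m) l" "\<And>m. N0 (y m) = 0" by metis
 have "(%m. y m k) \<longlonglongrightarrow> l k" if k: "k \<le> 2 * n" for k
 proof -
  have e0: "(%m. 1 / (real m + 1)) \<longlonglongrightarrow> 0"
   using LIMSEQ_inverse_real_of_nat by (simp add: inverse_eq_divide add.commute)
  have "(%m. y m k - l k) \<longlonglongrightarrow> 0"
   by (rule tendsto_rabs_zero_cancel, rule tendsto_sandwich[OF _ _ tendsto_const e0])
    (use y(1) k in \<open>auto simp: near_def\<close>)
  from tendsto_add[OF this tendsto_const[of "l k"]] show ?thesis by simp
 qed
 then have "(%m. N0 (y m)) \<longlonglongrightarrow> N0 l" by (rule tendsto_N0)
 then have "(%m. 0) \<longlonglongrightarrow> N0 l" by (simp add: y(2))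
 then show False using assms by (simp add: LIMSEQ_const_iff)
qed

lemma LF_slope: "LF y (slope i w) = LF y (unitv i) - 2 * a * symp n w (unitv i) * LF y (unitv (2 * n))"
proof -
 have "ip y (slope i w) = ip y (unitv i)" unfolding ip_def by (intro sum.cong) (auto simp: slope_def)
 then have "LN y (slope i w) = LN y (unitv i) - 2 * a * symp n w (unitv i) * LN y (unitv (2 * n))"
  by (simp add: LN_def ip_unitv slope_def) (simp add: unitv_def algebra_simps)
 then show ?thesis unfolding LF_def by algebra
qed

lemma HF_scale: "HF y (%k. c * z k) v = c * HF y z v"
proof -
 have "ip y (%k. c * z k) = c * ip y z" "ip (%k. c * z k) v = c * ip z v" for y
  by (simp_all add: ip_def sum_distrib_left mult_ac)
 then have "LN y (%k. c * z k) = c * LN y z" "HN y (%k. c * z k) v = c * HN y z v"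
  by (simp_all add: LN_def HN_def algebra_simps)
 then show ?thesis unfolding HF_def by algebra
qed

text \<open>The intermediate point is described only by its coordinatewise distance from
  \<open>z\<close>, which is what passing to a limit requires.\<close>

lemma LF_mean_value:
 assumes "\<And>\<theta>. 0 \<le> \<theta> ==> \<theta> \<le> 1 ==> 0 < N0 (%k. z k + \<theta> * \<zeta> k)"
 shows "\<exists>y. (\<forall>k. \<bar>y k - z k\<bar> \<le> \<bar>\<zeta> k\<bar>) \<and> LF (%k. z k + \<zeta> k) u - LF z u = HF y \<zeta> u"
proof -
 let ?g = "%\<theta> k. z k + \<theta> * \<zeta> k"
 have "((%\<theta>. LF (?g \<theta>) u) has_real_derivative HF (?g \<theta>) \<zeta> u) (at \<theta>)" if "0 \<le> \<theta>" "\<theta> \<le> 1" for \<theta>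
  using assms[OF that] by (intro has_derivative_LF) (auto intro!: derivative_eq_intros)
 from MVT2[OF _ this, of 0 1] obtain \<theta> where \<theta>: "0 < \<theta>" "\<theta> < 1"
  "LF (?g 1) u - LF (?g 0) u = (1 - 0) * HF (?g \<theta>) \<zeta> u" by auto
 show ?thesis
  by (rule exI[of _ "?g \<theta>"]) (use \<theta> in \<open>auto simp: abs_mult mult_left_le_one_le\<close>)
qed

text \<open>The derivative of the phase difference between \<open>q\<close> and \<open>w q\<close>
  is at least of order |w|. After division by \<open>nsize w\<close>, failing sequences converge to
  a unit direction \<omega> on which the mixed Hessian vanishes, against
  \<open>mixed_Hessian_injective\<close>. Restricting to small \<open>w\<close> lets the difference
  quotient be compared with the derivative.\<close>

lemma mixed_gradient_lower_bound:
 assumes c: "0 < c"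
 shows "\<exists>\<kappa>>0. \<exists>\<delta>>0. \<forall>z0 w. (\<forall>k\<le>2 * n. \<bar>z0 k\<bar> \<le> R) --> c \<le> N0 z0 --> 0 < nsize w --> nsize w \<le> \<delta> -->
  (\<exists>i\<le>2 * n. \<forall>z. near \<delta> z z0 --> \<kappa> * nsize w \<le> \<bar>LF (lmul w z) (slope i w) - LF z (unitv i)\<bar>)"
proof (rule ccontr)
 assume neg: "\<not> ?thesis"
 let ?e = "%m. 1 / (real m + 1)"
 let ?Q = "%w z i. LF (lmul w z) (slope i w) - LF z (unitv i)"
 define P where "P e zw \<longleftrightarrow> (case zw of (z0, w) => (\<forall>k\<le>2 * n. \<bar>z0 k\<bar> \<le> R) \<and> c \<le> N0 z0 \<and> 0 < nsize w \<and> nsize w \<le> e \<and>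
   (\<forall>i\<le>2 * n. \<exists>z. near e z z0 \<and> \<bar>?Q w z i\<bar> < e * nsize w))" for e zw
 have ex: "\<exists>zw. P e zw" if "0 < e" for e
 proof (rule ccontr)
  assume "\<not> ?thesis"
  then have "\<forall>z0 w. (\<forall>k\<le>2 * n. \<bar>z0 k\<bar> \<le> R) --> c \<le> N0 z0 --> 0 < nsize w --> nsize w \<le> e -->
   (\<exists>i\<le>2 * n. \<forall>z. near e z z0 --> e * nsize w \<le> \<bar>?Q w z i\<bar>)"
   unfolding P_def split_paired_Ex prod.case by (metis not_le)
  then show False using neg that by blast
 qed
 define z0 where "z0 m = fst (SOME zw. P (?e m) zw)" for m
 define w where "w m = snd (SOME zw. P (?e m) zw)" for m
 have "P (?e m) (z0 m, w m)" for m
  unfolding z0_def w_def prod.collapse by (rule someI_ex) (rule ex, simp)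
 then have z0: "\<And>m k. k \<le> 2 * n ==> \<bar>z0 m k\<bar> \<le> R" "\<And>m. c \<le> N0 (z0 m)"
  and w: "\<And>m. 0 < nsize (w m)" "\<And>m. nsize (w m) \<le> ?e m"
  and zex: "\<And>m i. i \<le> 2 * n ==> \<exists>z. near (?e m) z (z0 m) \<and> \<bar>?Q (w m) z i\<bar> < ?e m * nsize (w m)"
  by (auto simp: P_def)
 define z where "z m i = (SOME z. near (?e m) z (z0 m) \<and> \<bar>?Q (w m) z i\<bar> < ?e m * nsize (w m))" for m i
 have z: "near (?e m) (z m i) (z0 m)" "\<bar>?Q (w m) (z m i) i\<bar> < ?e m * nsize (w m)" if "i \<le> 2 * n" for m i
  using someI_ex[OF zex[OF that, of m]] unfolding z_def by auto
 let ?d = "2 * n + 1"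
 \<comment> \<open>Centre and normalised translation are packed into one vector of length
   \<open>2 * (2 * n + 1)\<close>, so that a single subsequence handles both.\<close>
 let ?u = "%m k. if k < ?d then z0 m k else w m (k - ?d) / nsize (w m)"
 have "\<bar>?u m k\<bar> \<le> max R 1" if "k < ?d + ?d" for m k
 proof (cases "k < ?d")
  case True
  then show ?thesis using z0(1)[of k m] by (simp add: le_max_iff_disj)
 next
  case False
  then have "\<bar>w m (k - ?d)\<bar> \<le> nsize (w m)" using that by (intro abs_le_nsize) auto
  then show ?thesis using False w(1)[of m] by (simp add: le_max_iff_disj)
 qed
 from common_convergent_subseq[of "?d + ?d" ?u, OF this] obtain r l where r: "strict_mono r"
  and lim: "\<forall>k<?d + ?d. (%m. ?u (r m) k) \<longlonglongrightarrow> l k" by blast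
 define \<omega> where "\<omega> k = l (k + ?d)" for k
 have e0: "(%m. ?e (r m)) \<longlonglongrightarrow> 0"
  using LIMSEQ_subseq_LIMSEQ[OF LIMSEQ_inverse_real_of_nat r] by (simp add: o_def inverse_eq_divide add.commute)
 have lim0: "(%m. z0 (r m) k) \<longlonglongrightarrow> l k" if "k \<le> 2 * n" for k
  using lim[rule_format, of k] that by simp
 have limw: "(%m. w (r m) k / nsize (w (r m))) \<longlonglongrightarrow> \<omega> k" if "k \<le> 2 * n" for k
  using lim[rule_format, of "k + ?d"] that by (simp add: \<omega>_def)
 have "c \<le> N0 l"
  by (rule LIMSEQ_le_const[OF tendsto_N0[OF lim0]]) (use z0 in auto)
 then have l: "0 < N0 l" using c by simp
 from N0_near[OF l] obtain \<eta> where \<eta>: "0 < \<eta>" "\<And>y. near \<eta> y l ==> 0 < N0 y" by blast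
 have w0: "(%m. nsize (w (r m))) \<longlonglongrightarrow> 0"
  by (rule tendsto_sandwich[OF _ _ tendsto_const e0]) (use w in \<open>auto simp: nsize_nonneg\<close>)
 \<comment> \<open>The velocity at \<open>l\<close> of left translation in the direction \<omega>, a
   right-invariant field. It has the horizontal components of \<omega>, so each of \<omega> and
   \<open>\<zeta>0\<close> determines the other.\<close>
 define \<zeta>0 where "\<zeta>0 k = \<omega> k - (if k = 2 * n then 2 * a * symp n \<omega> l else 0)" for k
 have s\<zeta>: "symp n \<zeta>0 v = symp n \<omega> v" for v by (intro symp_cong) (auto simp: \<zeta>0_def)
 have main: "HF l \<zeta>0 (unitv i) - 2 * a * symp n \<zeta>0 (unitv i) * LF l (unitv (2 * n)) = 0" if i: "i \<le> 2 * n" for i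
 proof -
  let ?z = "%m. z (r m) i"
  let ?w = "%m. w (r m)"
  let ?\<nu> = "%m. nsize (w (r m))"
  let ?h = "%m k. ?w m k / ?\<nu> m"
  \<comment> \<open>\<open>lmul\<close> is affine in \<open>w\<close>, so \<open>lmul w z\<close>
    equals \<open>z\<close> plus \<open>nsize w\<close> times this vector exactly, with no
    remainder.\<close>
  define \<zeta> where "\<zeta> m k = ?h m k - (if k = 2 * n then 2 * a * symp n (?h m) (?z m) else 0)" for m k
  have zl: "(%m. ?z m k) \<longlonglongrightarrow> l k" if k: "k \<le> 2 * n" for k
  proof -
   have "(%m. z (r m) i k - z0 (r m) k) \<longlonglongrightarrow> 0"
    by (rule tendsto_rabs_zero_cancel, rule tendsto_sandwich[OF _ _ tendsto_const e0])
     (use z(1)[OF i] k in \<open>auto simp: near_def\<close>)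
   from tendsto_add[OF this lim0[OF k]] show ?thesis by simp
  qed
  have \<zeta>l: "(%m. \<zeta> m k) \<longlonglongrightarrow> \<zeta>0 k" if k: "k \<le> 2 * n" for k
   unfolding \<zeta>_def \<zeta>0_def using tendsto_symp[OF limw zl] limw[OF k] by (auto intro!: tendsto_intros)
  have lm: "lmul (?w m) (?z m) = (%k. ?z m k + ?\<nu> m * \<zeta> m k)" for m
  proof
   fix k
   have "symp n (?h m) (?z m) = symp n (?w m) (?z m) / ?\<nu> m"
    using symp_scale_left[of n "1 / ?\<nu> m" "?w m" "?z m"] by simp
   then show "lmul (?w m) (?z m) k = ?z m k + ?\<nu> m * \<zeta> m k"
    using w(1)[of "r m"] by (simp add: lmul_def \<zeta>_def field_simps)
  qed
  have d0: "(%m. ?\<nu> m * \<zeta> m k) \<longlonglongrightarrow> 0" if k: "k \<le> 2 * n" for k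
   using tendsto_mult[OF w0 \<zeta>l[OF k]] by simp
  have "\<forall>\<^sub>F m in sequentially. \<forall>k\<in>{..2 * n}. \<bar>?z m k - l k\<bar> < \<eta> / 2 \<and> \<bar>?\<nu> m * \<zeta> m k\<bar> < \<eta> / 2"
  proof (rule eventually_ball_finite)
   show "\<forall>k\<in>{..2 * n}. \<forall>\<^sub>F m in sequentially. \<bar>?z m k - l k\<bar> < \<eta> / 2 \<and> \<bar>?\<nu> m * \<zeta> m k\<bar> < \<eta> / 2"
   proof
    fix k assume "k \<in> {..2 * n}"
    then have k: "k \<le> 2 * n" by simp
    have "\<forall>\<^sub>F m in sequentially. dist (?z m k) (l k) < \<eta> / 2" "\<forall>\<^sub>F m in sequentially. dist (?\<nu> m * \<zeta> m k) 0 < \<eta> / 2"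
     using tendstoD[OF zl[OF k], of "\<eta> / 2"] tendstoD[OF d0[OF k], of "\<eta> / 2"] \<eta>(1) by auto
    then show "\<forall>\<^sub>F m in sequentially. \<bar>?z m k - l k\<bar> < \<eta> / 2 \<and> \<bar>?\<nu> m * \<zeta> m k\<bar> < \<eta> / 2"
     by eventually_elim (simp add: dist_real_def)
   qed
  qed simp
  then have ev: "\<forall>\<^sub>F m in sequentially. \<exists>y. (\<forall>k. \<bar>y k - ?z m k\<bar> \<le> \<bar>?\<nu> m * \<zeta> m k\<bar>) \<and>
   LF (lmul (?w m) (?z m)) (unitv i) - LF (?z m) (unitv i) = HF y (%k. ?\<nu> m * \<zeta> m k) (unitv i)"
  proof eventually_elim
   case (elim m)
   show ?case unfolding lm
   proof (rule LF_mean_value, rule \<eta>(2))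
    fix \<theta> :: real assume \<theta>: "0 \<le> \<theta>" "\<theta> \<le> 1"
    show "near \<eta> (%k. ?z m k + \<theta> * (?\<nu> m * \<zeta> m k)) l"
     unfolding near_def
    proof (intro allI impI)
     fix k assume k: "k \<le> 2 * n"
     have "\<bar>\<theta> * (?\<nu> m * \<zeta> m k)\<bar> \<le> \<bar>?\<nu> m * \<zeta> m k\<bar>"
      unfolding abs_mult[of \<theta>] using \<theta> by (intro mult_left_le_one_le) auto
     then show "\<bar>?z m k + \<theta> * (?\<nu> m * \<zeta> m k) - l k\<bar> \<le> \<eta>"
      using bspec[OF elim, of k] k unfolding atMost_iff by argo
    qed
   qed
  qed
  define Y where "Y m y \<longleftrightarrow> (\<forall>k. \<bar>y k - ?z m k\<bar> \<le> \<bar>?\<nu> m * \<zeta> m k\<bar>) \<and>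
   LF (lmul (?w m) (?z m)) (unitv i) - LF (?z m) (unitv i) = HF y (%k. ?\<nu> m * \<zeta> m k) (unitv i)" for m y
  \<comment> \<open>The default \<open>?z m\<close> keeps the closeness bound true for every
    \<open>m\<close>, so that the convergence of \<open>y\<close> is immediate.\<close>
  define y where "y m = (if \<exists>y. Y m y then SOME y. Y m y else ?z m)" for m
  have yz: "\<bar>y m k - ?z m k\<bar> \<le> \<bar>?\<nu> m * \<zeta> m k\<bar>" for m k
   using someI_ex[of "Y m"] by (auto simp: y_def Y_def)
  have yY: "\<forall>\<^sub>F m in sequentially. Y m (y m)"
   using ev unfolding Y_def[symmetric]
  proof eventually_elim
   case (elim m)
   have "Y m (SOME y. Y m y)" using elim by (rule someI_ex)
   then show ?case using elim by (simp add: y_def)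
  qed
  have yl: "(%m. y m k) \<longlonglongrightarrow> l k" if k: "k \<le> 2 * n" for k
  proof -
   have "(%m. y m k - ?z m k) \<longlonglongrightarrow> 0"
    by (rule tendsto_rabs_zero_cancel, rule tendsto_sandwich[OF _ _ tendsto_const tendsto_rabs_zero[OF d0[OF k]]])
     (use yz in auto)
   from tendsto_add[OF this zl[OF k]] show ?thesis by simp
  qed
  have ll: "(%m. lmul (?w m) (?z m) k) \<longlonglongrightarrow> l k" if k: "k \<le> 2 * n" for k
   unfolding lm using tendsto_add[OF zl[OF k] d0[OF k]] by simp
  have "(%m. HF (y m) (\<zeta> m) (unitv i) - 2 * a * symp n (?h m) (unitv i) * LF (lmul (?w m) (?z m)) (unitv (2 * n)))
   \<longlonglongrightarrow> HF l \<zeta>0 (unitv i) - 2 * a * symp n \<omega> (unitv i) * LF l (unitv (2 * n))"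
   by (intro tendsto_intros tendsto_HF[OF yl \<zeta>l l] tendsto_LF[OF ll l] tendsto_symp[OF limw tendsto_const])
  moreover have "(%m. HF (y m) (\<zeta> m) (unitv i) - 2 * a * symp n (?h m) (unitv i) * LF (lmul (?w m) (?z m)) (unitv (2 * n))) \<longlonglongrightarrow> 0"
  proof (rule tendsto_rabs_zero_cancel, rule tendsto_sandwich[OF _ _ tendsto_const e0])
   show "\<forall>\<^sub>F m in sequentially. \<bar>HF (y m) (\<zeta> m) (unitv i) - 2 * a * symp n (?h m) (unitv i) * LF (lmul (?w m) (?z m)) (unitv (2 * n))\<bar> \<le> ?e (r m)"
    using yY
   proof eventually_elim
    case (elim m)
    have \<nu>: "0 < ?\<nu> m" by (rule w)
    have s: "symp n (?w m) (unitv i) = ?\<nu> m * symp n (?h m) (unitv i)"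
     using symp_scale_left[of n "?\<nu> m" "?h m" "unitv i"] \<nu> by simp
    have "LF (lmul (?w m) (?z m)) (unitv i) - LF (?z m) (unitv i) = ?\<nu> m * HF (y m) (\<zeta> m) (unitv i)"
     using elim unfolding Y_def HF_scale by blast
    then have "?Q (?w m) (?z m) i = ?\<nu> m * (HF (y m) (\<zeta> m) (unitv i) - 2 * a * symp n (?h m) (unitv i) * LF (lmul (?w m) (?z m)) (unitv (2 * n)))"
     unfolding LF_slope s by algebra
    then have "?\<nu> m * \<bar>HF (y m) (\<zeta> m) (unitv i) - 2 * a * symp n (?h m) (unitv i) * LF (lmul (?w m) (?z m)) (unitv (2 * n))\<bar> < ?\<nu> m * ?e (r m)"
     using z(2)[OF i, of "r m"] \<nu> by (simp add: abs_mult mult.commute)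
    from mult_left_le_imp_le[OF less_imp_le[OF this] \<nu>] show ?case .
   qed
  qed auto
  ultimately show ?thesis unfolding s\<zeta> by (rule LIMSEQ_unique)
 qed
 from mixed_Hessian_injective[OF l main] have \<zeta>0: "\<zeta>0 k = 0" if "k \<le> 2 * n" for k using that by blast
 \<comment> \<open>The horizontal components vanish first; they determine the symplectic correction
   in the last component, which then vanishes too. This contradicts the normalisation of
   \<omega>.\<close>
 have "\<omega> k = 0" if k: "k \<le> 2 * n" for k
 proof -
  have "symp n \<omega> l = symp n (%k. 0) l"
   using \<zeta>0 by (intro symp_cong) (auto simp: \<zeta>0_def)
  then have "symp n \<omega> l = 0" by (simp add: symp_def)
  then show ?thesis using \<zeta>0[OF k] by (simp add: \<zeta>0_def split: if_splits)
 qed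
 moreover have "(%m. \<Sum>k\<le>2 * n. \<bar>w (r m) k / nsize (w (r m))\<bar>) \<longlonglongrightarrow> (\<Sum>k\<le>2 * n. \<bar>\<omega> k\<bar>)"
  by (intro tendsto_intros limw) auto
 moreover have "(\<Sum>k\<le>2 * n. \<bar>w (r m) k / nsize (w (r m))\<bar>) = 1" for m
 proof -
  have "(\<Sum>k\<le>2 * n. \<bar>w (r m) k / nsize (w (r m))\<bar>) = nsize (w (r m)) / nsize (w (r m))"
   using w(1)[of "r m"] unfolding abs_divide sum_divide_distrib[symmetric] nsize_def by simp
  then show ?thesis using w(1)[of "r m"] by simp
 qed
 ultimately show False by (simp add: LIMSEQ_const_iff)
qed

end

section \<open>Oscillatory integrals on the group\<close>

lemma bd_Un:
 assumes "open I" "open J"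
 shows "bd m I K f ==> bd m J K f ==> bd m (I \<union> J) K f"
proof (induction m arbitrary: f)
 case 0
 then show ?case using assms by (auto intro: continuous_on_open_Un)
next
 case (Suc m)
 obtain f1 where f1: "\<forall>s\<in>I. (f has_real_derivative f1 s) (at s)" "bd m I K f1"
  using Suc.prems(1) by (rule bd_SucE)
 obtain f2 where f2: "\<forall>s\<in>J. (f has_real_derivative f2 s) (at s)" "bd m J K f2"
  using Suc.prems(2) by (rule bd_SucE)
 let ?f = "%s. if s \<in> I then f1 s else f2 s"
 have d: "(f has_real_derivative ?f s) (at s)" if "s \<in> I \<union> J" for s
  using f1 f2 that by auto
 have "bd m (I \<union> J) K ?f"
 proof (rule Suc.IH)
  show "bd m I K ?f" by (rule bd_cong[OF assms(1) _ f1(2)]) simp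
  show "bd m J K ?f"
  proof (rule bd_cong[OF assms(2) _ f2(2)])
   fix s assume "s \<in> J"
   then show "f2 s = ?f s" using DERIV_unique[OF bspec[OF f2(1)] d] by auto
  qed
 qed
 moreover have "\<bar>f s\<bar> \<le> K" if "s \<in> I \<union> J" for s
  using that Suc.prems by (auto dest: bd_bound simp del: bd.simps)
 ultimately show ?case using d by (intro bd_SucI[where f' = ?f]) auto
qed

text \<open>For profiles built from powers and roots, which are smooth only away from 0 but vanish
  near the ends of the interval.\<close>

lemma bd_extend:
 assumes "bd m {a<..<b} K f" "a < a'" "b' < b" "\<And>u. f u \<noteq> 0 ==> a' \<le> u \<and> u \<le> b'" "0 \<le> K"
 shows "bd m UNIV K f"
proof -
 have "bd m (- {a'..b'}) K (%_. 0)" by (rule bd_const) (use assms in auto)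
 then have "bd m (- {a'..b'}) K f"
  by (rule bd_cong[rotated -1]) (use assms(4) in force)+
 from bd_Un[OF _ _ assms(1) this] show ?thesis
  using assms(2,3) by (auto simp: open_Compl elim!: back_subst[of "%I. bd m I K f"])
qed

text \<open>Averaging over translations replaces singling out the \<open>i\<close>-th factor of the
  product measure: by invariance and Fubini, \<open>2 * \<delta>\<close> times the integral is an
  integral over the cube of integrals along lines. The truncation \<open>T\<close> confines the base
  point to the slab of the cube.\<close>

lemma line_average:
 assumes f[measurable]: "f \<in> borel_measurable (hmeasure n)" and \<delta>: "0 < \<delta>" and i: "i \<le> 2 * n"
  and bnd: "\<And>p. p \<in> hspace n ==> cmod (f p) \<le> A"
  and supp: "\<And>p. p \<in> hspace n ==> f p \<noteq> 0 ==> p \<in> cube n c \<delta>"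
  and B: "\<And>p. p \<in> cube n c \<delta> ==> cmod (\<integral>s. f (shift n i p s) \<partial>(lborel :: real measure)) \<le> B"
 shows "cmod (\<integral>p. f p \<partial>hmeasure n) \<le> (2 * \<delta>) ^ (2 * n) * B"
proof -
 let ?M = "hmeasure n"
 let ?X = "cube n c \<delta>"
 interpret LM: pair_sigma_finite "lborel :: real measure" ?M by standard
 have eX: "emeasure ?M ?X = ennreal ((2 * \<delta>) ^ (2 * n + 1))"
  using \<delta> by (subst emeasure_box) auto
 have mX: "measure ?M ?X = (2 * \<delta>) ^ (2 * n + 1)"
  using \<delta> by (simp add: measure_def eX)
 define T where "T p = (indicator {c i - \<delta>..c i + \<delta>} (co n p i) :: real)" for p
 have T[measurable]: "T \<in> borel_measurable ?M" unfolding T_def[abs_def] by measurable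
 define F where "F s p = T p *\<^sub>R f (shift n i p s)" for s p
 have F[measurable]: "case_prod F \<in> borel_measurable (lborel \<Otimes>\<^sub>M ?M)"
  unfolding F_def[abs_def] by measurable
 have Fsupp: "p \<in> ?X \<and> s \<in> {-(2 * \<delta>)..2 * \<delta>}" if "p \<in> hspace n" "F s p \<noteq> 0" for s :: real and p
 proof -
  have t: "c i - \<delta> \<le> co n p i" "co n p i \<le> c i + \<delta>" and nz: "f (shift n i p s) \<noteq> 0"
   using that(2) by (auto simp: F_def T_def indicator_def split: if_splits)
  have "shift n i p s \<in> ?X" using nz that(1) by (intro supp) auto
  then have x: "\<forall>k\<le>2 * n. c k - \<delta> \<le> co n (shift n i p s) k \<and> co n (shift n i p s) k \<le> c k + \<delta>"
   by (simp add: box_def)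
  have "c k - \<delta> \<le> co n p k \<and> co n p k \<le> c k + \<delta>" if "k \<le> 2 * n" for k
   using x[rule_format, OF that] t i that by (cases "k = i") (auto simp: co_shift)
  moreover have "s \<in> {-(2 * \<delta>)..2 * \<delta>}"
   using x[rule_format, OF i] t i by (auto simp: co_shift)
  ultimately show ?thesis using that by (simp add: box_def)
 qed
 \<comment> \<open>\<open>hinv n undefined\<close> is just some point of
   \<open>hspace n\<close>.\<close>
 have A: "0 \<le> A" using order_trans[OF norm_ge_zero bnd[of "hinv n undefined"]] by simp
 have "integrable (lborel \<Otimes>\<^sub>M ?M) (case_prod F)"
 proof (rule integrableI_bounded_set[where A = "{-(2 * \<delta>)..2 * \<delta>} \<times> ?X" and B = A])
  show "{-(2 * \<delta>)..2 * \<delta>} \<times> ?X \<in> sets (lborel \<Otimes>\<^sub>M ?M)" by measurable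
  show "emeasure (lborel \<Otimes>\<^sub>M ?M) ({-(2 * \<delta>)..2 * \<delta>} \<times> ?X) < \<infinity>"
   using \<delta> by (subst hm.emeasure_pair_measure_Times) (auto simp: eX ennreal_mult_less_top)
  show "AE x in lborel \<Otimes>\<^sub>M ?M. x \<in> {-(2 * \<delta>)..2 * \<delta>} \<times> ?X --> norm (case_prod F x) \<le> A"
  proof (rule AE_I2, unfold split_paired_all, intro impI)
   fix s :: real and p assume "(s, p) \<in> space (lborel \<Otimes>\<^sub>M ?M)"
   then have p: "p \<in> hspace n" by (simp add: space_pair_measure space_hmeasure)
   then have "cmod (f (shift n i p s)) \<le> A" by (intro bnd) auto
   then show "norm (case_prod F (s, p)) \<le> A" using A by (auto simp: F_def T_def indicator_def)
  qed
  show "AE x in lborel \<Otimes>\<^sub>M ?M. x \<notin> {-(2 * \<delta>)..2 * \<delta>} \<times> ?X --> case_prod F x = 0"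
   using Fsupp by (intro AE_I2) (auto simp: space_pair_measure space_hmeasure)
 qed measurable
 note int = this
 have e: "(\<integral>p. \<integral>s. F s p \<partial>lborel \<partial>?M) = (\<integral>s. \<integral>p. F s p \<partial>?M \<partial>lborel)"
  using LM.Fubini_integral[OF int] .
 have "(\<integral>s. \<integral>p. F s p \<partial>?M \<partial>lborel) = (\<integral>s. \<integral>p. T (shift n i p (- s)) *\<^sub>R f p \<partial>?M \<partial>lborel)"
 proof (rule Bochner_Integration.integral_cong[OF refl])
  fix s :: real
  have "(\<integral>p. T (shift n i p (- s)) *\<^sub>R f p \<partial>?M) =
   (\<integral>p. T (shift n i (shift n i p s) (- s)) *\<^sub>R f (shift n i p s) \<partial>?M)"
   by (subst integral_scales[OF scales_shift[of n i s]]) auto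
  also have "\<dots> = (\<integral>p. F s p \<partial>?M)"
   using i by (intro Bochner_Integration.integral_cong refl) (simp add: F_def T_def co_shift)
  finally show "(\<integral>p. F s p \<partial>?M) = (\<integral>p. T (shift n i p (- s)) *\<^sub>R f p \<partial>?M)" by simp
 qed
 also have "\<dots> = (\<integral>p. \<integral>s. T (shift n i p (- s)) *\<^sub>R f p \<partial>lborel \<partial>?M)"
 proof (rule LM.Fubini_integral[symmetric])
  show "integrable (lborel \<Otimes>\<^sub>M ?M) (%(s, p). T (shift n i p (- s)) *\<^sub>R f p)"
  proof (rule integrableI_bounded_set[where A = "{-(2 * \<delta>)..2 * \<delta>} \<times> ?X" and B = A])
   show "{-(2 * \<delta>)..2 * \<delta>} \<times> ?X \<in> sets (lborel \<Otimes>\<^sub>M ?M)" by measurable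
   show "emeasure (lborel \<Otimes>\<^sub>M ?M) ({-(2 * \<delta>)..2 * \<delta>} \<times> ?X) < \<infinity>"
    using \<delta> by (subst hm.emeasure_pair_measure_Times) (auto simp: eX ennreal_mult_less_top)
   show "AE x in lborel \<Otimes>\<^sub>M ?M. x \<in> {-(2 * \<delta>)..2 * \<delta>} \<times> ?X -->
     norm (case x of (s, p) => T (shift n i p (- s)) *\<^sub>R f p) \<le> A"
    using bnd A by (intro AE_I2) (auto simp: T_def indicator_def space_pair_measure space_hmeasure)
   show "AE x in lborel \<Otimes>\<^sub>M ?M. x \<notin> {-(2 * \<delta>)..2 * \<delta>} \<times> ?X -->
     (case x of (s, p) => T (shift n i p (- s)) *\<^sub>R f p) = 0"
   proof (rule AE_I2, unfold split_paired_all, intro impI)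
    fix s :: real and p assume sp: "(s, p) \<in> space (lborel \<Otimes>\<^sub>M ?M)" and nX: "(s, p) \<notin> {-(2 * \<delta>)..2 * \<delta>} \<times> ?X"
    then have p: "p \<in> hspace n" by (simp add: space_pair_measure space_hmeasure)
    show "(case (s, p) of (s, p) => T (shift n i p (- s)) *\<^sub>R f p) = 0"
    proof (rule ccontr)
     assume "(case (s, p) of (s, p) => T (shift n i p (- s)) *\<^sub>R f p) \<noteq> 0"
     then have nz: "T (shift n i p (- s)) *\<^sub>R f p \<noteq> 0" by simp
     then have "p \<in> ?X" using p by (intro supp) auto
     moreover have "c i - \<delta> \<le> co n p i - s" "co n p i - s \<le> c i + \<delta>"
      using nz i by (auto simp: T_def co_shift indicator_def split: if_splits)
     moreover have "c i - \<delta> \<le> co n p i \<and> co n p i \<le> c i + \<delta>"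
      using \<open>p \<in> ?X\<close> i by (simp add: box_def)
     ultimately show False using nX by auto
    qed
   qed
  qed measurable
 qed
 \<comment> \<open>For fixed \<open>p\<close> the admissible shifts form an interval of length
   \<open>2 * \<delta>\<close>.\<close>
 also have "\<dots> = (\<integral>p. (2 * \<delta>) *\<^sub>R f p \<partial>?M)"
 proof (intro Bochner_Integration.integral_cong refl)
  fix p
  have "(\<integral>s. T (shift n i p (- s)) \<partial>lborel) = (\<integral>s. indicator {co n p i - c i - \<delta>..co n p i - c i + \<delta>} s \<partial>lborel)"
   using i by (intro Bochner_Integration.integral_cong refl) (auto simp: T_def co_shift indicator_def)
  also have "\<dots> = 2 * \<delta>" using \<delta> by simp
  finally have 1: "(\<integral>s. T (shift n i p (- s)) \<partial>lborel) = 2 * \<delta>" .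
  then have "integrable lborel (%s. T (shift n i p (- s)))"
   using \<delta> not_integrable_integral_eq by fastforce
  then show "(\<integral>s. T (shift n i p (- s)) *\<^sub>R f p \<partial>lborel) = (2 * \<delta>) *\<^sub>R f p"
   using 1 by (simp add: integral_scaleR_left)
 qed
 finally have "(\<integral>p. \<integral>s. F s p \<partial>lborel \<partial>?M) = (2 * \<delta>) *\<^sub>R (\<integral>p. f p \<partial>?M)"
  unfolding e by simp
 moreover have "cmod (\<integral>p. \<integral>s. F s p \<partial>lborel \<partial>?M) \<le> (\<integral>p. B * indicator ?X p \<partial>?M)"
 proof (rule integral_norm_le_integral)
  show "integrable ?M (%p. \<integral>s. F s p \<partial>lborel)"
   using LM.integrable_snd[OF int] by simp
  show "integrable ?M (%p. B * indicator ?X p)" using eX by auto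
  fix p assume "p \<in> space ?M"
  then have p: "p \<in> hspace n" by (simp add: space_hmeasure)
  show "norm (\<integral>s. F s p \<partial>lborel) \<le> B * indicator ?X p"
  proof (cases "p \<in> ?X")
   case True
   then have "T p = 1" using i by (auto simp: T_def box_def)
   then show ?thesis using B[OF True] True by (simp add: F_def)
  next
   case False
   then have "F s p = 0" for s using Fsupp[OF p] by blast
   then show ?thesis using False by simp
  qed
 qed
 ultimately have "2 * \<delta> * cmod (\<integral>p. f p \<partial>?M) \<le> B * (2 * \<delta>) ^ (2 * n + 1)"
  using \<delta> by (simp add: mX)
 also have "\<dots> = 2 * \<delta> * ((2 * \<delta>) ^ (2 * n) * B)" by (simp add: mult_ac)
 finally show ?thesis using \<delta> by (simp add: mult_le_cancel_left_pos)
qed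

text \<open>The normal form required by \<open>nonstationary_phase\<close>: \<omega> carries the
  size of the frequency, and \<open>u\<close> is the normalised derivative of the phase, bounded
  below by \<kappa>.\<close>

definition phase_form :: "nat => real => real => real => real => real => (real => complex) => bool" where
 "phase_form m r K L \<kappa> \<omega> f \<longleftrightarrow> (\<exists>A \<Phi> u. bd m {-r<..<r} K A \<and> bd m {-r<..<r} L u \<and>
   (\<forall>s\<in>{-r<..<r}. \<kappa> \<le> \<bar>u s\<bar> \<and> (\<Phi> has_real_derivative \<omega> * u s) (at s) \<and>
    f s = of_real (A s) * exp (\<i> * of_real (\<Phi> s))))"

text \<open>One constant for all functions, centres, directions and frequencies. The bound
  \<open>A0\<close> only ensures integrability and does not enter the estimate.\<close>

definition osc_bound :: "nat => nat => real => real => real => real => real => bool" where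
 "osc_bound n m \<delta> K L \<kappa> C \<longleftrightarrow> (\<forall>f c i \<omega> A0. f \<in> borel_measurable (hmeasure n) --> i \<le> 2 * n --> 0 < \<omega> -->
   (\<forall>p\<in>hspace n. cmod (f p) \<le> A0) --> (\<forall>p\<in>hspace n. f p \<noteq> 0 --> p \<in> cube n c \<delta>) -->
   (\<forall>p\<in>cube n c \<delta>. phase_form m (6 * \<delta>) K L \<kappa> \<omega> (%s. f (shift n i p s))) -->
   cmod (\<integral>p. f p \<partial>hmeasure n) \<le> C / \<omega> ^ m)"

lemmas osc_boundD = osc_bound_def[THEN iffD1, rule_format]

lemma oscillatory_integral_bound:
 assumes "0 < \<kappa>" "0 < \<delta>" "0 \<le> L" "0 \<le> K"
 shows "\<exists>C\<ge>0. osc_bound n m \<delta> K L \<kappa> C"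
proof -
 let ?I = "{-(6 * \<delta>)<..<6 * \<delta>}"
 \<comment> \<open>Two points of the cube on one line are at most \<open>2 * \<delta>\<close> apart,
   so the one-dimensional lemma is used with \<open>r = 2 * \<delta>\<close>; hence the radius
   \<open>6 * \<delta>\<close> for the lines.\<close>
 have I: "{-3 * (2 * \<delta>)<..<3 * (2 * \<delta>)} = ?I" "{-2 * (2 * \<delta>)..2 * (2 * \<delta>)} = {-(4 * \<delta>)..4 * \<delta>}" by auto
 obtain C where C: "0 \<le> C" "\<And>A \<Phi> u \<omega>. bd m ?I K A ==> bd m ?I L u ==> (\<forall>s\<in>?I. \<kappa> \<le> \<bar>u s\<bar>) ==>
  (\<forall>s\<in>?I. (\<Phi> has_real_derivative \<omega> * u s) (at s)) ==>
  (\<forall>s\<in>?I. 2 * \<delta> < \<bar>s\<bar> --> A s = 0) ==> 0 < \<omega> ==>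
  cmod (integral {-(4 * \<delta>)..4 * \<delta>} (%s. of_real (A s) * exp (\<i> * of_real (\<Phi> s)))) \<le> C / \<omega> ^ m"
  using nonstationary_phase[of \<kappa> "2 * \<delta>" L K m] assms unfolding I by auto
 show ?thesis
  unfolding osc_bound_def phase_form_def
 proof (intro exI[of _ "(2 * \<delta>) ^ (2 * n) * C"] conjI allI impI)
  fix f c i \<omega> A0
  assume f[measurable]: "f \<in> borel_measurable (hmeasure n)" and i: "i \<le> 2 * n" and \<omega>: "0 < \<omega>"
   and bnd: "\<forall>p\<in>hspace n. cmod (f p) \<le> A0"
   and supp: "\<forall>p\<in>hspace n. f p \<noteq> 0 --> p \<in> cube n c \<delta>"
   and line: "\<forall>p\<in>cube n c \<delta>. \<exists>A \<Phi> u. bd m ?I K A \<and> bd m ?I L u \<and>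
    (\<forall>s\<in>?I. \<kappa> \<le> \<bar>u s\<bar> \<and> (\<Phi> has_real_derivative \<omega> * u s) (at s) \<and>
     f (shift n i p s) = of_real (A s) * exp (\<i> * of_real (\<Phi> s)))"
  have "cmod (\<integral>p. f p \<partial>hmeasure n) \<le> (2 * \<delta>) ^ (2 * n) * (C / \<omega> ^ m)"
  proof (rule line_average[OF f assms(2) i bspec[OF bnd] supp[rule_format]])
   fix p assume p: "p \<in> cube n c \<delta>"
   then have ph: "p \<in> hspace n" and pi: "c i - \<delta> \<le> co n p i" "co n p i \<le> c i + \<delta>" using i by (auto simp: box_def)
   obtain A \<Phi> u where *: "bd m ?I K A" "bd m ?I L u" "\<forall>s\<in>?I. \<kappa> \<le> \<bar>u s\<bar>"
    "\<forall>s\<in>?I. (\<Phi> has_real_derivative \<omega> * u s) (at s)"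
    and eq: "\<And>s. s \<in> ?I ==> f (shift n i p s) = of_real (A s) * exp (\<i> * of_real (\<Phi> s))"
    using line p by blast
   have z: "f (shift n i p s) = 0" if "2 * \<delta> < \<bar>s\<bar>" for s
   proof (rule ccontr)
    assume "f (shift n i p s) \<noteq> 0"
    then have "shift n i p s \<in> cube n c \<delta>" using supp ph by auto
    then have "c i - \<delta> \<le> co n p i + s" "co n p i + s \<le> c i + \<delta>"
     using i by (auto simp: box_def co_shift)
    with pi that show False by linarith
   qed
   have "\<forall>s\<in>?I. 2 * \<delta> < \<bar>s\<bar> --> A s = 0" using z eq by fastforce
   note C(2)[OF * this \<omega>]
   also have "integral {-(4 * \<delta>)..4 * \<delta>} (%s. of_real (A s) * exp (\<i> * of_real (\<Phi> s))) =
     integral {-(4 * \<delta>)..4 * \<delta>} (%s. f (shift n i p s))"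
    using assms(2) by (intro Henstock_Kurzweil_Integration.integral_cong) (auto simp: eq)
   also have "\<dots> = (LINT s:{-(4 * \<delta>)..4 * \<delta>}|lborel. f (shift n i p s))"
   proof (rule set_borel_integral_eq_integral(2)[symmetric])
    have [measurable]: "p \<in> space (hmeasure n)" using ph by (simp add: space_hmeasure)
    have "(%s. f (shift n i p s)) \<in> borel_measurable lborel" by measurable
    then show "set_integrable lborel {-(4 * \<delta>)..4 * \<delta>} (%s. f (shift n i p s))"
     unfolding set_integrable_def
     using bnd ph by (intro integrableI_bounded_set[where A = "{-(4 * \<delta>)..4 * \<delta>}" and B = A0])
      (use assms(2) in \<open>auto simp: indicator_def\<close>)
   qed
   also have "\<dots> = (\<integral>s. f (shift n i p s) \<partial>lborel)"
    unfolding set_lebesgue_integral_def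
    by (intro Bochner_Integration.integral_cong) (use z assms(2) in \<open>auto simp: indicator_def\<close>)
   finally show "cmod (\<integral>s. f (shift n i p s) \<partial>lborel) \<le> C / \<omega> ^ m" .
  qed
  then show "cmod (\<integral>p. f p \<partial>hmeasure n) \<le> (2 * \<delta>) ^ (2 * n) * C / \<omega> ^ m" by simp
 qed (use C assms in auto)
qed

section \<open>Bounds for phase and amplitude along curves\<close>

context heis
begin

abbreviation M where "M \<equiv> hmeasure n"

definition pbd :: "nat => real set => real => (real => nat => real) => bool" where
 "pbd m I K y \<longleftrightarrow> (\<forall>k\<le>2 * n. bd m I K (%s. y s k))"

lemma bd_square:
 assumes "0 \<le> K" "bd m I K f"
 shows "bd m I (2 ^ m * K * K) (%s. (f s)\<^sup>2)"
 using bd_mult[OF assms(1,1,2,2)] by (simp add: power2_eq_square)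

lemma bd_N0:
 assumes "0 \<le> K"
 shows "\<exists>C\<ge>0. \<forall>y I. pbd m I K y --> bd m I C (%s. N0 (y s))"
proof -
 let ?S = "\<Sum>k<2 * n. 2 ^ m * K * K"
 let ?C = "\<bar>b ^ 4\<bar> * (2 ^ m * ?S * ?S) + \<bar>b\<^sup>2\<bar> * (2 ^ m * K * K)"
 have S: "0 \<le> ?S" using assms by (intro sum_nonneg) auto
 show ?thesis
 proof (intro exI[of _ ?C] conjI allI impI)
  show "0 \<le> ?C" using S assms by (intro add_nonneg_nonneg mult_nonneg_nonneg) auto
  fix y I assume y: "pbd m I K y"
  have "bd m I ?S (%s. sq (y s))"
   unfolding sq_def using y assms by (intro bd_sum bd_square) (auto simp: pbd_def)
  then show "bd m I ?C (%s. N0 (y s))"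
   unfolding N0_def using y assms S by (intro bd_add bd_cmult bd_square) (auto simp: pbd_def)
 qed
qed

lemma bd_N0_diff:
 assumes "0 \<le> K"
 shows "\<exists>C\<ge>0. \<forall>y z I E. 0 \<le> E --> pbd m I K y --> pbd m I K z --> pbd m I E (%s k. y s k - z s k) -->
  bd m I (C * E) (%s. N0 (y s) - N0 (z s))"
proof -
 let ?S = "\<Sum>k<2 * n. 2 ^ m * K * K"
 let ?D = "\<Sum>k<2 * n. 2 ^ m * (K + K)"
 let ?C = "\<bar>b ^ 4\<bar> * (2 ^ m * ?D * (?S + ?S)) + \<bar>b\<^sup>2\<bar> * (2 ^ m * (K + K))"
 have S: "0 \<le> ?S" "0 \<le> ?D" using assms by (auto intro!: sum_nonneg)
 show ?thesis
 proof (intro exI[of _ ?C] conjI allI impI)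
  show "0 \<le> ?C" using S assms by (intro add_nonneg_nonneg mult_nonneg_nonneg) auto
  fix y z I E assume E: "0 \<le> E" and y: "pbd m I K y" and z: "pbd m I K z"
   and yz: "pbd m I E (%s k. y s k - z s k)"
  have sq: "bd m I ?S (%s. sq (y s))" if "pbd m I K y" for y
   unfolding sq_def using that assms by (intro bd_sum bd_square) (auto simp: pbd_def)
  have c: "bd m I (2 ^ m * E * (K + K)) (%s. (y s k - z s k) * (y s k + z s k))" if "k \<le> 2 * n" for k
   using that y z yz assms E by (intro bd_mult bd_add) (auto simp: pbd_def)
  have "bd m I (\<Sum>k<2 * n. 2 ^ m * E * (K + K)) (%s. \<Sum>k<2 * n. (y s k - z s k) * (y s k + z s k))"
   by (intro bd_sum c) auto
  then have d: "bd m I (E * ?D) (%s. sq (y s) - sq (z s))"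
   by (simp add: sq_def sum_subtractf[symmetric] power2_eq_square algebra_simps)
  have "bd m I (\<bar>b ^ 4\<bar> * (2 ^ m * (E * ?D) * (?S + ?S)) + \<bar>b\<^sup>2\<bar> * (2 ^ m * E * (K + K)))
   (%s. b ^ 4 * ((sq (y s) - sq (z s)) * (sq (y s) + sq (z s))) + b\<^sup>2 * ((y s (2 * n) - z s (2 * n)) * (y s (2 * n) + z s (2 * n))))"
   using S E assms by (intro bd_add bd_cmult bd_mult d sq y z c) (auto intro!: mult_nonneg_nonneg)
  also have "(%s. b ^ 4 * ((sq (y s) - sq (z s)) * (sq (y s) + sq (z s))) + b\<^sup>2 * ((y s (2 * n) - z s (2 * n)) * (y s (2 * n) + z s (2 * n))))
   = (%s. N0 (y s) - N0 (z s))"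
   by (simp add: N0_def power2_eq_square algebra_simps)
  also have "\<bar>b ^ 4\<bar> * (2 ^ m * (E * ?D) * (?S + ?S)) + \<bar>b\<^sup>2\<bar> * (2 ^ m * E * (K + K)) = ?C * E"
   by (simp only: distrib_right distrib_left mult_ac)
  finally show "bd m I (?C * E) (%s. N0 (y s) - N0 (z s))" .
 qed
qed

text \<open>The curve estimate of order 0 applied to constant curves.\<close>

lemma N0_lipschitz:
 assumes "0 \<le> K"
 shows "\<exists>C\<ge>0. \<forall>y z \<eta>. 0 \<le> \<eta> --> (\<forall>k\<le>2 * n. \<bar>y k\<bar> \<le> K \<and> \<bar>z k\<bar> \<le> K) --> near \<eta> y z --> \<bar>N0 y - N0 z\<bar> \<le> C * \<eta>"
proof -
 obtain C where C: "0 \<le> C" "\<And>y z I E. 0 \<le> E ==> pbd 0 I K y ==> pbd 0 I K z ==> pbd 0 I E (%s k. y s k - z s k) ==>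
  bd 0 I (C * E) (%s. N0 (y s) - N0 (z s))" using bd_N0_diff[OF assms, of 0] by blast
 show ?thesis
 proof (intro exI[of _ C] conjI allI impI)
  fix y z :: "nat => real" and \<eta> :: real
  assume "0 \<le> \<eta>" "\<forall>k\<le>2 * n. \<bar>y k\<bar> \<le> K \<and> \<bar>z k\<bar> \<le> K" "near \<eta> y z"
  then show "\<bar>N0 y - N0 z\<bar> \<le> C * \<eta>"
   using C(2)[of \<eta> "{0}" "%_. y" "%_. z"] by (simp add: pbd_def near_def)
 qed (rule C)
qed

lemma bd_F0:
 assumes "0 \<le> K" "0 < c" "c < d"
 shows "\<exists>C\<ge>0. \<forall>y I. pbd m I K y --> (\<forall>s\<in>I. N0 (y s) \<in> {c<..<d}) --> bd m I C (%s. F0 (y s))"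
proof -
 obtain C where C: "0 \<le> C" "\<And>y I. pbd m I K y ==> bd m I C (%s. N0 (y s))" using bd_N0[OF assms(1), of m] by blast
 obtain H where H: "0 \<le> H" "bd m {c<..<d} H (%u. u powr (- \<beta> / 4))" using bd_powr[OF assms(2,3)] by blast
 obtain D where D: "0 \<le> D" "\<And>h f I J. bd m J H h ==> bd m I C f ==> f ` I \<subseteq> J ==> bd m I D (%s. h (f s))"
  using bd_comp[OF H(1) C(1), of m] by blast
 show ?thesis
 proof (intro exI[of _ D] conjI allI impI)
  fix y I assume "pbd m I K y" "\<forall>s\<in>I. N0 (y s) \<in> {c<..<d}"
  then show "bd m I D (%s. F0 (y s))" unfolding F0_def by (intro D(2)[OF H(2) C(2)]) auto
 qed (rule D)
qed

lemma bd_F0_diff: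
 assumes "0 \<le> K" "0 < c" "c < d"
 shows "\<exists>C\<ge>0. \<forall>y z I E. 0 \<le> E --> open I --> pbd m I K y --> pbd m I K z --> pbd m I E (%s k. y s k - z s k) -->
  (\<forall>s\<in>I. N0 (y s) \<in> {c<..<d} \<and> N0 (z s) \<in> {c<..<d}) --> bd m I (C * E) (%s. F0 (y s) - F0 (z s))"
proof -
 obtain C where C: "0 \<le> C" "\<And>y I. pbd m I K y ==> bd m I C (%s. N0 (y s))" using bd_N0[OF assms(1), of m] by blast
 obtain C' where C': "0 \<le> C'" "\<And>y z I E. 0 \<le> E ==> pbd m I K y ==> pbd m I K z ==> pbd m I E (%s k. y s k - z s k) ==>
  bd m I (C' * E) (%s. N0 (y s) - N0 (z s))" using bd_N0_diff[OF assms(1), of m] by blast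
 obtain H where H: "0 \<le> H" "bd (Suc m) {c<..<d} H (%u. u powr (- \<beta> / 4))" using bd_powr[OF assms(2,3)] by blast
 obtain D where D: "0 \<le> D" "\<And>g p q I a b E. 0 \<le> E ==> open I ==> bd (Suc m) {a<..<b} H g ==> bd m I C p ==> bd m I C q ==>
  p ` I \<subseteq> {a<..<b} ==> q ` I \<subseteq> {a<..<b} ==> bd m I E (%s. p s - q s) ==>
  bd m I (D * E) (%s. g (p s) - g (q s))" using bd_comp_diff[OF H(1) C(1), of m] by blast
 show ?thesis
 proof (intro exI[of _ "D * C'"] conjI allI impI)
  fix y z I E
  assume "0 \<le> E" "open I" "pbd m I K y" "pbd m I K z" "pbd m I E (%s k. y s k - z s k)"
   "\<forall>s\<in>I. N0 (y s) \<in> {c<..<d} \<and> N0 (z s) \<in> {c<..<d}"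
  then have "bd m I (D * (C' * E)) (%s. F0 (y s) - F0 (z s))"
   unfolding F0_def using C' by (intro D(2)[OF _ _ H(2)] C C'(2)) auto
  then show "bd m I (D * C' * E) (%s. F0 (y s) - F0 (z s))" by (simp add: mult.assoc)
 qed (use C' D in auto)
qed

definition cutoffs :: "nat => real => real => (nat => real) => (nat => real => real) => bool" where
 "cutoffs m X \<delta> c g \<longleftrightarrow> (\<forall>k\<le>2 * n. bd m UNIV X (g k) \<and> (\<forall>x. g k x \<noteq> 0 --> \<bar>x - c k\<bar> \<le> \<delta>))"

text \<open>The argument is \<open>N0\<close>, the fourth power of \<rho>, so 1/16 and 16 correspond
  to the endpoints 1/2 and 2 of the support of the dyadic partition.\<close>

definition shellf :: "nat => real => (real => real) => bool" where
 "shellf m H h \<longleftrightarrow> bd m UNIV H h \<and> (\<forall>u. h u \<noteq> 0 --> 1 / 16 \<le> u \<and> u \<le> 16)"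

definition amp :: "(nat => real => real) => (real => real) => (nat => real) => real" where
 "amp g h y = (\<Prod>k\<le>2 * n. g k (y k)) * h (N0 y)"

lemma amp_nz:
 assumes "cutoffs m X \<delta> c g" "shellf m H h" "amp g h y \<noteq> 0"
 shows "near \<delta> y c" "1 / 16 \<le> N0 y" "N0 y \<le> 16"
 using assms by (auto simp: amp_def cutoffs_def shellf_def near_def)

lemma amp_bound:
 assumes "cutoffs m X \<delta> c g" "shellf m H h" "0 \<le> X" "0 \<le> H"
 shows "\<bar>amp g h y\<bar> \<le> X ^ (2 * n + 1) * H"
proof -
 have "\<bar>\<Prod>k\<le>2 * n. g k (y k)\<bar> \<le> (\<Prod>k\<le>2 * n. X)"
  unfolding abs_prod using assms(1) by (intro prod_mono) (auto simp: cutoffs_def dest: bd_bound)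
 moreover have "\<bar>h (N0 y)\<bar> \<le> H" using assms(2) by (auto simp: shellf_def dest: bd_bound)
 ultimately show ?thesis unfolding amp_def abs_mult using assms(3,4) by (intro mult_mono) auto
qed

lemma bd_shellf:
 assumes "0 \<le> K" "0 \<le> H"
 shows "\<exists>C\<ge>0. \<forall>h y I. shellf m H h --> pbd m I K y --> bd m I C (%s. h (N0 (y s)))"
proof -
 obtain C where C: "0 \<le> C" "\<And>y I. pbd m I K y ==> bd m I C (%s. N0 (y s))" using bd_N0[OF assms(1), of m] by blast
 obtain D where D: "0 \<le> D" "\<And>h f I J. bd m J H h ==> bd m I C f ==> f ` I \<subseteq> J ==> bd m I D (%s. h (f s))"
  using bd_comp[OF assms(2) C(1), of m] by blast
 show ?thesis
 proof (intro exI[of _ D] conjI allI impI)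
  fix h y I assume "shellf m H h" "pbd m I K y"
  then show "bd m I D (%s. h (N0 (y s)))"
   unfolding shellf_def by (intro D(2)[of UNIV h I "%s. N0 (y s)"] C(2)) auto
 qed (rule D)
qed

lemma bd_amp:
 assumes "0 \<le> K" "0 \<le> X" "0 \<le> H"
 shows "\<exists>C\<ge>0. \<forall>g h \<delta> c y I. cutoffs m X \<delta> c g --> shellf m H h --> pbd m I K y --> bd m I C (%s. amp g h (y s))"
proof -
 obtain C where C: "0 \<le> C" "\<And>h y I. shellf m H h ==> pbd m I K y ==> bd m I C (%s. h (N0 (y s)))"
  using bd_shellf[OF assms(1,3), of m] by blast
 obtain D where D: "0 \<le> D" "\<And>h f I J. bd m J X h ==> bd m I K f ==> f ` I \<subseteq> J ==> bd m I D (%s. h (f s))"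
  using bd_comp[OF assms(2,1), of m] by blast
 let ?P = "(2 ^ m * max 1 D) ^ card {..2 * n}"
 show ?thesis
 proof (intro exI[of _ "2 ^ m * ?P * C"] conjI allI impI)
  fix g h \<delta> c y I
  assume g: "cutoffs m X \<delta> c g" and h: "shellf m H h" and y: "pbd m I K y"
  have "bd m I (max 1 D) (%s. g k (y s k))" if "k \<in> {..2 * n}" for k
  proof (rule bd_mono)
   show "bd m I D (%s. g k (y s k))"
    using that g y by (intro D(2)[of UNIV "g k" I "%s. y s k"]) (auto simp: cutoffs_def pbd_def)
  qed simp
  then have "bd m I ?P (%s. \<Prod>k\<le>2 * n. g k (y s k))" by (intro bd_prod) auto
  then show "bd m I (2 ^ m * ?P * C) (%s. amp g h (y s))"
   unfolding amp_def using C h y by (intro bd_mult) auto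
 qed (use C in auto)
qed

lemma N0_cong: "(\<And>k. k \<le> 2 * n ==> y k = z k) ==> N0 y = N0 z"
 unfolding N0_def sq_def by (auto intro!: arg_cong2[where f = "(+)"] sum.cong)

lemma amp_cong: "(\<And>k. k \<le> 2 * n ==> y k = z k) ==> amp g h y = amp g h z"
 unfolding amp_def using N0_cong[of y z] by auto

lemma F0_cong: "(\<And>k. k \<le> 2 * n ==> y k = z k) ==> F0 y = F0 z"
 unfolding F0_def using N0_cong[of y z] by auto

lemma co_hmult: "k \<le> 2 * n ==> co n (hmult n a w p) k = lmul (co n w) (co n p) k"
proof -
 have "symp n (fst w) (fst p) = symp n (co n w) (co n p)" by (intro symp_cong) (auto simp: co_def)
 then show "k \<le> 2 * n ==> co n (hmult n a w p) k = lmul (co n w) (co n p) k"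
  by (auto simp: hmult_eq lmul_def co_def)
qed

definition aff :: "(nat => real) => (nat => real) => real => nat => real" where
 "aff z v s k = z k + v k * s"

lemma co_shift_aff: "i \<le> 2 * n ==> k \<le> 2 * n ==> co n (shift n i p s) k = aff (co n p) (unitv i) s k"
 by (simp add: co_shift aff_def unitv_def)

lemma lmul_cong: "(\<And>k. k \<le> 2 * n ==> y k = z k) ==> k \<le> 2 * n ==> lmul w y k = lmul w z k"
 unfolding lmul_def using symp_cong[of n w w y z] by auto

lemma lmul_aff: "lmul w (aff z (unitv i) s) k = aff (lmul w z) (slope i w) s k"
proof -
 have "symp n w (aff z (unitv i) s) = symp n w z + s * symp n w (unitv i)"
  using symp_add_right[of n w z "%k. s * unitv i k"] by (simp add: aff_def[abs_def] symp_scale_right mult.commute)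
 then show ?thesis by (simp add: lmul_def aff_def slope_def algebra_simps)
qed

lemma pbd_aff:
 assumes "\<And>k. k \<le> 2 * n ==> \<bar>z k\<bar> + \<bar>v k\<bar> * r \<le> K" "\<And>k. k \<le> 2 * n ==> \<bar>v k\<bar> \<le> K" "I \<subseteq> {-r..r}"
 shows "pbd m I K (aff z v)"
 unfolding pbd_def aff_def
proof (intro allI impI bd_affine assms(2))
 fix k s assume k: "k \<le> 2 * n" and s: "s \<in> I"
 have "\<bar>z k + v k * s\<bar> \<le> \<bar>z k\<bar> + \<bar>v k\<bar> * \<bar>s\<bar>" by (metis abs_mult abs_triangle_ineq)
 also have "\<dots> \<le> \<bar>z k\<bar> + \<bar>v k\<bar> * r" using subsetD[OF assms(3) s] by (intro add_left_mono mult_left_mono) auto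
 finally show "\<bar>z k + v k * s\<bar> \<le> K" using assms(1)[OF k] by simp
qed

text \<open>Where \<open>N0 y \<le> 16\<close> every coordinate is at most
  \<open>4 / \<bar>b\<bar>\<close>; the value 6 leaves a margin.\<close>

definition R0 :: real where
 "R0 = 6 / \<bar>b\<bar>"

lemma R0_pos: "0 < R0"
 using b_nz by (simp add: R0_def)

lemma abs_le_R0:
 assumes "N0 y \<le> 16" "k \<le> 2 * n"
 shows "\<bar>y k\<bar> \<le> R0"
proof -
 have 1: "(b\<^sup>2 * sq y)\<^sup>2 \<le> 16" "(b * y (2 * n))\<^sup>2 \<le> 16"
  using assms(1) N0_nonneg unfolding N0_def
  by (simp_all add: power_mult_distrib flip: power_mult) (smt (verit) zero_le_power2 mult_nonneg_nonneg zero_le_even_power even_numeral)+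
 have "\<bar>b * y k\<bar> \<le> 4"
 proof (cases "k = 2 * n")
  case True
  then show ?thesis using 1(2) abs_le_square_iff[of "b * y k" 4] by simp
 next
  case False
  then have "(y k)\<^sup>2 \<le> sq y" unfolding sq_def using assms(2) by (intro member_le_sum) auto
  then have "(b * y k)\<^sup>2 \<le> b\<^sup>2 * sq y" by (simp add: power_mult_distrib mult_left_mono)
  also have "\<dots> \<le> 4" using 1(1) abs_le_square_iff[of "b\<^sup>2 * sq y" 4] by simp
  finally have "(b * y k)\<^sup>2 \<le> 4\<^sup>2" by simp
  then show ?thesis using abs_le_square_iff[of "b * y k" 4] by simp
 qed
 then show ?thesis using b_nz by (simp add: R0_def field_simps abs_mult)
qed

lemma measurable_amp:
 assumes g: "cutoffs m X \<delta> c g" and h: "shellf m H h" and f[measurable]: "f \<in> measurable N M"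
 shows "(%x. amp g h (co n (f x))) \<in> borel_measurable N"
  and "(%x. F0 (co n (f x))) \<in> borel_measurable N" "(%x. N0 (co n (f x))) \<in> borel_measurable N"
proof -
 have gm: "g k \<in> borel_measurable borel" if "k \<le> 2 * n" for k
  using g that bd_continuous_on[of m UNIV X "g k"] by (auto simp: cutoffs_def intro: borel_measurable_continuous_onI)
 have hm[measurable]: "h \<in> borel_measurable borel"
  using h bd_continuous_on[of m UNIV H h] by (auto simp: shellf_def intro: borel_measurable_continuous_onI)
 have N[measurable]: "(%x. N0 (co n (f x))) \<in> borel_measurable N"
  unfolding N0_def sq_def by measurable
 then show "(%x. N0 (co n (f x))) \<in> borel_measurable N" .
 show "(%x. F0 (co n (f x))) \<in> borel_measurable N"
  unfolding F0_def by measurable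
 have "(%x. g k (co n (f x) k)) \<in> borel_measurable N" if "k \<le> 2 * n" for k
  by (rule measurable_compose[OF _ gm[OF that]]) measurable
 then show "(%x. amp g h (co n (f x))) \<in> borel_measurable N"
  unfolding amp_def by (intro borel_measurable_times borel_measurable_prod) auto
qed

lemma bd_phase_slope:
 assumes I: "open I" and \<nu>: "0 < \<nu>" and C: "bd (Suc m) I (C * \<nu>) \<Phi>"
  and d: "\<And>s. s \<in> I ==> (\<Phi> has_real_derivative D s) (at s)"
 shows "bd m I C (%s. D s / \<nu>)"
proof -
 have "bd m I (\<bar>1 / \<nu>\<bar> * (C * \<nu>)) (%s. (1 / \<nu>) * D s)"
  by (intro bd_cmult bd_deriv[OF I C d])
 then show ?thesis using \<nu> by simp
qed

lemma has_derivative_aff: "((%s. aff z v s k) has_real_derivative v k) (at s)"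
 unfolding aff_def by (auto intro!: derivative_eq_intros)

lemma abs_symp_unitv_le: "i \<le> 2 * n ==> \<bar>symp n w (unitv i)\<bar> \<le> nsize w"
proof -
 assume i: "i \<le> 2 * n"
 consider "i < n" | "n \<le> i" "i < 2 * n" | "i = 2 * n" using i by linarith
 then show ?thesis
 proof cases
  case 1
  then have "symp n w (unitv i) = (\<Sum>k<n. - w (n + k) * unitv i k)"
   unfolding symp_def by (intro sum.cong) (auto simp: unitv_def)
  also have "\<dots> = - w (n + i)" using 1 by (subst sum_unitv) auto
  finally show ?thesis using abs_le_nsize[of "n + i" w] 1 by simp
 next
  case 2
  then have "symp n w (unitv i) = (\<Sum>k<n. w k * unitv (i - n) k)"
   unfolding symp_def by (intro sum.cong) (auto simp: unitv_def)
  also have "\<dots> = w (i - n)" using 2 by (simp add: sum_unitv)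
  finally show ?thesis using abs_le_nsize[of "i - n" w] 2 by simp
 next
  case 3
  then show ?thesis using symp_unitv_top[of w] nsize_nonneg[of w] by simp
 qed
qed

section \<open>Kernel estimates\<close>

text \<open>The integrand of \<open>K * K~\<close> at the inverse of \<open>w\<close>, up to
  conjugation, for the localised kernel \<open>pkern\<close>; see \<open>conv_pkern\<close>.\<close>

definition pair_kernel :: "(nat => real => real) => (real => real) => real => hpoint => hpoint => complex" where
 "pair_kernel g h l w q = of_real (amp g h (co n (hmult n a w q)) * amp g h (co n q)) *
   exp (\<i> * of_real (l * (F0 (co n (hmult n a w q)) - F0 (co n q))))"

lemma lmul_near:
 assumes "near e y z" "\<And>k. k < 2 * n ==> \<bar>w k\<bar> \<le> W" "0 \<le> W" "k \<le> 2 * n"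
 shows "\<bar>lmul w y k - lmul w z k\<bar> \<le> e + 2 * \<bar>a\<bar> * (2 * real n * W * e)"
proof -
 have "symp n w y - symp n w z = symp n w (%k. y k - z k)"
  using symp_add_right[of n w "%k. y k - z k" z] by simp
 then have s: "\<bar>symp n w y - symp n w z\<bar> \<le> 2 * real n * W * e"
  using assms abs_symp_le[of n w W "%k. y k - z k" e] by (auto simp: near_def)
 have e: "\<bar>y k - z k\<bar> \<le> e" "0 \<le> e" using assms(1,4) by (auto simp: near_def intro: order_trans[OF abs_ge_zero])
 show ?thesis
 proof (cases "k = 2 * n")
  case True
  have "lmul w y k - lmul w z k = (y k - z k) - 2 * a * (symp n w y - symp n w z)"
   using True by (simp add: lmul_def algebra_simps)
  then have "\<bar>lmul w y k - lmul w z k\<bar> \<le> \<bar>y k - z k\<bar> + 2 * \<bar>a\<bar> * \<bar>symp n w y - symp n w z\<bar>"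
   by (metis abs_triangle_ineq4 abs_mult abs_numeral)
  also have "\<dots> \<le> e + 2 * \<bar>a\<bar> * (2 * real n * W * e)" using e s by (intro add_mono mult_left_mono) auto
  finally show ?thesis .
 next
  case False
  have "0 \<le> 2 * \<bar>a\<bar> * (2 * real n * W * e)" using assms(3) e by simp
  moreover have "lmul w y k - lmul w z k = y k - z k" using False by (simp add: lmul_def)
  ultimately show ?thesis using e by linarith
 qed
qed

lemma near_sym: "near e y z ==> near e z y"
 by (auto simp: near_def abs_minus_commute)

lemma near_trans: "near e x y ==> near d y z ==> near (e + d) x z"
 unfolding near_def
proof (intro allI impI)
 fix k assume "\<forall>k\<le>2 * n. \<bar>x k - y k\<bar> \<le> e" "\<forall>k\<le>2 * n. \<bar>y k - z k\<bar> \<le> d" "k \<le> 2 * n"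
 then have "\<bar>x k - y k\<bar> \<le> e" "\<bar>y k - z k\<bar> \<le> d" by auto
 then show "\<bar>x k - z k\<bar> \<le> e + d" by linarith
qed

lemma near_mono: "near e x y ==> e \<le> d ==> near d x y"
 by (auto simp: near_def intro: order_trans)

lemma near_aff: "\<bar>s\<bar> \<le> r ==> near r (aff z (unitv i) s) z"
 by (auto simp: near_def aff_def unitv_def)

lemma near_bound: "near e x y ==> (\<And>k. k \<le> 2 * n ==> \<bar>y k\<bar> \<le> R) ==> k \<le> 2 * n ==> \<bar>x k\<bar> \<le> R + e"
proof -
 assume "near e x y" "\<And>k. k \<le> 2 * n ==> \<bar>y k\<bar> \<le> R" and k: "k \<le> 2 * n"
 then have "\<bar>x k - y k\<bar> \<le> e" "\<bar>y k\<bar> \<le> R" by (auto simp: near_def)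
 then show ?thesis by linarith
qed

lemma slope_bound: "i \<le> 2 * n ==> \<bar>slope i w k\<bar> \<le> 1 + 2 * \<bar>a\<bar> * nsize w"
proof -
 assume "i \<le> 2 * n"
 then have "2 * \<bar>a\<bar> * \<bar>symp n w (unitv i)\<bar> \<le> 2 * \<bar>a\<bar> * nsize w"
  by (intro mult_left_mono abs_symp_unitv_le) auto
 moreover have "\<bar>unitv i k\<bar> \<le> 1" by (simp add: unitv_def)
 moreover have "\<bar>slope i w k\<bar> \<le> \<bar>unitv i k\<bar> + 2 * \<bar>a\<bar> * \<bar>symp n w (unitv i)\<bar>"
  unfolding slope_def by (auto simp: abs_mult intro!: order_trans[OF abs_triangle_ineq4])
 ultimately show ?thesis by linarith
qed

lemma box_iff_near: "p \<in> cube n c \<delta> \<longleftrightarrow> p \<in> hspace n \<and> near \<delta> (co n p) c"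
proof -
 have "\<bar>x - d\<bar> \<le> \<delta> \<longleftrightarrow> d - \<delta> \<le> x \<and> x \<le> d + \<delta>" for x d by linarith
 then show ?thesis unfolding box_def near_def by simp
qed

section \<open>The diagonal estimate\<close>

definition diag_bound :: "nat => real => real => real => real => bool" where
 "diag_bound m X H \<delta> C \<longleftrightarrow> (\<forall>c g h l w. cutoffs m X \<delta> c g --> shellf m H h --> 0 < l --> w \<in> hspace n --> 0 < nsize (co n w) -->
    cmod (\<integral>q. pair_kernel g h l w q \<partial>M) \<le> C / (l * nsize (co n w)) ^ m)"

text \<open>Both amplitudes live in one cube of side O(\<delta>), so a nonzero integrand forces
  \<open>w\<close> to be small and \<open>mixed_gradient_lower_bound\<close> applies. The phase
  difference then has a derivative comparable to \<open>l * nsize w\<close> along one coordinate,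
  with controlled higher derivatives. The threshold for \<delta> precedes the other parameters since
  it depends on the geometry alone.\<close>

lemma diag_estimate:
 "\<exists>\<delta>0>0. \<delta>0 \<le> 1 \<and> (\<forall>\<delta> X H m. 0 < \<delta> --> \<delta> \<le> \<delta>0 --> 0 \<le> X --> 0 \<le> H -->
   (\<exists>C\<ge>0. diag_bound m X H \<delta> C))"
proof -
 \<comment> \<open>\<open>R1\<close> bounds the centre of the cube, \<open>C0 * \<delta>\<close> the
   translation \<open>w\<close>, \<open>S1\<close> the slopes, \<open>E1 * \<delta>\<close> the
   excursion of the translated line, and \<open>K\<close> all coordinates along both lines.\<close>
 define R1 where "R1 = R0 + 1"
 define C0 where "C0 = 4 * real n + 2 + 8 * \<bar>a\<bar> * real n * R1"
 define S1 where "S1 = 1 + 2 * \<bar>a\<bar> * C0"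
 define E1 where "E1 = 8 + 2 * \<bar>a\<bar> * (2 * real n * C0 * 8)"
 define K where "K = R1 + 10 + 10 * S1 + E1"
 have R1: "0 < R1" using R0_pos by (simp add: R1_def)
 have C0: "0 < C0" unfolding C0_def using R1 by (intro add_nonneg_pos add_pos_nonneg) auto
 have S1: "1 \<le> S1" unfolding S1_def using C0 by simp
 have E1: "8 \<le> E1" unfolding E1_def using C0 by simp
 have K: "0 \<le> K" using R1 S1 E1 by (simp add: K_def)
 have RK: "R0 \<le> K" "R1 \<le> K" using S1 E1 by (simp_all add: K_def R1_def)
 obtain CL where CL: "0 \<le> CL" "\<And>y z \<eta>. 0 \<le> \<eta> ==> (\<forall>k\<le>2 * n. \<bar>y k\<bar> \<le> K \<and> \<bar>z k\<bar> \<le> K) ==> near \<eta> y z ==> \<bar>N0 y - N0 z\<bar> \<le> CL * \<eta>"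
  using N0_lipschitz[OF K] by blast
 obtain \<kappa> \<delta>N where \<kappa>: "0 < \<kappa>" "0 < \<delta>N" "\<And>z0 w. (\<forall>k\<le>2 * n. \<bar>z0 k\<bar> \<le> R1) ==> 1 / 32 \<le> N0 z0 ==> 0 < nsize w ==> nsize w \<le> \<delta>N ==>
  (\<exists>i\<le>2 * n. \<forall>z. near \<delta>N z z0 --> \<kappa> * nsize w \<le> \<bar>LF (lmul w z) (slope i w) - LF z (unitv i)\<bar>)"
  using mixed_gradient_lower_bound[of "1 / 32" R1] by auto
 \<comment> \<open>The entries after 1 ensure in turn that \<open>w\<close> is small enough for the
   gradient bound, that a line of length \<open>6 * \<delta>\<close> from a point of the cube stays
   near the centre, and that \<open>N0\<close> varies by at most 1/32.\<close>
 define \<delta>0 where "\<delta>0 = Min {1, \<delta>N / C0, \<delta>N / 7, 1 / (32 * (CL + 1) * E1)}"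
 have \<delta>0: "0 < \<delta>0" "\<delta>0 \<le> 1" "\<delta>0 \<le> \<delta>N / C0" "\<delta>0 \<le> \<delta>N / 7" "\<delta>0 \<le> 1 / (32 * (CL + 1) * E1)"
 proof -
  show "0 < \<delta>0" using \<kappa> C0 CL(1) E1 by (auto simp: \<delta>0_def)
  show "\<delta>0 \<le> 1" "\<delta>0 \<le> \<delta>N / C0" "\<delta>0 \<le> \<delta>N / 7" "\<delta>0 \<le> 1 / (32 * (CL + 1) * E1)"
   unfolding \<delta>0_def by (rule Min_le; simp)+
 qed
 show ?thesis
 proof (rule exI[of _ \<delta>0], intro conjI \<delta>0(1,2) allI impI)
  fix \<delta> X H :: real and m :: nat
  assume \<delta>: "0 < \<delta>" "\<delta> \<le> \<delta>0" and X: "0 \<le> X" and H: "0 \<le> H"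
  have \<delta>1: "\<delta> \<le> 1" "C0 * \<delta> \<le> \<delta>N" "7 * \<delta> \<le> \<delta>N" "CL * (E1 * \<delta>) \<le> 1 / 32"
  proof -
   show "\<delta> \<le> 1" "7 * \<delta> \<le> \<delta>N" using \<delta>0 \<delta> by auto
   show "C0 * \<delta> \<le> \<delta>N" using order_trans[OF \<delta>(2) \<delta>0(3)] C0 by (simp add: field_simps)
   have "\<delta> * (32 * (CL + 1) * E1) \<le> 1"
   proof -
    have "0 < 32 * (CL + 1) * E1" using CL(1) E1 by (intro mult_pos_pos) auto
    then show ?thesis using order_trans[OF \<delta>(2) \<delta>0(5)] by (simp only: pos_le_divide_eq)
   qed
   moreover have "\<delta> * (32 * CL * E1) \<le> \<delta> * (32 * (CL + 1) * E1)"
    using \<delta> CL(1) E1 by (intro mult_left_mono mult_right_mono) auto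
   ultimately show "CL * (E1 * \<delta>) \<le> 1 / 32" by (simp add: mult_ac)
  qed
  let ?I = "{-(6 * \<delta>)<..<6 * \<delta>}"
  \<comment> \<open>\<open>nsize w * Ec\<close> will bound the difference of the two lines together
    with that of their slopes.\<close>
  define Ec where "Ec = 1 + 2 * \<bar>a\<bar> * (2 * real n * K) + 2 * \<bar>a\<bar> * 6 + 2 * \<bar>a\<bar>"
  have Ec: "0 \<le> Ec" unfolding Ec_def using K by (intro add_nonneg_nonneg mult_nonneg_nonneg) auto
  obtain CA where CA: "0 \<le> CA" "\<And>g h \<delta> c y I. cutoffs m X \<delta> c g ==> shellf m H h ==> pbd m I K y ==> bd m I CA (%s. amp g h (y s))"
   using bd_amp[OF K X H, of m] by blast
  obtain CF where CF: "0 \<le> CF" "\<And>y z I E. 0 \<le> E ==> open I ==> pbd (Suc m) I K y ==> pbd (Suc m) I K z ==>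
   pbd (Suc m) I E (%s k. y s k - z s k) ==>
   (\<forall>s\<in>I. N0 (y s) \<in> {1/64<..<32} \<and> N0 (z s) \<in> {1/64<..<32}) ==> bd (Suc m) I (CF * E) (%s. F0 (y s) - F0 (z s))"
   using bd_F0_diff[OF K, of "1/64" 32 "Suc m"] by auto
  have "0 \<le> CF * Ec" "0 \<le> 2 ^ m * CA * CA" using CF CA Ec by auto
  from oscillatory_integral_bound[OF \<kappa>(1) \<delta>(1) this, of n m] obtain C where C: "0 \<le> C" "osc_bound n m \<delta> (2 ^ m * CA * CA) (CF * Ec) \<kappa> C" by blast
  show "\<exists>C\<ge>0. diag_bound m X H \<delta> C"
   unfolding diag_bound_def
  proof (intro exI[of _ C] conjI C(1) allI impI)
   fix c g h w and l :: real
   assume g: "cutoffs m X \<delta> c g" and h: "shellf m H h" and l: "0 < l" and w: "w \<in> hspace n" and \<nu>: "0 < nsize (co n w)"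
   let ?W = "co n w"
   let ?\<nu> = "nsize ?W"
   show "cmod (\<integral>q. pair_kernel g h l w q \<partial>M) \<le> C / (l * ?\<nu>) ^ m"
   proof (cases "\<exists>q\<in>hspace n. pair_kernel g h l w q \<noteq> 0")
    case False
    then have "(\<integral>q. pair_kernel g h l w q \<partial>M) = (\<integral>q. 0 \<partial>M)"
     by (intro Bochner_Integration.integral_cong refl) (auto simp: space_hmeasure)
    then show ?thesis using C(1) l \<nu> by simp
   next
    case True
    \<comment> \<open>One point at which both amplitudes are nonzero anchors the argument: it makes
      \<open>w\<close> small and places the centre and both lines near the shell.\<close>
    then obtain z where z: "z \<in> hspace n" "amp g h (co n (hmult n a w z)) \<noteq> 0" "amp g h (co n z) \<noteq> 0"
     by (auto simp: pair_kernel_def)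
    let ?Z = "co n z"
    note z1 = amp_nz[OF g h z(2)] and z2 = amp_nz[OF g h z(3)]
    have zR: "\<bar>?Z k\<bar> \<le> R0" "\<bar>lmul ?W ?Z k\<bar> \<le> R0" if "k \<le> 2 * n" for k
     using abs_le_R0[OF z1(3) that] abs_le_R0[OF z2(3) that] that by (simp_all add: co_hmult)
    have cZ: "near (2 * \<delta>) (co n (hmult n a w z)) ?Z"
     using near_trans[OF z1(1) near_sym[OF z2(1)]] by simp
    have Wk: "\<bar>?W k\<bar> \<le> 2 * \<delta>" if "k < 2 * n" for k
     using cZ that by (auto simp: near_def co_hmult lmul_def split: if_splits dest!: spec[of _ k])
    have \<nu>C: "?\<nu> \<le> C0 * \<delta>"
    proof -
     have "\<bar>symp n ?W ?Z\<bar> \<le> 2 * real n * (2 * \<delta>) * R1"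
     proof (rule abs_symp_le)
      show "\<bar>?Z k\<bar> \<le> R1" if "k < 2 * n" for k using zR(1)[of k] that by (simp add: R1_def)
     qed (use Wk \<delta> in auto)
     then have "2 * \<bar>a\<bar> * \<bar>symp n ?W ?Z\<bar> \<le> 2 * \<bar>a\<bar> * (2 * real n * (2 * \<delta>) * R1)" by (intro mult_left_mono) auto
     moreover have "\<bar>?W (2 * n) - 2 * a * symp n ?W ?Z\<bar> \<le> 2 * \<delta>"
      using cZ by (auto simp: near_def co_hmult lmul_def dest!: spec[of _ "2 * n"])
     ultimately have t: "\<bar>?W (2 * n)\<bar> \<le> 2 * \<delta> + 2 * \<bar>a\<bar> * (2 * real n * (2 * \<delta>) * R1)"
     proof -
      assume 1: "2 * \<bar>a\<bar> * \<bar>symp n ?W ?Z\<bar> \<le> 2 * \<bar>a\<bar> * (2 * real n * (2 * \<delta>) * R1)"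
       and 2: "\<bar>?W (2 * n) - 2 * a * symp n ?W ?Z\<bar> \<le> 2 * \<delta>"
      have "\<bar>2 * a * symp n ?W ?Z\<bar> = 2 * \<bar>a\<bar> * \<bar>symp n ?W ?Z\<bar>" by (simp add: abs_mult)
      with 1 2 show ?thesis by linarith
     qed
     have "?\<nu> = (\<Sum>k<2 * n. \<bar>?W k\<bar>) + \<bar>?W (2 * n)\<bar>" by (simp add: nsize_def lessThan_Suc_atMost[symmetric])
     also have "\<dots> \<le> (\<Sum>k<2 * n. 2 * \<delta>) + (2 * \<delta> + 2 * \<bar>a\<bar> * (2 * real n * (2 * \<delta>) * R1))"
      using Wk t by (intro add_mono sum_mono) auto
     also have "\<dots> = C0 * \<delta>" by (simp add: C0_def algebra_simps)
     finally show ?thesis .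
    qed
    have \<nu>1: "?\<nu> \<le> C0" using \<nu>C mult_left_mono[OF \<delta>1(1) less_imp_le[OF C0]] by linarith
    have c1: "\<forall>k\<le>2 * n. \<bar>c k\<bar> \<le> R1"
    proof (intro allI impI)
     fix k assume k: "k \<le> 2 * n"
     have "\<bar>c k\<bar> \<le> R0 + \<delta>" by (rule near_bound[OF near_sym[OF z2(1)] zR(1) k])
     then show "\<bar>c k\<bar> \<le> R1" using \<delta>1(1) by (simp add: R1_def)
    qed
    have "\<bar>N0 c - N0 ?Z\<bar> \<le> CL * (E1 * \<delta>)"
    proof (rule CL(2))
     show "near (E1 * \<delta>) c ?Z"
      using mult_right_mono[of 1 E1 \<delta>] E1 \<delta>(1) by (intro near_mono[OF near_sym[OF z2(1)]]) simp
     show "\<forall>k\<le>2 * n. \<bar>c k\<bar> \<le> K \<and> \<bar>?Z k\<bar> \<le> K"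
      using order_trans[OF c1[rule_format] RK(2)] order_trans[OF zR(1) RK(1)] by blast
    qed (use E1 \<delta> in auto)
    then have c2: "1 / 32 \<le> N0 c" using z2(2) \<delta>1(4) by linarith
    from \<kappa>(3)[OF c1 c2 \<nu>] \<nu>C \<delta>1(2) obtain i where i: "i \<le> 2 * n"
     "\<And>z. near \<delta>N z c ==> \<kappa> * ?\<nu> \<le> \<bar>LF (lmul ?W z) (slope i ?W) - LF z (unitv i)\<bar>" by auto
    note am[measurable] = measurable_amp(1,2)[OF g h]
    show ?thesis
    proof (rule osc_boundD[OF C(2) _ i(1)])
     show "pair_kernel g h l w \<in> borel_measurable M"
     proof -
      have [measurable]: "w \<in> space M" using w by (simp add: space_hmeasure)
      show ?thesis unfolding pair_kernel_def[abs_def] by measurable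
     qed
     show "0 < l * ?\<nu>" using l \<nu> by simp
     show "cmod (pair_kernel g h l w p) \<le> (X ^ (2 * n + 1) * H) * (X ^ (2 * n + 1) * H)" for p
      unfolding pair_kernel_def norm_mult norm_exp_i_times norm_of_real abs_mult mult_1_right
      using amp_bound[OF g h X H] X H by (intro mult_mono) auto
     show "p \<in> cube n c \<delta>" if "p \<in> hspace n" "pair_kernel g h l w p \<noteq> 0" for p
      using that amp_nz(1)[OF g h, of "co n p"] by (auto simp: pair_kernel_def box_iff_near)
    next
     fix p assume p: "p \<in> cube n c \<delta>"
     let ?P = "co n p"
     define q where "q = aff ?P (unitv i)"
     define y where "y = aff (lmul ?W ?P) (slope i ?W)"
     have yq: "y s = lmul ?W (q s)" for s unfolding y_def q_def by (rule ext) (simp add: lmul_aff)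
     have pc: "near \<delta> ?P c" using p by (simp add: box_iff_near)
     have pz: "near (2 * \<delta>) ?P ?Z" using near_trans[OF pc near_sym[OF z2(1)]] by simp
     have qP: "near (6 * \<delta>) (q s) ?P" if "s \<in> ?I" for s
      unfolding q_def using that by (intro near_aff) auto
     have qz: "near (8 * \<delta>) (q s) ?Z" if "s \<in> ?I" for s
      using near_trans[OF qP[OF that] pz] by simp
     have qc: "near \<delta>N (q s) c" if "s \<in> ?I" for s
      using near_mono[OF near_trans[OF qP[OF that] pc]] \<delta>1(3) by simp
     have yz: "near (E1 * \<delta>) (y s) (lmul ?W ?Z)" if "s \<in> ?I" for s
      unfolding near_def yq
     proof (intro allI impI)
      fix k assume k: "k \<le> 2 * n"
      have "\<bar>lmul ?W (q s) k - lmul ?W ?Z k\<bar> \<le> 8 * \<delta> + 2 * \<bar>a\<bar> * (2 * real n * C0 * (8 * \<delta>))"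
      proof (rule lmul_near[OF qz[OF that] _ _ k])
       show "\<bar>?W k\<bar> \<le> C0" if "k < 2 * n" for k
        using order_trans[OF abs_le_nsize \<nu>1, of k] that by simp
      qed (use C0 in simp)
      also have "\<dots> = E1 * \<delta>" by (simp add: E1_def algebra_simps)
      finally show "\<bar>lmul ?W (q s) k - lmul ?W ?Z k\<bar> \<le> E1 * \<delta>" .
     qed
     have qK: "\<bar>q s k\<bar> \<le> K" if "s \<in> ?I" "k \<le> 2 * n" for s k
      using near_bound[OF qz[OF that(1)] zR(1) that(2)] \<delta>1(1) S1 E1 unfolding K_def R1_def by linarith
     have E1\<delta>: "E1 * \<delta> \<le> E1" "0 \<le> E1 * \<delta>" "8 * \<delta> \<le> E1 * \<delta>"
      using mult_left_mono[OF \<delta>1(1), of E1] E1 \<delta> by auto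
     have yK: "\<bar>y s k\<bar> \<le> K" if "s \<in> ?I" "k \<le> 2 * n" for s k
      using near_bound[OF yz[OF that(1)] zR(2) that(2)] E1\<delta> S1 E1 unfolding K_def R1_def by linarith
     \<comment> \<open>At the anchor \<open>N0\<close> is in \<open>[1/16, 16]\<close> and it varies
       by at most 1/32, so both lines avoid the singularity of the phase.\<close>
     have dom: "N0 (y s) \<in> {1/64<..<32} \<and> N0 (q s) \<in> {1/64<..<32}" if s: "s \<in> ?I" for s
     proof -
      have "\<bar>N0 (q s) - N0 ?Z\<bar> \<le> CL * (E1 * \<delta>)"
       using qK[OF s] order_trans[OF zR(1) RK(1)]
       by (intro CL(2) near_mono[OF qz[OF s] E1\<delta>(3)] E1\<delta>(2)) blast
      moreover have "\<bar>N0 (y s) - N0 (lmul ?W ?Z)\<bar> \<le> CL * (E1 * \<delta>)"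
       using yK[OF s] order_trans[OF zR(2) RK(1)]
       by (intro CL(2) yz[OF s] E1\<delta>(2)) blast
      moreover have "N0 (lmul ?W ?Z) = N0 (co n (hmult n a w z))" by (rule N0_cong) (simp add: co_hmult)
      ultimately have "1/64 < N0 (y s) \<and> N0 (y s) < 32" "1/64 < N0 (q s) \<and> N0 (q s) < 32"
       using z1(2,3) z2(2,3) \<delta>1(4) by linarith+
      then show ?thesis by simp
     qed
     have I: "?I \<subseteq> {-6..6}" using \<delta>1(1) by auto
     have pq: "pbd m' ?I K q" for m'
      unfolding q_def
     proof (rule pbd_aff[where r = 6])
      fix k assume k: "k \<le> 2 * n"
      have "\<bar>?P k\<bar> \<le> R0 + 2 * \<delta>" by (rule near_bound[OF pz zR(1) k])
      then show "\<bar>?P k\<bar> + \<bar>unitv i k\<bar> * 6 \<le> K" "\<bar>unitv i k\<bar> \<le> K"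
       using \<delta>1(1) S1 E1 R0_pos unfolding K_def R1_def by (auto simp: unitv_def)
     qed (rule I)
     have py: "pbd m' ?I K y" for m'
      unfolding y_def
     proof (rule pbd_aff[where r = 6])
      fix k assume k: "k \<le> 2 * n"
      have "lmul ?W ?P = y 0" by (simp add: y_def aff_def fun_eq_iff)
      then have "\<bar>lmul ?W ?P k\<bar> \<le> R0 + E1 * \<delta>"
       using near_bound[OF yz zR(2) k, of 0] \<delta>(1) by simp
      moreover have "\<bar>slope i ?W k\<bar> \<le> S1"
       using slope_bound[OF i(1), of ?W k] mult_left_mono[OF \<nu>1, of "2 * \<bar>a\<bar>"] unfolding S1_def by simp
      ultimately show "\<bar>lmul ?W ?P k\<bar> + \<bar>slope i ?W k\<bar> * 6 \<le> K" "\<bar>slope i ?W k\<bar> \<le> K"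
       using E1\<delta> S1 E1 R0_pos unfolding K_def R1_def by linarith+
     qed (rule I)
     have pyq: "pbd m' ?I (?\<nu> * Ec) (%s k. y s k - q s k)" for m'
     proof -
      have eq: "(%s k. y s k - q s k) = aff (%k. lmul ?W ?P k - ?P k) (%k. slope i ?W k - unitv i k)"
       by (simp add: y_def q_def aff_def fun_eq_iff algebra_simps)
      show ?thesis unfolding eq
      proof (rule pbd_aff[where r = 6])
       fix k assume k: "k \<le> 2 * n"
       have "\<bar>symp n ?W ?P\<bar> \<le> 2 * real n * ?\<nu> * K"
       proof (rule abs_symp_le)
        show "\<bar>?W k\<bar> \<le> ?\<nu>" if "k < 2 * n" for k using that by (intro abs_le_nsize) auto
        show "\<bar>?P k\<bar> \<le> K" if "k < 2 * n" for k
        proof -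
         have "\<bar>?P k\<bar> \<le> R0 + 2 * \<delta>" by (rule near_bound[OF pz zR(1)]) (use that in auto)
         then show ?thesis using \<delta>1(1) S1 E1 unfolding K_def R1_def by linarith
        qed
       qed (use \<nu> in auto)
       then have s1: "2 * \<bar>a\<bar> * \<bar>symp n ?W ?P\<bar> \<le> 2 * \<bar>a\<bar> * (2 * real n * ?\<nu> * K)" by (intro mult_left_mono) auto
       have s2: "2 * \<bar>a\<bar> * \<bar>symp n ?W (unitv i)\<bar> \<le> 2 * \<bar>a\<bar> * ?\<nu>"
        by (intro mult_left_mono abs_symp_unitv_le i) auto
       have "\<bar>lmul ?W ?P k - ?P k\<bar> \<le> \<bar>?W k\<bar> + 2 * \<bar>a\<bar> * \<bar>symp n ?W ?P\<bar>"
        by (auto simp: lmul_def abs_mult intro!: order_trans[OF abs_triangle_ineq4])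
       also have "\<dots> \<le> ?\<nu> + 2 * \<bar>a\<bar> * (2 * real n * ?\<nu> * K)"
        using abs_le_nsize[OF k, of ?W] s1 by linarith
       finally have b1: "\<bar>lmul ?W ?P k - ?P k\<bar> \<le> ?\<nu> + 2 * \<bar>a\<bar> * (2 * real n * ?\<nu> * K)" .
       have "\<bar>slope i ?W k - unitv i k\<bar> \<le> 2 * \<bar>a\<bar> * \<bar>symp n ?W (unitv i)\<bar>"
        by (simp add: slope_def abs_mult)
       then have b2: "\<bar>slope i ?W k - unitv i k\<bar> \<le> 2 * \<bar>a\<bar> * ?\<nu>" using s2 by linarith
       have nn: "0 \<le> 2 * \<bar>a\<bar> * (2 * real n * ?\<nu> * K)" "0 \<le> 2 * \<bar>a\<bar> * ?\<nu>" using \<nu> K by auto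
       have e: "?\<nu> * Ec = ?\<nu> + 2 * \<bar>a\<bar> * (2 * real n * ?\<nu> * K) + 2 * \<bar>a\<bar> * ?\<nu> * 6 + 2 * \<bar>a\<bar> * ?\<nu>"
        by (simp add: Ec_def algebra_simps)
       show "\<bar>lmul ?W ?P k - ?P k\<bar> + \<bar>slope i ?W k - unitv i k\<bar> * 6 \<le> ?\<nu> * Ec"
        "\<bar>slope i ?W k - unitv i k\<bar> \<le> ?\<nu> * Ec"
        unfolding e using b1 b2 nn \<nu> by linarith+
      qed (rule I)
     qed
     let ?D = "%s. LF (y s) (slope i ?W) - LF (q s) (unitv i)"
     let ?\<Phi> = "%s. F0 (y s) - F0 (q s)"
     have d: "(?\<Phi> has_real_derivative ?D s) (at s)" if "s \<in> ?I" for s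
     proof -
      have "0 < N0 (y s)" "0 < N0 (q s)" using dom[OF that] by auto
      then show ?thesis unfolding y_def q_def
       by (intro DERIV_diff has_derivative_F0 has_derivative_aff)
     qed
     \<comment> \<open>Order \<open>Suc m\<close>, so that the derivative of the phase still has
       \<open>m\<close> derivatives to spend.\<close>
     have bF: "bd (Suc m) ?I (CF * (?\<nu> * Ec)) ?\<Phi>"
      using \<nu> Ec dom by (intro CF(2) py pq pyq) auto
     show "phase_form m (6 * \<delta>) (2 ^ m * CA * CA) (CF * Ec) \<kappa> (l * ?\<nu>) (%s. pair_kernel g h l w (shift n i p s))"
      unfolding phase_form_def
     proof (rule exI[of _ "%s. amp g h (y s) * amp g h (q s)"], rule exI[of _ "%s. l * ?\<Phi> s"],
       rule exI[of _ "%s. ?D s / ?\<nu>"], intro conjI ballI)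
      show "bd m ?I (2 ^ m * CA * CA) (%s. amp g h (y s) * amp g h (q s))"
       by (intro bd_mult CA(1) CA(2)[OF g h] py pq)
      show "bd m ?I (CF * Ec) (%s. ?D s / ?\<nu>)"
       using bF by (intro bd_phase_slope[OF _ \<nu> _ d]) (auto simp: mult_ac)
      fix s assume s: "s \<in> ?I"
      have "\<kappa> * ?\<nu> \<le> \<bar>?D s\<bar>" using i(2)[OF qc[OF s]] by (simp add: yq)
      then show "\<kappa> \<le> \<bar>?D s / ?\<nu>\<bar>" using \<nu> by (simp add: field_simps)
      show "((%s. l * ?\<Phi> s) has_real_derivative (l * ?\<nu>) * (?D s / ?\<nu>)) (at s)"
       using DERIV_cmult[OF d[OF s], of l] \<nu> by simp
      have c1: "co n (shift n i p s) k = q s k" if "k \<le> 2 * n" for k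
       using i that by (simp add: q_def co_shift_aff)
      have c2: "co n (hmult n a w (shift n i p s)) k = y s k" if "k \<le> 2 * n" for k
       using that lmul_cong[of "co n (shift n i p s)" "q s" k ?W] c1 by (simp add: yq co_hmult)
      show "pair_kernel g h l w (shift n i p s) =
       of_real (amp g h (y s) * amp g h (q s)) * exp (\<i> * of_real (l * ?\<Phi> s))"
       unfolding pair_kernel_def
       by (simp add: amp_cong[OF c1] amp_cong[OF c2] F0_cong[OF c1] F0_cong[OF c2])
     qed
    qed
   qed
  qed
 qed
qed

section \<open>The interaction of a fast and a slow phase\<close>

definition dilv :: "real => (nat => real) => nat => real" where
 "dilv e y k = (if k < 2 * n then e else e\<^sup>2) * y k"

lemma co_dil_dilv: "k \<le> 2 * n ==> co n (dil n e p) k = dilv e (co n p) k"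
 by (simp add: co_dil dilv_def)

lemma dilv_aff: "dilv e (aff z v s) k = aff (dilv e z) (dilv e v) s k"
 by (simp add: dilv_def aff_def algebra_simps)

text \<open>The fast factor is rescaled to unit size and localised by \<open>g\<close>; the slow one
  appears at scale ratio \<open>e\<close> with frequency ratio \<mu>. Only the fast factor needs a
  partition of unity.\<close>

definition fs_kernel :: "(nat => real => real) => (real => real) => (real => real) => real => real => real => hpoint => hpoint => complex" where
 "fs_kernel g h h' l \<mu> e w q = of_real (amp g h (co n q) * h' (N0 (co n (dil n e (hmult n a w q))))) *
   exp (\<i> * of_real (l * (F0 (co n q) - \<mu> * F0 (co n (dil n e (hmult n a w q))))))"

lemma shellf_bound: "shellf m H h ==> \<bar>h u\<bar> \<le> H"
 by (auto simp: shellf_def dest: bd_bound)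

lemma shellf_measurable: "shellf m H h ==> h \<in> borel_measurable borel"
 using bd_continuous_on[of m UNIV H h] by (auto simp: shellf_def intro: borel_measurable_continuous_onI)

definition fs_bound :: "nat => real => real => real => real => real => bool" where
 "fs_bound m X H \<delta> \<mu>0 C \<longleftrightarrow> (\<forall>c g h h' l \<mu> e w. cutoffs m X \<delta> c g --> shellf m H h --> shellf m H h' --> 0 < l -->
    0 \<le> \<mu> --> \<mu> \<le> \<mu>0 --> 0 < e --> e \<le> 1 --> w \<in> hspace n -->
    cmod (\<integral>q. fs_kernel g h h' l \<mu> e w q \<partial>M) \<le> C / l ^ m)"

text \<open>The first-order bound on the gradient suffices here: for small \<mu> the slow phase
  cannot cancel the gradient of the fast one. The estimate is uniform in \<open>w\<close>, which may
  be arbitrarily large, so all bounds on the slow argument must come from points where its amplitude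
  is nonzero.\<close>

lemma fast_slow_estimate:
 "\<exists>\<delta>0>0. \<delta>0 \<le> 1 \<and> (\<exists>\<mu>0>0. \<forall>\<delta> X H m. 0 < \<delta> --> \<delta> \<le> \<delta>0 --> 0 \<le> X --> 0 \<le> H --> (\<exists>C\<ge>0. fs_bound m X H \<delta> \<mu>0 C))"
proof -
 define R1 where "R1 = R0 + 1"
 define S1 where "S1 = 1 + 8 * \<bar>a\<bar> * real n * R0"
 define K where "K = R0 + 20 * S1 + 20"
 have S1: "1 \<le> S1" unfolding S1_def using R0_pos by simp
 have K: "0 \<le> K" using R0_pos S1 by (simp add: K_def)
 have RK: "R0 \<le> K" "R1 \<le> K" using S1 by (simp_all add: K_def R1_def)
 obtain CL where CL: "0 \<le> CL" "\<And>y z \<eta>. 0 \<le> \<eta> ==> (\<forall>k\<le>2 * n. \<bar>y k\<bar> \<le> K \<and> \<bar>z k\<bar> \<le> K) ==> near \<eta> y z ==> \<bar>N0 y - N0 z\<bar> \<le> CL * \<eta>"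
  using N0_lipschitz[OF K] by blast
 obtain \<kappa> \<delta>N where \<kappa>: "0 < \<kappa>" "0 < \<delta>N" "\<And>z0. (\<forall>k\<le>2 * n. \<bar>z0 k\<bar> \<le> R1) ==> 1 / 32 \<le> N0 z0 ==>
  (\<exists>i\<le>2 * n. \<forall>z. near \<delta>N z z0 --> \<kappa> \<le> \<bar>LF z (unitv i)\<bar>)"
  using gradient_lower_bound[of "1 / 32" R1] by auto
 obtain C1 where C1: "0 \<le> C1" "\<And>y I. pbd (Suc 0) I K y ==> (\<forall>s\<in>I. N0 (y s) \<in> {1/64<..<32}) ==> bd (Suc 0) I C1 (%s. F0 (y s))"
  using bd_F0[OF K, of "1/64" 32 "Suc 0"] by auto
 define \<delta>0 where "\<delta>0 = Min {1, \<delta>N / 7, 1 / (32 * (CL + 1) * (12 * S1))}"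
 have \<delta>0: "0 < \<delta>0" "\<delta>0 \<le> 1" "\<delta>0 \<le> \<delta>N / 7" "\<delta>0 \<le> 1 / (32 * (CL + 1) * (12 * S1))"
 proof -
  show "0 < \<delta>0" using \<kappa> CL(1) S1 by (auto simp: \<delta>0_def)
  show "\<delta>0 \<le> 1" "\<delta>0 \<le> \<delta>N / 7" "\<delta>0 \<le> 1 / (32 * (CL + 1) * (12 * S1))"
   unfolding \<delta>0_def by (rule Min_le; simp)+
 qed
 \<comment> \<open>\<open>C1\<close> bounds the derivative of the slow phase along the line, so this
   choice leaves half of \<kappa>.\<close>
 define \<mu>0 where "\<mu>0 = min 1 (\<kappa> / (2 * (C1 + 1)))"
 have \<mu>0: "0 < \<mu>0" using \<kappa> C1(1) by (simp add: \<mu>0_def)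
 \<comment> \<open>The 1 accommodates lines on which the amplitude vanishes; they are given a linear
   phase with \<open>u = 1\<close>.\<close>
 define \<kappa>2 where "\<kappa>2 = min 1 (\<kappa> / 2)"
 have \<kappa>2: "0 < \<kappa>2" "\<kappa>2 \<le> 1" "\<kappa>2 \<le> \<kappa> / 2" using \<kappa> by (auto simp: \<kappa>2_def)
 have "\<forall>\<delta> X H m. 0 < \<delta> --> \<delta> \<le> \<delta>0 --> 0 \<le> X --> 0 \<le> H --> (\<exists>C\<ge>0. fs_bound m X H \<delta> \<mu>0 C)"
 proof (intro allI impI)
  fix \<delta> X H :: real and m :: nat
  assume \<delta>: "0 < \<delta>" "\<delta> \<le> \<delta>0" and X: "0 \<le> X" and H: "0 \<le> H"
  define E where "E = 12 * S1 * \<delta>"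
  have \<delta>1: "\<delta> \<le> 1" "7 * \<delta> \<le> \<delta>N" using \<delta>0 \<delta> by auto
  have E: "CL * E \<le> 1 / 32" "0 \<le> E" "12 * \<delta> \<le> E" "E \<le> 12 * S1"
  proof -
   have "0 < 32 * (CL + 1) * (12 * S1)" using CL(1) S1 by (intro mult_pos_pos) auto
   then have "\<delta> * (32 * (CL + 1) * (12 * S1)) \<le> 1" using order_trans[OF \<delta>(2) \<delta>0(4)] by (simp only: pos_le_divide_eq)
   moreover have "\<delta> * (32 * CL * (12 * S1)) \<le> \<delta> * (32 * (CL + 1) * (12 * S1))"
    using \<delta> CL(1) S1 by (intro mult_left_mono mult_right_mono) auto
   ultimately show "CL * E \<le> 1 / 32" by (simp add: E_def mult_ac)
   show "0 \<le> E" "12 * \<delta> \<le> E" using S1 \<delta> mult_right_mono[OF S1, of \<delta>] by (auto simp: E_def)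
   show "E \<le> 12 * S1" using S1 mult_left_mono[OF \<delta>1(1), of "12 * S1"] by (simp add: E_def)
  qed
  let ?I = "{-(6 * \<delta>)<..<6 * \<delta>}"
  have I0: "open ?I" "?I \<subseteq> {-6..6}" using \<delta>1(1) by auto
  obtain CA where CA: "0 \<le> CA" "\<And>g h \<delta> c y I. cutoffs m X \<delta> c g ==> shellf m H h ==> pbd m I K y ==> bd m I CA (%s. amp g h (y s))"
   using bd_amp[OF K X H, of m] by blast
  obtain CH where CH: "0 \<le> CH" "\<And>h y I. shellf m H h ==> pbd m I K y ==> bd m I CH (%s. h (N0 (y s)))"
   using bd_shellf[OF K H, of m] by blast
  obtain CF where CF: "0 \<le> CF" "\<And>y I. pbd (Suc m) I K y ==> (\<forall>s\<in>I. N0 (y s) \<in> {1/64<..<32}) ==> bd (Suc m) I CF (%s. F0 (y s))"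
   using bd_F0[OF K, of "1/64" 32 "Suc m"] by auto
  define L where "L = 1 + CF + CF"
  have "0 \<le> L" "0 \<le> 2 ^ m * CA * CH" using CF CA CH by (auto simp: L_def)
  from oscillatory_integral_bound[OF \<kappa>2(1) \<delta>(1) this, of n m]
  obtain C where C: "0 \<le> C" "osc_bound n m \<delta> (2 ^ m * CA * CH) L \<kappa>2 C" by blast
  show "\<exists>C\<ge>0. fs_bound m X H \<delta> \<mu>0 C"
   unfolding fs_bound_def
  proof (intro exI[of _ C] conjI C(1) allI impI)
   fix c g h h' w and l \<mu> e :: real
   assume g: "cutoffs m X \<delta> c g" and h: "shellf m H h" and h': "shellf m H h'" and l: "0 < l"
    and \<mu>: "0 \<le> \<mu>" "\<mu> \<le> \<mu>0" and e: "0 < e" "e \<le> 1" and w: "w \<in> hspace n"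
   let ?W = "co n w"
   show "cmod (\<integral>q. fs_kernel g h h' l \<mu> e w q \<partial>M) \<le> C / l ^ m"
   proof (cases "\<exists>q\<in>hspace n. fs_kernel g h h' l \<mu> e w q \<noteq> 0")
    case False
    then have "(\<integral>q. fs_kernel g h h' l \<mu> e w q \<partial>M) = (\<integral>q. 0 \<partial>M)"
     by (intro Bochner_Integration.integral_cong refl) (auto simp: space_hmeasure)
    then show ?thesis using C(1) l by simp
   next
    case True
    then obtain z where z: "z \<in> hspace n" "amp g h (co n z) \<noteq> 0" by (auto simp: fs_kernel_def)
    note z2 = amp_nz[OF g h z(2)]
    have zR: "\<bar>co n z k\<bar> \<le> R0" if "k \<le> 2 * n" for k using abs_le_R0[OF z2(3) that] .
    have c1: "\<forall>k\<le>2 * n. \<bar>c k\<bar> \<le> R1"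
    proof (intro allI impI)
     fix k assume k: "k \<le> 2 * n"
     have "\<bar>c k\<bar> \<le> R0 + \<delta>" by (rule near_bound[OF near_sym[OF z2(1)] zR k])
     then show "\<bar>c k\<bar> \<le> R1" using \<delta>1(1) by (simp add: R1_def)
    qed
    have "\<bar>N0 c - N0 (co n z)\<bar> \<le> CL * E"
    proof (rule CL(2)[OF E(2)])
     show "near E c (co n z)" using E(3) \<delta> by (intro near_mono[OF near_sym[OF z2(1)]]) simp
     show "\<forall>k\<le>2 * n. \<bar>c k\<bar> \<le> K \<and> \<bar>co n z k\<bar> \<le> K"
      using order_trans[OF c1[rule_format] RK(2)] order_trans[OF zR RK(1)] by blast
    qed
    then have c2: "1 / 32 \<le> N0 c" using z2(2) E(1) by linarith
    from \<kappa>(3)[OF c1 c2] obtain i where i: "i \<le> 2 * n" "\<And>z. near \<delta>N z c ==> \<kappa> \<le> \<bar>LF z (unitv i)\<bar>" by auto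
    note [measurable] = measurable_amp[OF g h] shellf_measurable[OF h']
    show ?thesis
    proof (rule osc_boundD[OF C(2) _ i(1) l])
     show "fs_kernel g h h' l \<mu> e w \<in> borel_measurable M"
     proof -
      have [measurable]: "w \<in> space M" using w by (simp add: space_hmeasure)
      show ?thesis unfolding fs_kernel_def[abs_def] by measurable
     qed
     show "cmod (fs_kernel g h h' l \<mu> e w p) \<le> (X ^ (2 * n + 1) * H) * H" for p
      unfolding fs_kernel_def norm_mult norm_exp_i_times norm_of_real abs_mult mult_1_right
      using amp_bound[OF g h X H] shellf_bound[OF h'] X H by (intro mult_mono) auto
     show "p \<in> cube n c \<delta>" if "p \<in> hspace n" "fs_kernel g h h' l \<mu> e w p \<noteq> 0" for p
      using that amp_nz(1)[OF g h] by (auto simp: fs_kernel_def box_iff_near)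
    next
     fix p assume p: "p \<in> cube n c \<delta>"
     let ?P = "co n p"
     define q where "q = aff ?P (unitv i)"
     define y where "y = aff (dilv e (lmul ?W ?P)) (dilv e (slope i ?W))"
     have yq: "y s = dilv e (lmul ?W (q s))" for s
     proof
      fix k
      have "dilv e (lmul ?W (q s)) k = dilv e (aff (lmul ?W ?P) (slope i ?W) s) k"
       by (simp add: dilv_def q_def lmul_aff)
      then show "y s k = dilv e (lmul ?W (q s)) k" by (simp add: y_def dilv_aff)
     qed
     have k1: "co n (shift n i p s) k = q s k" if "k \<le> 2 * n" for s k
      using i that by (simp add: q_def co_shift_aff)
     have k2: "co n (dil n e (hmult n a w (shift n i p s))) k = y s k" if "k \<le> 2 * n" for s k
      using that lmul_cong[of "co n (shift n i p s)" "q s" k ?W] k1 by (simp add: yq co_dil_dilv dilv_def co_hmult)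
     let ?\<Phi> = "%s. F0 (q s) - \<mu> * F0 (y s)"
     have f: "fs_kernel g h h' l \<mu> e w (shift n i p s) =
       of_real (amp g h (q s) * h' (N0 (y s))) * exp (\<i> * of_real (l * ?\<Phi> s))" for s
      using amp_cong[OF k1, where g = g and h = h] N0_cong[OF k2] F0_cong[OF k1] F0_cong[OF k2]
      unfolding fs_kernel_def by simp
     show "phase_form m (6 * \<delta>) (2 ^ m * CA * CH) L \<kappa>2 l (%s. fs_kernel g h h' l \<mu> e w (shift n i p s))"
     proof (cases "\<exists>s0\<in>?I. amp g h (q s0) \<noteq> 0 \<and> h' (N0 (y s0)) \<noteq> 0")
      \<comment> \<open>The integrand vanishes on the whole line, and nothing confines the slow
        argument there, so a zero amplitude with a dummy phase is supplied.\<close>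
      case False
      show ?thesis
       unfolding phase_form_def
      proof (rule exI[of _ "%s. 0"], rule exI[of _ "%s. l * s"], rule exI[of _ "%s. 1"], intro conjI ballI)
       show "bd m ?I (2 ^ m * CA * CH) (%s. 0)" using CA CH by (intro bd_const) auto
       show "bd m ?I L (%s. 1)" using CF by (intro bd_const) (auto simp: L_def)
       fix s assume s: "s \<in> ?I"
       show "\<kappa>2 \<le> \<bar>1\<bar>" using \<kappa>2 by simp
       show "((%s. l * s) has_real_derivative l * 1) (at s)" by (auto intro!: derivative_eq_intros)
       have "amp g h (q s) = 0 \<or> h' (N0 (y s)) = 0" using False s by blast
       then have "amp g h (q s) * h' (N0 (y s)) = 0" by auto
       then show "fs_kernel g h h' l \<mu> e w (shift n i p s) = of_real 0 * exp (\<i> * of_real (l * s))"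
        unfolding f by simp
      qed
     next
      case True
      then obtain s0 where s0: "s0 \<in> ?I" "amp g h (q s0) \<noteq> 0" "h' (N0 (y s0)) \<noteq> 0" by blast
      note q0 = amp_nz[OF g h s0(2)]
      have y0: "1 / 16 \<le> N0 (y s0)" "N0 (y s0) \<le> 16" using h' s0(3) by (auto simp: shellf_def)
      have qR: "\<bar>q s0 k\<bar> \<le> R0" and yR: "\<bar>y s0 k\<bar> \<le> R0" if "k \<le> 2 * n" for k
       using abs_le_R0[OF q0(3) that] abs_le_R0[OF y0(2) that] by auto
      \<comment> \<open>The product of \<open>e\<close> with the horizontal part of \<open>w\<close>
        is bounded although \<open>w\<close> is not: at \<open>s0\<close> both the point and its
        dilated translate lie in bounded sets.\<close>
      have eW: "\<bar>e * ?W k\<bar> \<le> 2 * R0" if "k < 2 * n" for k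
      proof -
       have "e * ?W k = y s0 k - e * q s0 k" using that by (simp add: yq dilv_def lmul_def algebra_simps)
       moreover have "\<bar>e * q s0 k\<bar> \<le> 1 * R0" unfolding abs_mult using e qR[of k] that by (intro mult_mono) auto
       ultimately show ?thesis using yR[of k] that by linarith
      qed
      have sl: "\<bar>dilv e (slope i ?W) k\<bar> \<le> S1" if k: "k \<le> 2 * n" for k
      proof (cases "k < 2 * n")
       case True
       have "\<bar>e * unitv i k\<bar> \<le> 1 * 1" unfolding abs_mult using e by (intro mult_mono) (auto simp: unitv_def)
       then show ?thesis using True S1 by (simp add: dilv_def slope_def)
      next
       case False
       then have k2: "k = 2 * n" using k by simp
       have "e * symp n ?W (unitv i) = symp n (%k. e * ?W k) (unitv i)" by (simp add: symp_scale_left)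
       then have "\<bar>e * symp n ?W (unitv i)\<bar> \<le> 2 * real n * (2 * R0) * 1"
        using eW R0_pos abs_symp_le[of n "%k. e * ?W k" "2 * R0" "unitv i" 1] by (simp add: unitv_def)
       then have 1: "2 * \<bar>a\<bar> * \<bar>e * symp n ?W (unitv i)\<bar> \<le> 2 * \<bar>a\<bar> * (2 * real n * (2 * R0) * 1)"
        by (intro mult_left_mono) auto
       \<comment> \<open>The \<open>t\<close>-slope carries \<open>e\<^sup>2\<close>; one factor
         controls \<open>w\<close>, the other is at most 1.\<close>
       have 2: "dilv e (slope i ?W) k = e * (e * unitv i k - 2 * a * (e * symp n ?W (unitv i)))"
        using k2 by (simp add: dilv_def slope_def power2_eq_square algebra_simps)
       have "\<bar>e * unitv i k\<bar> \<le> 1 * 1" unfolding abs_mult using e by (intro mult_mono) (auto simp: unitv_def)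
       moreover have "\<bar>2 * a * (e * symp n ?W (unitv i))\<bar> = 2 * \<bar>a\<bar> * \<bar>e * symp n ?W (unitv i)\<bar>"
        by (simp add: abs_mult)
       ultimately have 3: "\<bar>e * unitv i k - 2 * a * (e * symp n ?W (unitv i))\<bar> \<le> S1"
        using 1 unfolding S1_def by linarith
       have "\<bar>dilv e (slope i ?W) k\<bar> \<le> 1 * S1"
        unfolding 2 abs_mult[of e] using e 3 by (intro mult_mono) auto
       then show ?thesis by simp
      qed
      have dist: "\<bar>s - s0\<bar> \<le> 12 * \<delta>" if "s \<in> ?I" for s using that s0(1) by auto
      have yy: "near E (y s) (y s0)" if "s \<in> ?I" for s
       unfolding near_def
      proof (intro allI impI)
       fix k assume k: "k \<le> 2 * n"
       have "y s k - y s0 k = dilv e (slope i ?W) k * (s - s0)" by (simp add: y_def aff_def algebra_simps)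
       moreover have "\<bar>dilv e (slope i ?W) k * (s - s0)\<bar> \<le> S1 * (12 * \<delta>)"
        unfolding abs_mult using sl[OF k] dist[OF that] S1 by (intro mult_mono) auto
       ultimately show "\<bar>y s k - y s0 k\<bar> \<le> E" by (simp add: E_def mult_ac)
      qed
      have qq: "near E (q s) (q s0)" if "s \<in> ?I" for s
       unfolding near_def
      proof (intro allI impI)
       fix k
       have "q s k - q s0 k = unitv i k * (s - s0)" by (simp add: q_def aff_def algebra_simps)
       then have "\<bar>q s k - q s0 k\<bar> \<le> \<bar>s - s0\<bar>" by (simp add: unitv_def)
       then show "\<bar>q s k - q s0 k\<bar> \<le> E" using dist[OF that] E(3) by linarith
      qed
      have qK: "\<bar>q s k\<bar> \<le> R0 + 12 * S1" and yK: "\<bar>y s k\<bar> \<le> R0 + 12 * S1" if "s \<in> ?I" "k \<le> 2 * n" for s k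
       using near_bound[OF qq[OF that(1)] qR that(2)] near_bound[OF yy[OF that(1)] yR that(2)] E(4) by linarith+
      have le: "R0 + 12 * S1 \<le> K" using S1 by (simp add: K_def)
      have dq: "N0 (q s) \<in> {1/64<..<32}" and dy: "N0 (y s) \<in> {1/64<..<32}" if s: "s \<in> ?I" for s
      proof -
       have "\<bar>N0 (q s) - N0 (q s0)\<bar> \<le> CL * E"
        using order_trans[OF qK[OF s] le] order_trans[OF qR RK(1)] by (intro CL(2) E(2) qq[OF s]) blast
       moreover have "\<bar>N0 (y s) - N0 (y s0)\<bar> \<le> CL * E"
        using order_trans[OF yK[OF s] le] order_trans[OF yR RK(1)] by (intro CL(2) E(2) yy[OF s]) blast
       ultimately have "1/64 < N0 (q s) \<and> N0 (q s) < 32" "1/64 < N0 (y s) \<and> N0 (y s) < 32"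
        using q0(2,3) y0 E(1) by linarith+
       then show "N0 (q s) \<in> {1/64<..<32}" "N0 (y s) \<in> {1/64<..<32}" by auto
      qed
      have z0: "0 \<in> ?I" using \<delta> by simp
      have pq: "pbd m' ?I K q" for m'
       unfolding q_def
      proof (rule pbd_aff[where r = 6])
       fix k assume k: "k \<le> 2 * n"
       have "?P = q 0" by (simp add: q_def aff_def fun_eq_iff)
       then have "\<bar>?P k\<bar> \<le> R0 + 12 * S1" using qK[OF z0 k] by simp
       moreover have "\<bar>unitv i k\<bar> \<le> 1" by (simp add: unitv_def)
       ultimately show "\<bar>?P k\<bar> + \<bar>unitv i k\<bar> * 6 \<le> K" "\<bar>unitv i k\<bar> \<le> K"
        using S1 R0_pos unfolding K_def by linarith+
      qed (rule I0)
      have py: "pbd m' ?I K y" for m'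
       unfolding y_def
      proof (rule pbd_aff[where r = 6])
       fix k assume k: "k \<le> 2 * n"
       have "dilv e (lmul ?W ?P) = y 0" by (simp add: y_def aff_def fun_eq_iff)
       then have "\<bar>dilv e (lmul ?W ?P) k\<bar> \<le> R0 + 12 * S1" using yK[OF z0 k] by simp
       then show "\<bar>dilv e (lmul ?W ?P) k\<bar> + \<bar>dilv e (slope i ?W) k\<bar> * 6 \<le> K" "\<bar>dilv e (slope i ?W) k\<bar> \<le> K"
        using sl[OF k] S1 R0_pos unfolding K_def by linarith+
      qed (rule I0)
      let ?d = "%s. LF (y s) (dilv e (slope i ?W))"
      let ?D = "%s. LF (q s) (unitv i) - \<mu> * ?d s"
      have dyd: "((%s. F0 (y s)) has_real_derivative ?d s) (at s)" if "s \<in> ?I" for s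
      proof -
       have "0 < N0 (y s)" using dy[OF that] by auto
       then show ?thesis unfolding y_def by (intro has_derivative_F0 has_derivative_aff)
      qed
      have dqd: "((%s. F0 (q s)) has_real_derivative LF (q s) (unitv i)) (at s)" if "s \<in> ?I" for s
      proof -
       have "0 < N0 (q s)" using dq[OF that] by auto
       then show ?thesis unfolding q_def by (intro has_derivative_F0 has_derivative_aff)
      qed
      have d: "(?\<Phi> has_real_derivative ?D s) (at s)" if "s \<in> ?I" for s
       by (intro DERIV_diff DERIV_cmult dyd dqd that)
      have \<mu>1: "\<mu> \<le> 1" "\<mu> * C1 \<le> \<kappa> / 2"
      proof -
       show "\<mu> \<le> 1" using \<mu> by (simp add: \<mu>0_def)
       have "\<mu> \<le> \<kappa> / (2 * (C1 + 1))" using \<mu> by (simp add: \<mu>0_def)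
       then have "\<mu> * (2 * (C1 + 1)) \<le> \<kappa>" using C1(1) by (simp add: pos_le_divide_eq)
       then show "\<mu> * C1 \<le> \<kappa> / 2" using \<mu>(1) by (simp add: algebra_simps)
      qed
      have "bd (Suc m) ?I (CF + \<bar>\<mu>\<bar> * CF) ?\<Phi>"
       using dq dy by (intro bd_diff bd_cmult CF(2) pq py) auto
      moreover have "\<bar>\<mu>\<bar> * CF \<le> 1 * CF" using \<mu> \<mu>1 CF by (intro mult_right_mono) auto
      ultimately have bF: "bd (Suc m) ?I (L * 1) ?\<Phi>" by (elim bd_mono) (simp add: L_def)
      have b1: "bd 0 ?I C1 ?d"
       using dy by (intro bd_deriv[OF I0(1) C1(2) dyd] py) auto
      show ?thesis
       unfolding phase_form_def
      proof (rule exI[of _ "%s. amp g h (q s) * h' (N0 (y s))"], rule exI[of _ "%s. l * ?\<Phi> s"],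
        rule exI[of _ "%s. ?D s / 1"], intro conjI ballI)
       show "bd m ?I (2 ^ m * CA * CH) (%s. amp g h (q s) * h' (N0 (y s)))"
        by (intro bd_mult CA(1) CH(1) CA(2)[OF g h] CH(2)[OF h'] py pq)
       show "bd m ?I L (%s. ?D s / 1)"
        by (rule bd_phase_slope[OF I0(1) _ bF d]) auto
       fix s assume s: "s \<in> ?I"
       have "near \<delta>N (q s) c"
       proof -
        have "near (6 * \<delta>) (q s) ?P" unfolding q_def using s by (intro near_aff) auto
        moreover have "near \<delta> ?P c" using p by (simp add: box_iff_near)
        ultimately have "near (6 * \<delta> + \<delta>) (q s) c" by (rule near_trans)
        then show ?thesis by (rule near_mono) (use \<delta>1(2) in simp)
       qed
       from i(2)[OF this] have "\<kappa> \<le> \<bar>LF (q s) (unitv i)\<bar>" .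
       moreover have "\<bar>\<mu> * ?d s\<bar> \<le> \<mu> * C1"
        unfolding abs_mult using \<mu>(1) bd_bound[OF b1 s] by (simp add: mult_left_mono)
       ultimately show "\<kappa>2 \<le> \<bar>?D s / 1\<bar>" using \<mu>1(2) \<kappa>2(3) by simp
       show "((%s. l * ?\<Phi> s) has_real_derivative l * (?D s / 1)) (at s)"
        using DERIV_cmult[OF d[OF s], of l] by simp
       show "fs_kernel g h h' l \<mu> e w (shift n i p s) =
         of_real (amp g h (q s) * h' (N0 (y s))) * exp (\<i> * of_real (l * ?\<Phi> s))" by (rule f)
      qed
     qed
    qed
   qed
  qed
 qed
 then show ?thesis using \<delta>0(1,2) \<mu>0 by blast
qed

end

section \<open>Cutoffs and partitions of unity\<close>

lemma smooth_real_deriv: "smooth_real f ==> smooth_real (deriv f)"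
 unfolding smooth_real_def by (metis comp_apply funpow_Suc_right)

lemma smooth_real_has_derivative: "smooth_real f ==> (f has_real_derivative deriv f x) (at x)"
 unfolding smooth_real_def by (metis DERIV_deriv_iff_real_differentiable funpow_0)

lemma smooth_real_imp_bd:
 assumes "smooth_real f" "\<And>r. r \<notin> {c..d} ==> f r = 0"
 shows "\<exists>K\<ge>0. bd m UNIV K f"
 using assms
proof (induction m arbitrary: f)
 have bounded: "\<exists>K\<ge>0. \<forall>s. \<bar>f s\<bar> \<le> K" if "smooth_real f" "\<And>r. r \<notin> {c..d} ==> f r = 0" for f
 proof -
  have "continuous_on {c..d} f"
   using smooth_real_has_derivative[OF that(1)] by (auto intro!: continuous_at_imp_continuous_on DERIV_isCont)
  then have "compact (f ` {c..d})" by (rule compact_continuous_image) simp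
  then have "bounded (f ` {c..d})" by (rule compact_imp_bounded)
  then obtain B where B: "\<forall>r\<in>{c..d}. \<bar>f r\<bar> \<le> B" by (auto simp: bounded_iff)
  then have "\<bar>f s\<bar> \<le> max 0 B" for s
   using that(2)[of s] B by (cases "s \<in> {c..d}") (auto simp: le_max_iff_disj)
  then show ?thesis by (intro exI[of _ "max 0 B"]) auto
 qed
 {
  case 0
  then obtain K where "K \<ge> 0" "\<forall>s. \<bar>f s\<bar> \<le> K" using bounded[OF 0] by blast
  moreover have "continuous_on UNIV f"
   using smooth_real_has_derivative[OF 0(1)] by (auto intro!: continuous_at_imp_continuous_on DERIV_isCont)
  ultimately show ?case by auto
 next
  case (Suc m)
  have z: "deriv f r = 0" if "r \<notin> {c..d}" for r
  proof -
   have "open (- {c..d})" by (simp add: open_Compl)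
   then have "(f has_real_derivative 0) (at r)"
   proof (rule has_field_derivative_transform_within_open[OF DERIV_const])
    show "r \<in> - {c..d}" using that by simp
    show "0 = f x" if "x \<in> - {c..d}" for x using Suc.prems(2)[of x] that by simp
   qed
   then show ?thesis by (rule DERIV_imp_deriv)
  qed
  obtain K where K: "K \<ge> 0" "bd m UNIV K (deriv f)"
   using Suc.IH[OF smooth_real_deriv[OF Suc.prems(1)] z] by blast
  obtain L where L: "L \<ge> 0" "\<forall>s. \<bar>f s\<bar> \<le> L" using bounded[OF Suc.prems] by blast
  have "bd (Suc m) UNIV (max K L) f"
   using bd_mono[OF K(2), of "max K L"] L smooth_real_has_derivative[OF Suc.prems(1)]
   by (intro bd_SucI[where f' = "deriv f"]) (auto simp: le_max_iff_disj)
  then show ?case using K(1) by (intro exI[of _ "max K L"]) auto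
 }
qed

lemma bd_imp_smooth_real:
 assumes "\<And>m. \<exists>K. bd m UNIV K f"
 shows "smooth_real f"
proof -
 have "\<exists>K. bd m UNIV K ((deriv ^^ k) f)" for m k
 proof (induction k arbitrary: m)
  case 0
  then show ?case using assms by simp
 next
  case (Suc k)
  obtain K where K: "bd (Suc m) UNIV K ((deriv ^^ k) f)" using Suc.IH by blast
  then obtain f' where f': "\<forall>s\<in>UNIV. ((deriv ^^ k) f has_real_derivative f' s) (at s)" "bd m UNIV K f'"
   by (rule bd_SucE)
  have "deriv ((deriv ^^ k) f) = f'" using f'(1) by (auto intro!: DERIV_imp_deriv)
  then show ?case using f'(2) by auto
 qed
 note * = this
 show ?thesis
  unfolding smooth_real_def
 proof (intro allI)
  fix k x
  obtain K where "bd (Suc 0) UNIV K ((deriv ^^ k) f)" using * by blast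
  then obtain f' where "\<forall>s\<in>UNIV. ((deriv ^^ k) f has_real_derivative f' s) (at s)" by (rule bd_SucE)
  then show "(deriv ^^ k) f differentiable at x" by (auto simp: real_differentiable_def)
 qed
qed

definition bump :: "(real => real) => bool" where
 "bump p \<longleftrightarrow> (\<forall>m. \<exists>K\<ge>0. bd m UNIV K p) \<and> (\<forall>r. r \<notin> {-1..1} --> p r = 0) \<and> (\<forall>r. 0 \<le> p r) \<and> p 0 > 0"

text \<open>Squaring makes the cutoff non-negative. This bump is the source of the partition of
  unity, the mollifier and the test functions below.\<close>

lemma cutoff_bump: "cutoff \<psi> ==> bump (%r. (\<psi> r)\<^sup>2)"
proof -
 assume \<psi>: "cutoff \<psi>"
 have "\<exists>K\<ge>0. bd m UNIV K (%r. (\<psi> r)\<^sup>2)" for m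
 proof -
  obtain K where K: "K \<ge> 0" "bd m UNIV K \<psi>"
   using \<psi> smooth_real_imp_bd[of \<psi> "-1" 1 m] by (auto simp: cutoff_def)
  have "bd m UNIV (2 ^ m * K * K) (%r. \<psi> r * \<psi> r)" by (intro bd_mult K)
  then show ?thesis using K(1) by (intro exI[of _ "2 ^ m * K * K"]) (simp add: power2_eq_square)
 qed
 then show ?thesis using \<psi> by (auto simp: bump_def cutoff_def)
qed

text \<open>The normalised antiderivative of the bump.\<close>

lemma smooth_step:
 assumes p: "bump p"
 shows "\<exists>st. (\<forall>m. \<exists>K\<ge>0. bd m UNIV K st) \<and> (\<forall>x\<le>-1. st x = 0) \<and> (\<forall>x\<ge>1. st x = (1::real))"
proof -
 have cont: "continuous_on UNIV p"
  using p bd_continuous_on unfolding bump_def by blast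
 have z: "p r = 0" if "r \<notin> {-1..1}" for r using p that unfolding bump_def by blast
 have nn: "0 \<le> p r" for r using p unfolding bump_def by blast
 have ci: "continuous_on {u..v} p" for u v using cont by (rule continuous_on_subset) simp
 have int: "p integrable_on {u..v}" for u v by (intro integrable_continuous_real ci)
 \<comment> \<open>Starting at -2, to the left of the support, makes the fundamental theorem
   two-sided at -1.\<close>
 define G where "G x = integral {-2..x} p" for x
 have G0: "G x = 0" if "x \<le> -1" for x
 proof -
  have "p r = 0" if "r \<in> {-2..x}" "r \<noteq> -1" for r using z[of r] that \<open>x \<le> -1\<close> by auto
  then have "integral {-2..x} p = integral {-2..x} (%r. 0)"
   by (intro integral_spike[of "{-1}"]) auto
  then show ?thesis by (simp add: G_def)
 qed
 have G1: "G x = G 1" if "x \<ge> 1" for x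
 proof -
  have "integral {-2..1} p + integral {1..x} p = integral {-2..x} p"
   using that by (intro Henstock_Kurzweil_Integration.integral_combine int) auto
  moreover have "integral {1..x} p = integral {1..x} (%r. 0)"
  proof (intro integral_spike[of "{1}"])
   show "0 = p r" if "r \<in> {1..x} - {1}" for r using z[of r] that by auto
  qed simp
  ultimately show ?thesis by (simp add: G_def)
 qed
 have d: "(G has_real_derivative p x) (at x)" for x
 proof (cases "x < -1")
  case True
  have "(G has_real_derivative 0) (at x)"
   by (rule has_field_derivative_transform_within_open[OF DERIV_const, where S = "{..<-1}"]) (use True G0 in auto)
  then show ?thesis using z[of x] True by simp
 next
  case False
  have "(G has_real_derivative p x) (at x within {-2..x + 1})"
   unfolding G_def[abs_def] using False by (intro integral_has_real_derivative ci) auto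
  moreover have "at x within {-2..x + 1} = at x"
   using False by (intro at_within_interior) (simp add: interior_atLeastAtMost_real)
  ultimately show ?thesis by simp
 qed
 have mono: "G x \<le> G y" if "x \<le> y" for x y
  using that d nn by (intro DERIV_nonneg_imp_nondecreasing[of x y G]) auto
 have pos: "G 1 > 0"
 proof -
  have "G 1 \<noteq> 0"
  proof
   assume "G 1 = 0"
   then have "\<forall>r\<in>{-2..1}. p r = 0" unfolding G_def
    using integral_eq_0_iff[of "-2" 1 p] ci nn by auto
   then show False using p by (auto simp: bump_def dest!: bspec[of _ _ 0])
  qed
  moreover have "0 \<le> G 1" using mono[of "-1" 1] G0[of "-1"] by simp
  ultimately show ?thesis by simp
 qed
 have Gb: "0 \<le> G x" "G x \<le> G 1" for x
  using mono[of "-1" x] mono[of x 1] G0[of x] G0[of "-1"] G1[of x] pos by (cases "x \<le> -1"; cases "x \<le> 1"; simp)+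
 let ?st = "%x. (1 / G 1) * G x"
 have "\<exists>K\<ge>0. bd m UNIV K ?st" for m
 proof -
  obtain K where K: "K \<ge> 0" "bd m UNIV K p" using p unfolding bump_def by blast
  have "bd (Suc m) UNIV (max K (G 1)) G"
   using bd_mono[OF K(2), of "max K (G 1)"] Gb d by (intro bd_SucI[where f' = p]) (auto simp: le_max_iff_disj)
  from bd_cmult[OF bd_pred[OF this], of "1 / G 1"] show ?thesis
   using K(1) by (intro exI[of _ "\<bar>1 / G 1\<bar> * max K (G 1)"]) auto
 qed
 moreover have "\<forall>x\<le>-1. ?st x = 0" using G0 by auto
 moreover have "\<forall>x\<ge>1. ?st x = 1"
 proof (intro allI impI)
  fix x :: real assume "1 \<le> x"
  from G1[OF this] show "?st x = 1" using pos by simp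
 qed
 ultimately show ?thesis by (intro exI[of _ ?st] conjI) auto
qed

text \<open>Differences of consecutive translates of the step telescope to 1. All members are
  translates of one function, which gives the bound uniform in \<open>j\<close>; the spacing
  \<open>\<delta> / 2\<close> makes each support fit in a \<delta>-neighbourhood of its
  centre.\<close>

lemma smooth_partition:
 fixes \<delta> R :: real
 assumes p: "bump p" and \<delta>: "0 < \<delta>"
 shows "\<exists>J \<phi> c. (\<forall>m. \<exists>X\<ge>0. \<forall>j. bd m UNIV X (\<phi> j)) \<and> (\<forall>j x. \<phi> j x \<noteq> 0 --> \<bar>x - c j\<bar> \<le> \<delta>) \<and>
  (\<forall>x. \<bar>x\<bar> \<le> R --> (\<Sum>j\<in>{..<J}. \<phi> (j::nat) x) = (1::real))"
proof -
 obtain st where st: "\<And>m. \<exists>K\<ge>0. bd m UNIV K st" "\<And>x. x \<le> -1 ==> st x = 0" "\<And>x. x \<ge> 1 ==> st x = (1::real)"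
  using smooth_step[OF p] by blast
 define \<eta> where "\<eta> = \<delta> / 2"
 have \<eta>: "0 < \<eta>" using \<delta> by (simp add: \<eta>_def)
 obtain M :: nat where M: "R / \<eta> \<le> real M" using real_arch_simple by blast
 define \<phi> where "\<phi> j x = st (real M - real j + 1 + (1 / \<eta>) * x) - st (real M - real j + (1 / \<eta>) * x)" for j :: nat and x
 define c where "c j = (real j - real M) * \<eta>" for j :: nat
 have "\<exists>X\<ge>0. \<forall>j. bd m UNIV X (\<phi> j)" for m
 proof -
  obtain K where K: "K \<ge> 0" "bd m UNIV K st" using st(1) by blast
  have scal: "bd m UNIV (K * (1 + \<bar>1 / \<eta>\<bar>) ^ m) (%x. st (d + (1 / \<eta>) * x))" for d
  proof -
   \<comment> \<open>Generalised over the function, since the induction on the order passes to the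
     derivative; each order brings out a factor \<open>1 / \<eta>\<close>.\<close>
   have "bd m' UNIV K' (%x. f (d + (1 / \<eta>) * x))"
    if "bd m' UNIV K f" "K * (1 + \<bar>1 / \<eta>\<bar>) ^ m' \<le> K'" "0 \<le> K" for m' f K K'
    using that
   proof (induction m' arbitrary: f K K')
    case 0
    have "continuous_on UNIV f" using 0 by auto
    then have "continuous_on UNIV (%x. f (d + (1 / \<eta>) * x))"
     using \<eta> by (intro continuous_on_compose2[of UNIV f UNIV "%x. d + (1 / \<eta>) * x"]) (auto intro!: continuous_intros)
    then show ?case using 0 by (auto intro: order_trans)
   next
    case (Suc m')
    obtain f' where f': "\<forall>s\<in>UNIV. (f has_real_derivative f' s) (at s)" "bd m' UNIV K f'"
     using Suc.prems(1) by (rule bd_SucE)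
    have "bd m' UNIV (K * (1 + \<bar>1 / \<eta>\<bar>) ^ m') (%x. f' (d + (1 / \<eta>) * x))"
     using Suc.prems by (intro Suc.IH[OF f'(2)]) auto
    from bd_cmult[OF this, of "1 / \<eta>"]
    have "bd m' UNIV K' (%x. (1 / \<eta>) * f' (d + (1 / \<eta>) * x))"
    proof (rule bd_mono)
     have "\<bar>1 / \<eta>\<bar> * (K * (1 + \<bar>1 / \<eta>\<bar>) ^ m') \<le> (1 + \<bar>1 / \<eta>\<bar>) * (K * (1 + \<bar>1 / \<eta>\<bar>) ^ m')"
      using Suc.prems(3) by (intro mult_right_mono) auto
     then show "\<bar>1 / \<eta>\<bar> * (K * (1 + \<bar>1 / \<eta>\<bar>) ^ m') \<le> K'" using Suc.prems(2) by (simp add: mult_ac)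
    qed
    moreover have "((%x. f (d + (1 / \<eta>) * x)) has_real_derivative (1 / \<eta>) * f' (d + (1 / \<eta>) * x)) (at x)" for x
    proof -
     have "((%x. d + (1 / \<eta>) * x) has_real_derivative 1 / \<eta>) (at x)"
      by (rule DERIV_cong[OF DERIV_add[OF DERIV_const DERIV_cmult[OF DERIV_ident]]]) simp
     from DERIV_chain2[OF f'(1)[rule_format, OF UNIV_I] this] show ?thesis by (simp add: mult.commute)
    qed
    moreover have "\<bar>f (d + (1 / \<eta>) * x)\<bar> \<le> K'" for x
    proof -
     have "K * 1 \<le> K * (1 + \<bar>1 / \<eta>\<bar>) ^ Suc m'" using Suc.prems(3) by (intro mult_left_mono one_le_power) auto
     then show ?thesis using bd_bound[OF Suc.prems(1), of "d + (1 / \<eta>) * x"] Suc.prems(2) by auto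
    qed
    ultimately show ?case by (intro bd_SucI[where f' = "%x. (1 / \<eta>) * f' (d + (1 / \<eta>) * x)"])
   qed
   from this[OF K(2) order_refl K(1)] show ?thesis .
  qed
  show ?thesis
   unfolding \<phi>_def[abs_def] using bd_diff[OF scal scal] K(1)
   by (intro exI[of _ "K * (1 + \<bar>1 / \<eta>\<bar>) ^ m + K * (1 + \<bar>1 / \<eta>\<bar>) ^ m"]) auto
 qed
 moreover have "\<bar>x - c j\<bar> \<le> \<delta>" if "\<phi> j x \<noteq> 0" for j x
 proof -
  let ?u = "real M - real j + (1 / \<eta>) * x"
  have "?u < 1" using st(3)[of ?u] st(3)[of "1 + ?u"] that unfolding \<phi>_def by (cases "?u < 1") (auto simp: algebra_simps)
  moreover have "-2 < ?u" using st(2)[of ?u] st(2)[of "1 + ?u"] that unfolding \<phi>_def by (cases "-2 < ?u") (auto simp: algebra_simps)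
  ultimately have "\<bar>?u\<bar> \<le> 2" by simp
  moreover have "x - c j = \<eta> * ?u" using \<eta> by (simp add: c_def field_simps)
  moreover have "\<eta> * \<bar>?u\<bar> \<le> \<eta> * 2" using \<open>\<bar>?u\<bar> \<le> 2\<close> \<eta> by (intro mult_left_mono) auto
  ultimately show ?thesis using \<eta> by (simp only: abs_mult abs_of_pos) (simp add: \<eta>_def)
 qed
 moreover have "(\<Sum>j<2 * M + 2. \<phi> j x) = 1" if "\<bar>x\<bar> \<le> R" for x
 proof -
  \<comment> \<open>\<open>M * \<eta> \<ge> R\<close>, so for \<open>\<bar>x\<bar> \<le> R\<close>
    the step is already 1 at index 0 and still 0 at index \<open>2 * M + 2\<close>.\<close>
  let ?s = "%j::nat. - st (real M + 1 - real j + (1 / \<eta>) * x)"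
  have "(\<Sum>j<2 * M + 2. \<phi> j x) = (\<Sum>j<2 * M + 2. ?s (Suc j) - ?s j)"
   unfolding \<phi>_def by (intro sum.cong) (auto simp: algebra_simps)
  also have "\<dots> = ?s (2 * M + 2) - ?s 0" by (rule sum_lessThan_telescope)
  also have "\<dots> = 1"
  proof -
   have "\<bar>(1 / \<eta>) * x\<bar> \<le> real M"
    using that M \<eta> order_trans[OF divide_right_mono[OF that, of \<eta>] M] by (simp add: abs_mult)
   then have "real M + 1 - real (2 * M + 2) + (1 / \<eta>) * x \<le> -1" "1 \<le> real M + 1 - real 0 + (1 / \<eta>) * x"
    unfolding abs_le_iff by linarith+
   from st(2)[OF this(1)] st(3)[OF this(2)] show ?thesis by simp
  qed
  finally show ?thesis .
 qed
 ultimately show ?thesis by blast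
qed

section \<open>An integrable product majorant\<close>

lemma nn_integral_inverse_1_plus_square: "(\<integral>\<^sup>+x. ennreal (1 / (1 + x\<^sup>2)) \<partial>lborel) \<le> ennreal pi"
proof -
 let ?f = "%x::real. 1 / (1 + x\<^sup>2)"
 have "(\<integral>\<^sup>+x. ennreal (?f x) * indicator {0..} x \<partial>lborel) = ennreal (pi / 2 - arctan 0)"
 proof (rule nn_integral_FTC_atLeast)
  show "DERIV arctan x :> ?f x" for x
   using DERIV_arctan[of x] by (simp add: inverse_eq_divide)
  show "(arctan \<longlongrightarrow> pi / 2) at_top" by (rule tendsto_arctan_at_top)
 qed auto
 then have h: "(\<integral>\<^sup>+x. ennreal (?f x) * indicator {0..} x \<partial>lborel) = ennreal (pi / 2)" by simp
 have "(\<integral>\<^sup>+x. ennreal (?f x) * indicator {..0} x \<partial>lborel) = (\<integral>\<^sup>+x. ennreal (?f x) * indicator {0..} x \<partial>lborel)"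
  by (subst nn_integral_real_affine[of _ "-1" 0]) (auto intro!: nn_integral_cong simp: indicator_def)
 moreover have "(\<integral>\<^sup>+x. ennreal (?f x) \<partial>lborel) \<le> (\<integral>\<^sup>+x. ennreal (?f x) * indicator {0..} x + ennreal (?f x) * indicator {..0} x \<partial>lborel)"
  by (intro nn_integral_mono) (auto simp: indicator_def)
 moreover have "\<dots> = (\<integral>\<^sup>+x. ennreal (?f x) * indicator {0..} x \<partial>lborel) + (\<integral>\<^sup>+x. ennreal (?f x) * indicator {..0} x \<partial>lborel)"
  by (intro nn_integral_add) auto
 ultimately show ?thesis by (simp add: h flip: ennreal_plus)
qed

text \<open>A majorant in product form factorises by Tonelli, so no polar coordinates are needed;
  each of the \<open>2 * n + 1\<close> factors contributes at most \<open>pi / l\<close>.\<close>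

lemma nn_integral_product_decay:
 assumes l: "0 < l"
 shows "(\<integral>\<^sup>+p. ennreal (\<Prod>k\<le>2 * n. 1 / (1 + (l * co n p k)\<^sup>2)) \<partial>hmeasure n) \<le> ennreal ((pi / l) ^ (2 * n + 1))"
proof -
 let ?f = "%x::real. ennreal (1 / (1 + (l * x)\<^sup>2))"
 interpret P: product_sigma_finite "%_::nat. lborel :: real measure" by standard
 have one: "(\<integral>\<^sup>+x. ?f x \<partial>lborel) \<le> ennreal (pi / l)"
 proof -
  have "(\<integral>\<^sup>+x. ennreal (1 / (1 + x\<^sup>2)) \<partial>lborel) = ennreal \<bar>l\<bar> * (\<integral>\<^sup>+x. ?f x \<partial>lborel)"
   using l by (subst nn_integral_real_affine[of _ l 0]) auto
  then have "ennreal l * (\<integral>\<^sup>+x. ?f x \<partial>lborel) \<le> ennreal pi" using nn_integral_inverse_1_plus_square l by simp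
  then have "ennreal (1 / l) * (ennreal l * (\<integral>\<^sup>+x. ?f x \<partial>lborel)) \<le> ennreal (1 / l) * ennreal pi" by (rule mult_left_mono) simp
  then show ?thesis using l by (simp add: mult.assoc[symmetric] ennreal_mult[symmetric])
 qed
 have "(\<integral>\<^sup>+p. ennreal (\<Prod>k\<le>2 * n. 1 / (1 + (l * co n p k)\<^sup>2)) \<partial>hmeasure n) =
   (\<integral>\<^sup>+p. (\<Prod>k<2 * n. ?f (fst p k)) * ?f (snd p) \<partial>hmeasure n)"
  by (intro nn_integral_cong) (simp add: lessThan_Suc_atMost[symmetric] co_def prod_ennreal ennreal_mult[symmetric] prod_nonneg)
 also have "\<dots> = (\<integral>\<^sup>+x. \<integral>\<^sup>+t. (\<Prod>k<2 * n. ?f (x k)) * ?f t \<partial>lborel \<partial>PiM {..<2 * n} (%_. lborel))"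
  unfolding hmeasure_def by (subst lborel.nn_integral_fst[symmetric]) auto
 also have "\<dots> = (\<integral>\<^sup>+x. (\<Prod>k<2 * n. ?f (x k)) \<partial>PiM {..<2 * n} (%_. lborel)) * (\<integral>\<^sup>+t. ?f t \<partial>lborel)"
  by (simp add: nn_integral_cmult nn_integral_multc)
 also have "(\<integral>\<^sup>+x. (\<Prod>k<2 * n. ?f (x k)) \<partial>PiM {..<2 * n} (%_. lborel)) = (\<Prod>k<2 * n. \<integral>\<^sup>+t. ?f t \<partial>lborel)"
  by (intro P.product_nn_integral_prod) auto
 also have "\<dots> * (\<integral>\<^sup>+t. ?f t \<partial>lborel) = (\<integral>\<^sup>+t. ?f t \<partial>lborel) ^ (2 * n + 1)" by (simp add: mult.commute)
 also have "\<dots> \<le> ennreal (pi / l) ^ (2 * n + 1)" by (intro power_mono one) simp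
 also have "\<dots> = ennreal ((pi / l) ^ (2 * n + 1))" using l by (intro ennreal_power) simp
 finally show ?thesis .
qed

section \<open>A single dyadic piece\<close>

lemma cmod_of_real_power: "0 \<le> D ==> cmod (of_real (D ^ k)) = D ^ k"
 unfolding norm_of_real by simp

text \<open>Dilation normalised to preserve the \<open>L\<^sup>1\<close> norm. As dilations are
  automorphisms, it commutes with convolution and adjoints.\<close>

definition dk :: "nat => real => (hpoint => complex) => hpoint => complex" where
 "dk n D K p = of_real (D ^ (2 * n + 2)) * K (dil n D p)"

lemma ckernel_dk:
 assumes K: "ckernel n K" and D: "0 < D"
 shows "ckernel n (dk n D K)"
proof -
 obtain C R where C: "0 \<le> C" "0 \<le> R" "\<And>p. p \<in> hspace n ==> cmod (K p) \<le> C"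
  "\<And>p. p \<in> hspace n ==> K p \<noteq> 0 ==> p \<in> ball_inf n R" using ckernelE[OF K] by blast
 note [measurable] = ckernel_measurable[OF K]
 show ?thesis
 proof (rule ckernelI)
  show "dk n D K \<in> borel_measurable (hmeasure n)" unfolding dk_def[abs_def] by measurable
  show "cmod (dk n D K p) \<le> D ^ (2 * n + 2) * C" for p
   using D unfolding dk_def norm_mult by (intro mult_mono C(3)) (auto simp only: cmod_of_real_power, auto)
  show "p \<in> ball_inf n (R / D + R / D\<^sup>2)" if p: "p \<in> hspace n" "dk n D K p \<noteq> 0" for p
  proof (rule ball_infI[OF p(1)])
   have d: "dil n D p \<in> ball_inf n R" using p by (intro C(4)) (auto simp: dk_def)
   have nn: "0 \<le> R / D" "0 \<le> R / D\<^sup>2" using C D by auto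
   show "\<bar>fst p k\<bar> \<le> R / D + R / D\<^sup>2" if k: "k < 2 * n" for k
   proof -
    have "D * \<bar>fst p k\<bar> \<le> R" using abs_co_le[OF d k] D k by (simp add: dil_def abs_mult)
    then have "\<bar>fst p k\<bar> \<le> R / D" using D by (simp add: field_simps)
    then show ?thesis using nn by linarith
   qed
   have "D\<^sup>2 * \<bar>snd p\<bar> \<le> R" using abs_snd_le[OF d] by (simp add: dil_def abs_mult)
   then have "\<bar>snd p\<bar> \<le> R / D\<^sup>2" using D by (simp add: field_simps)
   then show "\<bar>snd p\<bar> \<le> R / D + R / D\<^sup>2" using nn by linarith
  qed
 qed
qed

lemma norm_L1_dk:
 assumes [measurable]: "K \<in> borel_measurable (hmeasure n)" and D: "0 < D"
 shows "norm_L1 n (dk n D K) = norm_L1 n K"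
proof -
 have "norm_L1 n K = D ^ (2 * n + 2) *\<^sub>R (\<integral>p. cmod (K (dil n D p)) \<partial>hmeasure n)"
  unfolding norm_L1_def by (rule integral_scales[OF scales_dil[OF D]]) measurable
 also have "\<dots> = norm_L1 n (dk n D K)"
  using D unfolding norm_L1_def dk_def norm_mult by (simp only: cmod_of_real_power less_imp_le) simp
 finally show ?thesis by simp
qed

lemma conv_dk:
 assumes [measurable]: "K \<in> borel_measurable (hmeasure n)" "L \<in> borel_measurable (hmeasure n)" and D: "0 < D"
 shows "conv n a (dk n D L) (dk n D K) p = dk n D (conv n a L K) p"
proof -
 let ?c = "complex_of_real (D ^ (2 * n + 2))"
 let ?g = "%q. K (hmult n a (hinv n q) (dil n D p)) * L q"
 have "dil n D p \<in> space (hmeasure n)" by (simp add: space_hmeasure)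
 then have "?g \<in> borel_measurable (hmeasure n)" by measurable
 from integral_scales[OF scales_dil[OF D] this]
 have "conv n a L K (dil n D p) = ?c * (\<integral>q. ?g (dil n D q) \<partial>hmeasure n)"
  unfolding conv_def by (simp add: scaleR_conv_of_real)
 also have "(\<integral>q. ?g (dil n D q) \<partial>hmeasure n) = (\<integral>q. K (dil n D (hmult n a (hinv n q) p)) * L (dil n D q) \<partial>hmeasure n)"
  by (simp add: dil_hmult dil_hinv)
 finally show ?thesis
  unfolding conv_def dk_def by (simp add: mult_ac flip: integral_mult_right_zero)
qed

lemma tilde_dk: "tilde n (dk n D K) = dk n D (tilde n K)"
 by (simp add: fun_eq_iff tilde_def dk_def dil_hinv)

text \<open>Reduces the diagonal estimate at every scale to scale 1.\<close>

lemma norm_L1_conv_tilde_dk: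
 assumes K: "ckernel n K" and L: "ckernel n L" and D: "0 < D"
 shows "norm_L1 n (conv n a (dk n D L) (tilde n (dk n D K))) = norm_L1 n (conv n a L (tilde n K))"
proof -
 note [measurable] = ckernel_measurable[OF ckernel_tilde[OF K]] ckernel_measurable[OF L]
 have "conv n a (dk n D L) (tilde n (dk n D K)) = dk n D (conv n a L (tilde n K))"
  unfolding tilde_dk by (rule ext) (simp add: conv_dk D)
 then show ?thesis by (simp add: norm_L1_dk D)
qed

lemma conv_sum_kernel:
 assumes "finite A" "\<And>k. k \<in> A ==> ckernel n (K k)" "square_integrable (hmeasure n) f" "p \<in> hspace n"
 shows "conv n a f (%q. \<Sum>k\<in>A. K k q) p = (\<Sum>k\<in>A. conv n a f (K k) p)"
 unfolding conv_def sum_distrib_right using assms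
 by (subst Bochner_Integration.integral_sum) (auto intro: conv_integrable)

lemma ckernel_cmult: "ckernel n K ==> ckernel n (%p. c * K p)"
proof -
 assume K: "ckernel n K"
 obtain C R where C: "0 \<le> C" "0 \<le> R" "\<And>p. p \<in> hspace n ==> cmod (K p) \<le> C"
  "\<And>p. p \<in> hspace n ==> K p \<noteq> 0 ==> p \<in> ball_inf n R" using ckernelE[OF K] by blast
 show ?thesis
  using ckernel_measurable[OF K] C
  by (intro ckernelI[where C = "cmod c * C" and R = R]) (auto simp: norm_mult mult_left_mono)
qed

lemma conv_cmult_kernel: "conv n a f (%q. c * K q) p = c * conv n a f K p"
 unfolding conv_def by (simp add: mult.assoc)

section \<open>The kernel at unit scale\<close>

context heis
begin

definition ukern :: "(real => real) => real => hpoint => complex" where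
 "ukern h l p = of_real (h (N0 (co n p))) * exp (\<i> * of_real (l * F0 (co n p)))"

definition pkern :: "(nat => real => real) => (real => real) => real => hpoint => complex" where
 "pkern g h l p = of_real (amp g h (co n p)) * exp (\<i> * of_real (l * F0 (co n p)))"

lemma N0_le_ball_inf: "p \<in> hspace n ==> N0 (co n p) \<le> 16 ==> p \<in> ball_inf n R0"
 by (auto simp: ball_inf_iff intro: abs_le_R0)

lemma measurable_N0[measurable (raw)]:
 "f \<in> measurable N M ==> (%x. N0 (co n (f x))) \<in> borel_measurable N"
 unfolding N0_def sq_def
 by (intro borel_measurable_add borel_measurable_times borel_measurable_power borel_measurable_sum measurable_co) auto

lemma measurable_F0[measurable (raw)]:
 "f \<in> measurable N M ==> (%x. F0 (co n (f x))) \<in> borel_measurable N"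
 unfolding F0_def by measurable

lemma measurable_ukern: "shellf m H h ==> ukern h l \<in> borel_measurable M"
proof -
 assume "shellf m H h"
 note [measurable] = shellf_measurable[OF this]
 show ?thesis unfolding ukern_def[abs_def] by measurable
qed

lemma ckernel_ukern: "shellf m H h ==> ckernel n (ukern h l)"
proof (rule ckernelI)
 assume h: "shellf m H h"
 show "ukern h l \<in> borel_measurable M" by (rule measurable_ukern[OF h])
 show "cmod (ukern h l p) \<le> H" for p
  unfolding ukern_def norm_mult norm_exp_i_times using shellf_bound[OF h] by simp
 show "p \<in> ball_inf n R0" if "p \<in> hspace n" "ukern h l p \<noteq> 0" for p
  using that h by (intro N0_le_ball_inf) (auto simp: ukern_def shellf_def)
qed

lemma ckernel_pkern:
 assumes "cutoffs m X \<delta> c g" "shellf m H h" "0 \<le> X" "0 \<le> H"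
 shows "ckernel n (pkern g h l)"
  and "cmod (pkern g h l p) \<le> X ^ (2 * n + 1) * H"
proof -
 show b: "cmod (pkern g h l p) \<le> X ^ (2 * n + 1) * H" for p
  unfolding pkern_def norm_mult norm_exp_i_times using amp_bound[OF assms] by simp
 note [measurable] = measurable_amp(1)[OF assms(1,2)]
 show "ckernel n (pkern g h l)"
 proof (rule ckernelI[OF _ b])
  show "pkern g h l \<in> borel_measurable M" unfolding pkern_def[abs_def] by measurable
  show "p \<in> ball_inf n R0" if "p \<in> hspace n" "pkern g h l p \<noteq> 0" for p
   using that amp_nz(3)[OF assms(1,2), of "co n p"] by (intro N0_le_ball_inf) (auto simp: pkern_def)
 qed
qed

lemma nsize_hinv: "nsize (co n (hinv n w)) = nsize (co n w)"
 unfolding nsize_def by (intro sum.cong) (auto simp: co_def hinv_eq)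

lemma conv_pkern: "conv n a (pkern g h l) (tilde n (pkern g h l)) w = cnj (\<integral>q. pair_kernel g h l (hinv n w) q \<partial>M)"
proof -
 have e: "exp (\<i> * of_real (l * x)) * cnj (exp (\<i> * of_real (l * y))) = exp (\<i> * of_real (l * (x - y)))" for x y
  by (simp add: exp_cnj exp_add[symmetric] algebra_simps)
 have "tilde n (pkern g h l) (hmult n a (hinv n q) w) * pkern g h l q = cnj (pair_kernel g h l (hinv n w) q)"
  if "q \<in> hspace n" for q
 proof -
  have "pair_kernel g h l (hinv n w) q = pkern g h l (hmult n a (hinv n w) q) * cnj (pkern g h l q)"
   unfolding pair_kernel_def pkern_def e[symmetric] by simp
  then show ?thesis using that by (simp add: tilde_def hinv_hmult)
 qed
 then show ?thesis
  unfolding conv_def Bochner_Integration.integral_cnj[symmetric]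
  by (intro Bochner_Integration.integral_cong refl) (simp add: space_hmeasure)
qed

text \<open>Every coordinate of \<open>w\<close> is at most \<open>nsize\<close>, so a radial decay
  with two powers per coordinate dominates the product. For \<open>l * nsize \<le> 1\<close> the
  trivial bound \<open>A\<close> takes over.\<close>

lemma decay_product_le:
 assumes l: "0 < l" and x: "0 \<le> x" "x \<le> A" "0 < nsize (co n w) ==> x \<le> C / (l * nsize (co n w)) ^ (2 * (2 * n + 1))" "0 \<le> C"
 shows "x \<le> 2 ^ (2 * n + 1) * (A + C) * (\<Prod>k\<le>2 * n. 1 / (1 + (l * co n w k)\<^sup>2))"
proof -
 let ?d = "2 * n + 1"
 define z where "z = l * nsize (co n w)"
 have z: "0 \<le> z" using l nsize_nonneg by (simp add: z_def)
 have A: "0 \<le> A" using x by simp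
 have "x * (1 + z\<^sup>2) ^ ?d \<le> 2 ^ ?d * (A + C)"
 proof (cases "z \<le> 1")
  case True
  then have "1 + z\<^sup>2 \<le> 2" using z by (simp add: power_le_one)
  then have "(1 + z\<^sup>2) ^ ?d \<le> 2 ^ ?d" by (intro power_mono) auto
  then have "x * (1 + z\<^sup>2) ^ ?d \<le> (A + C) * 2 ^ ?d" using x A by (intro mult_mono) auto
  then show ?thesis by (simp only: mult.commute)
 next
  case False
  then have z1: "1 \<le> z" by simp
  then have "0 < nsize (co n w)" using l nsize_nonneg[of "co n w"] by (cases "nsize (co n w) = 0") (auto simp: z_def)
  from x(3)[OF this] have "x * z ^ (2 * ?d) \<le> C" using z1 by (simp add: z_def[symmetric] pos_le_divide_eq)
  have "1 \<le> z\<^sup>2" using z1 by (rule one_le_power)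
  then have "(1 + z\<^sup>2) ^ ?d \<le> (2 * z\<^sup>2) ^ ?d" by (intro power_mono) auto
  also have "\<dots> = 2 ^ ?d * z ^ (2 * ?d)" by (simp only: power_mult_distrib power_mult)
  finally have "x * (1 + z\<^sup>2) ^ ?d \<le> 2 ^ ?d * (x * z ^ (2 * ?d))"
   using mult_left_mono[OF _ x(1), of "(1 + z\<^sup>2) ^ ?d" "2 ^ ?d * z ^ (2 * ?d)"] by (simp only: mult_ac)
  also have "\<dots> \<le> 2 ^ ?d * (A + C)" using \<open>x * z ^ (2 * ?d) \<le> C\<close> A by (intro mult_left_mono) auto
  finally show ?thesis .
 qed
 moreover have "(\<Prod>k\<le>2 * n. 1 + (l * co n w k)\<^sup>2) \<le> (1 + z\<^sup>2) ^ ?d"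
 proof -
  have "(\<Prod>k\<le>2 * n. 1 + (l * co n w k)\<^sup>2) \<le> (\<Prod>k\<le>2 * n. 1 + z\<^sup>2)"
  proof (intro prod_mono conjI)
   fix k assume "k \<in> {..2 * n}"
   then have "\<bar>l * co n w k\<bar> \<le> \<bar>z\<bar>" using abs_le_nsize[of k "co n w"] l z by (simp add: abs_mult z_def)
   then have "(l * co n w k)\<^sup>2 \<le> z\<^sup>2" by (simp only: abs_le_square_iff)
   then show "1 + (l * co n w k)\<^sup>2 \<le> 1 + z\<^sup>2" by simp
  qed auto
  then show ?thesis by simp
 qed
 ultimately have "x * (\<Prod>k\<le>2 * n. 1 + (l * co n w k)\<^sup>2) \<le> 2 ^ ?d * (A + C)"
  using x(1) by (meson mult_left_mono order_trans)
 moreover have "0 < (\<Prod>k\<le>2 * n. 1 + (l * co n w k)\<^sup>2)" by (intro prod_pos) (auto simp: add_pos_nonneg)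
 ultimately show ?thesis by (simp add: prod_dividef pos_le_divide_eq)
qed

definition diag_L1_bound :: "real => real => real => real => bool" where
 "diag_L1_bound X H \<delta> C \<longleftrightarrow> (\<forall>c g h l. cutoffs (2 * (2 * n + 1)) X \<delta> c g --> shellf (2 * (2 * n + 1)) H h --> 0 < l -->
    norm_L1 n (conv n a (pkern g h l) (tilde n (pkern g h l))) \<le> C / l ^ (2 * n + 1))"

lemma diag_L1_estimate:
 "\<exists>\<delta>0>0. \<delta>0 \<le> 1 \<and> (\<forall>\<delta> X H. 0 < \<delta> --> \<delta> \<le> \<delta>0 --> 0 \<le> X --> 0 \<le> H --> (\<exists>C\<ge>0. diag_L1_bound X H \<delta> C))"
proof -
 \<comment> \<open>Two integrations by parts per coordinate, as many as the integrable product
   majorant consumes.\<close>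
 let ?m = "2 * (2 * n + 1)"
 obtain \<delta>0 where \<delta>0: "0 < \<delta>0" "\<delta>0 \<le> 1" and est: "\<And>\<delta> X H m. 0 < \<delta> ==> \<delta> \<le> \<delta>0 ==> 0 \<le> X ==> 0 \<le> H ==> (\<exists>C\<ge>0. diag_bound m X H \<delta> C)"
  using diag_estimate by blast
 have "\<forall>\<delta> X H. 0 < \<delta> --> \<delta> \<le> \<delta>0 --> 0 \<le> X --> 0 \<le> H --> (\<exists>C\<ge>0. diag_L1_bound X H \<delta> C)"
 proof (intro allI impI)
  fix \<delta> X H :: real
  assume \<delta>: "0 < \<delta>" "\<delta> \<le> \<delta>0" and X: "0 \<le> X" and H: "0 \<le> H"
  obtain C where "0 \<le> C" "diag_bound ?m X H \<delta> C" using est[OF \<delta> X H, of ?m] by blast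
  note C = this(1) this(2)[unfolded diag_bound_def, rule_format]
  define A0 where "A0 = X ^ (2 * n + 1) * H"
  have A0: "0 \<le> A0" using X H by (simp add: A0_def)
  \<comment> \<open>The trivial bound: supremum of one factor times the \<open>L\<^sup>1\<close>
    norm of the other.\<close>
  define A where "A = A0 * (A0 * (2 * R0) ^ (2 * n + 1))"
  have A: "0 \<le> A" using A0 R0_pos by (simp add: A_def)
  let ?C = "2 ^ (2 * n + 1) * (A + C)"
  show "\<exists>C\<ge>0. diag_L1_bound X H \<delta> C"
   unfolding diag_L1_bound_def
  proof (intro exI[of _ "?C * pi ^ (2 * n + 1)"] conjI allI impI)
   fix c g h l assume g: "cutoffs ?m X \<delta> c g" and h: "shellf ?m H h" and l: "(0::real) < l"
   let ?K = "pkern g h l"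
   let ?V = "conv n a ?K (tilde n ?K)"
   note pk = ckernel_pkern[OF g h X H, of l]
   have ck: "ckernel n ?V" by (intro ckernel_conv ckernel_tilde pk(1))
   have b1: "cmod (?V w) \<le> A" if w: "w \<in> hspace n" for w
   proof -
    have "cmod (?V w) \<le> (\<integral>q. A0 * cmod (?K q) \<partial>M)"
     unfolding conv_def
    proof (rule integral_norm_le_integral)
     show "integrable M (%q. tilde n ?K (hmult n a (hinv n q) w) * ?K q)"
      by (rule conv_integrable[OF ckernel_square_integrable[OF pk(1)] ckernel_tilde[OF pk(1)] w])
     show "integrable M (%q. A0 * cmod (?K q))" using ckernel_integrable[OF pk(1)] by auto
     show "norm (tilde n ?K (hmult n a (hinv n q) w) * ?K q) \<le> A0 * cmod (?K q)" for q
      unfolding norm_mult using pk(2) by (intro mult_right_mono) (auto simp: tilde_def A0_def)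
    qed
    also have "\<dots> = A0 * norm_L1 n ?K" by (simp add: norm_L1_def)
    also have "norm_L1 n ?K \<le> A0 * (2 * R0) ^ (2 * n + 1)"
    proof (rule norm_L1_bound[OF pk(1)])
     show "p \<in> ball_inf n R0" if "p \<in> hspace n" "?K p \<noteq> 0" for p
      using that amp_nz(3)[OF g h, of "co n p"] by (intro N0_le_ball_inf) (auto simp: pkern_def)
    qed (use pk(2) A0 R0_pos in \<open>auto simp: A0_def\<close>)
    finally show ?thesis using A0 by (simp add: A_def mult_left_mono)
   qed
   have b2: "cmod (?V w) \<le> ?C * (\<Prod>k\<le>2 * n. 1 / (1 + (l * co n w k)\<^sup>2))" if w: "w \<in> hspace n" for w
   proof (rule decay_product_le[OF l _ b1[OF w] _ C(1)])
    assume "0 < nsize (co n w)"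
    then show "cmod (?V w) \<le> C / (l * nsize (co n w)) ^ ?m"
     using C(2)[OF g h l, of "hinv n w"] by (simp add: conv_pkern nsize_hinv)
   qed simp
   show "norm_L1 n ?V \<le> ?C * pi ^ (2 * n + 1) / l ^ (2 * n + 1)"
   proof (rule norm_L1_leI[OF ck])
    have "(\<integral>\<^sup>+w. ennreal (cmod (?V w)) \<partial>M) \<le> (\<integral>\<^sup>+w. ennreal ?C * ennreal (\<Prod>k\<le>2 * n. 1 / (1 + (l * co n w k)\<^sup>2)) \<partial>M)"
     using b2 A C by (intro nn_integral_mono) (auto simp: space_hmeasure ennreal_mult[symmetric] prod_nonneg intro!: ennreal_leI)
    also have "\<dots> = ennreal ?C * (\<integral>\<^sup>+w. ennreal (\<Prod>k\<le>2 * n. 1 / (1 + (l * co n w k)\<^sup>2)) \<partial>M)"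
     by (intro nn_integral_cmult) measurable
    also have "\<dots> \<le> ennreal ?C * ennreal ((pi / l) ^ (2 * n + 1))"
     by (intro mult_left_mono nn_integral_product_decay l) auto
    also have "\<dots> = ennreal (?C * pi ^ (2 * n + 1) / l ^ (2 * n + 1))"
     using A C l by (subst ennreal_mult[symmetric]) (auto simp: power_divide)
    finally show "(\<integral>\<^sup>+w. ennreal (cmod (?V w)) \<partial>M) \<le> ennreal (?C * pi ^ (2 * n + 1) / l ^ (2 * n + 1))" .
   qed (use A C l in auto)
  qed (use A C in auto)
 qed
 then show ?thesis using \<delta>0 by blast
qed

text \<open>Multiplies out one partition of unity per coordinate. It covers the shell because
  coordinates there are at most \<open>R0\<close>. Here \<alpha> is a multi-index, not the exponent
  of the kernel.\<close>

lemma pieces: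
 assumes p: "bump p" and \<delta>: "0 < \<delta>"
 shows "\<exists>A G c. finite A \<and> (\<forall>m. \<exists>X\<ge>0. \<forall>\<alpha>::nat => nat. cutoffs m X \<delta> (c \<alpha>) (G \<alpha>)) \<and>
  (\<forall>m H h y. shellf m H h --> (\<Sum>\<alpha>\<in>A. amp (G \<alpha>) h y) = h (N0 y))"
proof -
 obtain J and \<phi> :: "nat => real => real" and c where \<phi>: "\<forall>m. \<exists>X\<ge>0. \<forall>j. bd m UNIV X (\<phi> j)"
  "\<forall>j x. \<phi> j x \<noteq> 0 --> \<bar>x - c j\<bar> \<le> \<delta>" "\<forall>x. \<bar>x\<bar> \<le> R0 --> (\<Sum>j\<in>{..<J}. \<phi> j x) = 1"
  using smooth_partition[OF p \<delta>, of R0] by blast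
 define A where "A = PiE {..2 * n} (%_. {..<J})"
 show ?thesis
 proof (rule exI[of _ A], rule exI[of _ "%\<alpha> k. \<phi> (\<alpha> k)"], rule exI[of _ "%\<alpha> k. c (\<alpha> k)"], intro conjI allI impI)
  show "finite A" unfolding A_def by (intro finite_PiE) auto
  fix m
  obtain X where "0 \<le> X" "\<forall>j. bd m UNIV X (\<phi> j)" using \<phi>(1) by blast
  then show "\<exists>X\<ge>0. \<forall>\<alpha>::nat => nat. cutoffs m X \<delta> (%k. c (\<alpha> k)) (%k. \<phi> (\<alpha> k))"
   using \<phi>(2) by (intro exI[of _ X]) (simp add: cutoffs_def)
 next
  fix m H h y assume h: "shellf m H h"
  have "(\<Sum>\<alpha>\<in>A. amp (%k. \<phi> (\<alpha> k)) h y) = (\<Sum>\<alpha>\<in>A. \<Prod>k\<le>2 * n. \<phi> (\<alpha> k) (y k)) * h (N0 y)"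
   by (simp add: amp_def sum_distrib_right)
  also have "(\<Sum>\<alpha>\<in>A. \<Prod>k\<le>2 * n. \<phi> (\<alpha> k) (y k)) = (\<Prod>k\<le>2 * n. \<Sum>j\<in>{..<J}. \<phi> j (y k))"
   unfolding A_def by (rule prod_sum_PiE[symmetric]) auto
  also have "\<dots> * h (N0 y) = h (N0 y)"
  proof (cases "h (N0 y) = 0")
   case False
   then have "N0 y \<le> 16" using h by (auto simp: shellf_def)
   then have "(\<Prod>k\<le>2 * n. \<Sum>j\<in>{..<J}. \<phi> j (y k)) = 1"
    using \<phi>(3) abs_le_R0 by (intro prod.neutral) auto
   then show ?thesis by simp
  qed simp
  finally show "(\<Sum>\<alpha>\<in>A. amp (%k. \<phi> (\<alpha> k)) h y) = h (N0 y)" .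
 qed
qed

text \<open>Finitely many cubes, each treated by \<open>conv_norm_le\<close>. The square root of
  \<open>1 / l ^ (2 * n + 1)\<close> is the origin of the exponent \<open>n + 1/2\<close>, hence of
  the critical index.\<close>

lemma conv_ukern_bound:
 assumes p: "bump p" and H: "0 \<le> H"
 shows "\<exists>C\<ge>0. \<forall>h l D f. shellf (2 * (2 * n + 1)) H h --> 0 < l --> 0 < D --> square_integrable M f -->
  norm_L2 M (conv n a f (dk n D (ukern h l))) \<le> C * l powr (- (real n + 1 / 2)) * norm_L2 M f"
proof -
 let ?m = "2 * (2 * n + 1)"
 obtain \<delta> where \<delta>: "0 < \<delta>" and est: "\<And>X H. 0 \<le> X ==> 0 \<le> H ==> (\<exists>C\<ge>0. diag_L1_bound X H \<delta> C)"
 proof -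
  from diag_L1_estimate obtain \<delta>0 where "0 < \<delta>0" and *: "\<forall>\<delta> X H. 0 < \<delta> --> \<delta> \<le> \<delta>0 --> 0 \<le> X --> 0 \<le> H --> (\<exists>C\<ge>0. diag_L1_bound X H \<delta> C)" by blast
  then show ?thesis using that[of \<delta>0] by simp
 qed
 obtain A G c where A: "finite A" and G: "\<forall>m. \<exists>X\<ge>0. \<forall>\<alpha>::nat => nat. cutoffs m X \<delta> (c \<alpha>) (G \<alpha>)"
  and sum: "\<And>m H h y. shellf m H h ==> (\<Sum>\<alpha>\<in>A. amp (G \<alpha>) h y) = h (N0 y)"
  using pieces[OF p \<delta>] by metis
 obtain X where X: "0 \<le> X" "\<And>\<alpha>. cutoffs ?m X \<delta> (c \<alpha>) (G \<alpha>)" using G by blast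
 obtain C where "0 \<le> C" "diag_L1_bound X H \<delta> C" using est[OF X(1) H] by blast
 note C = this(1) this(2)[unfolded diag_L1_bound_def, rule_format]
 show ?thesis
 proof (intro exI[of _ "real (card A) * sqrt C"] conjI allI impI)
  fix h l D f
  assume h: "shellf ?m H h" and l: "(0::real) < l" and D: "(0::real) < D" and f: "square_integrable M f"
  let ?P = "%\<alpha>. dk n D (pkern (G \<alpha>) h l)"
  let ?B = "sqrt C * l powr (- (real n + 1 / 2))"
  have ck: "ckernel n (pkern (G \<alpha>) h l)" for \<alpha> by (rule ckernel_pkern(1)[OF X(2) h X(1) H])
  have eq: "dk n D (ukern h l) = (%q. \<Sum>\<alpha>\<in>A. ?P \<alpha> q)"
   by (rule ext) (simp add: dk_def ukern_def pkern_def sum[OF h, symmetric] sum_distrib_left sum_distrib_right of_real_sum)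
  have Y: "square_integrable M (conv n a f (?P \<alpha>))" for \<alpha>
   by (intro Young(1) f ckernel_dk ck D)
  have B: "norm_L2 M (conv n a f (?P \<alpha>)) \<le> ?B * norm_L2 M f" for \<alpha>
  proof (rule conv_norm_le[OF f])
   show "ckernel n (?P \<alpha>)" by (intro ckernel_dk ck D)
   have "norm_L1 n (conv n a (?P \<alpha>) (tilde n (?P \<alpha>))) \<le> C / l ^ (2 * n + 1)"
    unfolding norm_L1_conv_tilde_dk[OF ck ck D] by (rule C(2)[OF X(2) h l])
   also have "C / l ^ (2 * n + 1) = ?B\<^sup>2"
   proof -
    have "(l powr (- (real n + 1 / 2)))\<^sup>2 = l powr (- real (2 * n + 1))"
    proof -
     have "- (real n + 1 / 2) + - (real n + 1 / 2) = - real (2 * n + 1)" by simp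
     then show ?thesis by (simp only: power2_eq_square powr_add[symmetric])
    qed
    also have "\<dots> = 1 / l ^ (2 * n + 1)" using l by (simp only: powr_minus powr_realpow inverse_eq_divide)
    finally show ?thesis using C(1) by (simp add: power_mult_distrib)
   qed
   finally show "norm_L1 n (conv n a (?P \<alpha>) (tilde n (?P \<alpha>))) \<le> ?B\<^sup>2" .
  qed (use C in auto)
  have "norm_L2 M (conv n a f (dk n D (ukern h l))) = norm_L2 M (%p. \<Sum>\<alpha>\<in>A. conv n a f (?P \<alpha>) p)"
   unfolding eq norm_L2_def
   by (intro arg_cong[where f = sqrt] Bochner_Integration.integral_cong refl)
    (simp add: space_hmeasure conv_sum_kernel[OF A ckernel_dk[OF ck D] f])
  also have "\<dots> \<le> (\<Sum>\<alpha>\<in>A. norm_L2 M (conv n a f (?P \<alpha>)))"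
   by (rule conjunct2[OF square_integrable_sum[where f = "%\<alpha>. conv n a f (?P \<alpha>)", OF A Y]])
  also have "\<dots> \<le> (\<Sum>\<alpha>\<in>A. ?B * norm_L2 M f)" by (intro sum_mono B)
  also have "\<dots> = real (card A) * sqrt C * l powr (- (real n + 1 / 2)) * norm_L2 M f" by simp
  finally show "norm_L2 M (conv n a f (dk n D (ukern h l))) \<le>
   real (card A) * sqrt C * l powr (- (real n + 1 / 2)) * norm_L2 M f" .
 qed (use C in auto)
qed

section \<open>Interaction of different scales\<close>

definition T :: "(real => real) => real => real => hpoint => complex" where
 "T h l D = dk n D (ukern h l)"

lemma ckernel_T: "shellf m H h ==> 0 < D ==> ckernel n (T h l D)"
 unfolding T_def by (intro ckernel_dk ckernel_ukern)

lemma N0_hinv: "N0 (co n (hinv n p)) = N0 (co n p)"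
proof -
 have "N0 (co n (hinv n p)) = N0 (%k. - co n p k)" by (rule N0_cong) (auto simp: co_def hinv_eq)
 then show ?thesis by (simp add: N0_def sq_def)
qed

lemma ukern_hinv: "ukern h l (hinv n p) = ukern h l p"
 unfolding ukern_def F0_def N0_hinv ..

lemma T_hinv: "T h l D (hinv n p) = T h l D p"
 by (simp add: T_def dk_def dil_hinv ukern_hinv)

text \<open>\<open>N0\<close> is invariant under inversion, so passing to the adjoint is plain
  conjugation.\<close>

lemma tilde_T: "tilde n (T h l D) = (%p. cnj (T h l D p))"
 by (simp add: tilde_def T_hinv fun_eq_iff)

lemma T_support:
 assumes "shellf m H h" "1 \<le> D" "p \<in> hspace n" "T h l D p \<noteq> 0"
 shows "p \<in> ball_inf n R0"
proof -
 have "h (N0 (co n (dil n D p))) \<noteq> 0" using assms(4) by (auto simp: T_def dk_def ukern_def)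
 then have N: "N0 (co n (dil n D p)) \<le> 16" using assms(1) by (auto simp: shellf_def)
 have "\<bar>co n p k\<bar> \<le> R0" if k: "k \<le> 2 * n" for k
 proof -
  have "\<bar>(if k < 2 * n then D else D\<^sup>2) * co n p k\<bar> \<le> R0" using abs_le_R0[OF N k] k by (simp add: co_dil)
  moreover have "1 * \<bar>co n p k\<bar> \<le> \<bar>if k < 2 * n then D else D\<^sup>2\<bar> * \<bar>co n p k\<bar>"
   using assms(2) by (intro mult_right_mono) (auto simp: one_le_power)
  ultimately show ?thesis by (simp add: abs_mult)
 qed
 then show ?thesis using assms(3) by (simp add: ball_inf_iff)
qed

text \<open>\<open>D1 ^ (2 * n + 2)\<close> is the height of the slow kernel; the fast one is
  \<open>L\<^sup>1\<close> normalised and contributes no power of \<open>D2\<close>. The slow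
  frequency may be 0 and the two scales may coincide.\<close>

definition slow_pair :: "nat => real => real => real => bool" where
 "slow_pair m H \<mu>0 C \<longleftrightarrow> (\<forall>h1 h2 l1 l2 D1 D2 w. shellf m H h1 --> shellf m H h2 --> 0 < l2 -->
  0 \<le> l1 --> l1 \<le> \<mu>0 * l2 --> 0 < D1 --> D1 \<le> D2 --> w \<in> hspace n -->
  cmod (\<integral>q. T h2 l2 D2 q * cnj (T h1 l1 D1 (hmult n a w q)) \<partial>M) \<le> C * D1 ^ (2 * n + 2) / l2 ^ m)"

definition offdiag :: "nat => real => real => real => bool" where
 "offdiag m H \<mu>0 C \<longleftrightarrow> (\<forall>h1 h2 l1 l2 D1 D2. shellf m H h1 --> shellf m H h2 --> 0 < l2 -->
  0 \<le> l1 --> l1 \<le> \<mu>0 * l2 --> 1 \<le> D1 --> D1 \<le> D2 -->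
  norm_L1 n (conv n a (T h2 l2 D2) (tilde n (T h1 l1 D1))) \<le> C * D1 ^ (2 * n + 2) / l2 ^ m \<and>
  norm_L1 n (conv n a (T h1 l1 D1) (tilde n (T h2 l2 D2))) \<le> C * D1 ^ (2 * n + 2) / l2 ^ m)"

text \<open>Substituting the dilation by \<open>D2\<close> brings the fast kernel to unit size. What
  remains of the slow one is a dilation by \<open>D1 / D2 \<le> 1\<close> and a relative frequency
  \<open>l1 / l2\<close>, the setting of \<open>fast_slow_estimate\<close>.\<close>

lemma fast_slow_pairing:
 assumes p: "bump p"
 shows "\<exists>\<mu>0>0. \<forall>H m. 0 \<le> H --> (\<exists>C\<ge>0. slow_pair m H \<mu>0 C)"
proof -
 obtain \<delta> \<mu>0 where \<delta>: "0 < \<delta>" and \<mu>0: "0 < \<mu>0" and est: "\<And>X H m. 0 \<le> X ==> 0 \<le> H ==> (\<exists>C\<ge>0. fs_bound m X H \<delta> \<mu>0 C)"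
 proof -
  obtain \<delta>0 \<mu>0 where "0 < \<delta>0" "0 < \<mu>0" and *: "\<forall>\<delta> X H m. 0 < \<delta> --> \<delta> \<le> \<delta>0 --> 0 \<le> X --> 0 \<le> H --> (\<exists>C\<ge>0. fs_bound m X H \<delta> \<mu>0 C)"
   using fast_slow_estimate by (elim exE conjE) (erule (2) that)
  show ?thesis by (rule that[OF \<open>0 < \<delta>0\<close> \<open>0 < \<mu>0\<close>]) (rule *[rule_format, OF \<open>0 < \<delta>0\<close> order_refl])
 qed
 obtain A G c where A: "finite A" and G: "\<forall>m. \<exists>X\<ge>0. \<forall>\<alpha>::nat => nat. cutoffs m X \<delta> (c \<alpha>) (G \<alpha>)"
  and sum: "\<And>m H h y. shellf m H h ==> (\<Sum>\<alpha>\<in>A. amp (G \<alpha>) h y) = h (N0 y)"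
  using pieces[OF p \<delta>] by metis
 have "\<exists>C\<ge>0. slow_pair m H \<mu>0 C"
  if H: "0 \<le> H" for H m
 proof -
  obtain X where X: "0 \<le> X" "\<And>\<alpha>. cutoffs m X \<delta> (c \<alpha>) (G \<alpha>)" using G by blast
  obtain C where "0 \<le> C" "fs_bound m X H \<delta> \<mu>0 C" using est[OF X(1) H] by blast
  note C = this(1) this(2)[unfolded fs_bound_def, rule_format]
  show ?thesis
   unfolding slow_pair_def
  proof (intro exI[of _ "real (card A) * C"] conjI allI impI)
   fix h1 h2 w and l1 l2 D1 D2 :: real
   assume h1: "shellf m H h1" and h2: "shellf m H h2" and l: "0 < l2" "0 \<le> l1" "l1 \<le> \<mu>0 * l2"
    and D: "0 < D1" "D1 \<le> D2" and w: "w \<in> hspace n"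
   have D2: "0 < D2" using D by simp
   let ?e = "D1 / D2"
   let ?\<mu> = "l1 / l2"
   let ?w = "dil n D2 w"
   let ?Q = "2 * n + 2"
   let ?f = "%q. ukern h2 l2 q * cnj (ukern h1 l1 (dil n ?e (hmult n a ?w q)))"
   note [measurable] = measurable_ukern[OF h1] measurable_ukern[OF h2] shellf_measurable[OF h1]
   have [measurable]: "w \<in> space M" "?w \<in> space M" using w by (auto simp: space_hmeasure)
   have f[measurable]: "?f \<in> borel_measurable M" by measurable
   have "(\<integral>q. T h2 l2 D2 q * cnj (T h1 l1 D1 (hmult n a w q)) \<partial>M) =
    (\<integral>q. of_real (D2 ^ ?Q * D1 ^ ?Q) * ?f (dil n D2 q) \<partial>M)"
   proof (intro Bochner_Integration.integral_cong refl)
    fix q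
    have "dil n ?e (hmult n a ?w (dil n D2 q)) = dil n D1 (hmult n a w q)"
     using D2 by (simp add: dil_hmult dil_dil)
    then show "T h2 l2 D2 q * cnj (T h1 l1 D1 (hmult n a w q)) = of_real (D2 ^ ?Q * D1 ^ ?Q) * ?f (dil n D2 q)"
     unfolding T_def dk_def by (simp add: mult_ac)
   qed
   also have "\<dots> = of_real (D1 ^ ?Q) * (\<integral>q. ?f q \<partial>M)"
    unfolding integral_scales[OF scales_dil[OF D2] f] by (simp add: scaleR_conv_of_real mult_ac flip: integral_mult_right_zero)
   also have "(\<integral>q. ?f q \<partial>M) = (\<integral>q. (\<Sum>\<alpha>\<in>A. fs_kernel (G \<alpha>) h2 h1 l2 ?\<mu> ?e ?w q) \<partial>M)"
   proof (intro Bochner_Integration.integral_cong refl)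
    fix q
    let ?q = "dil n ?e (hmult n a ?w q)"
    have "exp (\<i> * of_real (l2 * F0 (co n q))) * cnj (exp (\<i> * of_real (l1 * F0 (co n ?q))))
     = exp (\<i> * of_real (l2 * (F0 (co n q) - ?\<mu> * F0 (co n ?q))))"
     using l(1) by (simp add: exp_cnj exp_add[symmetric] algebra_simps)
    then show "?f q = (\<Sum>\<alpha>\<in>A. fs_kernel (G \<alpha>) h2 h1 l2 ?\<mu> ?e ?w q)"
     unfolding ukern_def fs_kernel_def sum_distrib_right[symmetric] of_real_mult of_real_sum[symmetric] sum[OF h2]
     by (simp add: mult_ac)
   qed
   also have "\<dots> = (\<Sum>\<alpha>\<in>A. \<integral>q. fs_kernel (G \<alpha>) h2 h1 l2 ?\<mu> ?e ?w q \<partial>M)"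
   proof (intro Bochner_Integration.integral_sum)
    fix \<alpha>
    note [measurable] = measurable_amp(1)[OF X(2)[of \<alpha>] h2]
    have "ckernel n (fs_kernel (G \<alpha>) h2 h1 l2 ?\<mu> ?e ?w)"
    proof (rule ckernelI)
     show "fs_kernel (G \<alpha>) h2 h1 l2 ?\<mu> ?e ?w \<in> borel_measurable M"
      unfolding fs_kernel_def[abs_def] by measurable
     show "cmod (fs_kernel (G \<alpha>) h2 h1 l2 ?\<mu> ?e ?w p) \<le> (X ^ (2 * n + 1) * H) * H" for p
      unfolding fs_kernel_def norm_mult norm_exp_i_times norm_of_real abs_mult mult_1_right
      using amp_bound[OF X(2) h2 X(1) H] shellf_bound[OF h1] X H by (intro mult_mono) auto
     show "p \<in> ball_inf n R0" if "p \<in> hspace n" "fs_kernel (G \<alpha>) h2 h1 l2 ?\<mu> ?e ?w p \<noteq> 0" for p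
      using that amp_nz(3)[OF X(2) h2, of \<alpha> "co n p"] by (intro N0_le_ball_inf) (auto simp: fs_kernel_def)
    qed
    then show "integrable M (%q. fs_kernel (G \<alpha>) h2 h1 l2 ?\<mu> ?e ?w q)" by (rule ckernel_integrable)
   qed
   also have "cmod (of_real (D1 ^ ?Q) * \<dots>) \<le> D1 ^ ?Q * (\<Sum>\<alpha>\<in>A. C / l2 ^ m)"
    unfolding norm_mult
   proof (intro mult_mono)
    show "cmod (of_real (D1 ^ ?Q)) \<le> D1 ^ ?Q" using D(1) by (simp only: cmod_of_real_power less_imp_le order_refl)
    show "cmod (\<Sum>\<alpha>\<in>A. \<integral>q. fs_kernel (G \<alpha>) h2 h1 l2 ?\<mu> ?e ?w q \<partial>M) \<le> (\<Sum>\<alpha>\<in>A. C / l2 ^ m)"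
     using l D D2 by (intro order_trans[OF norm_sum] sum_mono C(2)[OF X(2) h2 h1]) (auto simp: divide_le_eq)
   qed (use D in auto)
   also have "\<dots> = real (card A) * C * D1 ^ ?Q / l2 ^ m" by simp
   finally show "cmod (\<integral>q. T h2 l2 D2 q * cnj (T h1 l1 D1 (hmult n a w q)) \<partial>M) \<le>
    real (card A) * C * D1 ^ ?Q / l2 ^ m" .
  qed (use C in auto)
 qed
 then show ?thesis using \<mu>0 by blast
qed

lemma conv_tilde_eq:
 assumes "w \<in> hspace n"
 shows "conv n a L (tilde n K) w = (\<integral>q. L q * cnj (K (hmult n a (hinv n w) q)) \<partial>M)"
 unfolding conv_def using assms
 by (intro Bochner_Integration.integral_cong refl) (simp add: tilde_def hinv_hmult space_hmeasure mult.commute)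

text \<open>A left translation moves \<open>w\<close> to the other factor. Whatever the order of
  composition, the fast kernel can thus be kept at the untranslated point.\<close>

lemma conv_tilde_swap:
 assumes K: "ckernel n K" and L: "ckernel n L" and w: "w \<in> hspace n"
 shows "conv n a L (tilde n K) w = cnj (\<integral>q. K q * cnj (L (hmult n a w q)) \<partial>M)"
proof -
 note [measurable] = ckernel_measurable[OF K] ckernel_measurable[OF L]
 have [measurable]: "hinv n w \<in> space M" by (simp add: space_hmeasure)
 have "(\<integral>q. L q * cnj (K (hmult n a (hinv n w) q)) \<partial>M) = (\<integral>q. L (hmult n a w q) * cnj (K (hmult n a (hinv n w) (hmult n a w q))) \<partial>M)"
  by (subst integral_scales[OF scales_left[of n a w]]) auto
 also have "\<dots> = (\<integral>q. cnj (K q * cnj (L (hmult n a w q))) \<partial>M)"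
  by (intro Bochner_Integration.integral_cong refl) (simp add: space_hmeasure mult.commute)
 finally show ?thesis using w unfolding Bochner_Integration.integral_cnj[symmetric] by (simp only: conv_tilde_eq)
qed

lemma conv_T_support:
 assumes "shellf m H h1" "1 \<le> D1" "shellf m H h2" "1 \<le> D2" "w \<in> hspace n"
  and "conv n a (T h1 l1 D1) (tilde n (T h2 l2 D2)) w \<noteq> 0"
 shows "w \<in> ball_inf n (R0 + R0 + 4 * \<bar>a\<bar> * real n * R0 * R0)"
proof -
 obtain q where q: "q \<in> hspace n" "tilde n (T h2 l2 D2) (hmult n a (hinv n q) w) * T h1 l1 D1 q \<noteq> 0"
  using assms(6) Bochner_Integration.integral_cong[OF refl, of "M" "%q. tilde n (T h2 l2 D2) (hmult n a (hinv n q) w) * T h1 l1 D1 q" "%q. 0"]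
  unfolding conv_def by (auto simp: space_hmeasure)
 then have "q \<in> ball_inf n R0" "hmult n a (hinv n q) w \<in> ball_inf n R0"
  using assms by (auto simp: tilde_T intro: T_support)
 from hmult_ball_inf[OF this, of a] show ?thesis using assms(5) by simp
qed

text \<open>For \<open>1 \<le> D1\<close> and \<open>D1 \<le> D2\<close> all composed kernels live
  in one fixed ball, so the pointwise bound integrates to an \<open>L\<^sup>1\<close> bound at the
  cost of its volume.\<close>

lemma offdiag_norm_L1:
 assumes p: "bump p"
 shows "\<exists>\<mu>0>0. \<forall>H m. 0 \<le> H --> (\<exists>C\<ge>0. offdiag m H \<mu>0 C)"
proof -
 obtain \<mu>0 where \<mu>0: "0 < \<mu>0" and est: "\<And>H m. 0 \<le> H ==> (\<exists>C\<ge>0. slow_pair m H \<mu>0 C)"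
  using fast_slow_pairing[OF p] by blast
 define R where "R = R0 + R0 + 4 * \<bar>a\<bar> * real n * R0 * R0"
 have R: "0 \<le> R" using R0_pos by (simp add: R_def)
 have "\<exists>C\<ge>0. offdiag m H \<mu>0 C"
  if H: "0 \<le> H" for H m
 proof -
  obtain C where "0 \<le> C" "slow_pair m H \<mu>0 C" using est[OF H] by blast
  note C = this(1) this(2)[unfolded slow_pair_def, rule_format]
  show ?thesis
   unfolding offdiag_def
  proof (intro exI[of _ "C * (2 * R) ^ (2 * n + 1)"], rule conjI, goal_cases)
   case 1
   then show ?case using C R by simp
  next
   case 2
   show ?case
   proof (intro allI impI)
    fix h1 h2 and l1 l2 D1 D2 :: real
    assume h1: "shellf m H h1" and h2: "shellf m H h2" and l: "0 < l2" "0 \<le> l1" "l1 \<le> \<mu>0 * l2"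
     and D: "1 \<le> D1" "D1 \<le> D2"
    have D': "0 < D1" "0 < D2" "1 \<le> D2" using D by auto
    let ?B = "C * D1 ^ (2 * n + 2) / l2 ^ m"
    have B: "0 \<le> ?B" using C l D by simp
    note c1 = ckernel_T[OF h1 D'(1), of l1] and c2 = ckernel_T[OF h2 D'(2), of l2]
    have "norm_L1 n (conv n a (T h2 l2 D2) (tilde n (T h1 l1 D1))) \<le> ?B * (2 * R) ^ (2 * n + 1)"
    proof (rule norm_L1_bound[OF ckernel_conv[OF c2 ckernel_tilde[OF c1]] _ B R])
     fix w assume w: "w \<in> hspace n"
     show "cmod (conv n a (T h2 l2 D2) (tilde n (T h1 l1 D1)) w) \<le> ?B"
      unfolding conv_tilde_eq[OF w] by (rule C(2)[OF h1 h2 l D'(1) D(2)]) simp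
     show "w \<in> ball_inf n R" if "conv n a (T h2 l2 D2) (tilde n (T h1 l1 D1)) w \<noteq> 0"
      unfolding R_def by (rule conv_T_support[OF h2 D'(3) h1 D(1) w that])
    qed
    moreover have "norm_L1 n (conv n a (T h1 l1 D1) (tilde n (T h2 l2 D2))) \<le> ?B * (2 * R) ^ (2 * n + 1)"
    proof (rule norm_L1_bound[OF ckernel_conv[OF c1 ckernel_tilde[OF c2]] _ B R])
     fix w assume w: "w \<in> hspace n"
     show "cmod (conv n a (T h1 l1 D1) (tilde n (T h2 l2 D2)) w) \<le> ?B"
      unfolding conv_tilde_swap[OF c2 c1 w] complex_mod_cnj by (rule C(2)[OF h1 h2 l D'(1) D(2) w])
     show "w \<in> ball_inf n R" if "conv n a (T h1 l1 D1) (tilde n (T h2 l2 D2)) w \<noteq> 0"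
      unfolding R_def by (rule conv_T_support[OF h1 D(1) h2 D'(3) w that])
    qed
    ultimately show "norm_L1 n (conv n a (T h2 l2 D2) (tilde n (T h1 l1 D1))) \<le> C * (2 * R) ^ (2 * n + 1) * D1 ^ (2 * n + 2) / l2 ^ m \<and>
     norm_L1 n (conv n a (T h1 l1 D1) (tilde n (T h2 l2 D2))) \<le> C * (2 * R) ^ (2 * n + 1) * D1 ^ (2 * n + 2) / l2 ^ m"
     by (simp add: mult_ac)
   qed
  qed
 qed
 then show ?thesis using \<mu>0 by blast
qed

end

section \<open>Convergence of almost orthogonal series\<close>

lemma L2_limit_unique:
 assumes f: "\<And>N. square_integrable M (f N)" and g: "square_integrable M g" and h: "square_integrable M h"
  and lim: "(%N. norm_L2 M (%p. f N p - g p)) \<longlonglongrightarrow> 0" "(%N. norm_L2 M (%p. f N p - h p)) \<longlonglongrightarrow> 0"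
 shows "AE p in M. g p = h p"
proof -
 have gh: "square_integrable M (%p. g p - h p)" by (rule square_integrable_diff[OF g h])
 have "norm_L2 M (%p. g p - h p) \<le> norm_L2 M (%p. f N p - g p) + norm_L2 M (%p. f N p - h p)" for N
  using square_integrable_diff(2)[OF square_integrable_diff(1)[OF f h] square_integrable_diff(1)[OF f g], of N N]
  by (simp add: algebra_simps)
 then have "norm_L2 M (%p. g p - h p) \<le> 0 + 0"
  by (intro LIMSEQ_le_const[OF tendsto_add[OF lim]]) auto
 then have "norm_L2 M (%p. g p - h p) = 0" using norm_L2_nonneg[of M "%p. g p - h p"] by linarith
 from norm_L2_eq_0[OF gh this] show ?thesis by simp
qed

text \<open>Convergence in norm alone would give pointwise convergence along a subsequence only;
  summability of the norms gives it for the whole series.\<close>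

lemma AE_tendsto_L2_series:
 assumes u: "\<And>k. square_integrable M (u k)" and s: "summable (%k. norm_L2 M (u k))"
  and g: "square_integrable M g" and lim: "(%N. norm_L2 M (%p. (\<Sum>k<N. u k p) - g p)) \<longlonglongrightarrow> 0"
 shows "AE p in M. (%N. \<Sum>k\<le>N. u k p) \<longlonglongrightarrow> g p"
proof -
 have "AE p in M. (\<Sum>k. u k p) = g p"
 proof (rule L2_limit_unique[OF _ Riesz_Fischer_series(2)[OF u s] g _ lim])
  show "square_integrable M (%p. \<Sum>k<N. u k p)" for N
   by (rule conjunct1[OF square_integrable_sum[where f = u, OF _ u]]) simp
  show "(%N. norm_L2 M (%p. (\<Sum>k<N. u k p) - (\<Sum>k. u k p))) \<longlonglongrightarrow> 0"
   using Riesz_Fischer_series(3)[OF u s] by (simp add: norm_L2_minus_commute)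
 qed
 with Riesz_Fischer_series(1)[OF u s] show ?thesis
 proof eventually_elim
  case (elim p)
  then have "(%N. \<Sum>k<Suc N. u k p) \<longlonglongrightarrow> g p" using summable_LIMSEQ LIMSEQ_Suc by fastforce
  then show ?case by (simp add: lessThan_Suc_atMost)
 qed
qed

lemma conv_cnj: "conv n a (%q. cnj (L q)) (%q. cnj (K q)) p = cnj (conv n a L K p)"
 unfolding conv_def Bochner_Integration.integral_cnj[symmetric] by simp

lemma square_integrable_cnj: "square_integrable M f ==> square_integrable M (%p. cnj (f p))"
 unfolding square_integrable_def by (auto intro: borel_measurable_cnj)

lemma norm_L2_cnj[simp]: "norm_L2 M (%p. cnj (f p)) = norm_L2 M f"
 by (simp add: norm_L2_def)

lemma norm_L2_cong: "(\<And>p. p \<in> space M ==> f p = g p) ==> norm_L2 M f = norm_L2 M g"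
 unfolding norm_L2_def by (intro arg_cong[where f = sqrt] Bochner_Integration.integral_cong refl) simp

lemma conv_linear:
 assumes f: "square_integrable (hmeasure n) f" and g: "square_integrable (hmeasure n) g" and K: "ckernel n K" and p: "p \<in> hspace n"
 shows "conv n a (%q. f q + c * g q) K p = conv n a f K p + c * conv n a g K p"
proof -
 have "conv n a (%q. f q + c * g q) K p = (\<integral>q. K (hmult n a (hinv n q) p) * f q + c * (K (hmult n a (hinv n q) p) * g q) \<partial>hmeasure n)"
  unfolding conv_def by (simp add: algebra_simps)
 also have "\<dots> = conv n a f K p + c * conv n a g K p"
  unfolding conv_def using conv_integrable[OF f K p] conv_integrable[OF g K p] by simp
 finally show ?thesis .
qed

text \<open>By \<open>sym\<close> the adjoint kernels are complex conjugates, so the bounds for the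
  adjoints follow from those for the operators and one off-diagonal hypothesis serves both halves of
  the argument. The square function controls the blocks of the series, which makes the partial sums
  Cauchy.\<close>

lemma almost_orthogonal_series:
 fixes K :: "nat => hpoint => complex" and n :: nat
 defines "M \<equiv> hmeasure n"
 assumes ck: "\<And>j. ckernel n (K j)" and sym: "\<And>j p. K j (hinv n p) = K j p"
  and B: "0 \<le> B" "\<And>j f. square_integrable M f ==> norm_L2 M (conv n a f (K j)) \<le> B * norm_L2 M f"
  and D: "0 \<le> D" "\<And>j k. j + m \<le> k \<or> k + m \<le> j ==> norm_L1 n (conv n a (K k) (tilde n (K j))) \<le> D * (1/2)^j * (1/2)^k"
 shows "\<exists>S. bounded_operator_L2 M S \<and>
  (\<forall>f. square_integrable M f --> (%N. norm_L2 M (%p. (\<Sum>j<N. conv n a f (K j) p) - S f p)) \<longlonglongrightarrow> 0)"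
proof -
 have tl: "tilde n (K j) = (%p. cnj (K j p))" for j by (simp add: tilde_def sym fun_eq_iff)
 have tl2: "tilde n (%p. cnj (K j p)) = K j" for j by (simp add: tilde_def sym fun_eq_iff)
 let ?T = "%j f. conv n a f (K j)"
 let ?T' = "%j f. conv n a f (tilde n (K j))"
 let ?P = "%f N p. \<Sum>j<N. ?T j f p"
 define C0 where "C0 = 2 * real m * B\<^sup>2 + 4 * D"
 have C0: "0 \<le> C0" using B D by (simp add: C0_def)
 have T: "square_integrable M (?T j f)" if "square_integrable M f" for j f
  using Young(1)[OF _ ck] that unfolding M_def by blast
 have T': "square_integrable M (?T' j f)" if "square_integrable M f" for j f
  using Young(1)[OF _ ckernel_tilde[OF ck]] that unfolding M_def by blast
 have B': "norm_L2 M (?T' j f) \<le> B * norm_L2 M f" if "square_integrable M f" for j f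
 proof -
  have "?T' j f = (%p. cnj (?T j (%q. cnj (f q)) p))" unfolding tl conv_cnj[symmetric] by simp
  then show ?thesis using B(2)[OF square_integrable_cnj[OF that], of j] by simp
 qed
 have far1: "cmod (inner_L2 M (?T j f) (?T k g)) \<le> D * (1/2)^j * (1/2)^k * (norm_L2 M f * norm_L2 M g)"
  if "square_integrable M f" "square_integrable M g" "j + m \<le> k \<or> k + m \<le> j" for j k f g
  using that unfolding M_def
  by (intro order_trans[OF inner_conv_conv_le[OF _ _ ck ck]] mult_right_mono D(2)) auto
 have far2: "cmod (inner_L2 M (?T' j f) (?T' k g)) \<le> D * (1/2)^j * (1/2)^k * (norm_L2 M f * norm_L2 M g)"
  if "square_integrable M f" "square_integrable M g" "j + m \<le> k \<or> k + m \<le> j" for j k f g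
 proof -
  have "conv n a (tilde n (K k)) (tilde n (tilde n (K j))) = (%p. cnj (conv n a (K k) (tilde n (K j)) p))"
   unfolding conv_cnj[symmetric] tl by (simp add: tl2)
  then have "norm_L1 n (conv n a (tilde n (K k)) (tilde n (tilde n (K j)))) = norm_L1 n (conv n a (K k) (tilde n (K j)))"
   by (simp add: norm_L1_def)
  then show ?thesis using that D(2)[OF that(3)] unfolding M_def
   by (intro order_trans[OF inner_conv_conv_le[OF _ _ ckernel_tilde[OF ck] ckernel_tilde[OF ck]]] mult_right_mono) auto
 qed
 have adj: "inner_L2 M (?T j f) g = inner_L2 M f (?T' j g)" if "square_integrable M f" "square_integrable M g" for j f g
  using conv_adjoint[OF _ _ ck] that unfolding M_def by blast
 have sq: "(\<Sum>j\<in>A. (norm_L2 M (?T j f))\<^sup>2) \<le> C0 * (norm_L2 M f)\<^sup>2" if "square_integrable M f" "finite A" for f A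
  unfolding C0_def by (rule square_function_bound[where T = ?T and T' = ?T', OF T T' adj B(1) B' D(1) far2 that])
 have ao: "(norm_L2 M (%p. \<Sum>j\<in>A. ?T j f p))\<^sup>2 \<le>
   2 * real m * (\<Sum>j\<in>A. (norm_L2 M (?T j f))\<^sup>2) + 4 * D * (norm_L2 M f)\<^sup>2 * (1/2)^J"
  if "square_integrable M f" "finite A" "\<And>j. j \<in> A ==> J \<le> j" for f A J
  using far1[OF that(1) that(1)] that
  by (intro almost_orthogonal_sum[where T = ?T] T) (auto simp: D power2_eq_square)
 have P: "square_integrable M (?P f N)" if "square_integrable M f" for f N
  by (rule conjunct1[OF square_integrable_sum[where f = "%j. ?T j f"]]) (auto intro: T that)
 have lim: "\<exists>g. square_integrable M g \<and> (%N. norm_L2 M (%p. ?P f N p - g p)) \<longlonglongrightarrow> 0" if f: "square_integrable M f" for f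
 proof (rule L2_complete[of M "?P f", OF P[OF f]])
  fix e :: real assume e: "0 < e"
  let ?s = "%j. (norm_L2 M (?T j f))\<^sup>2"
  have "summable ?s"
   by (rule bounded_imp_summable[of _ "C0 * (norm_L2 M f)\<^sup>2"]) (use sq[OF f] in auto)
  \<comment> \<open>This threshold keeps \<open>2 * real m\<close> times any later block of the
    square sum below \<open>e\<^sup>2 / 4\<close>.\<close>
  then have "\<forall>\<^sub>F N in sequentially. dist (sum ?s {..<N}) (suminf ?s) < e\<^sup>2 / (8 * (real m + 1))"
   using e by (intro tendstoD summable_LIMSEQ) auto
  moreover have "(%N. 4 * D * (norm_L2 M f)\<^sup>2 * (1/2)^N) \<longlonglongrightarrow> 4 * D * (norm_L2 M f)\<^sup>2 * 0"
   by (intro tendsto_intros LIMSEQ_power_zero) auto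
  then have "\<forall>\<^sub>F N in sequentially. 4 * D * (norm_L2 M f)\<^sup>2 * (1/2)^N < e\<^sup>2 / 2"
   using e by (intro order_tendstoD(2)) auto
  ultimately have "\<forall>\<^sub>F N in sequentially. dist (sum ?s {..<N}) (suminf ?s) < e\<^sup>2 / (8 * (real m + 1)) \<and>
    4 * D * (norm_L2 M f)\<^sup>2 * (1/2)^N < e\<^sup>2 / 2" by (rule eventually_conj)
  then obtain N0 where N0: "\<And>N. N \<ge> N0 ==> dist (sum ?s {..<N}) (suminf ?s) < e\<^sup>2 / (8 * (real m + 1))"
   "\<And>N. N \<ge> N0 ==> 4 * D * (norm_L2 M f)\<^sup>2 * (1/2)^N < e\<^sup>2 / 2"
   unfolding eventually_sequentially by blast
  have main: "norm_L2 M (%p. ?P f l p - ?P f k p) < e" if kl: "N0 \<le> k" "k \<le> l" for k l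
  proof -
   have "sum ?s {..<k} + sum ?s {k..<l} = sum ?s {..<l}"
    using kl sum.atLeastLessThan_concat[of 0 k l ?s] by (simp add: lessThan_atLeast0)
   also have "\<dots> \<le> suminf ?s" by (rule sum_le_suminf[OF \<open>summable ?s\<close>]) auto
   finally have "sum ?s {k..<l} \<le> e\<^sup>2 / (8 * (real m + 1))" using N0(1)[OF kl(1)] by (simp add: dist_real_def abs_less_iff)
   then have "2 * real m * sum ?s {k..<l} \<le> 2 * real m * (e\<^sup>2 / (8 * (real m + 1)))" by (intro mult_left_mono) auto
   also have "\<dots> = e\<^sup>2 * (real m / (real m + 1)) / 4" by (simp add: field_simps)
   also have "\<dots> \<le> e\<^sup>2 * 1 / 4" by (intro divide_right_mono mult_left_mono) (auto simp: divide_le_eq)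
   finally have s: "2 * real m * sum ?s {k..<l} \<le> e\<^sup>2 / 4" by simp
   have "(%p. ?P f l p - ?P f k p) = (%p. \<Sum>j\<in>{k..<l}. ?T j f p)"
   proof
    fix p
    show "?P f l p - ?P f k p = (\<Sum>j\<in>{k..<l}. ?T j f p)"
     using kl sum.atLeastLessThan_concat[of 0 k l "%j. ?T j f p"] by (simp add: lessThan_atLeast0 algebra_simps)
   qed
   then have "(norm_L2 M (%p. ?P f l p - ?P f k p))\<^sup>2 \<le> 2 * real m * sum ?s {k..<l} + 4 * D * (norm_L2 M f)\<^sup>2 * (1/2)^k"
    using ao[OF f, of "{k..<l}" k] by simp
   also have "\<dots> < e\<^sup>2" using s N0(2)[OF kl(1)] zero_less_power[OF e, of 2] by linarith
   finally show ?thesis using e by (simp add: power2_less_imp_less)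
  qed
  show "\<exists>N. \<forall>k\<ge>N. \<forall>l\<ge>N. norm_L2 M (%p. ?P f k p - ?P f l p) < e"
  proof (intro exI[of _ N0] allI impI)
   fix k l assume "N0 \<le> k" "N0 \<le> l"
   then show "norm_L2 M (%p. ?P f k p - ?P f l p) < e"
    using main[of k l] main[of l k] norm_L2_minus_commute[of M "?P f l" "?P f k"] by (cases "k \<le> l") auto
  qed
 qed
 \<comment> \<open>The limit is chosen separately for each representative, so linearity holds almost
   everywhere only, by uniqueness of limits in norm.\<close>
 define S where "S f = (SOME g. square_integrable M g \<and> (%N. norm_L2 M (%p. ?P f N p - g p)) \<longlonglongrightarrow> 0)" for f
 have S: "square_integrable M (S f)" "(%N. norm_L2 M (%p. ?P f N p - S f p)) \<longlonglongrightarrow> 0" if "square_integrable M f" for f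
  using someI_ex[OF lim[OF that]] unfolding S_def by auto
 have "bounded_operator_L2 M S"
  unfolding bounded_operator_L2_def
 proof (intro conjI allI impI)
  fix f g :: "hpoint => complex" and c
  assume f: "square_integrable M f" and g: "square_integrable M g"
  let ?h = "%q. f q + c * g q"
  have h: "square_integrable M ?h" by (intro square_integrable_add square_integrable_cmult f g)
  have cSg: "square_integrable M (%p. c * S g p)" by (intro square_integrable_cmult S g)
  have SS: "square_integrable M (%p. S f p + c * S g p)" by (intro square_integrable_add S f cSg)
  have "(%N. norm_L2 M (%p. ?P ?h N p - (S f p + c * S g p))) \<longlonglongrightarrow> 0"
  proof (rule tendsto_sandwich[OF _ _ tendsto_const])
   show "(%N. norm_L2 M (%p. ?P f N p - S f p) + cmod c * norm_L2 M (%p. ?P g N p - S g p)) \<longlonglongrightarrow> 0"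
    using tendsto_add[OF S(2)[OF f] tendsto_mult[OF tendsto_const[of "cmod c"] S(2)[OF g]]] by simp
   show "\<forall>\<^sub>F N in sequentially. norm_L2 M (%p. ?P ?h N p - (S f p + c * S g p)) \<le>
    norm_L2 M (%p. ?P f N p - S f p) + cmod c * norm_L2 M (%p. ?P g N p - S g p)"
   proof (intro always_eventually allI)
    fix N
    have "norm_L2 M (%p. ?P ?h N p - (S f p + c * S g p)) =
     norm_L2 M (%p. (?P f N p - S f p) + c * (?P g N p - S g p))"
    proof (rule norm_L2_cong)
     fix p assume "p \<in> space M"
     then have "?P ?h N p = ?P f N p + c * ?P g N p"
      using conv_linear[OF f[unfolded M_def] g[unfolded M_def] ck]
      by (simp add: M_def space_hmeasure sum.distrib sum_distrib_left)
     then show "?P ?h N p - (S f p + c * S g p) = (?P f N p - S f p) + c * (?P g N p - S g p)"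
      by (simp add: algebra_simps)
    qed
    also have "\<dots> \<le> norm_L2 M (%p. ?P f N p - S f p) + norm_L2 M (%p. c * (?P g N p - S g p))"
     by (intro square_integrable_add square_integrable_cmult square_integrable_diff P S f g)
    also have "norm_L2 M (%p. c * (?P g N p - S g p)) = cmod c * norm_L2 M (%p. ?P g N p - S g p)"
     by (intro square_integrable_cmult square_integrable_diff P S g)
    finally show "norm_L2 M (%p. ?P ?h N p - (S f p + c * S g p)) \<le>
     norm_L2 M (%p. ?P f N p - S f p) + cmod c * norm_L2 M (%p. ?P g N p - S g p)" .
   qed
  qed auto
  from L2_limit_unique[OF P[OF h] S(1)[OF h] SS S(2)[OF h] this]
  show "AE p in M. S ?h p = S f p + c * S g p" .
 next
  let ?B = "sqrt (2 * real m * C0 + 4 * D)"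
  have "norm_L2 M (S f) \<le> ?B * norm_L2 M f" if f: "square_integrable M f" for f
  proof -
   have Pb: "norm_L2 M (?P f N) \<le> ?B * norm_L2 M f" for N
   proof -
    have "(norm_L2 M (?P f N))\<^sup>2 \<le> 2 * real m * (\<Sum>j<N. (norm_L2 M (?T j f))\<^sup>2) + 4 * D * (norm_L2 M f)\<^sup>2 * (1/2)^0"
     by (rule ao[OF f]) auto
    also have "\<dots> \<le> 2 * real m * (C0 * (norm_L2 M f)\<^sup>2) + 4 * D * (norm_L2 M f)\<^sup>2"
     using mult_left_mono[OF sq[OF f, of "{..<N}"], of "2 * real m"] by simp
    also have "\<dots> = (2 * real m * C0 + 4 * D) * (norm_L2 M f)\<^sup>2" by (simp add: algebra_simps)
    finally show ?thesis using real_le_rsqrt by (fastforce simp: real_sqrt_mult)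
   qed
   have "norm_L2 M (S f) \<le> ?B * norm_L2 M f + norm_L2 M (%p. ?P f N p - S f p)" for N
    using square_integrable_diff(2)[OF P[OF f, of N] square_integrable_diff(1)[OF P[OF f, of N] S(1)[OF f]]] Pb[of N] by simp
   then have "norm_L2 M (S f) \<le> ?B * norm_L2 M f + 0"
    by (intro LIMSEQ_le_const[OF tendsto_add[OF tendsto_const S(2)[OF f]]]) auto
   then show ?thesis by simp
  qed
  then show "\<exists>B. \<forall>f. square_integrable M f --> square_integrable M (S f) \<and> norm_L2 M (S f) \<le> B * norm_L2 M f"
   using S(1) by blast
 qed
 then show ?thesis using S(2) by blast
qed

section \<open>Test functions\<close>

text \<open>The singletons \<open>{undefined}\<close> at the outer indices turn the box into a
  product over all indices, to which Tychonoff's theorem in the topology of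
  \<open>nat \<Rightarrow> real\<close> applies.\<close>

lemma ball_inf_PiE:
 "ball_inf n R = (\<Pi>\<^sub>E i\<in>UNIV. if i < 2 * n then {-R..R} else {undefined}) \<times> {-R..R}"
proof -
 have "(\<Pi>\<^sub>E i\<in>{..<2 * n}. {-R..R}) = (\<Pi>\<^sub>E i\<in>UNIV. if i < 2 * n then {-R..R} else {undefined})"
 proof (rule set_eqI)
  fix x :: "nat => real"
  have "(x i \<in> (if i < 2 * n then {-R..R} else {undefined})) \<longleftrightarrow> (i < 2 * n --> x i \<in> {-R..R}) \<and> (\<not> i < 2 * n --> x i = undefined)" for i
   by simp
  then show "x \<in> (\<Pi>\<^sub>E i\<in>{..<2 * n}. {-R..R}) \<longleftrightarrow> x \<in> (\<Pi>\<^sub>E i\<in>UNIV. if i < 2 * n then {-R..R} else {undefined})"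
   by (simp only: PiE_iff extensional_def all_conj_distrib Ball_def lessThan_iff mem_Collect_eq UNIV_I simp_thms)
 qed
 then show ?thesis unfolding ball_inf_def box_eq by simp
qed

lemma compact_ball_inf: "compact (ball_inf n R)"
proof -
 have "compactin (product_topology (%_. euclidean) UNIV) (\<Pi>\<^sub>E i\<in>UNIV. if i < 2 * n then {-R..R} else {undefined::real})"
  by (subst compactin_PiE) auto
 then show ?thesis unfolding ball_inf_PiE euclidean_product_topology by (auto intro: compact_Times)
qed

lemma ball_inf_subset: "ball_inf n R \<subseteq> hspace n"
 by (auto simp: ball_inf_iff)

lemma continuous_bounded_on_ball_inf:
 fixes f :: "hpoint => complex"
 assumes "continuous_on (hspace n) f"
 shows "\<exists>B\<ge>0. \<forall>p\<in>ball_inf n R. cmod (f p) \<le> B"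
proof -
 have "bounded (f ` ball_inf n R)"
  by (intro compact_imp_bounded compact_continuous_image compact_ball_inf continuous_on_subset[OF assms ball_inf_subset])
 then obtain B where B: "\<And>p. p \<in> ball_inf n R ==> cmod (f p) \<le> B" unfolding bounded_iff by blast
 show ?thesis
 proof (intro exI[of _ "max B 0"] conjI ballI)
  fix p assume "p \<in> ball_inf n R"
  from B[OF this] show "cmod (f p) \<le> max B 0" by simp
 qed simp
qed

lemma hspace_borel: "hspace n \<in> sets borel"
proof -
 have "hspace n = (\<Inter>i\<in>{2 * n..}. {p. fst p i = undefined})"
  by (auto simp: hspace_iff extensional_def)
 also have "closed \<dots>"
  by (intro closed_INT ballI closed_Collect_eq continuous_intros continuous_on_product_then_coordinatewise)
 finally show ?thesis by (rule borel_closed)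
qed

text \<open>Links the topology of the full function space, in which test functions are continuous,
  with the finite product measure: coordinates beyond \<open>2 * n\<close> are constant on
  \<open>hspace n\<close>.\<close>

lemma measurable_hmeasure_borel: "(%p. p) \<in> measurable (hmeasure n) borel"
proof -
 have "fst \<in> borel_measurable (hmeasure n)"
 proof (rule measurable_coordinatewise_then_product)
  fix i
  show "(%p. fst p i) \<in> borel_measurable (hmeasure n)"
  proof (cases "i < 2 * n")
   case False
   then have "(%p. fst p i) \<in> borel_measurable (hmeasure n) \<longleftrightarrow> (%p. undefined :: real) \<in> borel_measurable (hmeasure n)"
    by (intro measurable_cong) (auto simp: space_hmeasure hspace_iff extensional_def)
   then show ?thesis by simp
  qed (intro measurable_fst_comp measurable_ident_sets refl; simp)
 qed
 from borel_measurable_Pair[OF this measurable_snd_hmeasure] show ?thesis by simp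
qed

lemma measurable_continuous_hspace:
 fixes f :: "hpoint => complex"
 assumes "continuous_on (hspace n) f"
 shows "f \<in> borel_measurable (hmeasure n)"
proof -
 have "(%p. indicator (hspace n) p *\<^sub>R f p) \<in> borel_measurable (hmeasure n)"
  by (rule measurable_compose[OF measurable_hmeasure_borel borel_measurable_continuous_on_indicator[OF hspace_borel assms]])
 then show ?thesis
  by (rule measurable_cong[THEN iffD1, rotated]) (simp add: space_hmeasure)
qed

lemma shift_shift: "i \<le> 2 * n ==> shift n i (shift n i p h) s = shift n i p (h + s)"
 by (auto simp: shift_eq add.assoc)

text \<open>The iterated partial derivatives are continuous, hence bounded on the compact box.
  Changing one coordinate at a time stays in the box, so the mean value theorem on each segment
  yields the Lipschitz bound.\<close>

lemma test_function_bounds: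
 assumes "f \<in> test_functions n"
 shows "ckernel n f"
  and "\<exists>L\<ge>0. \<forall>p\<in>ball_inf n R. \<forall>q\<in>ball_inf n R. cmod (f p - f q) \<le> L * (\<Sum>k\<le>2 * n. \<bar>co n p k - co n q k\<bar>)"
proof -
 have sm: "smooth n f" using assms by (simp add: test_functions_def)
 have c: "continuous_on (hspace n) f" using sm by (auto simp: smooth_def dest: bspec[of _ _ "[]"])
 obtain S where S: "\<And>p. p \<in> hspace n ==> f p \<noteq> 0 ==> L2_set (fst p) {..<2 * n} \<le> S \<and> \<bar>snd p\<bar> \<le> S"
  using assms by (fastforce simp: test_functions_def)
 have supp: "p \<in> ball_inf n S" if "p \<in> hspace n" "f p \<noteq> 0" for p
  using S[OF that] order_trans[OF member_le_L2_set[of "{..<2 * n}" _ "%i. \<bar>fst p i\<bar>"], of _ S] that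
  by (intro ball_infI) (auto simp: L2_set_def)
 obtain B where B: "0 \<le> B" "\<And>p. p \<in> ball_inf n S ==> cmod (f p) \<le> B"
  using continuous_bounded_on_ball_inf[OF c] by blast
 show "ckernel n f"
 proof (rule ckernelI[OF measurable_continuous_hspace[OF c] _ supp])
  fix p assume "p \<in> hspace n"
  then show "cmod (f p) \<le> B" using B supp by (cases "f p = 0") auto
 qed
 have pd: "continuous_on (hspace n) (partial_deriv n i f)" if "i \<le> 2 * n" for i
  using sm that by (auto simp: smooth_def dest!: bspec[of _ _ "[i]"])
 have "\<forall>i\<in>{..2 * n}. \<exists>Li\<ge>0. \<forall>p\<in>ball_inf n R. cmod (partial_deriv n i f p) \<le> Li"
  using continuous_bounded_on_ball_inf[OF pd] by blast
 then obtain Li where Li: "\<And>i. i \<le> 2 * n ==> 0 \<le> Li i"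
   "\<And>i p. i \<le> 2 * n ==> p \<in> ball_inf n R ==> cmod (partial_deriv n i f p) \<le> Li i"
  unfolding bchoice_iff by auto
 define L where "L = (\<Sum>i\<le>2 * n. Li i)"
 have L: "0 \<le> L" "\<And>i. i \<le> 2 * n ==> Li i \<le> L"
  using Li(1) unfolding L_def by (auto intro!: sum_nonneg member_le_sum)
 have der: "((%s. f (shift n i p s)) has_vector_derivative partial_deriv n i f (shift n i p s)) (at s)"
  if "i \<le> 2 * n" "p \<in> hspace n" for i p s
 proof -
  have "(%h. f (shift n i (shift n i p s) h)) differentiable (at 0)"
   using sm that by (auto simp: smooth_def dest: bspec[of _ _ "[]"])
  then have "((%h. f (shift n i (shift n i p s) h)) has_vector_derivative partial_deriv n i f (shift n i p s)) (at 0)"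
   unfolding partial_deriv_def by (simp add: vector_derivative_works)
  then have "((%h. f (shift n i p (s + h))) has_vector_derivative partial_deriv n i f (shift n i p s)) (at (s - s))"
   using that by (simp add: shift_shift)
  moreover have "((%x. x - s) has_vector_derivative 1) (at s)" by (auto intro!: derivative_eq_intros)
  ultimately show ?thesis using vector_diff_chain_at[of "%x. x - s" 1 s] by (fastforce simp: o_def)
 qed
 have seg: "cmod (f (shift n i p h) - f p) \<le> L * \<bar>h\<bar>"
  if i: "i \<le> 2 * n" and p: "p \<in> ball_inf n R" "shift n i p h \<in> ball_inf n R" for i p h
 proof -
  have ph: "p \<in> hspace n" using p by (auto simp: ball_inf_iff)
  have p0: "shift n i p 0 = p" by (auto simp: shift_eq)
  have sh: "shift n i p s \<in> ball_inf n R" if s: "s \<in> closed_segment 0 h" for s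
  proof -
   obtain u where u: "0 \<le> u" "u \<le> 1" "s = u * h" using s by (auto simp: closed_segment_def)
   have "\<bar>co n (shift n i p s) k\<bar> \<le> R" if k: "k \<le> 2 * n" for k
   proof -
    have "co n (shift n i p s) k = (1 - u) * co n p k + u * co n (shift n i p h) k"
     using u k i by (auto simp: co_shift algebra_simps)
    also have "\<bar>\<dots>\<bar> \<le> (1 - u) * \<bar>co n p k\<bar> + u * \<bar>co n (shift n i p h) k\<bar>"
     using u by (intro order_trans[OF abs_triangle_ineq]) (simp add: abs_mult)
    also have "\<dots> \<le> (1 - u) * R + u * R"
     using u p k by (intro add_mono mult_left_mono) (auto simp: ball_inf_iff)
    finally show ?thesis by (simp add: algebra_simps)
   qed
   then show ?thesis using ph by (simp add: ball_inf_iff)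
  qed
  have "norm (f (shift n i p h) - f (shift n i p 0)) \<le> L * norm (h - 0)"
  proof (rule differentiable_bound[of "closed_segment 0 h" "%s. f (shift n i p s)" "%s x. x *\<^sub>R partial_deriv n i f (shift n i p s)"])
   show "((%s. f (shift n i p s)) has_derivative (%x. x *\<^sub>R partial_deriv n i f (shift n i p s))) (at s within closed_segment 0 h)" for s
    using der[OF i ph, of s] unfolding has_vector_derivative_def by (rule has_derivative_at_withinI)
   show "onorm (%x. x *\<^sub>R partial_deriv n i f (shift n i p s)) \<le> L" if "s \<in> closed_segment 0 h" for s
   proof (rule onorm_le)
    fix x :: real
    have "cmod (partial_deriv n i f (shift n i p s)) \<le> L" using Li(2)[OF i sh[OF that]] L(2)[OF i] by simp
    then show "norm (x *\<^sub>R partial_deriv n i f (shift n i p s)) \<le> L * norm x"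
     by (simp add: mult.commute[of L] mult_left_mono)
   qed
  qed auto
  then show ?thesis by (simp add: p0)
 qed
 show "\<exists>L\<ge>0. \<forall>p\<in>ball_inf n R. \<forall>q\<in>ball_inf n R. cmod (f p - f q) \<le> L * (\<Sum>k\<le>2 * n. \<bar>co n p k - co n q k\<bar>)"
 proof (intro exI[of _ L] conjI ballI L(1))
  fix p q assume p: "p \<in> ball_inf n R" and q: "q \<in> ball_inf n R"
  \<comment> \<open>A hybrid point whose first \<open>m\<close> coordinates are those of
    \<open>q\<close>.\<close>
  define P where "P m = (\<lambda>i\<in>{..<2 * n}. if i < m then fst q i else fst p i, if 2 * n < m then snd q else snd p)" for m
  have P: "P m \<in> ball_inf n R" for m
   using p q unfolding P_def by (intro ball_infI) (auto simp: abs_co_le abs_snd_le)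
  have coP: "co n (P m) k = (if k < m then co n q k else co n p k)" if "k \<le> 2 * n" for m k
   using that by (auto simp: co_def P_def)
  have eq: "P (Suc m) = shift n m (P m) (co n q m - co n p m)" if "m \<le> 2 * n" for m
   using that P[unfolded ball_inf_iff] by (intro hspace_co_eqI) (auto simp: co_shift coP)
  have "cmod (f (P m) - f p) \<le> L * (\<Sum>k<m. \<bar>co n p k - co n q k\<bar>)" if "m \<le> Suc (2 * n)" for m
   using that
  proof (induction m)
   case 0
   have "P 0 = p" using p P[unfolded ball_inf_iff] by (intro hspace_co_eqI) (auto simp: coP ball_inf_iff)
   then show ?case by simp
  next
   case (Suc m)
   have "cmod (f (P (Suc m)) - f (P m)) \<le> L * \<bar>co n q m - co n p m\<bar>"
    using Suc.prems P[of "Suc m"] unfolding eq[OF Suc.prems[unfolded Suc_le_mono]]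
    by (intro seg P) auto
   moreover have "cmod (f (P (Suc m)) - f p) \<le> cmod (f (P (Suc m)) - f (P m)) + cmod (f (P m) - f p)"
    using norm_triangle_ineq[of "f (P (Suc m)) - f (P m)" "f (P m) - f p"] by simp
   ultimately show ?case using Suc by (simp add: algebra_simps abs_minus_commute)
  qed
  from this[of "Suc (2 * n)"] have "cmod (f (P (Suc (2 * n))) - f p) \<le> L * (\<Sum>k\<le>2 * n. \<bar>co n p k - co n q k\<bar>)"
   by (simp add: lessThan_Suc_atMost)
  moreover have "P (Suc (2 * n)) = q" using q P[unfolded ball_inf_iff] by (intro hspace_co_eqI) (auto simp: coP ball_inf_iff)
  ultimately show "cmod (f p - f q) \<le> L * (\<Sum>k\<le>2 * n. \<bar>co n p k - co n q k\<bar>)" by (simp add: norm_minus_commute)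
 qed
qed

lemma norm_L2_bound:
 assumes "f \<in> borel_measurable (hmeasure n)" "0 \<le> C" "0 \<le> R" "\<And>p. p \<in> hspace n ==> cmod (f p) \<le> C"
  "\<And>p. p \<in> hspace n ==> f p \<noteq> 0 ==> p \<in> ball_inf n R"
 shows "norm_L2 (hmeasure n) f \<le> C * sqrt ((2 * R) ^ (2 * n + 1))"
proof (rule square_integrableI(2)[OF assms(1)])
 have "(\<integral>\<^sup>+p. (ennreal (cmod (f p)))\<^sup>2 \<partial>hmeasure n) \<le> (\<integral>\<^sup>+p. ennreal (C\<^sup>2) * indicator (ball_inf n R) p \<partial>hmeasure n)"
 proof (rule nn_integral_mono)
  fix p assume "p \<in> space (hmeasure n)"
  then have p: "p \<in> hspace n" by (simp add: space_hmeasure)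
  show "(ennreal (cmod (f p)))\<^sup>2 \<le> ennreal (C\<^sup>2) * indicator (ball_inf n R) p"
  proof (cases "f p = 0")
   case False
   then show ?thesis using assms(5)[OF p] assms(4)[OF p] by (simp add: ennreal_power ennreal_leI power_mono)
  qed simp
 qed
 also have "\<dots> = ennreal (C\<^sup>2) * ennreal ((2 * R) ^ (2 * n + 1))"
  by (subst nn_integral_cmult_indicator[OF sets_ball_inf]) (simp only: emeasure_ball_inf[OF assms(3)])
 also have "\<dots> = (ennreal (C * sqrt ((2 * R) ^ (2 * n + 1))))\<^sup>2"
  using assms(2,3) by (simp add: ennreal_power power_mult_distrib flip: ennreal_mult)
 finally show "(\<integral>\<^sup>+p. (ennreal (cmod (f p)))\<^sup>2 \<partial>hmeasure n) \<le> (ennreal (C * sqrt ((2 * R) ^ (2 * n + 1))))\<^sup>2" .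
qed (use assms in auto)

section \<open>The dyadic decomposition and sufficiency\<close>

lemma integral_inverse_translate:
 fixes K :: "hpoint => 'b :: {banach, second_countable_topology}"
 assumes [measurable]: "K \<in> borel_measurable (hmeasure n)" and p: "p \<in> hspace n"
 shows "(\<integral>q. K (hmult n a (hinv n q) p) \<partial>hmeasure n) = (\<integral>q. K q \<partial>hmeasure n)"
  and "integrable (hmeasure n) (%q. K (hmult n a (hinv n q) p)) \<longleftrightarrow> integrable (hmeasure n) K"
proof -
 have [measurable]: "p \<in> space (hmeasure n)" using p by (simp add: space_hmeasure)
 show "(\<integral>q. K (hmult n a (hinv n q) p) \<partial>hmeasure n) = (\<integral>q. K q \<partial>hmeasure n)"
  using integral_scales[OF scales_hinv, of "%q. K (hmult n a q p)"] integral_scales[OF scales_right, of K n a p] by simp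
 show "integrable (hmeasure n) (%q. K (hmult n a (hinv n q) p)) \<longleftrightarrow> integrable (hmeasure n) K"
  using integrable_scales[OF scales_hinv, of "%q. K (hmult n a q p)"] integrable_scales[OF scales_right, of K n a p] by simp
qed

lemma power4_powr:
 fixes x :: real
 assumes "0 < x"
 shows "(x ^ 4) powr (e / 4) = x powr e"
proof -
 have "x ^ 4 = x powr 4" using assms by simp
 then show ?thesis by (simp only: powr_powr) simp
qed

lemma norm_L1_conv_cmult:
 assumes "0 \<le> c" "0 \<le> d"
 shows "norm_L1 n (conv n a (%p. of_real c * L p) (tilde n (%p. of_real d * K p))) = c * d * norm_L1 n (conv n a L (tilde n K))"
proof -
 have "conv n a (%p. of_real c * L p) (tilde n (%p. of_real d * K p)) w = of_real (c * d) * conv n a L (tilde n K) w" for w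
  unfolding conv_def tilde_def by (subst Bochner_Integration.integral_mult_right_zero[symmetric]) (simp add: mult_ac)
 then show ?thesis using assms by (simp add: norm_L1_def norm_mult)
qed

text \<open>All growing factors are powers of \<open>2 ^ k\<close>. With \<open>m\<close> large the
  total exponent drops below -2, and one of the two factors \<open>(1/2)^k\<close> is relaxed to
  \<open>(1/2)^j\<close>.\<close>

lemma dyadic_decay:
 fixes \<alpha> \<alpha>' A \<beta> :: real
 assumes A: "\<bar>\<alpha>\<bar> \<le> A" "\<bar>\<alpha>'\<bar> \<le> A" and m: "2 * A + 2 * real n + 4 \<le> real m * \<beta>" and jk: "j \<le> k"
 shows "(2 ^ j) powr \<alpha> * (2 ^ k) powr \<alpha>' * ((2 ^ j) ^ (2 * n + 2) / ((2 ^ k) powr \<beta>) ^ m) \<le> (1 / 2) ^ j * (1 / 2 :: real) ^ k"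
proof -
 define x y :: real where "x = 2 ^ k" and "y = 2 ^ j"
 have xy: "1 \<le> y" "y \<le> x" "1 \<le> x" using jk by (auto simp: x_def y_def power_increasing)
 have 1: "y powr \<alpha> \<le> x powr A"
  using powr_mono[of \<alpha> A y] powr_mono2[of A y x] A xy by linarith
 have 2: "x powr \<alpha>' \<le> x powr A" using A xy by (intro powr_mono) auto
 have 3: "y ^ (2 * n + 2) \<le> x powr (2 * real n + 2)"
  using power_mono[of y x "2 * n + 2"] powr_realpow[of x "2 * n + 2"] xy by (simp add: add.commute)
 have 4: "(x powr \<beta>) ^ m = x powr (real m * \<beta>)"
  using xy by (simp add: powr_powr mult.commute flip: powr_realpow)
 have "y powr \<alpha> * x powr \<alpha>' * (y ^ (2 * n + 2) / (x powr \<beta>) ^ m) \<le> x powr A * x powr A * (x powr (2 * real n + 2) / x powr (real m * \<beta>))"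
  unfolding 4 using xy by (intro mult_mono divide_right_mono 1 2 3) auto
 also have "\<dots> = x powr (2 * A + 2 * real n + 2 - real m * \<beta>)" by (simp add: algebra_simps flip: powr_diff powr_add)
 also have "\<dots> \<le> x powr (- 2)" using m xy by (intro powr_mono) auto
 also have "\<dots> = 1 / x * (1 / x)" using xy by (simp add: powr_minus power2_eq_square inverse_eq_divide)
 also have "\<dots> \<le> 1 / y * (1 / x)" using xy by (intro mult_right_mono) (auto simp: frac_le)
 finally show ?thesis by (simp add: x_def y_def power_one_over)
qed

section \<open>The kernel as a sum of dyadic pieces\<close>

context heis
begin

definition rho :: "hpoint => real" where
 "rho p = root 4 (N0 (co n p))"

lemma rho_eq: "rho1 n (hscale n b p) = rho p"
proof -
 obtain x t where p: "p = (x, t)" by (cases p)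
 have "(L2_set (\<lambda>i\<in>{..<2 * n}. b * x i) {..<2 * n})\<^sup>2 = b\<^sup>2 * sq (co n p)"
  unfolding L2_set_def sq_def p co_def
  by (subst real_sqrt_pow2) (auto simp: sum_nonneg sum_distrib_left power_mult_distrib intro!: sum.cong)
 then have "L2_set (\<lambda>i\<in>{..<2 * n}. b * x i) {..<2 * n} ^ 4 = b ^ 4 * (sq (co n p))\<^sup>2"
  by (simp add: power4_eq_xxxx power2_eq_square mult_ac)
 then show ?thesis by (simp add: p rho1_def hscale_def rho_def N0_def co_def power_mult_distrib)
qed

lemma rho_nonneg: "0 \<le> rho p"
 by (simp add: rho_def N0_nonneg)

lemma N0_rho: "N0 (co n p) = rho p ^ 4"
 by (simp add: rho_def N0_nonneg)

lemma N0_dil: "N0 (co n (dil n r p)) = r ^ 4 * N0 (co n p)"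
proof -
 have "sq (co n (dil n r p)) = r\<^sup>2 * sq (co n p)"
  by (simp add: sq_def co_dil sum_distrib_left power_mult_distrib)
 then show ?thesis by (simp add: N0_def co_dil algebra_simps power_mult_distrib flip: power_mult)
qed

text \<open>The amplitude of the \<open>j\<close>-th piece as a function of \<rho> to the fourth
  power after dilation by \<open>2 ^ j\<close>. The cutoff sees the radius before dilation, hence
  the division by \<open>2 ^ j\<close>.\<close>

definition profile :: "(real => real) => (real => real) => real => nat => real => real" where
 "profile \<theta> \<psi> \<alpha> j u = \<theta> (root 4 u) * u powr ((- 2 * real n - 2 - \<alpha>) / 4) * \<psi> (root 4 u / 2 ^ j)"

definition piece :: "(real => real) => (real => real) => real => nat => hpoint => complex" where
 "piece \<theta> \<psi> \<alpha> j p = of_real ((2 ^ j) powr \<alpha>) * T (profile \<theta> \<psi> \<alpha> j) ((2 ^ j) powr \<beta>) (2 ^ j) p"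

lemma dyadic_partition_0: "dyadic_partition \<theta> ==> \<theta> 0 = 0"
 by (simp add: dyadic_partition_def)

text \<open>A count of homogeneity: of the growth \<open>2n + 2 + \<alpha>\<close> at scale
  \<open>2 ^ - j\<close> the part \<open>2n + 2\<close> is the normalisation of \<open>dk\<close>,
  so \<open>(2 ^ j) powr \<alpha>\<close> remains, and the phase acquires the frequency
  \<open>(2 ^ j) powr \<beta>\<close>.\<close>

lemma kernel_piece:
 assumes \<theta>: "dyadic_partition \<theta>"
 shows "of_real (\<theta> (2 ^ j * rho p)) * kernel n rho \<alpha> \<beta> \<psi> p = piece \<theta> \<psi> \<alpha> j p"
proof -
 define r D :: real where "r = rho p" and "D = 2 ^ j"
 have D: "0 < D" by (simp add: D_def)
 have r: "0 \<le> r" by (simp add: r_def rho_nonneg)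
 have N: "N0 (co n (dil n D p)) = (D * r) ^ 4" unfolding N0_dil r_def by (simp add: N0_rho power_mult_distrib)
 then have root: "root 4 (N0 (co n (dil n D p))) = D * r" using D r by (simp add: real_root_power_cancel)
 show ?thesis
 proof (cases "r = 0")
  \<comment> \<open>At the origin both sides vanish because \<open>\<theta> 0 = 0\<close>.\<close>
  case True
  then show ?thesis using dyadic_partition_0[OF \<theta>] root
   by (simp add: piece_def T_def dk_def ukern_def profile_def flip: r_def D_def)
 next
  case False
  with r have r0: "0 < r" by simp
  have pw: "((D * r) ^ 4) powr (e / 4) = D powr e * r powr e" for e
   using D r0 by (simp only: power4_powr mult_pos_pos powr_mult)
  have 1: "D powr \<alpha> * D ^ (2 * n + 2) * ((D * r) ^ 4) powr ((- 2 * real n - 2 - \<alpha>) / 4) = r powr (- 2 * real n - 2 - \<alpha>)"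
  proof -
   have "D ^ (2 * n + 2) = D powr (2 * real n + 2)" using D powr_realpow[of D "2 * n + 2"] by (simp add: add.commute)
   then have "D powr \<alpha> * D ^ (2 * n + 2) * D powr (- 2 * real n - 2 - \<alpha>) = D powr (\<alpha> + (2 * real n + 2) + (- 2 * real n - 2 - \<alpha>))"
    by (simp only: powr_add)
   also have "\<dots> = 1" using D by simp
   finally show ?thesis unfolding pw by (simp add: mult.assoc[symmetric])
  qed
  have 2: "D powr \<beta> * F0 (co n (dil n D p)) = r powr (- \<beta>)"
  proof -
   have "D powr \<beta> * D powr (- \<beta>) = 1" using D by (simp flip: powr_add)
   then show ?thesis unfolding F0_def N pw by (simp add: mult.assoc[symmetric])
  qed
  have "piece \<theta> \<psi> \<alpha> j p = of_real (D powr \<alpha> * D ^ (2 * n + 2) * ((D * r) ^ 4) powr ((- 2 * real n - 2 - \<alpha>) / 4)) *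
    of_real (\<theta> (D * r) * \<psi> (D * r / D)) * exp (\<i> * of_real (D powr \<beta> * F0 (co n (dil n D p))))"
   unfolding piece_def T_def dk_def ukern_def profile_def D_def[symmetric] root unfolding N by (simp add: mult_ac)
  also have "\<dots> = of_real (\<theta> (2 ^ j * rho p)) * kernel n rho \<alpha> \<beta> \<psi> p"
   unfolding 1 2 kernel_def r_def[symmetric] D_def[symmetric] using D by (simp add: mult_ac)
  finally show ?thesis ..
 qed
qed

lemma truncated_kernel_pieces:
 "dyadic_partition \<theta> ==> truncated_kernel n rho \<alpha> \<beta> \<psi> \<theta> N p = (\<Sum>j\<le>N. piece \<theta> \<psi> \<alpha> j p)"
 by (simp add: truncated_kernel_def kernel_piece)

text \<open>The bound does not depend on \<open>j\<close>: the only dependence is through the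
  division by \<open>2 ^ j\<close> inside \<psi>, which shrinks derivatives.\<close>

lemma shellf_profile:
 assumes \<theta>: "dyadic_partition \<theta>" and \<psi>: "cutoff \<psi>"
 shows "\<exists>H\<ge>0. \<forall>j. shellf m H (profile \<theta> \<psi> \<alpha> j)"
proof -
 \<comment> \<open>Wider than the support, to leave room for the extension by zero.\<close>
 let ?I = "{1/32<..<32::real}"
 obtain K1 where K1: "0 \<le> K1" "bd m UNIV K1 \<theta>"
  using smooth_real_imp_bd[of \<theta> "1/2" 2 m] \<theta> unfolding dyadic_partition_def by blast
 obtain K2 where K2: "0 \<le> K2" "bd m UNIV K2 \<psi>"
  using smooth_real_imp_bd[of \<psi> "-1" 1 m] \<psi> unfolding cutoff_def by blast
 obtain C1 where C1: "0 \<le> C1" "bd m ?I C1 (%u. u powr (1/4))" using bd_powr[of "1/32" 32] by auto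
 obtain C2 where C2: "0 \<le> C2" "bd m ?I C2 (%u. u powr ((- 2 * real n - 2 - \<alpha>) / 4))" using bd_powr[of "1/32" 32] by auto
 have root: "bd m ?I C1 (root 4)"
  by (rule bd_cong[OF _ _ C1(2)]) (auto simp: root_powr_inverse)
 obtain C3 where C3: "0 \<le> C3" "\<And>h f I J. bd m J K1 h ==> bd m I C1 f ==> f ` I \<subseteq> J ==> bd m I C3 (%s. h (f s))"
  using bd_comp[OF K1(1) C1(1)] by blast
 obtain C4 where C4: "0 \<le> C4" "\<And>h f I J. bd m J K2 h ==> bd m I C1 f ==> f ` I \<subseteq> J ==> bd m I C4 (%s. h (f s))"
  using bd_comp[OF K2(1) C1(1)] by blast
 define H where "H = 2 ^ m * (2 ^ m * C3 * C2) * C4"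
 have H: "0 \<le> H" using C2 C3 C4 by (simp add: H_def)
 have nz: "1 / 16 \<le> u \<and> u \<le> 16" if "profile \<theta> \<psi> \<alpha> j u \<noteq> 0" for j u
 proof -
  have "\<theta> (root 4 u) \<noteq> 0" using that by (auto simp: profile_def)
  then have r: "1/2 \<le> root 4 u" "root 4 u \<le> 2" using \<theta> unfolding dyadic_partition_def by force+
  then have "0 < root 4 u" by linarith
  then have "0 < u" by simp
  then have "u = root 4 u ^ 4" by simp
  moreover have "(1/2) ^ 4 \<le> root 4 u ^ 4" by (intro power_mono r) simp
  moreover have "root 4 u ^ 4 \<le> 2 ^ 4" using \<open>0 < root 4 u\<close> by (intro power_mono r) linarith
  ultimately show ?thesis by (simp add: power4_eq_xxxx)
 qed
 have "shellf m H (profile \<theta> \<psi> \<alpha> j)" for j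
  unfolding shellf_def
 proof (intro conjI allI impI)
  have "bd m ?I (\<bar>1 / 2 ^ j\<bar> * C1) (%u. 1 / 2 ^ j * root 4 u)" by (rule bd_cmult[OF root])
  then have "bd m ?I (C1 / 2 ^ j) (%u. root 4 u / 2 ^ j)" by simp
  moreover have "C1 / 2 ^ j \<le> C1" using C1(1) mult_left_mono[of 1 "2 ^ j :: real" C1] by (simp add: divide_le_eq)
  ultimately have r: "bd m ?I C1 (%u. root 4 u / 2 ^ j)" by (rule bd_mono)
  have "bd m ?I C3 (%u. \<theta> (root 4 u))" by (rule C3(2)[OF K1(2) root]) simp
  moreover have "bd m ?I C4 (%u. \<psi> (root 4 u / 2 ^ j))" by (rule C4(2)[OF K2(2) r]) simp
  ultimately have "bd m ?I H (profile \<theta> \<psi> \<alpha> j)"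
   unfolding profile_def[abs_def] H_def using C2 C3(1) C4(1) by (intro bd_mult) auto
  then show "bd m UNIV H (profile \<theta> \<psi> \<alpha> j)"
   by (rule bd_extend[where a' = "1/16" and b' = 16]) (use nz H in auto)
 qed (use nz in auto)
 then show ?thesis using H by blast
qed

context
 fixes \<theta> \<psi> :: "real => real"
 assumes \<theta>: "dyadic_partition \<theta>" and \<psi>: "cutoff \<psi>"
begin

lemma ckernel_piece: "ckernel n (piece \<theta> \<psi> \<alpha> j)"
proof -
 obtain H where "shellf 0 H (profile \<theta> \<psi> \<alpha> j)" using shellf_profile[OF \<theta> \<psi>] by blast
 then show ?thesis unfolding piece_def[abs_def] by (intro ckernel_cmult ckernel_T) auto
qed

lemma piece_hinv: "piece \<theta> \<psi> \<alpha> j (hinv n p) = piece \<theta> \<psi> \<alpha> j p"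
 by (simp add: piece_def T_hinv)

text \<open>The hypothesis says exactly that the exponent
  \<open>\<alpha> - (n + 1/2) * \<beta>\<close> of \<open>2 ^ j\<close> is at most 0.\<close>

lemma conv_piece_bound:
 assumes \<alpha>: "\<alpha> \<le> (real n + 1 / 2) * \<beta>"
 shows "\<exists>B\<ge>0. \<forall>j f. square_integrable M f -->
  norm_L2 M (conv n a f (piece \<theta> \<psi> \<alpha> j)) \<le> B * norm_L2 M f"
proof -
 obtain H where H: "0 \<le> H" "\<And>j. shellf (2 * (2 * n + 1)) H (profile \<theta> \<psi> \<alpha> j)"
  using shellf_profile[OF \<theta> \<psi>] by blast
 obtain C where C: "0 \<le> C" "\<And>h l D f. shellf (2 * (2 * n + 1)) H h ==> 0 < l ==> 0 < D ==> square_integrable M f ==>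
  norm_L2 M (conv n a f (dk n D (ukern h l))) \<le> C * l powr (- (real n + 1 / 2)) * norm_L2 M f"
  using conv_ukern_bound[OF cutoff_bump[OF \<psi>] H(1)] by blast
 show ?thesis
 proof (intro exI[of _ C] conjI allI impI C(1))
  fix j and f :: "hpoint => complex"
  assume f: "square_integrable M f"
  let ?D = "2 ^ j :: real"
  let ?K = "T (profile \<theta> \<psi> \<alpha> j) (?D powr \<beta>) ?D"
  have "ckernel n ?K" by (rule ckernel_T[OF H(2)]) simp
  have "norm_L2 M (conv n a f (piece \<theta> \<psi> \<alpha> j)) = ?D powr \<alpha> * norm_L2 M (conv n a f ?K)"
   unfolding piece_def[abs_def] conv_cmult_kernel[abs_def]
   using square_integrable_cmult(2)[OF Young(1)[OF f \<open>ckernel n ?K\<close>]] by simp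
  also have "\<dots> \<le> ?D powr \<alpha> * (C * (?D powr \<beta>) powr (- (real n + 1 / 2)) * norm_L2 M f)"
   unfolding T_def by (intro mult_left_mono C(2) H f) auto
  also have "\<dots> = ?D powr \<alpha> * (?D powr \<beta>) powr (- (real n + 1 / 2)) * (C * norm_L2 M f)" by (simp only: mult_ac)
  also have "?D powr \<alpha> * (?D powr \<beta>) powr (- (real n + 1 / 2)) = ?D powr (\<alpha> - (real n + 1 / 2) * \<beta>)"
   by (simp only: powr_powr powr_add[symmetric]) (simp add: algebra_simps)
  also have "?D powr (\<alpha> - (real n + 1 / 2) * \<beta>) * (C * norm_L2 M f) \<le> 1 * (C * norm_L2 M f)"
  proof (rule mult_right_mono)
   show "?D powr (\<alpha> - (real n + 1 / 2) * \<beta>) \<le> 1"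
    using powr_mono[of "\<alpha> - (real n + 1 / 2) * \<beta>" 0 ?D] \<alpha> by simp
  qed (use C in simp)
  finally show "norm_L2 M (conv n a f (piece \<theta> \<psi> \<alpha> j)) \<le> C * norm_L2 M f" by simp
 qed
qed

text \<open>Valid for every \<alpha>: arbitrarily many integrations by parts beat any power growth.
  Only the diagonal bound restricts \<alpha>.\<close>

lemma pieces_almost_orthogonal:
 "\<exists>D\<ge>0. \<exists>m. \<forall>j k. j + m \<le> k \<or> k + m \<le> j -->
  norm_L1 n (conv n a (piece \<theta> \<psi> \<alpha> k) (tilde n (piece \<theta> \<psi> \<alpha> j))) \<le> D * (1/2)^j * (1/2)^k"
proof -
 \<comment> \<open>The number of integrations by parts, sufficient to absorb both factors of growth
   and the volume factor and to leave geometric decay.\<close>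
 obtain m where m: "(2 * \<bar>\<alpha>\<bar> + 2 * real n + 4) / \<beta> \<le> real m" using real_arch_simple by blast
 then have m: "2 * \<bar>\<alpha>\<bar> + 2 * real n + 4 \<le> real m * \<beta>" using beta_pos by (simp add: divide_le_eq)
 obtain H where H: "0 \<le> H" "\<And>j. shellf m H (profile \<theta> \<psi> \<alpha> j)" using shellf_profile[OF \<theta> \<psi>] by blast
 obtain \<mu>0 C where \<mu>0: "0 < \<mu>0" and "0 \<le> C" "offdiag m H \<mu>0 C"
  using offdiag_norm_L1[OF cutoff_bump[OF \<psi>]] H(1) by metis
 note C = this(2) this(3)[unfolded offdiag_def, rule_format]
 have "2 powr (- \<beta>) < 1" using beta_pos powr_less_mono[of "- \<beta>" 0 "2 :: real"] by simp
 \<comment> \<open>The gap in scales from which on the ratio of frequencies is at most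
   \<open>\<mu>0\<close>.\<close>
 then obtain m0 where m0: "(2 powr (- \<beta>)) ^ m0 < \<mu>0" using real_arch_pow_inv[OF \<mu>0] by blast
 have sep: "(2 ^ j) powr \<beta> \<le> \<mu>0 * (2 ^ k) powr \<beta>" if "j + m0 \<le> k" for j k :: nat
 proof -
  have "(2 ^ j) powr \<beta> * (2 ^ m0) powr \<beta> = (2 ^ (j + m0) :: real) powr \<beta>" by (simp add: powr_mult power_add)
  also have "\<dots> \<le> (2 ^ k) powr \<beta>" using that beta_pos by (intro powr_mono2) (auto intro: power_increasing)
  finally have *: "(2 powr (- \<beta>)) ^ m0 * ((2 ^ j) powr \<beta> * (2 ^ m0) powr \<beta>) \<le> (2 powr (- \<beta>)) ^ m0 * (2 ^ k) powr \<beta>"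
   by (intro mult_left_mono) auto
  have "(2 powr (- \<beta>)) ^ m0 * (2 ^ m0) powr \<beta> = 1"
   by (simp add: powr_minus power_inverse powr_power powr_powr mult.commute flip: powr_realpow)
  then have "(2 ^ j) powr \<beta> = (2 powr (- \<beta>)) ^ m0 * (2 ^ m0) powr \<beta> * (2 ^ j) powr \<beta>" by simp
  also have "\<dots> = (2 powr (- \<beta>)) ^ m0 * ((2 ^ j) powr \<beta> * (2 ^ m0) powr \<beta>)" by (simp only: mult_ac)
  also note *
  also have "(2 powr (- \<beta>)) ^ m0 * (2 ^ k) powr \<beta> \<le> \<mu>0 * (2 ^ k) powr \<beta>" using m0 by (intro mult_right_mono) auto
  finally show ?thesis .
 qed
 let ?T = "%j. T (profile \<theta> \<psi> \<alpha> j) ((2 ^ j) powr \<beta>) (2 ^ j)"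
 have both: "norm_L1 n (conv n a (?T k) (tilde n (?T j))) \<le> C * (2 ^ j) ^ (2 * n + 2) / ((2 ^ k) powr \<beta>) ^ m"
   "norm_L1 n (conv n a (?T j) (tilde n (?T k))) \<le> C * (2 ^ j) ^ (2 * n + 2) / ((2 ^ k) powr \<beta>) ^ m"
   if "j + m0 \<le> k" for j k
  using that C(2)[OF H(2)[of j] H(2)[of k], of "(2 ^ k) powr \<beta>" "(2 ^ j) powr \<beta>" "2 ^ j" "2 ^ k"] sep[OF that] by (auto intro: power_increasing)
 have fin: "(2 ^ j) powr \<alpha> * (2 ^ k) powr \<alpha> * (C * (2 ^ j) ^ (2 * n + 2) / ((2 ^ k) powr \<beta>) ^ m) \<le> C * ((1/2)^j * (1/2)^k)"
  if "j + m0 \<le> k" for j k :: nat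
  using mult_left_mono[OF dyadic_decay[OF order_refl order_refl m, of j k] C(1)] that by (simp add: mult_ac)
 have piece: "norm_L1 n (conv n a (piece \<theta> \<psi> \<alpha> k) (tilde n (piece \<theta> \<psi> \<alpha> j))) = (2 ^ k) powr \<alpha> * (2 ^ j) powr \<alpha> * norm_L1 n (conv n a (?T k) (tilde n (?T j)))" for j k
  unfolding piece_def[abs_def] by (rule norm_L1_conv_cmult) auto
 show ?thesis
 proof (rule exI[of _ C], rule conjI[OF C(1)], rule exI[of _ m0], intro allI impI)
  fix j k assume "j + m0 \<le> k \<or> k + m0 \<le> j"
  then show "norm_L1 n (conv n a (piece \<theta> \<psi> \<alpha> k) (tilde n (piece \<theta> \<psi> \<alpha> j))) \<le> C * (1/2)^j * (1/2)^k"
  proof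
   assume jk: "j + m0 \<le> k"
   have "norm_L1 n (conv n a (piece \<theta> \<psi> \<alpha> k) (tilde n (piece \<theta> \<psi> \<alpha> j))) \<le>
     (2 ^ k) powr \<alpha> * (2 ^ j) powr \<alpha> * (C * (2 ^ j) ^ (2 * n + 2) / ((2 ^ k) powr \<beta>) ^ m)"
    unfolding piece by (intro mult_left_mono both jk) auto
   with fin[OF jk] show ?thesis by (simp add: mult_ac)
  next
   assume kj: "k + m0 \<le> j"
   have "norm_L1 n (conv n a (piece \<theta> \<psi> \<alpha> k) (tilde n (piece \<theta> \<psi> \<alpha> j))) \<le>
     (2 ^ k) powr \<alpha> * (2 ^ j) powr \<alpha> * (C * (2 ^ k) ^ (2 * n + 2) / ((2 ^ j) powr \<beta>) ^ m)"
    unfolding piece by (intro mult_left_mono both kj) auto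
   with fin[OF kj] show ?thesis by (simp add: mult_ac)
  qed
 qed
qed

section \<open>Approximation by mollifiers\<close>

text \<open>The mollifier is a shell function of \<open>N0\<close>, so with frequency 0 it is itself
  a kernel of the form \<open>T\<close> and the off-diagonal estimate applies to it as the slow
  factor. It is the squared cutoff moved into \<open>[1, 3]\<close>.\<close>

lemma exists_mollifier:
 "\<exists>\<kappa>. (\<forall>m. \<exists>H\<ge>0. shellf m H \<kappa>) \<and> (\<forall>u. 0 \<le> \<kappa> u) \<and> 0 < (\<integral>p. \<kappa> (N0 (co n p)) \<partial>M)"
proof -
 define p where "p = (%r. (\<psi> r)\<^sup>2)"
 have p: "bump p" unfolding p_def by (rule cutoff_bump[OF \<psi>])
 define \<kappa> where "\<kappa> u = p (u - 2)" for u
 have nz: "1 \<le> u \<and> u \<le> 3" if "\<kappa> u \<noteq> 0" for u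
 proof -
  have "u - 2 \<in> {-1..1}" using that p unfolding bump_def \<kappa>_def by blast
  then show ?thesis by auto
 qed
 have nn: "0 \<le> \<kappa> u" for u by (simp add: \<kappa>_def p_def)
 have sh: "\<exists>H\<ge>0. shellf m H \<kappa>" for m
 proof -
  obtain K where K: "0 \<le> K" "bd m UNIV K p" using p unfolding bump_def by blast
  obtain C where C: "0 \<le> C" "\<And>h f I J. bd m J K h ==> bd m I 2 f ==> f ` I \<subseteq> J ==> bd m I C (%s. h (f s))"
   using bd_comp[OF K(1) zero_le_numeral, of m "num.Bit0 num.One"] by blast
  have "bd m {0<..<4} 2 (%u. -2 + 1 * u)" by (intro bd_affine) auto
  from C(2)[OF K(2) this] have "bd m {0<..<4} C \<kappa>" by (simp add: \<kappa>_def[abs_def])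
  then have "bd m UNIV C \<kappa>" by (rule bd_extend[where a' = 1 and b' = 3]) (use nz C in auto)
  moreover have "1 / 16 \<le> u \<and> u \<le> 16" if "\<kappa> u \<noteq> 0" for u using nz[OF that] by simp
  ultimately show ?thesis using C(1) unfolding shellf_def by blast
 qed
 obtain H where H: "0 \<le> H" "shellf 1 H \<kappa>" using sh by blast
 have \<kappa>2: "0 < \<kappa> 2" using p by (simp add: bump_def \<kappa>_def)
 have "isCont \<kappa> 2" using bd_continuous_on[of 1 UNIV H \<kappa>] H by (simp add: shellf_def continuous_on_eq_continuous_at)
 then obtain d where d: "0 < d" "\<And>u. \<bar>u - 2\<bar> < d ==> \<kappa> 2 / 2 < \<kappa> u"
 proof -
  have "\<exists>d>0. \<forall>u. dist u 2 < d --> dist (\<kappa> u) (\<kappa> 2) < \<kappa> 2 / 2"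
   by (rule continuous_at_eps_delta[THEN iffD1, rule_format, OF \<open>isCont \<kappa> 2\<close>]) (use \<kappa>2 in simp)
  then obtain d where "d > 0" and d: "\<forall>u. dist u 2 < d --> dist (\<kappa> u) (\<kappa> 2) < \<kappa> 2 / 2" by blast
  show ?thesis
  proof (rule that[OF \<open>d > 0\<close>])
   fix u :: real assume "\<bar>u - 2\<bar> < d"
   then have "dist (\<kappa> u) (\<kappa> 2) < \<kappa> 2 / 2" using d by (simp add: dist_real_def)
   then show "\<kappa> 2 / 2 < \<kappa> u" unfolding dist_real_def abs_less_iff by linarith
  qed
 qed
 \<comment> \<open>A point of the \<open>t\<close>-axis at the centre of the moved bump; a small box
   around it makes the integral positive.\<close>
 define y0 :: "nat => real" where "y0 = (%k. if k = 2 * n then sqrt 2 / \<bar>b\<bar> else 0)"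
 have y0: "N0 y0 = 2"
  using b_nz by (simp add: N0_def sq_def y0_def power_divide)
 obtain CL where CL: "0 \<le> CL" "\<And>y z \<eta>. 0 \<le> \<eta> ==> (\<forall>k\<le>2 * n. \<bar>y k\<bar> \<le> R0 + 1 \<and> \<bar>z k\<bar> \<le> R0 + 1) ==> near \<eta> y z ==> \<bar>N0 y - N0 z\<bar> \<le> CL * \<eta>"
  using N0_lipschitz[of "R0 + 1"] R0_pos by force
 define \<eta> where "\<eta> = min 1 (d / (2 * (CL + 1)))"
 have \<eta>: "0 < \<eta>" "\<eta> \<le> 1" using d CL by (auto simp: \<eta>_def)
 have "(CL + 1) * \<eta> \<le> (CL + 1) * (d / (2 * (CL + 1)))" unfolding \<eta>_def using CL by (intro mult_left_mono) auto
 also have "\<dots> = d / 2" using CL by (simp add: field_simps)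
 finally have \<eta>d: "CL * \<eta> < d" using \<eta> d by (simp add: algebra_simps)
 let ?E = "box n (%k. y0 k - \<eta>) (%k. y0 k + \<eta>)"
 have large: "\<kappa> 2 / 2 \<le> \<kappa> (N0 (co n p))" if "p \<in> ?E" for p
 proof -
  have y0R: "\<bar>y0 k\<bar> \<le> R0" if "k \<le> 2 * n" for k using abs_le_R0[of y0] y0 that by simp
  have nr: "\<bar>co n p k - y0 k\<bar> \<le> \<eta>" if "k \<le> 2 * n" for k
   using \<open>p \<in> ?E\<close> that by (auto simp: box_def abs_le_iff algebra_simps)
  have "\<bar>N0 (co n p) - N0 y0\<bar> \<le> CL * \<eta>"
  proof (rule CL(2))
   show "\<forall>k\<le>2 * n. \<bar>co n p k\<bar> \<le> R0 + 1 \<and> \<bar>y0 k\<bar> \<le> R0 + 1"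
   proof (intro allI impI)
    fix k assume "k \<le> 2 * n"
    from y0R[OF this] nr[OF this] \<eta> show "\<bar>co n p k\<bar> \<le> R0 + 1 \<and> \<bar>y0 k\<bar> \<le> R0 + 1" by linarith
   qed
  qed (use nr \<eta> in \<open>auto simp: near_def\<close>)
  then show ?thesis using d(2)[of "N0 (co n p)"] \<eta>d y0 by simp
 qed
 let ?g = "%p. \<kappa> (N0 (co n p))"
 have int: "integrable M ?g"
 proof -
  have "integrable M (%p. Re (ukern \<kappa> 0 p))"
   by (intro integrable_Re ckernel_integrable ckernel_ukern[OF H(2)])
  then show ?thesis by (simp add: ukern_def)
 qed
 have mE: "0 < measure M ?E" "emeasure M ?E < \<infinity>"
 proof -
  have e: "emeasure M ?E = ennreal (\<Prod>k\<le>2 * n. 2 * \<eta>)"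
   by (subst emeasure_box) (use \<eta> in auto)
  then show "emeasure M ?E < \<infinity>" by (simp only: e) simp
  show "0 < measure M ?E" unfolding measure_def e using \<eta> by (simp add: prod_pos)
 qed
 have "0 < (\<kappa> 2 / 2) * measure M ?E" using \<kappa>2 mE by simp
 also have "\<dots> = (\<integral>p. (\<kappa> 2 / 2) * indicator ?E p \<partial>M)"
  using sets.sets_into_space[OF sets_box] by (simp add: Int_absorb2)
 also have "\<dots> \<le> (\<integral>p. ?g p \<partial>M)"
 proof (rule integral_mono[OF _ int])
  show "integrable M (%p. \<kappa> 2 / 2 * indicator ?E p)"
   using mE by (intro integrable_mult_right integrable_real_indicator sets_box) auto
  show "\<kappa> 2 / 2 * indicator ?E p \<le> ?g p" for p using large[of p] nn by (auto simp: indicator_def)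
 qed
 finally show ?thesis using sh nn by blast
qed

end

lemma integral_dk:
 assumes [measurable]: "K \<in> borel_measurable (hmeasure n)" and D: "0 < D"
 shows "(\<integral>p. dk n D K p \<partial>hmeasure n) = (\<integral>p. K p \<partial>hmeasure n)"
 unfolding integral_scales[OF scales_dil[OF D] assms(1)] dk_def by (simp add: scaleR_conv_of_real)

lemma T_support_scaled:
 assumes "shellf m H h" "1 \<le> D" "T h l D p \<noteq> 0" "k \<le> 2 * n"
 shows "\<bar>co n p k\<bar> \<le> R0 / D"
proof -
 have "h (N0 (co n (dil n D p))) \<noteq> 0" using assms(3) by (auto simp: T_def dk_def ukern_def)
 then have "N0 (co n (dil n D p)) \<le> 16" using assms(1) by (auto simp: shellf_def)
 from abs_le_R0[OF this assms(4)] have "\<bar>if k < 2 * n then D else D\<^sup>2\<bar> * \<bar>co n p k\<bar> \<le> R0"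
  by (simp add: co_dil[OF assms(4)] abs_mult)
 moreover have "D * \<bar>co n p k\<bar> \<le> \<bar>if k < 2 * n then D else D\<^sup>2\<bar> * \<bar>co n p k\<bar>"
  using assms(2) self_le_power[of D 2] by (intro mult_right_mono) auto
 ultimately show ?thesis using assms(2) by (simp add: le_divide_eq mult.commute)
qed

lemma translation_modulus:
 assumes p: "p \<in> ball_inf n R" and w: "w \<in> hspace n" "\<And>k. k \<le> 2 * n ==> \<bar>co n w k\<bar> \<le> \<epsilon>" and R: "0 \<le> R"
 shows "(\<Sum>k\<le>2 * n. \<bar>co n p k - co n (hmult n a p (hinv n w)) k\<bar>) \<le> (2 * real n + 1) * (1 + 4 * \<bar>a\<bar> * real n * R) * \<epsilon>"
proof -
 have \<epsilon>: "0 \<le> \<epsilon>" using w(2)[of 0] by simp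
 have c: "1 \<le> 1 + 4 * \<bar>a\<bar> * real n * R" using R by simp
 have "\<bar>co n p k - co n (hmult n a p (hinv n w)) k\<bar> \<le> (1 + 4 * \<bar>a\<bar> * real n * R) * \<epsilon>" if k: "k \<le> 2 * n" for k
 proof (cases "k < 2 * n")
  case True
  then have "\<bar>co n p k - co n (hmult n a p (hinv n w)) k\<bar> \<le> 1 * \<epsilon>"
   using w(2)[OF k] by (simp add: co_def hmult_eq hinv_eq)
  also have "\<dots> \<le> (1 + 4 * \<bar>a\<bar> * real n * R) * \<epsilon>" by (rule mult_right_mono[OF c \<epsilon>])
  finally show ?thesis .
 next
  case False
  with k have k2: "k = 2 * n" by simp
  have "\<bar>fst w i\<bar> \<le> \<epsilon>" if "i < 2 * n" for i using w(2)[of i] that by (simp add: co_def)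
  then have "\<bar>symp n (fst p) (fst w)\<bar> \<le> 2 * real n * R * \<epsilon>"
   using p R by (intro abs_symp_le) (auto simp: abs_co_le)
  then have s: "2 * \<bar>a\<bar> * \<bar>symp n (fst p) (fst w)\<bar> \<le> 2 * \<bar>a\<bar> * (2 * real n * R * \<epsilon>)" by (intro mult_left_mono) auto
  have "co n p k - co n (hmult n a p (hinv n w)) k = co n w k - 2 * a * symp n (fst p) (fst w)"
   by (simp add: k2 co_def hmult_eq hinv_eq symp_minus_right)
  also have "\<bar>\<dots>\<bar> \<le> \<bar>co n w k\<bar> + \<bar>2 * a * symp n (fst p) (fst w)\<bar>" by (rule abs_triangle_ineq4)
  also have "\<bar>2 * a * symp n (fst p) (fst w)\<bar> = 2 * \<bar>a\<bar> * \<bar>symp n (fst p) (fst w)\<bar>" by (simp add: abs_mult)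
  also have "\<bar>co n w k\<bar> + \<dots> \<le> \<epsilon> + 2 * \<bar>a\<bar> * (2 * real n * R * \<epsilon>)" by (rule add_mono[OF w(2)[OF k] s])
  finally show ?thesis by (simp add: algebra_simps)
 qed
 then have "(\<Sum>k\<le>2 * n. \<bar>co n p k - co n (hmult n a p (hinv n w)) k\<bar>) \<le> (\<Sum>k\<le>2 * n. (1 + 4 * \<bar>a\<bar> * real n * R) * \<epsilon>)"
  by (intro sum_mono) auto
 then show ?thesis by (simp add: add.commute mult.assoc)
qed

text \<open>The mollifier has mass 1 and support of size O(\<open>2 ^ - j\<close>), so the Lipschitz
  bound for \<open>f\<close> gives the rate pointwise; compact support then transfers it to the
  norm.\<close>

lemma mollifier_approx:
 assumes sh: "shellf m H \<kappa>" and nn: "\<And>u. 0 \<le> \<kappa> u" and Z: "0 < (\<integral>p. \<kappa> (N0 (co n p)) \<partial>hmeasure n)" (is "0 < ?Z")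
  and f: "f \<in> test_functions n"
 shows "\<exists>C\<ge>0. \<forall>j. norm_L2 (hmeasure n) (%p. f p - conv n a f (%p. of_real (1 / ?Z) * T \<kappa> 0 (2 ^ j) p) p) \<le> C * (1/2)^j"
proof -
 define \<phi> where "\<phi> j = (%p. of_real (1 / ?Z) * T \<kappa> 0 (2 ^ j) p)" for j :: nat
 note mu[measurable] = measurable_ukern[OF sh, of 0]
 have u: "ukern \<kappa> 0 = (%p. of_real (\<kappa> (N0 (co n p))))" by (simp add: ukern_def fun_eq_iff)
 have ck: "ckernel n (\<phi> j)" for j unfolding \<phi>_def by (intro ckernel_cmult ckernel_T[OF sh]) simp
 have int1: "(\<integral>p. \<phi> j p \<partial>hmeasure n) = 1" for j
 proof -
  have "(\<integral>p. dk n (2 ^ j) (ukern \<kappa> 0) p \<partial>hmeasure n) = of_real ?Z" by (subst integral_dk[OF mu]) (simp_all add: u)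
  then show ?thesis using Z unfolding \<phi>_def T_def by simp
 qed
 have L1: "norm_L1 n (\<phi> j) = 1" for j
 proof -
  have "norm_L1 n (\<phi> j) = 1 / ?Z * norm_L1 n (dk n (2 ^ j) (ukern \<kappa> 0))"
   using Z by (simp add: norm_L1_def \<phi>_def T_def norm_mult norm_divide)
  also have "\<dots> = 1" using Z nn by (simp add: norm_L1_dk[OF mu]) (simp add: norm_L1_def u)
  finally show ?thesis .
 qed
 have supp: "\<bar>co n w k\<bar> \<le> R0 / 2 ^ j" if "\<phi> j w \<noteq> 0" "k \<le> 2 * n" for j w k
  using that by (intro T_support_scaled[OF sh, where l = 0]) (auto simp: \<phi>_def)
 have ckf: "ckernel n f" by (rule test_function_bounds(1)[OF f])
 obtain R where R: "0 \<le> R" "\<And>p. p \<in> hspace n ==> f p \<noteq> 0 ==> p \<in> ball_inf n R" by (rule ckernelE[OF ckf]) blast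
 \<comment> \<open>\<open>R2\<close> contains the support of the mollified function,
   \<open>R3\<close> every point that the mollifier can reach from there.\<close>
 define R2 where "R2 = R + R0 + 4 * \<bar>a\<bar> * real n * R * R0"
 define R3 where "R3 = R2 + R0 + 4 * \<bar>a\<bar> * real n * R2 * R0"
 have R23: "R \<le> R2" "0 \<le> R2" "R2 \<le> R3" using R R0_pos by (auto simp: R2_def R3_def)
 obtain L where L: "0 \<le> L" "\<And>p q. p \<in> ball_inf n R3 ==> q \<in> ball_inf n R3 ==> cmod (f p - f q) \<le> L * (\<Sum>k\<le>2 * n. \<bar>co n p k - co n q k\<bar>)"
  using test_function_bounds(2)[OF f] by blast
 define E where "E = L * ((2 * real n + 1) * (1 + 4 * \<bar>a\<bar> * real n * R2) * R0)"
 have E: "0 \<le> E" using L R23 R0_pos by (simp add: E_def)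
 have bnd: "\<phi> j w \<noteq> 0 ==> w \<in> hspace n ==> w \<in> ball_inf n R0" for j w
  using supp[of j w] R0_pos order_trans[OF _ divide_left_mono[of 1 "2 ^ j" R0]] by (fastforce simp: ball_inf_iff)
 have sqf: "square_integrable (hmeasure n) f" by (rule ckernel_square_integrable[OF ckf])
 have pt: "cmod (f p - conv n a f (\<phi> j) p) \<le> E * (1/2)^j" if p: "p \<in> ball_inf n R2" for p j
 proof -
  have ph: "p \<in> hspace n" using p by (simp add: ball_inf_iff)
  have [measurable]: "\<phi> j \<in> borel_measurable (hmeasure n)" using ck by (rule ckernel_measurable)
  have i1: "integrable (hmeasure n) (%q. \<phi> j (hmult n a (hinv n q) p))"
   by (simp add: integral_inverse_translate(2)[OF _ ph] ckernel_integrable[OF ck])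
  have i2: "integrable (hmeasure n) (%q. \<phi> j (hmult n a (hinv n q) p) * f q)" by (rule conv_integrable[OF sqf ck ph])
  have "f p - conv n a f (\<phi> j) p = (\<integral>q. \<phi> j (hmult n a (hinv n q) p) * f p - \<phi> j (hmult n a (hinv n q) p) * f q \<partial>hmeasure n)"
   unfolding conv_def using i1 i2 integral_inverse_translate(1)[OF _ ph, of "\<phi> j" a] by (simp add: int1)
  also have "cmod \<dots> \<le> (\<integral>q. cmod (\<phi> j (hmult n a (hinv n q) p)) * (E * (1/2)^j) \<partial>hmeasure n)"
  proof (rule integral_norm_le_integral)
   show "integrable (hmeasure n) (%q. \<phi> j (hmult n a (hinv n q) p) * f p - \<phi> j (hmult n a (hinv n q) p) * f q)"
    using i1 i2 by simp
   show "integrable (hmeasure n) (%q. cmod (\<phi> j (hmult n a (hinv n q) p)) * (E * (1/2)^j))"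
    using i1 by simp
   fix q assume "q \<in> space (hmeasure n)"
   then have q: "q \<in> hspace n" by (simp add: space_hmeasure)
   let ?w = "hmult n a (hinv n q) p"
   have "cmod (f p - f q) \<le> E * (1/2)^j" if nz: "\<phi> j ?w \<noteq> 0"
   proof -
    have qeq: "hmult n a p (hinv n ?w) = q" using q ph by (simp add: hinv_hmult)
    have "hinv n ?w \<in> ball_inf n R0" using bnd[OF nz] by (simp add: hinv_ball_inf)
    from hmult_ball_inf[OF p this, of a] have "q \<in> ball_inf n R3" unfolding qeq R3_def .
    moreover have "p \<in> ball_inf n R3" using p ball_inf_mono[OF R23(3)] by blast
    ultimately have "cmod (f p - f q) \<le> L * (\<Sum>k\<le>2 * n. \<bar>co n p k - co n q k\<bar>)" by (intro L)
    also have "\<dots> \<le> L * ((2 * real n + 1) * (1 + 4 * \<bar>a\<bar> * real n * R2) * (R0 / 2 ^ j))"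
     using translation_modulus[OF p _ supp[OF nz] R23(2)] qeq by (intro mult_left_mono L) simp
    also have "\<dots> = E * (1/2)^j" by (simp add: E_def power_one_over)
    finally show ?thesis .
   qed
   then show "norm (\<phi> j ?w * f p - \<phi> j ?w * f q) \<le> cmod (\<phi> j ?w) * (E * (1/2)^j)"
    by (cases "\<phi> j ?w = 0") (auto simp: norm_mult mult_left_mono simp flip: right_diff_distrib)
  qed
  also have "\<dots> = norm_L1 n (\<phi> j) * (E * (1/2)^j)"
   using integral_inverse_translate(1)[OF _ ph, of "%w. cmod (\<phi> j w)" a] by (simp add: norm_L1_def)
  finally show ?thesis by (simp add: L1)
 qed
 have out: "f p - conv n a f (\<phi> j) p = 0" if p: "p \<in> hspace n" "p \<notin> ball_inf n R2" for p j
 proof -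
  have "f p = 0" using p R ball_inf_mono[OF R23(1), of n] by blast
  moreover have "conv n a f (\<phi> j) p = (\<integral>q. 0 \<partial>hmeasure n)"
   unfolding conv_def
  proof (intro Bochner_Integration.integral_cong refl)
   fix q assume "q \<in> space (hmeasure n)"
   then have q: "q \<in> hspace n" by (simp add: space_hmeasure)
   show "\<phi> j (hmult n a (hinv n q) p) * f q = 0"
   proof (rule ccontr)
    assume "\<phi> j (hmult n a (hinv n q) p) * f q \<noteq> 0"
    then have "q \<in> ball_inf n R" "hmult n a (hinv n q) p \<in> ball_inf n R0" using R(2)[OF q] by (auto intro!: bnd[of j])
    from hmult_ball_inf[OF this, of a] show False using p by (simp add: R2_def)
   qed
  qed
  ultimately show ?thesis by simp
 qed
 have "norm_L2 (hmeasure n) (%p. f p - conv n a f (\<phi> j) p) \<le> (E * (1/2)^j) * sqrt ((2 * R2) ^ (2 * n + 1))" for j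
 proof (rule norm_L2_bound)
  have [measurable]: "\<phi> j \<in> borel_measurable (hmeasure n)" "f \<in> borel_measurable (hmeasure n)"
   using ck ckf by (auto intro: ckernel_measurable)
  show "(%p. f p - conv n a f (\<phi> j) p) \<in> borel_measurable (hmeasure n)" by measurable
  show "cmod (f p - conv n a f (\<phi> j) p) \<le> E * (1/2)^j" if "p \<in> hspace n" for p
   using pt[of p j] out[of p j] that E by (cases "p \<in> ball_inf n R2") auto
  show "p \<in> ball_inf n R2" if "p \<in> hspace n" "f p - conv n a f (\<phi> j) p \<noteq> 0" for p
   using out[of p j] that by blast
 qed (use E R23 in auto)
 then show ?thesis unfolding \<phi>_def
  by (intro exI[of _ "E * sqrt ((2 * R2) ^ (2 * n + 1))"]) (use E R23 in \<open>auto simp: mult_ac\<close>)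
qed

section \<open>Summability and the bounded extension\<close>

context
 fixes \<theta> \<psi> :: "real => real"
 assumes \<theta>: "dyadic_partition \<theta>" and \<psi>: "cutoff \<psi>"
begin

text \<open>
 The \<open>j\<close>-th piece oscillates much faster than the scale \<open>2\<^sup>-\<^sup>j\<close>, so it nearly annihilates a mollifier
 of that scale; and mollifying a test function at this scale costs only \<open>O(2\<^sup>-\<^sup>j)\<close>. Summability turns
 convergence in \<open>L\<^sup>2\<close> into the pointwise convergence that defines \<open>T_op\<close>.
\<close>

lemma summable_conv_piece:
 assumes \<alpha>: "\<alpha> \<le> (real n + 1 / 2) * \<beta>" and f: "f \<in> test_functions n"
 shows "summable (%j. norm_L2 (hmeasure n) (conv n a f (piece \<theta> \<psi> \<alpha> j)))"
proof -
 obtain \<kappa> where \<kappa>: "\<And>m. \<exists>H\<ge>0. shellf m H \<kappa>" "\<And>u. 0 \<le> \<kappa> u" "0 < (\<integral>p. \<kappa> (N0 (co n p)) \<partial>hmeasure n)" (is "0 < ?Z")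
  using exists_mollifier[OF \<theta> \<psi>] by blast
 obtain m where m: "(2 * \<bar>\<alpha>\<bar> + 2 * real n + 4) / \<beta> \<le> real m" using real_arch_simple by blast
 then have m: "2 * \<bar>\<alpha>\<bar> + 2 * real n + 4 \<le> real m * \<beta>" using beta_pos by (simp add: divide_le_eq)
 obtain H1 where H1: "0 \<le> H1" "\<And>j. shellf m H1 (profile \<theta> \<psi> \<alpha> j)" using shellf_profile[OF \<theta> \<psi>] by blast
 obtain H2 where H2: "0 \<le> H2" "shellf m H2 \<kappa>" using \<kappa>(1) by blast
 define H where "H = H1 + H2"
 have mono: "shellf m X h ==> X \<le> H ==> shellf m H h" for X h unfolding shellf_def using bd_mono by blast
 have H: "0 \<le> H" "shellf m H \<kappa>" "shellf m H (profile \<theta> \<psi> \<alpha> j)" for j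
  using H1(1) H2(1) mono[OF H1(2)] mono[OF H2(2)] by (auto simp: H_def)
 obtain \<mu>0 C where \<mu>0: "0 < \<mu>0" and "0 \<le> C" "offdiag m H \<mu>0 C"
  using offdiag_norm_L1[OF cutoff_bump[OF \<psi>]] H(1) by metis
 note C = this(2) this(3)[unfolded offdiag_def, rule_format]
 define \<phi> where "\<phi> j = (%p. of_real (1 / ?Z) * T \<kappa> 0 (2 ^ j) p)" for j :: nat
 have ck\<phi>: "ckernel n (\<phi> j)" for j unfolding \<phi>_def by (intro ckernel_cmult ckernel_T[OF H(2)]) simp
 note ckp = ckernel_piece[OF \<theta> \<psi>, of \<alpha>]
 obtain E where E: "0 \<le> E" "\<And>j. norm_L2 (hmeasure n) (%p. f p - conv n a f (\<phi> j) p) \<le> E * (1/2)^j"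
  using mollifier_approx[OF H(2) \<kappa>(2,3) f] unfolding \<phi>_def by blast
 obtain B where B: "0 \<le> B" "\<And>j f. square_integrable (hmeasure n) f ==>
   norm_L2 (hmeasure n) (conv n a f (piece \<theta> \<psi> \<alpha> j)) \<le> B * norm_L2 (hmeasure n) f"
  using conv_piece_bound[OF \<theta> \<psi> \<alpha>] by blast
 have sqf: "square_integrable (hmeasure n) f" by (rule ckernel_square_integrable[OF test_function_bounds(1)[OF f]])
 \<comment> \<open>\<open>offdiag\<close> is used with equal scales and slow frequency 0: separation
   of the frequencies alone suffices.\<close>
 have N1: "norm_L1 n (conv n a (\<phi> j) (piece \<theta> \<psi> \<alpha> j)) \<le> 1 / ?Z * C * (1/2)^j" for j
 proof -
  let ?D = "2 ^ j :: real"
  have "cnj (\<phi> j q) = \<phi> j q" for q by (simp add: \<phi>_def T_def dk_def ukern_def)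
  then have "conv n a (\<phi> j) (piece \<theta> \<psi> \<alpha> j) = (%p. cnj (conv n a (\<phi> j) (tilde n (piece \<theta> \<psi> \<alpha> j)) p))"
   unfolding conv_cnj[symmetric] by (simp add: tilde_def[abs_def] piece_hinv[OF \<theta> \<psi>])
  then have "norm_L1 n (conv n a (\<phi> j) (piece \<theta> \<psi> \<alpha> j)) = norm_L1 n (conv n a (\<phi> j) (tilde n (piece \<theta> \<psi> \<alpha> j)))"
   by (simp add: norm_L1_def)
  also have "\<dots> = 1 / ?Z * ?D powr \<alpha> * norm_L1 n (conv n a (T \<kappa> 0 ?D) (tilde n (T (profile \<theta> \<psi> \<alpha> j) (?D powr \<beta>) ?D)))"
   unfolding \<phi>_def piece_def[abs_def] by (rule norm_L1_conv_cmult) (use \<kappa>(3) in auto)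
  also have "\<dots> \<le> 1 / ?Z * ?D powr \<alpha> * (C * ?D ^ (2 * n + 2) / (?D powr \<beta>) ^ m)"
   using \<mu>0 \<kappa>(3) by (intro mult_left_mono C(2)[THEN conjunct2, OF H(2,3)]) auto
  also have "\<dots> = 1 / ?Z * C * (?D powr 0 * ?D powr \<alpha> * (?D ^ (2 * n + 2) / (?D powr \<beta>) ^ m))" by simp
  also have "\<dots> \<le> 1 / ?Z * C * ((1/2)^j * (1/2)^j)"
   using \<kappa>(3) C(1) m by (intro mult_left_mono dyadic_decay[where A = "\<bar>\<alpha>\<bar>"]) auto
  also have "\<dots> \<le> 1 / ?Z * C * ((1/2)^j * 1)"
   using \<kappa>(3) C(1) by (intro mult_left_mono) (auto simp: power_le_one)
  finally show ?thesis by simp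
 qed
 have main: "norm_L2 (hmeasure n) (conv n a f (piece \<theta> \<psi> \<alpha> j)) \<le> (B * E + 1 / ?Z * C * norm_L2 (hmeasure n) f) * (1/2)^j" for j
 proof -
  let ?g = "conv n a f (\<phi> j)" and ?K = "piece \<theta> \<psi> \<alpha> j"
  have g: "square_integrable (hmeasure n) ?g" by (rule Young[OF sqf ck\<phi>])
  have d: "square_integrable (hmeasure n) (%p. f p - ?g p)" by (rule square_integrable_diff[OF sqf g])
  \<comment> \<open>Splits \<open>f\<close> into its mollification and the error. The error has norm
    O(\<open>2 ^ - j\<close>) and the pieces are uniformly bounded; on the mollification
    associativity brings \<open>N1\<close> into play.\<close>
  have "norm_L2 (hmeasure n) (conv n a f ?K) = norm_L2 (hmeasure n) (%p. conv n a (%p. f p - ?g p) ?K p + conv n a f (conv n a (\<phi> j) ?K) p)"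
  proof (rule norm_L2_cong)
   fix p assume "p \<in> space (hmeasure n)"
   then have p: "p \<in> hspace n" by (simp add: space_hmeasure)
   show "conv n a f ?K p = conv n a (%p. f p - ?g p) ?K p + conv n a f (conv n a (\<phi> j) ?K) p"
    using conv_linear[OF d g ckp p, of a 1 j] by (simp add: conv_conv[OF sqf ck\<phi> ckp p])
  qed
  also have "\<dots> \<le> norm_L2 (hmeasure n) (conv n a (%p. f p - ?g p) ?K) + norm_L2 (hmeasure n) (conv n a f (conv n a (\<phi> j) ?K))"
   by (intro square_integrable_add Young sqf d ckp ckernel_conv ck\<phi>)
  also have "\<dots> \<le> B * (E * (1/2)^j) + (1 / ?Z * C * (1/2)^j) * norm_L2 (hmeasure n) f"
  proof (rule add_mono)
   show "norm_L2 (hmeasure n) (conv n a (%p. f p - ?g p) ?K) \<le> B * (E * (1/2)^j)"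
    using order_trans[OF B(2)[OF d] mult_left_mono[OF E(2) B(1)]] .
   show "norm_L2 (hmeasure n) (conv n a f (conv n a (\<phi> j) ?K)) \<le> (1 / ?Z * C * (1/2)^j) * norm_L2 (hmeasure n) f"
    using order_trans[OF Young(2)[OF sqf ckernel_conv[OF ck\<phi> ckp]] mult_right_mono[OF N1 norm_L2_nonneg]] .
  qed
  finally show ?thesis by (simp add: algebra_simps)
 qed
 show ?thesis
 proof (rule summable_comparison_test'[where N = 0])
  show "summable (%j. (B * E + 1 / ?Z * C * norm_L2 (hmeasure n) f) * (1/2)^j)"
   by (intro summable_mult summable_geometric) simp
  show "norm (norm_L2 (hmeasure n) (conv n a f (piece \<theta> \<psi> \<alpha> j))) \<le> (B * E + 1 / ?Z * C * norm_L2 (hmeasure n) f) * (1/2)^j" for j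
   using main[of j] by simp
 qed
qed

lemma T_op_eq:
 assumes f: "square_integrable (hmeasure n) f" and p: "p \<in> hspace n"
 shows "T_op n a rho \<alpha> \<beta> \<psi> \<theta> f p = lim (%N. \<Sum>j\<le>N. conv n a f (piece \<theta> \<psi> \<alpha> j) p)"
 using conv_sum_kernel[OF finite_atMost ckernel_piece[OF \<theta> \<psi>] f p]
 unfolding T_op_def truncated_kernel_pieces[OF \<theta>] by (simp only: conv_def)

theorem bounded_if_subcritical:
 assumes \<alpha>: "\<alpha> \<le> (real n + 1 / 2) * \<beta>"
 shows "extends_to_bounded_L2 (hmeasure n) (test_functions n) (T_op n a rho \<alpha> \<beta> \<psi> \<theta>)"
proof -
 let ?K = "piece \<theta> \<psi> \<alpha>"
 obtain B where B: "0 \<le> B" "\<And>j f. square_integrable (hmeasure n) f ==>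
   norm_L2 (hmeasure n) (conv n a f (?K j)) \<le> B * norm_L2 (hmeasure n) f"
  using conv_piece_bound[OF \<theta> \<psi> \<alpha>] by blast
 obtain D m where D: "0 \<le> D" "\<And>j k. j + m \<le> k \<or> k + m \<le> j ==>
   norm_L1 n (conv n a (?K k) (tilde n (?K j))) \<le> D * (1/2)^j * (1/2)^k"
  using pieces_almost_orthogonal[OF \<theta> \<psi>, of \<alpha>] by blast
 obtain S where S: "bounded_operator_L2 (hmeasure n) S" "\<And>f. square_integrable (hmeasure n) f ==>
   (%N. norm_L2 (hmeasure n) (%p. (\<Sum>j<N. conv n a f (?K j) p) - S f p)) \<longlonglongrightarrow> 0"
  using almost_orthogonal_series[of n ?K, OF ckernel_piece[OF \<theta> \<psi>] piece_hinv[OF \<theta> \<psi>] B D] by blast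
 have "AE p in hmeasure n. S f p = T_op n a rho \<alpha> \<beta> \<psi> \<theta> f p" if f: "f \<in> test_functions n" for f
 proof -
  have sqf: "square_integrable (hmeasure n) f" by (rule ckernel_square_integrable[OF test_function_bounds(1)[OF f]])
  have Sf: "square_integrable (hmeasure n) (S f)" using S(1) sqf unfolding bounded_operator_L2_def by blast
  have "AE p in hmeasure n. (%N. \<Sum>j\<le>N. conv n a f (?K j) p) \<longlonglongrightarrow> S f p"
   by (rule AE_tendsto_L2_series[OF Young(1)[OF sqf ckernel_piece[OF \<theta> \<psi>]] summable_conv_piece[OF \<alpha> f] Sf S(2)[OF sqf]])
  then show ?thesis
  proof (rule AE_mp, intro AE_I2 impI)
   fix p assume "p \<in> space (hmeasure n)" "(%N. \<Sum>j\<le>N. conv n a f (?K j) p) \<longlonglongrightarrow> S f p"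
   then show "S f p = T_op n a rho \<alpha> \<beta> \<psi> \<theta> f p"
    using T_op_eq[OF sqf] by (simp add: space_hmeasure limI)
  qed
 qed
 then show ?thesis using S(1) unfolding extends_to_bounded_L2_def by blast
qed

end

end

section \<open>Necessity\<close>

lemma smooth_real_scale:
 assumes f: "smooth_real f"
 shows "smooth_real (%x. f (c * x))"
proof -
 have d: "((deriv ^^ k) f has_real_derivative (deriv ^^ Suc k) f x) (at x)" for k x
  using f by (simp add: smooth_real_def DERIV_deriv_iff_real_differentiable)
 have D: "((%x. c ^ k * (deriv ^^ k) f (c * x)) has_real_derivative c ^ Suc k * (deriv ^^ Suc k) f (c * x)) (at x)" for k x
  using DERIV_chain2[OF d[of k "c * x"] DERIV_cmult_Id[of c]] by (auto intro!: derivative_eq_intros simp: mult_ac)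
 have eq: "(deriv ^^ k) (%x. f (c * x)) = (%x. c ^ k * (deriv ^^ k) f (c * x))" for k
 proof (induction k)
  case (Suc k)
  then show ?case using DERIV_imp_deriv[OF D[of k]] by (simp only: funpow.simps o_apply)
 qed simp
 show ?thesis
  unfolding smooth_real_def eq using D real_differentiable_def by blast
qed

lemma smooth_real_continuous: "smooth_real f ==> continuous_on A f"
 using smooth_real_has_derivative DERIV_isCont continuous_at_imp_continuous_on by blast

lemma continuous_on_co: "k \<le> 2 * n ==> continuous_on A (%p. co n p k)"
 unfolding co_def
 using continuous_on_product_then_coordinatewise[OF continuous_on_fst[OF continuous_on_id], of A k]
  continuous_on_snd[OF continuous_on_id, of A]
 by (cases "k < 2 * n") simp_all

text \<open>Iterated partial derivatives of a product of one-variable functions are again such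
  products, with one factor differentiated; the induction over the list of directions preserves this
  form.\<close>

lemma smooth_product:
 assumes "\<And>k. k \<le> 2 * n ==> smooth_real (g k)"
 shows "smooth n (%p. of_real (\<Prod>k\<le>2 * n. g k (co n p k)))"
proof -
 let ?P = "%g p. complex_of_real (\<Prod>k\<le>2 * n. g k (co n p k))"
 have prod: "(\<Prod>k\<le>2 * n. g k (co n (shift n i p h) k)) = g i (co n p i + h) * (\<Prod>k\<in>{..2 * n} - {i}. g k (co n p k))"
  if "i \<le> 2 * n" for g :: "nat => real => real" and i p h
 proof -
  have "(\<Prod>k\<le>2 * n. g k (co n (shift n i p h) k)) = g i (co n (shift n i p h) i) * (\<Prod>k\<in>{..2 * n} - {i}. g k (co n (shift n i p h) k))"
   by (rule prod.remove) (use that in auto)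
  also have "(\<Prod>k\<in>{..2 * n} - {i}. g k (co n (shift n i p h) k)) = (\<Prod>k\<in>{..2 * n} - {i}. g k (co n p k))"
   by (rule prod.cong) (use that in \<open>auto simp: co_shift\<close>)
  finally show ?thesis using that by (simp add: co_shift)
 qed
 have der: "((%h. ?P g (shift n i p h)) has_vector_derivative ?P (g(i := deriv (g i))) p) (at 0)"
  if g: "\<And>k. k \<le> 2 * n ==> smooth_real (g k)" and i: "i \<le> 2 * n" for g i p
 proof -
  let ?c = "\<Prod>k\<in>{..2 * n} - {i}. g k (co n p k)"
  have "((%h. g i (co n p i + h)) has_real_derivative deriv (g i) (co n p i) * 1) (at 0)"
   by (rule DERIV_chain2[where f = "g i"]) (auto intro!: derivative_eq_intros smooth_real_has_derivative g i)
  then have "((%h. g i (co n p i + h) * ?c) has_real_derivative deriv (g i) (co n p i) * ?c) (at 0)"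
   using DERIV_cmult_right[of _ _ _ _ ?c] by fastforce
  then have "((%h. of_real (g i (co n p i + h) * ?c) :: complex) has_vector_derivative of_real (deriv (g i) (co n p i) * ?c)) (at 0)"
   by (intro has_vector_derivative_of_real) (simp add: has_real_derivative_iff_has_vector_derivative)
  moreover have "(\<Prod>k\<le>2 * n. (g(i := deriv (g i))) k (co n p k)) = deriv (g i) (co n p i) * ?c"
   using i by (subst prod.remove[of _ i]) (auto intro!: prod.cong)
  ultimately show ?thesis unfolding prod[OF i] by simp
 qed
 have "\<exists>g. (\<forall>k\<le>2 * n. smooth_real (g k)) \<and> foldr (partial_deriv n) l (?P g0) = ?P g"
  if "l \<in> lists {..2 * n}" "\<And>k. k \<le> 2 * n ==> smooth_real (g0 k)" for l g0
  using that(1)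
 proof (induction l)
  case Nil
  then show ?case using that(2) by auto
 next
  case (Cons i l)
  then obtain g where g: "\<And>k. k \<le> 2 * n ==> smooth_real (g k)" "foldr (partial_deriv n) l (?P g0) = ?P g" by auto
  have "partial_deriv n i (?P g) = ?P (g(i := deriv (g i)))"
   using vector_derivative_at[OF der[OF g(1)]] Cons.hyps by (auto simp: partial_deriv_def fun_eq_iff)
  moreover have "\<forall>k\<le>2 * n. smooth_real ((g(i := deriv (g i))) k)" using g(1) smooth_real_deriv by auto
  ultimately show ?case using g(2) by (intro exI[of _ "g(i := deriv (g i))"]) simp
 qed
 note fold = this
 show ?thesis
  unfolding smooth_def
 proof (intro ballI conjI allI impI)
  fix l assume "l \<in> lists {..2 * n}"
  from fold[OF this, of g, OF assms] obtain g' where g': "\<And>k. k \<le> 2 * n ==> smooth_real (g' k)"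
   "foldr (partial_deriv n) l (?P g) = ?P g'" by auto
  have "continuous_on (hspace n) (%p. g' k (co n p k))" if "k \<in> {..2 * n}" for k
   using that by (intro continuous_on_compose2[OF smooth_real_continuous[OF g'(1), of k UNIV] continuous_on_co]) auto
  then show "continuous_on (hspace n) (foldr (partial_deriv n) l (?P g))"
   unfolding g'(2) by (intro continuous_on_of_real continuous_on_prod)
  show "(%h. foldr (partial_deriv n) l (?P g) (shift n i p h)) differentiable at 0" if "i \<le> 2 * n" for i p
   unfolding g'(2) using der[OF g'(1) that] by (rule differentiableI_vector)
 qed
qed

lemma product_test_function:
 assumes "\<And>k. k \<le> 2 * n ==> smooth_real (g k)" "\<And>k x. k \<le> 2 * n ==> g k x \<noteq> 0 ==> \<bar>x\<bar> \<le> R"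
 shows "(%p. of_real (\<Prod>k\<le>2 * n. g k (co n p k))) \<in> test_functions n"
proof -
 let ?f = "%p. complex_of_real (\<Prod>k\<le>2 * n. g k (co n p k))"
 have "L2_set x {..<2 * n} \<le> (2 * real n + 1) * R \<and> \<bar>t\<bar> \<le> (2 * real n + 1) * R" if "?f (x, t) \<noteq> 0" for x t
 proof -
  have "g k (co n (x, t) k) \<noteq> 0" if "k \<le> 2 * n" for k
   using \<open>?f (x, t) \<noteq> 0\<close> that by (auto simp: prod_zero_iff)
  then have co: "\<bar>co n (x, t) k\<bar> \<le> R" if "k \<le> 2 * n" for k using assms(2) that by blast
  have R: "0 \<le> R" using co[of 0] by simp
  have "L2_set x {..<2 * n} \<le> (\<Sum>i<2 * n. \<bar>x i\<bar>)" by (rule L2_set_le_sum_abs)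
  also have "\<dots> \<le> (\<Sum>i<2 * n. R)"
  proof (rule sum_mono)
   fix i assume "i \<in> {..<2 * n}"
   then show "\<bar>x i\<bar> \<le> R" using co[of i] by (simp add: co_def)
  qed
  finally have "L2_set x {..<2 * n} \<le> 2 * real n * R" by simp
  moreover have "\<bar>t\<bar> \<le> R" using co[of "2 * n"] by (simp add: co_def)
  moreover have "0 \<le> 2 * real n * R" using R by simp
  ultimately show ?thesis using R unfolding distrib_right mult_1_left by linarith
 qed
 then show ?thesis unfolding test_functions_def using smooth_product[of n g, OF assms(1)]
  by (intro CollectI conjI exI[of _ "(2 * real n + 1) * R"]) auto
qed

lemma powr_ge_min:
 fixes x :: real
 assumes "0 < c" "c \<le> x" "x \<le> d"
 shows "min (c powr e) (d powr e) \<le> x powr e"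
proof (cases "0 \<le> e")
 case True
 then show ?thesis using assms by (intro min.coboundedI1 powr_mono2) auto
next
 case False
 then show ?thesis using assms by (intro min.coboundedI2 powr_mono2') auto
qed

section \<open>Coherence of the kernel away from a small bump\<close>

context heis
begin

lemma F0_lipschitz:
 assumes "0 \<le> K" "0 < c" "c < d"
 shows "\<exists>C\<ge>0. \<forall>y z \<eta>. 0 \<le> \<eta> --> (\<forall>k\<le>2 * n. \<bar>y k\<bar> \<le> K \<and> \<bar>z k\<bar> \<le> K) --> near \<eta> y z -->
  N0 y \<in> {c<..<d} --> N0 z \<in> {c<..<d} --> \<bar>F0 y - F0 z\<bar> \<le> C * \<eta>"
proof -
 obtain C where C: "0 \<le> C" and ex: "\<forall>y z I E. 0 \<le> E --> open I --> pbd 0 I K y --> pbd 0 I K z --> pbd 0 I E (%s k. y s k - z s k) -->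
  (\<forall>s\<in>I. N0 (y s) \<in> {c<..<d} \<and> N0 (z s) \<in> {c<..<d}) --> bd 0 I (C * E) (%s. F0 (y s) - F0 (z s))"
  using bd_F0_diff[OF assms, of 0] by (elim exE conjE)
 show ?thesis
 proof (intro exI[of _ C] conjI C allI impI)
  fix y z \<eta>
  assume *: "0 \<le> \<eta>" "\<forall>k\<le>2 * n. \<bar>y k\<bar> \<le> K \<and> \<bar>z k\<bar> \<le> K" "near \<eta> y z" "N0 y \<in> {c<..<d}" "N0 z \<in> {c<..<d}"
  have "bd 0 UNIV (C * \<eta>) (%s. F0 ((%_. y) s) - F0 ((%_. z) s))"
   using * by (intro ex[rule_format]) (auto simp: pbd_def near_def intro!: bd_const)
  then show "\<bar>F0 y - F0 z\<bar> \<le> C * \<eta>" by simp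
 qed
qed

text \<open>Where the output is observed, after dilation: \<open>t\<close> between 1 and 2 keeps
  \<rho> away from 0 and bounded.\<close>

definition far_box :: "hpoint set" where
 "far_box = box n (%k. if k = 2 * n then 1 else 0) (%k. if k = 2 * n then 2 else 1)"

lemma near_hinv_hmult:
 assumes p: "\<And>k. k \<le> 2 * n ==> \<bar>co n p k\<bar> \<le> 2" and q: "\<And>k. k \<le> 2 * n ==> \<bar>co n q k\<bar> \<le> \<epsilon>"
 shows "near ((1 + 8 * \<bar>a\<bar> * real n) * \<epsilon>) (co n (hmult n a (hinv n q) p)) (co n p)"
 unfolding near_def
proof (intro allI impI)
 fix k assume k: "k \<le> 2 * n"
 have \<epsilon>: "0 \<le> \<epsilon>" using q[of 0] by simp
 show "\<bar>co n (hmult n a (hinv n q) p) k - co n p k\<bar> \<le> (1 + 8 * \<bar>a\<bar> * real n) * \<epsilon>"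
 proof (cases "k < 2 * n")
  case True
  then have "\<bar>co n (hmult n a (hinv n q) p) k - co n p k\<bar> \<le> 1 * \<epsilon>"
   using q[OF k] by (simp add: co_def hmult_eq hinv_eq)
  also have "\<dots> \<le> (1 + 8 * \<bar>a\<bar> * real n) * \<epsilon>" using \<epsilon> by (intro mult_right_mono) auto
  finally show ?thesis .
 next
  case False
  with k have k2: "k = 2 * n" by simp
  have "\<bar>fst q i\<bar> \<le> \<epsilon>" "\<bar>fst p i\<bar> \<le> 2" if "i < 2 * n" for i using q[of i] p[of i] that by (simp_all add: co_def)
  then have "\<bar>symp n (fst q) (fst p)\<bar> \<le> 2 * real n * \<epsilon> * 2" using \<epsilon> by (intro abs_symp_le) auto
  then have s: "2 * \<bar>a\<bar> * \<bar>symp n (fst q) (fst p)\<bar> \<le> 2 * \<bar>a\<bar> * (2 * real n * \<epsilon> * 2)" by (intro mult_left_mono) auto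
  have "co n (hmult n a (hinv n q) p) k - co n p k = 2 * a * symp n (fst q) (fst p) - co n q k"
   by (simp add: k2 co_def hmult_eq hinv_eq symp_minus_left)
  also have "\<bar>\<dots>\<bar> \<le> \<bar>2 * a * symp n (fst q) (fst p)\<bar> + \<bar>co n q k\<bar>" by (rule abs_triangle_ineq4)
  also have "\<bar>2 * a * symp n (fst q) (fst p)\<bar> = 2 * \<bar>a\<bar> * \<bar>symp n (fst q) (fst p)\<bar>" by (simp add: abs_mult)
  also have "\<dots> + \<bar>co n q k\<bar> \<le> 2 * \<bar>a\<bar> * (2 * real n * \<epsilon> * 2) + \<epsilon>" by (rule add_mono[OF s q[OF k]])
  finally show ?thesis by (simp add: algebra_simps)
 qed
qed

lemma rho_dil: "0 \<le> D ==> rho (dil n D p) = D * rho p"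
 by (simp add: rho_def N0_dil real_root_mult real_root_power_cancel)

lemma F0_rho: "0 < rho p ==> F0 (co n p) = rho p powr (- \<beta>)"
 unfolding F0_def N0_rho by (rule power4_powr)

text \<open>
 For \<open>q\<close> within \<open>\<eta> / D powr \<beta>\<close> of the origin (after dilation by \<open>D\<close>) the phase of the kernel at
 \<open>q\<^sup>-\<^sup>1 p\<close> differs from the phase at \<open>p\<close> by at most 1, so there is no cancellation.
\<close>

lemma kernel_coherence:
 assumes \<psi>: "cutoff \<psi>"
 shows "\<exists>\<eta>>0. \<exists>c>0. \<exists>c0>0. \<exists>D0\<ge>1. \<forall>D\<ge>D0. \<forall>p q. dil n D p \<in> far_box -->
  (\<forall>k\<le>2 * n. \<bar>co n (dil n D q) k\<bar> \<le> \<eta> / D powr \<beta>) -->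
  c0 / D \<le> rho (hmult n a (hinv n q) p) \<and> rho (hmult n a (hinv n q) p) \<le> 1 \<and>
  c * D powr (2 * real n + 2 + \<alpha>) \<le> Re (of_real (sgn (\<psi> 0)) * exp (- (\<i> * of_real (D powr \<beta> * F0 (co n (dil n D p))))) *
   kernel n rho \<alpha> \<beta> \<psi> (hmult n a (hinv n q) p))"
proof -
 define Ce where "Ce = 1 + 8 * \<bar>a\<bar> * real n"
 have Ce: "1 \<le> Ce" by (simp add: Ce_def)
 obtain CL where CL: "0 \<le> CL" "\<And>y z \<eta>. 0 \<le> \<eta> ==> (\<forall>k\<le>2 * n. \<bar>y k\<bar> \<le> 3 \<and> \<bar>z k\<bar> \<le> 3) ==> near \<eta> y z ==> \<bar>N0 y - N0 z\<bar> \<le> CL * \<eta>"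
  using N0_lipschitz[of 3] by auto
 have b2: "0 < b\<^sup>2" using b_nz by simp
 \<comment> \<open>On the far box \<open>N0\<close> lies between \<open>b\<^sup>2\<close> and
   \<open>3 * CL\<close>; the interval leaves room for a perturbation by
   \<open>b\<^sup>2 / 2\<close>.\<close>
 define c d where "c = b\<^sup>2 / 4" and "d = 3 * CL + b\<^sup>2 + 1"
 have cd: "0 < c" "c < d" using b2 CL(1) unfolding c_def d_def by linarith+
 obtain CF where CF: "0 \<le> CF" "\<And>y z \<eta>. 0 \<le> \<eta> ==> (\<forall>k\<le>2 * n. \<bar>y k\<bar> \<le> 3 \<and> \<bar>z k\<bar> \<le> 3) ==> near \<eta> y z ==>
   N0 y \<in> {c<..<d} ==> N0 z \<in> {c<..<d} ==> \<bar>F0 y - F0 z\<bar> \<le> CF * \<eta>"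
  using F0_lipschitz[of 3, OF _ cd] by auto
 \<comment> \<open>The three entries keep the perturbed point within distance 1, the change of
   \<open>N0\<close> below \<open>b\<^sup>2 / 2\<close>, and the change of the phase, after
   multiplication by the frequency, below 1.\<close>
 define \<eta> where "\<eta> = min (1 / Ce) (min (b\<^sup>2 / (2 * ((CL + 1) * Ce))) (1 / ((CF + 1) * Ce)))"
 have \<eta>0: "0 < \<eta>" using Ce CL CF b2 by (simp add: \<eta>_def)
 have \<eta>1: "Ce * \<eta> \<le> 1"
 proof -
  have "Ce * \<eta> \<le> Ce * (1 / Ce)" using Ce by (intro mult_left_mono) (auto simp: \<eta>_def)
  then show ?thesis using Ce by simp
 qed
 have \<eta>2: "CL * (Ce * \<eta>) \<le> b\<^sup>2 / 2"
 proof -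
  have "CL * (Ce * \<eta>) \<le> (CL + 1) * (Ce * \<eta>)" using Ce \<eta>0 by (intro mult_right_mono) auto
  also have "\<dots> = ((CL + 1) * Ce) * \<eta>" by simp
  also have "\<dots> \<le> ((CL + 1) * Ce) * (b\<^sup>2 / (2 * ((CL + 1) * Ce)))" using Ce CL by (intro mult_left_mono) (auto simp: \<eta>_def)
  also have "\<dots> = b\<^sup>2 / 2"
  proof -
   have "x * (b\<^sup>2 / (2 * x)) = b\<^sup>2 / 2" if "x \<noteq> 0" for x using that by simp
   then show ?thesis using Ce CL by auto
  qed
  finally show ?thesis .
 qed
 have \<eta>3: "CF * (Ce * \<eta>) \<le> 1"
 proof -
  have "CF * (Ce * \<eta>) \<le> (CF + 1) * (Ce * \<eta>)" using Ce \<eta>0 by (intro mult_right_mono) auto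
  also have "\<dots> = ((CF + 1) * Ce) * \<eta>" by simp
  also have "\<dots> \<le> ((CF + 1) * Ce) * (1 / ((CF + 1) * Ce))" using Ce CF by (intro mult_left_mono) (auto simp: \<eta>_def)
  also have "\<dots> = 1" using Ce CF by simp
  finally show ?thesis .
 qed
 have \<psi>0: "\<psi> 0 \<noteq> 0" using \<psi> by (simp add: cutoff_def)
 have "isCont \<psi> 0" using \<psi> smooth_real_has_derivative DERIV_isCont unfolding cutoff_def by blast
 then have "\<exists>r>0. \<forall>x. dist x 0 < r --> dist (\<psi> x) (\<psi> 0) < \<bar>\<psi> 0\<bar> / 2"
  by (rule continuous_at_eps_delta[THEN iffD1, rule_format]) (use \<psi>0 in simp)
 then obtain r where r: "0 < r" "\<And>x. \<bar>x\<bar> < r ==> \<bar>\<psi> x - \<psi> 0\<bar> < \<bar>\<psi> 0\<bar> / 2" by (auto simp: dist_real_def)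
 define e where "e = - 2 * real n - 2 - \<alpha>"
 define r1 r2 where "r1 = root 4 c" and "r2 = root 4 d"
 have r12: "0 < r1" "0 < r2" using cd by (auto simp: r1_def r2_def)
 define m where "m = min (r1 powr e) (r2 powr e)"
 have m: "0 < m" using r12 by (simp add: m_def)
 \<comment> \<open>\<open>r2 \<le> D\<close> puts \<rho> below 1, where the dyadic partition sums to
   1; \<open>r2 / r < D\<close> puts it where \<psi> is close to its value at 0.\<close>
 define D0 where "D0 = max 1 (max r2 (r2 / r + 1))"
 have cos: "1 / 2 \<le> cos x" if "\<bar>x\<bar> \<le> 1" for x :: real
 proof -
  have "cos (pi / 3) \<le> cos \<bar>x\<bar>" using that pi_gt3 by (intro cos_monotone_0_pi_le) auto
  then show ?thesis by (simp add: cos_60)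
 qed
 show ?thesis
 proof (rule exI[of _ \<eta>], rule conjI[OF \<eta>0], rule exI[of _ "\<bar>\<psi> 0\<bar> / 4 * m"], rule conjI,
   use \<psi>0 m in simp, rule exI[of _ r1], rule conjI[OF r12(1)], rule exI[of _ D0], rule conjI, simp add: D0_def, intro allI impI)
  fix D :: real and p q
  assume D: "D0 \<le> D" and p: "dil n D p \<in> far_box" and q: "\<forall>k\<le>2 * n. \<bar>co n (dil n D q) k\<bar> \<le> \<eta> / D powr \<beta>"
  define l where "l = D powr \<beta>"
  define w where "w = hmult n a (hinv n q) p"
  let ?y = "co n (dil n D p)" and ?z = "co n (dil n D w)"
  have D1: "1 \<le> D" "0 < D" "r2 \<le> D" using D by (auto simp: D0_def)
  have Dr: "r2 / D < r"
  proof -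
   have "r2 / r < D" using D by (simp add: D0_def)
   then show ?thesis using r(1) D1 by (simp add: divide_less_eq mult.commute)
  qed
  have l: "1 \<le> l" using D1 beta_pos by (simp add: l_def ge_one_powr_ge_zero)
  have y: "\<bar>?y k\<bar> \<le> 2" if "k \<le> 2 * n" for k
  proof -
   have "(if k = 2 * n then 1 else 0) \<le> ?y k \<and> ?y k \<le> (if k = 2 * n then 2 else 1)"
    using p that unfolding far_box_def box_def by blast
   then show ?thesis by (auto simp: abs_le_iff split: if_splits)
  qed
  have yt: "1 \<le> ?y (2 * n)" using p by (auto simp: far_box_def box_def)
  define E where "E = Ce * (\<eta> / l)"
  have "Ce * \<eta> / l \<le> Ce * \<eta> / 1" using l Ce \<eta>0 by (intro divide_left_mono) auto
  then have E: "0 \<le> E" "E \<le> Ce * \<eta>" "l * E = Ce * \<eta>" using l Ce \<eta>0 by (auto simp: E_def)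
  have "dil n D w = hmult n a (hinv n (dil n D q)) (dil n D p)" by (simp add: w_def dil_hmult dil_hinv)
  then have nr: "near E ?z ?y" using near_hinv_hmult[of "dil n D p" "dil n D q" "\<eta> / l"] y q by (simp add: E_def Ce_def l_def)
  have z: "\<bar>?z k\<bar> \<le> 3" if "k \<le> 2 * n" for k
  proof -
   have "\<bar>?z k - ?y k\<bar> \<le> E" using nr that by (simp add: near_def)
   then show ?thesis using y[OF that] E(2) \<eta>1 by linarith
  qed
  have yz: "\<forall>k\<le>2 * n. \<bar>?z k\<bar> \<le> 3 \<and> \<bar>?y k\<bar> \<le> 3" using y z by force
  have "\<bar>N0 ?z - N0 ?y\<bar> \<le> CL * E" by (rule CL(2)[OF E(1) yz nr])
  also have "\<dots> \<le> CL * (Ce * \<eta>)" by (rule mult_left_mono[OF E(2) CL(1)])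
  finally have Nzy: "\<bar>N0 ?z - N0 ?y\<bar> \<le> b\<^sup>2 / 2" using \<eta>2 by linarith
  have "1 \<le> (?y (2 * n))\<^sup>2" using yt by (simp add: one_le_power)
  then have "b\<^sup>2 * 1 \<le> b\<^sup>2 * (?y (2 * n))\<^sup>2" by (intro mult_left_mono) auto
  moreover have "0 \<le> b ^ 4 * (sq ?y)\<^sup>2" by simp
  ultimately have Ny1: "b\<^sup>2 \<le> N0 ?y" unfolding N0_def by linarith
  have "N0 (%_. 0) = 0" by (simp add: N0_def sq_def)
  moreover have "\<bar>N0 ?y - N0 (%_. 0)\<bar> \<le> CL * 3" using yz by (intro CL(2)) (auto simp: near_def)
  ultimately have Ny2: "N0 ?y \<le> 3 * CL" by simp
  have Ny: "N0 ?y \<in> {c<..<d}" and Nz: "N0 ?z \<in> {c<..<d}"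
   using Ny1 Ny2 Nzy b2 CL(1) unfolding c_def d_def abs_le_iff greaterThanLessThan_iff by (intro conjI; linarith)+
  have rz: "r1 \<le> rho (dil n D w)" "rho (dil n D w) \<le> r2"
   using Nz by (auto simp: rho_def r1_def r2_def)
  have rw: "rho w = rho (dil n D w) / D" using D1 by (simp add: rho_dil)
  have rpos: "0 < rho (dil n D w)" using rz r12 by linarith
  have "r1 / D \<le> rho w" unfolding rw using rz D1 by (intro divide_right_mono) auto
  moreover have rwr: "rho w \<le> r2 / D" unfolding rw using rz D1 by (intro divide_right_mono) auto
  moreover have "r2 / D \<le> 1" using D1 by simp
  moreover have "\<bar>\<psi> 0\<bar> / 4 * m * D powr (2 * real n + 2 + \<alpha>) \<le>
   Re (of_real (sgn (\<psi> 0)) * exp (- (\<i> * of_real (D powr \<beta> * F0 ?y))) * kernel n rho \<alpha> \<beta> \<psi> w)"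
  proof -
   have amp: "rho w powr e = rho (dil n D w) powr e * D powr (2 * real n + 2 + \<alpha>)"
   proof -
    have "rho w powr e = rho (dil n D w) powr e / D powr e" unfolding rw using D1 rpos by (simp add: powr_divide)
    also have "\<dots> = rho (dil n D w) powr e * D powr (- e)" by (simp add: powr_minus divide_inverse)
    also have "- e = 2 * real n + 2 + \<alpha>" by (simp add: e_def)
    finally show ?thesis .
   qed
   have ph: "rho w powr (- \<beta>) = l * F0 ?z"
    unfolding F0_rho[OF rpos] rw l_def using D1 rpos by (simp add: powr_divide powr_minus divide_simps)
   let ?\<delta> = "l * (F0 ?z - F0 ?y)"
   have "\<bar>F0 ?z - F0 ?y\<bar> \<le> CF * E" by (rule CF(2)[OF E(1) yz nr Nz Ny])
   then have "\<bar>?\<delta>\<bar> \<le> l * (CF * E)" using l by (simp add: abs_mult)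
   also have "\<dots> = CF * (l * E)" by simp
   finally have "\<bar>?\<delta>\<bar> \<le> 1" using \<eta>3 E(3) by simp
   then have c1: "1 / 2 \<le> cos ?\<delta>" by (rule cos)
   have "\<bar>rho w\<bar> < r" using rwr Dr rho_nonneg[of w] by simp
   from r(2)[OF this] have c2: "\<bar>\<psi> 0\<bar> / 2 \<le> sgn (\<psi> 0) * \<psi> (rho w)" by (auto simp: sgn_real_def abs_if split: if_splits)
   then have c2': "0 \<le> sgn (\<psi> 0) * \<psi> (rho w)" using abs_ge_zero[of "\<psi> 0"] by linarith
   have c3: "m \<le> rho (dil n D w) powr e" unfolding m_def using rz r12 by (intro powr_ge_min) auto
   have "exp (- (\<i> * of_real (D powr \<beta> * F0 ?y))) * exp (\<i> * of_real (rho w powr (- \<beta>))) = exp (\<i> * of_real ?\<delta>)"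
    unfolding ph l_def[symmetric] by (simp add: exp_add[symmetric] algebra_simps)
   then have eq: "of_real (sgn (\<psi> 0)) * exp (- (\<i> * of_real (D powr \<beta> * F0 ?y))) * kernel n rho \<alpha> \<beta> \<psi> w =
     of_real (sgn (\<psi> 0) * \<psi> (rho w) * rho w powr e) * exp (\<i> * of_real ?\<delta>)"
    unfolding kernel_def e_def[symmetric] by (simp add: mult_ac)
   have Re: "Re (of_real A * exp (\<i> * of_real x)) = A * cos x" for A x by (simp add: Re_exp)
   have "Re (of_real (sgn (\<psi> 0)) * exp (- (\<i> * of_real (D powr \<beta> * F0 ?y))) * kernel n rho \<alpha> \<beta> \<psi> w) =
     (sgn (\<psi> 0) * \<psi> (rho w)) * (rho (dil n D w) powr e * D powr (2 * real n + 2 + \<alpha>)) * cos ?\<delta>"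
    unfolding eq amp Re ..
   moreover have "(\<bar>\<psi> 0\<bar> / 2) * (m * D powr (2 * real n + 2 + \<alpha>)) * (1 / 2) \<le> \<dots>"
   proof (rule mult_mono)
    show "(\<bar>\<psi> 0\<bar> / 2) * (m * D powr (2 * real n + 2 + \<alpha>)) \<le> (sgn (\<psi> 0) * \<psi> (rho w)) * (rho (dil n D w) powr e * D powr (2 * real n + 2 + \<alpha>))"
     by (rule mult_mono[OF c2 mult_right_mono[OF c3 powr_ge_zero] c2']) (use m in simp)
    show "0 \<le> (sgn (\<psi> 0) * \<psi> (rho w)) * (rho (dil n D w) powr e * D powr (2 * real n + 2 + \<alpha>))"
     by (rule mult_nonneg_nonneg[OF c2']) simp
   qed (use c1 in auto)
   ultimately show ?thesis by simp
  qed
  ultimately show "r1 / D \<le> rho (hmult n a (hinv n q) p) \<and> rho (hmult n a (hinv n q) p) \<le> 1 \<and>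
   \<bar>\<psi> 0\<bar> / 4 * m * D powr (2 * real n + 2 + \<alpha>) \<le> Re (of_real (sgn (\<psi> 0)) * exp (- (\<i> * of_real (D powr \<beta> * F0 ?y))) *
    kernel n rho \<alpha> \<beta> \<psi> (hmult n a (hinv n q) p))"
   unfolding w_def[symmetric] by linarith
 qed
qed

end

lemma measure_box:
 assumes "\<And>k. k \<le> 2 * n ==> l k \<le> u k"
 shows "measure (hmeasure n) (box n l u) = (\<Prod>k\<le>2 * n. u k - l k)"
 unfolding measure_def using assms by (subst emeasure_box) (auto intro!: enn2real_ennreal prod_nonneg)

lemma prod_atMost_double:
 "(\<Prod>k\<le>2 * n. if k < 2 * n then x else y) = x ^ (2 * n) * (y :: real)"
 by (simp add: lessThan_Suc_atMost[symmetric])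

lemma integral_ge_indicator:
 fixes f :: "'a => real"
 assumes "integrable M f" "A \<in> sets M" "emeasure M A < \<infinity>" "AE p in M. p \<in> A --> c \<le> f p" "\<And>p. 0 \<le> f p"
 shows "c * measure M A \<le> (\<integral>p. f p \<partial>M)"
proof -
 have "c * measure M A = (\<integral>p. c * indicator A p \<partial>M)"
  using sets.sets_into_space[OF assms(2)] by (simp add: Int_absorb2)
 also have "\<dots> \<le> (\<integral>p. f p \<partial>M)"
 proof (rule integral_mono_AE)
  show "integrable M (%p. c * indicator A p)"
   using assms(2,3) by (intro integrable_mult_right integrable_real_indicator) auto
  show "AE p in M. c * indicator A p \<le> f p"
   using assms(4) by eventually_elim (use assms(5) in \<open>auto simp: indicator_def\<close>)
 qed (rule assms(1))
 finally show ?thesis .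
qed

section \<open>The lower bound and the contradiction\<close>

context heis
begin

context
 fixes \<theta> \<psi> :: "real => real"
 assumes \<theta>: "dyadic_partition \<theta>" and \<psi>: "cutoff \<psi>"
begin

text \<open>Away from the origin the truncation is eventually exact: the omitted terms have
  \<open>2 ^ j * rho w > 2\<close>, outside the support of \<theta>.\<close>

lemma truncated_kernel_eventually:
 assumes c: "0 < c" "c \<le> rho w" "rho w \<le> 1" and N: "2 / c < 2 ^ N"
 shows "truncated_kernel n rho \<alpha> \<beta> \<psi> \<theta> N w = kernel n rho \<alpha> \<beta> \<psi> w"
proof -
 have "(%j. \<theta> (2 ^ j * rho w)) sums 1" using \<theta> c unfolding dyadic_partition_def by auto
 moreover have "(%j. \<theta> (2 ^ j * rho w)) sums (\<Sum>j\<le>N. \<theta> (2 ^ j * rho w))"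
 proof (rule sums_finite)
  fix j assume "j \<notin> {..N}"
  then have "2 / c < 2 ^ j" by (intro less_le_trans[OF N] power_increasing) auto
  then have "2 < 2 ^ j * c" using c by (simp add: divide_less_eq)
  also have "\<dots> \<le> 2 ^ j * rho w" using c by simp
  finally show "\<theta> (2 ^ j * rho w) = 0" using \<theta> unfolding dyadic_partition_def by auto
 qed simp
 ultimately have "(\<Sum>j\<le>N. \<theta> (2 ^ j * rho w)) = 1" by (rule sums_unique2[symmetric])
 then show ?thesis unfolding truncated_kernel_def sum_distrib_right[symmetric] of_real_sum[symmetric] by simp
qed

text \<open>The support of \<phi> stays away from \<open>p\<close>, so the sequence defining
  \<open>T_op\<close> is eventually constant and equals an ordinary integral against the kernel,
  whatever \<alpha> is. Coherence then prevents cancellation in it.\<close>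

lemma T_op_lower_bound:
 "\<exists>\<eta>>0. \<exists>c>0. \<exists>D0\<ge>1. \<forall>D\<ge>D0. \<forall>\<phi> p. (%q. complex_of_real (\<phi> q)) \<in> test_functions n --> (\<forall>q. 0 \<le> \<phi> q) -->
  (\<forall>q\<in>hspace n. \<phi> q \<noteq> 0 --> (\<forall>k\<le>2 * n. \<bar>co n (dil n D q) k\<bar> \<le> \<eta> / D powr \<beta>)) --> p \<in> hspace n --> dil n D p \<in> far_box -->
  c * D powr (2 * real n + 2 + \<alpha>) * (\<integral>q. \<phi> q \<partial>M) \<le> cmod (T_op n a rho \<alpha> \<beta> \<psi> \<theta> (%q. of_real (\<phi> q)) p)"
proof -
 obtain \<eta> c c0 D0 where pos: "0 < \<eta>" "0 < c" "0 < c0" "1 \<le> D0" and coh: "\<forall>D\<ge>D0. \<forall>p q. dil n D p \<in> far_box -->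
  (\<forall>k\<le>2 * n. \<bar>co n (dil n D q) k\<bar> \<le> \<eta> / D powr \<beta>) -->
  c0 / D \<le> rho (hmult n a (hinv n q) p) \<and> rho (hmult n a (hinv n q) p) \<le> 1 \<and>
  c * D powr (2 * real n + 2 + \<alpha>) \<le> Re (of_real (sgn (\<psi> 0)) * exp (- (\<i> * of_real (D powr \<beta> * F0 (co n (dil n D p))))) *
   kernel n rho \<alpha> \<beta> \<psi> (hmult n a (hinv n q) p))"
  using kernel_coherence[OF \<psi>, of \<alpha>] by (elim exE conjE)
 show ?thesis
 proof (rule exI[of _ \<eta>], rule conjI[OF pos(1)], rule exI[of _ c], rule conjI[OF pos(2)], rule exI[of _ D0], rule conjI[OF pos(4)], intro allI impI)
  fix D :: real and \<phi> p
  assume D: "D0 \<le> D" and test: "(%q. complex_of_real (\<phi> q)) \<in> test_functions n" and nn: "\<forall>q. 0 \<le> \<phi> q"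
   and supp: "\<forall>q\<in>hspace n. \<phi> q \<noteq> 0 --> (\<forall>k\<le>2 * n. \<bar>co n (dil n D q) k\<bar> \<le> \<eta> / D powr \<beta>)"
   and p: "p \<in> hspace n" "dil n D p \<in> far_box"
  let ?f = "%q. complex_of_real (\<phi> q)"
  let ?w = "%q. hmult n a (hinv n q) p"
  define G where "G q = kernel n rho \<alpha> \<beta> \<psi> (?w q) * ?f q" for q
  \<comment> \<open>Removes the phase at \<open>p\<close> and the sign of \<open>\<psi> 0\<close>,
    so that the real parts add up.\<close>
  define v where "v = of_real (sgn (\<psi> 0)) * exp (- (\<i> * of_real (D powr \<beta> * F0 (co n (dil n D p)))))"
  define A where "A = c * D powr (2 * real n + 2 + \<alpha>)"
  have D1: "0 < D" using D pos by linarith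
  have ck: "ckernel n ?f" by (rule test_function_bounds(1)[OF test])
  note sqf = ckernel_square_integrable[OF ck]
  obtain N1 where N1: "2 / (c0 / D) < 2 ^ N1" using real_arch_pow[of 2 "2 / (c0 / D)"] by auto
  have trunc: "truncated_kernel n rho \<alpha> \<beta> \<psi> \<theta> N (?w q) * ?f q = G q" if "q \<in> hspace n" "N1 \<le> N" for q N
  proof (cases "\<phi> q = 0")
   case False
   have "2 ^ N1 \<le> (2 :: real) ^ N" using that by (intro power_increasing) auto
   then have "2 / (c0 / D) < 2 ^ N" using N1 by linarith
   then show ?thesis
    using coh[rule_format, OF D p(2), of q] supp that(1) False pos D1 unfolding G_def
    by (subst truncated_kernel_eventually[of "c0 / D"]) auto
  qed (simp add: G_def)
  have ck_trunc: "integrable M (%q. truncated_kernel n rho \<alpha> \<beta> \<psi> \<theta> N (?w q) * ?f q)" for N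
   unfolding truncated_kernel_pieces[OF \<theta>] sum_distrib_right
   by (intro Bochner_Integration.integrable_sum conv_integrable sqf ckernel_piece[OF \<theta> \<psi>] p)
  have G: "integrable M G"
   by (rule Bochner_Integration.integrable_cong[THEN iffD1, OF refl _ ck_trunc[of N1]]) (simp add: trunc space_hmeasure)
  have "T_op n a rho \<alpha> \<beta> \<psi> \<theta> ?f p = (\<integral>q. G q \<partial>M)"
   unfolding T_op_def
  proof (rule limI, rule tendsto_eventually, rule eventually_sequentiallyI[of N1])
   fix N assume "N1 \<le> N"
   then show "(\<integral>q. truncated_kernel n rho \<alpha> \<beta> \<psi> \<theta> N (?w q) * ?f q \<partial>M) = (\<integral>q. G q \<partial>M)"
    by (intro Bochner_Integration.integral_cong refl trunc) (simp_all add: space_hmeasure)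
  qed
  moreover have "A * (\<integral>q. \<phi> q \<partial>M) \<le> cmod (\<integral>q. G q \<partial>M)"
  proof -
   have int\<phi>: "integrable M \<phi>" using integrable_Re[OF ckernel_integrable[OF ck]] by simp
   have "A * (\<integral>q. \<phi> q \<partial>M) = (\<integral>q. A * \<phi> q \<partial>M)" by simp
   also have "\<dots> \<le> (\<integral>q. Re (v * G q) \<partial>M)"
   proof (rule integral_mono)
    fix q assume "q \<in> space M"
    then have q: "q \<in> hspace n" by (simp add: space_hmeasure)
    show "A * \<phi> q \<le> Re (v * G q)"
    proof (cases "\<phi> q = 0")
     case False
     then have "A \<le> Re (v * kernel n rho \<alpha> \<beta> \<psi> (?w q))"
      using coh[rule_format, OF D p(2), of q] supp q unfolding A_def v_def by auto
     then have "A * \<phi> q \<le> Re (v * kernel n rho \<alpha> \<beta> \<psi> (?w q)) * \<phi> q" using nn by (intro mult_right_mono nn[rule_format])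
     also have "\<dots> = Re (v * G q)" by (simp add: G_def mult.assoc[symmetric])
     finally show ?thesis .
    qed (simp add: G_def)
   qed (use int\<phi> G in \<open>auto intro!: integrable_Re integrable_mult_right\<close>)
   also have "\<dots> = Re (v * (\<integral>q. G q \<partial>M))" using G by (simp add: integral_Re)
   also have "\<dots> \<le> cmod (v * (\<integral>q. G q \<partial>M))" by (rule complex_Re_le_cmod)
   also have "\<dots> \<le> 1 * cmod (\<integral>q. G q \<partial>M)"
    unfolding norm_mult v_def by (intro mult_right_mono) (auto simp: norm_exp_eq_Re sgn_real_def)
   finally show ?thesis by simp
  qed
  ultimately show "c * D powr (2 * real n + 2 + \<alpha>) * (\<integral>q. \<phi> q \<partial>M) \<le> cmod (T_op n a rho \<alpha> \<beta> \<psi> \<theta> ?f p)"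
   by (simp add: A_def)
 qed
qed

text \<open>Let \<open>I\<close> be the integral of the bump \<phi>. The squared norm of its image
  is at least of order \<open>D powr (2 * (2 * n + 2 + \<alpha>)) * I\<^sup>2 / D ^ (2 * n +
  2)\<close>, that of \<phi> at most of order \<open>I\<close>, and \<open>I\<close> itself at least
  of order \<open>1 / (D powr (\<beta> * (2 * n + 1)) * D ^ (2 * n + 2))\<close>. Dividing leaves
  \<open>D powr (2 * \<alpha> - \<beta> * (2 * n + 1))\<close> bounded as \<open>D\<close>
  grows.\<close>

theorem unbounded_if_supercritical:
 assumes \<alpha>: "(real n + 1 / 2) * \<beta> < \<alpha>"
 shows "\<not> extends_to_bounded_L2 M (test_functions n) (T_op n a rho \<alpha> \<beta> \<psi> \<theta>)"
proof
 let ?M = "M"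
 assume "extends_to_bounded_L2 ?M (test_functions n) (T_op n a rho \<alpha> \<beta> \<psi> \<theta>)"
 then obtain S B where S: "\<And>f. square_integrable ?M f ==> square_integrable ?M (S f)"
   "\<And>f. square_integrable ?M f ==> norm_L2 ?M (S f) \<le> B * norm_L2 ?M f"
   "\<And>f. f \<in> test_functions n ==> AE p in ?M. S f p = T_op n a rho \<alpha> \<beta> \<psi> \<theta> f p"
  unfolding extends_to_bounded_L2_def bounded_operator_L2_def by blast
 obtain \<eta> c D0 where pos: "0 < \<eta>" "0 < c" "1 \<le> D0" and low: "\<forall>D\<ge>D0. \<forall>\<phi> p. (%q. complex_of_real (\<phi> q)) \<in> test_functions n --> (\<forall>q. 0 \<le> \<phi> q) -->
  (\<forall>q\<in>hspace n. \<phi> q \<noteq> 0 --> (\<forall>k\<le>2 * n. \<bar>co n (dil n D q) k\<bar> \<le> \<eta> / D powr \<beta>)) --> p \<in> hspace n --> dil n D p \<in> far_box -->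
  c * D powr (2 * real n + 2 + \<alpha>) * (\<integral>q. \<phi> q \<partial>?M) \<le> cmod (T_op n a rho \<alpha> \<beta> \<psi> \<theta> (%q. of_real (\<phi> q)) p)"
  using T_op_lower_bound[of \<alpha>] by (elim exE conjE)
 define g where "g = (%r. (\<psi> r)\<^sup>2)"
 have bump: "bump g" unfolding g_def by (rule cutoff_bump[OF \<psi>])
 have gs: "smooth_real g" using bump unfolding bump_def by (intro bd_imp_smooth_real) blast
 have gnz: "\<bar>x\<bar> \<le> 1" if "g x \<noteq> 0" for x
 proof -
  have "x \<in> {-1..1}" using that bump unfolding bump_def by blast
  then show ?thesis by auto
 qed
 have gnn: "0 \<le> g x" for x by (simp add: g_def)
 obtain X where X: "0 \<le> X" "\<And>x. g x \<le> X"
 proof -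
  obtain X where "0 \<le> X" "bd 0 UNIV X g" using bump unfolding bump_def by blast
  then show ?thesis using that[of X] by (auto simp: abs_le_iff)
 qed
 define s where "s = g 0 / 2"
 have s: "0 < s" using bump by (simp add: s_def bump_def)
 have "isCont g 0" using smooth_real_has_derivative[OF gs] DERIV_isCont by blast
 then have "\<exists>r>0. \<forall>x. dist x 0 < r --> dist (g x) (g 0) < s"
  by (rule continuous_at_eps_delta[THEN iffD1, rule_format]) (rule s)
 then obtain r where r: "0 < r" "\<And>x. \<bar>x\<bar> < r ==> \<bar>g x - g 0\<bar> < s" by (auto simp: dist_real_def)
 define \<delta> where "\<delta> = r / 2"
 have \<delta>: "0 < \<delta>" using r by (simp add: \<delta>_def)
 have glow: "s \<le> g x" if "\<bar>x\<bar> \<le> \<delta>" for x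
 proof -
  have "\<bar>x\<bar> < r" using that r(1) unfolding \<delta>_def by linarith
  from r(2)[OF this] show ?thesis unfolding s_def by linarith
 qed
 define Q where "Q = 2 * n + 1"
 define K0 where "K0 = c\<^sup>2 * (s ^ Q * (2 * \<delta> * \<eta>) ^ Q)"
 have K0: "0 < K0" using pos s \<delta> by (simp add: K0_def)
 define \<gamma> where "\<gamma> = 2 * \<alpha> - \<beta> * (2 * real n + 1)"
 have \<gamma>: "0 < \<gamma>" using \<alpha> by (simp add: \<gamma>_def algebra_simps)
 have main: "K0 * D powr \<gamma> \<le> B\<^sup>2 * X ^ Q" if D: "D0 \<le> D" for D
 proof -
  have D1: "1 \<le> D" "0 < D" using D pos by auto
  define l where "l = D powr \<beta>"
  have l: "1 \<le> l" using D1 beta_pos by (simp add: l_def ge_one_powr_ge_zero)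
  define m where "m k = (if k < 2 * n then D else D\<^sup>2)" for k
  have m: "1 \<le> m k" "0 < m k" for k using D1 by (auto simp: m_def)
  \<comment> \<open>Dilation by \<open>D\<close> turns the box with these half-widths into a cube of
    half-width \<open>\<eta> / l\<close>, the region of coherence.\<close>
  define e where "e k = \<eta> / l / m k" for k
  have e: "0 < e k" for k using pos l m by (simp add: e_def)
  have em: "m k * e k = \<eta> / l" for k using m(2)[of k] by (simp add: e_def)
  have e\<eta>: "e k \<le> \<eta>" for k
  proof -
   have "e k \<le> \<eta> / 1 / 1" unfolding e_def using pos l m[of k] by (intro frac_le) auto
   then show ?thesis by simp
  qed
  define \<phi> where "\<phi> q = (\<Prod>k\<le>2 * n. g (1 / e k * co n q k))" for q
  let ?f = "%q. complex_of_real (\<phi> q)"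
  have test: "?f \<in> test_functions n"
   unfolding \<phi>_def
  proof (rule product_test_function)
   show "smooth_real (%x. g (1 / e k * x))" for k by (rule smooth_real_scale[OF gs])
   fix k x assume "g (1 / e k * x) \<noteq> 0"
   from gnz[OF this] have "\<bar>x\<bar> \<le> e k" using e[of k] by (simp add: abs_mult)
   then show "\<bar>x\<bar> \<le> \<eta>" using e\<eta>[of k] by linarith
  qed
  have \<phi>nn: "0 \<le> \<phi> q" for q unfolding \<phi>_def by (intro prod_nonneg gnn)
  have \<phi>X: "\<phi> q \<le> X ^ Q" for q
   using prod_mono[of "{..2 * n}" "%k. g (1 / e k * co n q k)" "%_. X"] gnn X by (simp add: \<phi>_def Q_def)
  have supp: "\<bar>co n (dil n D q) k\<bar> \<le> \<eta> / D powr \<beta>" if "\<phi> q \<noteq> 0" "k \<le> 2 * n" for q k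
  proof -
   have "g (1 / e k * co n q k) \<noteq> 0" using that by (auto simp: \<phi>_def)
   from gnz[OF this] have "\<bar>co n q k\<bar> \<le> e k" using e[of k] by (simp add: abs_mult)
   then have "m k * \<bar>co n q k\<bar> \<le> m k * e k" using m[of k] by (intro mult_left_mono) auto
   then show ?thesis unfolding em using that(2) D1 by (simp add: co_dil m_def abs_mult l_def)
  qed
  have ck: "ckernel n ?f" by (rule test_function_bounds(1)[OF test])
  note sqf = ckernel_square_integrable[OF ck]
  define I where "I = (\<integral>q. \<phi> q \<partial>?M)"
  have int\<phi>: "integrable ?M \<phi>" using integrable_Re[OF ckernel_integrable[OF ck]] by simp
  have I: "s ^ Q * ((2 * \<delta> * \<eta>) ^ Q / l ^ Q / D ^ (2 * n + 2)) \<le> I"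
  proof -
   let ?E = "box n (%k. - (\<delta> * e k)) (%k. \<delta> * e k)"
   have le: "- (\<delta> * e k) \<le> \<delta> * e k" for k using \<delta> e[of k] mult_pos_pos[OF \<delta> e[of k]] by linarith
   have mE: "measure ?M ?E = (2 * \<delta> * \<eta>) ^ Q / l ^ Q / D ^ (2 * n + 2)"
   proof -
    have "measure ?M ?E = (\<Prod>k\<le>2 * n. \<delta> * e k - - (\<delta> * e k))" by (rule measure_box) (rule le)
    also have "\<dots> = (\<Prod>k\<le>2 * n. 2 * \<delta> * \<eta> / l * (if k < 2 * n then 1 / D else 1 / D\<^sup>2))"
     by (intro prod.cong refl) (auto simp: e_def m_def mult_ac)
    also have "\<dots> = (2 * \<delta> * \<eta> / l) ^ Q * ((1 / D) ^ (2 * n) * (1 / D\<^sup>2))"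
     unfolding prod.distrib prod_atMost_double by (simp add: Q_def)
    also have "\<dots> = (2 * \<delta> * \<eta>) ^ Q / l ^ Q / D ^ (2 * n + 2)"
     by (simp add: power_divide power_one_over power_add power2_eq_square)
    finally show ?thesis .
   qed
   have "s ^ Q * measure ?M ?E \<le> (\<integral>q. \<phi> q \<partial>?M)"
   proof (rule integral_ge_indicator[OF int\<phi> sets_box _ _ \<phi>nn])
    show "emeasure ?M ?E < \<infinity>" by (subst emeasure_box, rule le) simp
    have "s ^ Q \<le> \<phi> p" if "p \<in> ?E" for p
    proof -
     have "s \<le> g (1 / e k * co n p k)" if "k \<le> 2 * n" for k
     proof (rule glow)
      have "\<bar>co n p k\<bar> \<le> \<delta> * e k" using \<open>p \<in> ?E\<close> that by (auto simp: box_def abs_le_iff)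
      then show "\<bar>1 / e k * co n p k\<bar> \<le> \<delta>" using e[of k] by (simp add: abs_mult divide_le_eq)
     qed
     then show ?thesis using prod_mono[of "{..2 * n}" "%_. s" "%k. g (1 / e k * co n p k)"] s by (simp add: \<phi>_def Q_def)
    qed
    then show "AE p in ?M. p \<in> ?E --> s ^ Q \<le> \<phi> p" by simp
   qed
   then show ?thesis unfolding mE I_def .
  qed
  have I0: "0 < I"
   by (rule less_le_trans[OF _ I]) (use s \<delta> pos l D1 in simp)
  define A where "A = c * D powr (2 * real n + 2 + \<alpha>) * I"
  have A: "0 \<le> A" using pos I0 by (simp add: A_def)
  \<comment> \<open>The preimage of \<open>far_box\<close> under dilation by
    \<open>D\<close>.\<close>
  let ?P = "box n (%k. if k = 2 * n then 1 / D\<^sup>2 else 0) (%k. if k = 2 * n then 2 / D\<^sup>2 else 1 / D)"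
  have leP: "(if k = 2 * n then 1 / D\<^sup>2 else 0) \<le> (if k = 2 * n then 2 / D\<^sup>2 else 1 / D)" for k
   using D1 by (simp add: divide_right_mono)
  have mP: "measure ?M ?P = 1 / D ^ (2 * n + 2)"
  proof -
   have "measure ?M ?P = (\<Prod>k\<le>2 * n. (if k = 2 * n then 2 / D\<^sup>2 else 1 / D) - (if k = 2 * n then 1 / D\<^sup>2 else 0))"
    by (rule measure_box) (rule leP)
   also have "\<dots> = (\<Prod>k\<le>2 * n. if k < 2 * n then 1 / D else 1 / D\<^sup>2)"
    by (intro prod.cong refl) (auto simp: diff_divide_distrib[symmetric])
   finally show ?thesis unfolding prod_atMost_double by (simp add: power_one_over power_add power2_eq_square)
  qed
  have far: "dil n D p \<in> far_box" if "p \<in> ?P" for p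
  proof -
   have "(if k = 2 * n then 1 else 0) \<le> co n (dil n D p) k \<and> co n (dil n D p) k \<le> (if k = 2 * n then 2 else 1)" if k: "k \<le> 2 * n" for k
   proof -
    have "(if k = 2 * n then 1 / D\<^sup>2 else 0) \<le> co n p k" "co n p k \<le> (if k = 2 * n then 2 / D\<^sup>2 else 1 / D)"
     using \<open>p \<in> ?P\<close> k unfolding box_def by blast+
    then show ?thesis using k D1 by (auto simp: co_dil divide_le_eq le_divide_eq mult.commute split: if_splits)
   qed
   then show ?thesis unfolding far_box_def box_def by simp
  qed
  have "A\<^sup>2 * measure ?M ?P \<le> (\<integral>p. (cmod (S ?f p))\<^sup>2 \<partial>?M)"
  proof (rule integral_ge_indicator[OF _ sets_box])
   show "integrable ?M (%p. (cmod (S ?f p))\<^sup>2)" using S(1)[OF sqf] unfolding square_integrable_def by simp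
   show "emeasure ?M ?P < \<infinity>" by (subst emeasure_box, rule leP) simp
   show "AE p in ?M. p \<in> ?P --> A\<^sup>2 \<le> (cmod (S ?f p))\<^sup>2"
    using S(3)[OF test]
   proof eventually_elim
    case (elim p)
    show ?case
    proof
     assume p: "p \<in> ?P"
     then have ph: "p \<in> hspace n" by (simp add: box_def)
     have "A \<le> cmod (T_op n a rho \<alpha> \<beta> \<psi> \<theta> ?f p)"
      unfolding A_def I_def using supp \<phi>nn by (intro low[rule_format, OF D test _ _ ph far[OF p]]) auto
     then show "A\<^sup>2 \<le> (cmod (S ?f p))\<^sup>2" unfolding elim using A by (intro power_mono)
    qed
   qed
  qed simp
  also have "\<dots> = (norm_L2 ?M (S ?f))\<^sup>2" by (rule norm_L2_power2[symmetric])
  also have "\<dots> \<le> (B * norm_L2 ?M ?f)\<^sup>2" using S(2)[OF sqf] by (intro power_mono) auto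
  also have "\<dots> = B\<^sup>2 * (\<integral>p. (cmod (?f p))\<^sup>2 \<partial>?M)" by (simp only: power_mult_distrib norm_L2_power2)
  also have "\<dots> \<le> B\<^sup>2 * (\<integral>p. X ^ Q * \<phi> p \<partial>?M)"
  proof (rule mult_left_mono[OF integral_mono])
   show "integrable ?M (%p. (cmod (?f p))\<^sup>2)" using sqf unfolding square_integrable_def by simp
   show "integrable ?M (%p. X ^ Q * \<phi> p)" using int\<phi> by simp
   show "(cmod (?f p))\<^sup>2 \<le> X ^ Q * \<phi> p" for p
    using mult_right_mono[OF \<phi>X[of p] \<phi>nn[of p]] \<phi>nn[of p] by (simp add: power2_eq_square)
  qed simp
  also have "\<dots> = B\<^sup>2 * X ^ Q * I" by (simp add: I_def)
  finally have "(c\<^sup>2 * (D powr (2 * real n + 2 + \<alpha>))\<^sup>2 * I / D ^ (2 * n + 2)) * I \<le> (B\<^sup>2 * X ^ Q) * I"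
   unfolding mP A_def by (simp add: power2_eq_square mult_ac)
  then have b: "c\<^sup>2 * (D powr (2 * real n + 2 + \<alpha>))\<^sup>2 * I / D ^ (2 * n + 2) \<le> B\<^sup>2 * X ^ Q"
   using I0 by (simp only: mult_le_cancel_right_pos)
  have "D powr \<gamma> = (D powr (2 * real n + 2 + \<alpha>))\<^sup>2 / l ^ Q / D ^ (2 * n + 2) / D ^ (2 * n + 2)"
  proof -
   have 1: "l ^ Q = D powr (\<beta> * (2 * real n + 1))"
    using l D1 powr_realpow[of l Q] by (simp add: l_def powr_powr Q_def add.commute)
   have 2: "D ^ (2 * n + 2) = D powr (2 * real n + 2)" using D1 powr_realpow[of D "2 * n + 2"] by (simp add: add.commute)
   have 3: "(D powr (2 * real n + 2 + \<alpha>))\<^sup>2 = D powr (2 * (2 * real n + 2 + \<alpha>))"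
    by (simp only: power2_eq_square powr_add[symmetric] mult_2)
   show ?thesis unfolding 1 2 3 powr_diff[symmetric] \<gamma>_def
    by (rule arg_cong[where f = "%x. D powr x"]) (simp add: algebra_simps)
  qed
  then have "K0 * D powr \<gamma> = c\<^sup>2 * (D powr (2 * real n + 2 + \<alpha>))\<^sup>2 * (s ^ Q * ((2 * \<delta> * \<eta>) ^ Q / l ^ Q / D ^ (2 * n + 2))) / D ^ (2 * n + 2)"
   by (simp add: K0_def)
  also have "\<dots> \<le> c\<^sup>2 * (D powr (2 * real n + 2 + \<alpha>))\<^sup>2 * I / D ^ (2 * n + 2)"
   using D1 by (intro divide_right_mono mult_left_mono I) auto
  finally show ?thesis using b by linarith
 qed
 define Y where "Y = B\<^sup>2 * X ^ Q / K0 + 1"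
 have Y: "1 \<le> Y" using K0 X by (simp add: Y_def)
 define D where "D = max D0 (Y powr (1 / \<gamma>))"
 have "Y = (Y powr (1 / \<gamma>)) powr \<gamma>" using Y \<gamma> by (simp add: powr_powr)
 also have "\<dots> \<le> D powr \<gamma>" using \<gamma> by (intro powr_mono2) (auto simp: D_def)
 finally have "K0 * Y \<le> K0 * D powr \<gamma>" using K0 by (intro mult_left_mono) auto
 also have "\<dots> \<le> B\<^sup>2 * X ^ Q" by (rule main) (simp add: D_def)
 also have "\<dots> < K0 * Y" using K0 by (simp add: Y_def distrib_left)
 finally show False by simp
qed

end

end

theorem theorem1:
  fixes \<beta> :: real
  assumes "\<beta> > 0"
  shows "\<exists>C > 0. \<forall>(n::nat) (a::real) (b::real) (\<alpha>::real) \<rho> \<psi> \<theta>.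
           n \<ge> 1 \<longrightarrow> a \<noteq> 0 \<longrightarrow> b \<noteq> 0 \<longrightarrow> 0 < a\<^sup>2 / b\<^sup>2 \<longrightarrow> a\<^sup>2 / b\<^sup>2 < C \<longrightarrow>
           \<rho> = (\<lambda>p. rho1 n (hscale n b p)) \<longrightarrow> cutoff \<psi> \<longrightarrow> dyadic_partition \<theta> \<longrightarrow>
           (extends_to_bounded_L2 (hmeasure n) (test_functions n) (T_op n a \<rho> \<alpha> \<beta> \<psi> \<theta>)
              \<longleftrightarrow> \<alpha> \<le> (real n + 1 / 2) * \<beta>)"
proof (rule exI[of _ 3], intro conjI allI impI)
  fix n :: nat and a b \<alpha> :: real and \<rho> \<psi> \<theta>
  assume n: "1 \<le> n" and ab: "a \<noteq> 0" "b \<noteq> 0" "a\<^sup>2 / b\<^sup>2 < 3" and \<rho>: "\<rho> = (\<lambda>p. rho1 n (hscale n b p))"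
    and \<psi>: "cutoff \<psi>" and \<theta>: "dyadic_partition \<theta>"
  \<comment> \<open>The bound 3 is taken for every \<beta>: in the quadratic form the contribution
    \<open>3 * \<beta> / 2\<close> has the favourable sign.\<close>
  interpret heis n a b \<beta>
    using n ab assms by unfold_locales (auto simp: divide_less_eq)
  show "extends_to_bounded_L2 (hmeasure n) (test_functions n) (T_op n a \<rho> \<alpha> \<beta> \<psi> \<theta>) \<longleftrightarrow> \<alpha> \<le> (real n + 1 / 2) * \<beta>"
    unfolding \<rho> rho_eq using bounded_if_subcritical[OF \<theta> \<psi>] unbounded_if_supercritical[OF \<theta> \<psi>] by (meson not_le)
qed simp

end
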